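(* Let $V$ be a finite nonempty set with $|V|=d$, and let $(\Gamma,\sigma)$ be a CW-regular subdivision of the simplex $2^V$. Then the local $\gamma$-vector of the barycentric subdivision $\mathrm{sd}(\Gamma)$ (viewed as a subdivision of $2^V$ via the natural map $\sigma'$) is nonnegative, i.e., writing $\ell_V(\mathrm{sd}(\Gamma),x)=\sum_{k=0}^{\lfloor d/2\rfloor}\xi_k x^k(1+x)^{d-2k}$, one has $\xi_k\geq 0$ for all $k$.
   Context: For a simplicial complex $\Delta$ of dimension $e-1$ with $f_{i-1}(\Delta)$ faces of cardinality $i$, $h(\Delta,x)=\sum_{i=0}^{e} f_{i-1}(\Delta)x^i(1-x)^{e-i}$. A CW-regular subdivision of $2^V$ is a pair $(\Gamma,\sigma)$ where $\Gamma$ is a finite regular CW-complex with face poset $P(\Gamma)$ and $\sigma:P(\Gamma)\to 2^V$ is a map such that for every $F\subseteq V$: (i) $\Gamma_F:=\{\tau\in P(\Gamma):\sigma(\tau)\subseteq F\}$ forms a subcomplex of $\Gamma$ homeomorphic to a ball of dimension $|F|-1$; (ii) $\sigma^{-1}(F)$ is exactly the set of interior cells of $\Gamma_F$. The barycentric subdivision $\mathrm{sd}(\Gamma)$ is the simplicial complex whose faces are the chains $\tau_0\lneq\tau_1\lneq\cdots\lneq\tau_i$ of nonempty cells of $\Gamma$; it is a (topological) subdivision of $2^V$ via $\sigma'(\{\tau_0,\ldots,\tau_i\})=\sigma(\max\{\tau_0,\ldots,\tau_i\})$, and then $\mathrm{sd}(\Gamma)_F:=(\sigma')^{-1}(2^F)=\mathrm{sd}(\Gamma_F)$.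 The local $h$-polynomial of $\mathrm{sd}(\Gamma)$ (with respect to this map) is $\ell_V(\mathrm{sd}(\Gamma),x)=\sum_{F\subseteq V}(-1)^{d-|F|}h(\mathrm{sd}(\Gamma_F),x)$. It is a symmetric polynomial with $x^i$ and $x^{d-i}$ having equal coefficients, so it can be written uniquely as $\sum_{k=0}^{\lfloor d/2\rfloor}\xi_k x^k(1+x)^{d-2k}$ with $\xi_k\in\mathbb{Z}$; the vector $(\xi_0,\ldots,\xi_{\lfloor d/2\rfloor})$ is the local $\gamma$-vector. *)

theory Defs
  imports "HOL-Analysis.Analysis" "HOL-Computational_Algebra.Polynomial"
begin

section \<open>Balls\<close>

definition unit_ball :: "nat \<Rightarrow> (nat \<Rightarrow> real) topology" where
  "unit_ball n = subtopology (Euclidean_space n) {x. (\<Sum>i<n. x i ^ 2) \<le> 1}"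

definition unit_ball_interior :: "nat \<Rightarrow> (nat \<Rightarrow> real) set" where
  "unit_ball_interior n = {x \<in> topspace (Euclidean_space n). (\<Sum>i<n. x i ^ 2) < 1}"

definition unit_ball_boundary :: "nat \<Rightarrow> (nat \<Rightarrow> real) set" where
  "unit_ball_boundary n = {x \<in> topspace (Euclidean_space n). (\<Sum>i<n. x i ^ 2) = 1}"

text \<open>The dimension is an integer: the ball of dimension \<open>-1\<close> is the empty space.\<close>

definition is_ball :: "int \<Rightarrow> 'a topology \<Rightarrow> bool" where
  "is_ball m T \<longleftrightarrow>
     (if m = -1 then topspace T = {} else 0 \<le> m \<and> unit_ball (nat m) homeomorphic_space T)"

text \<open>The boundary of a space homeomorphic to the \<open>n\<close>-ball. By invariance of domain, the set
  \<open>h ` unit_ball_boundary n\<close> does not depend on the homeomorphism \<open>h\<close>.\<close>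

definition ball_boundary :: "nat \<Rightarrow> 'a topology \<Rightarrow> 'a set" where
  "ball_boundary n T =
     {x. \<exists>h. homeomorphic_map (unit_ball n) T h \<and> x \<in> h ` unit_ball_boundary n}"

section \<open>Finite regular CW-complexes\<close>

text \<open>A finite regular CW-complex is given by its underlying space \<open>X\<close> and the set \<open>C\<close> of its
  (nonempty) open cells. In the finite case closure-finiteness and the weak topology are
  automatic. Regularity is the requirement that the characteristic maps be embeddings.\<close>

definition characteristic_map ::
    "'a topology \<Rightarrow> nat \<Rightarrow> 'a set \<Rightarrow> ((nat \<Rightarrow> real) \<Rightarrow> 'a) \<Rightarrow> bool" where
  "characteristic_map X n e \<Phi> \<longleftrightarrow>
     embedding_map (unit_ball n) X \<Phi> \<and> \<Phi> ` unit_ball_interior n = e"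

definition finite_regular_CW :: "'a topology \<Rightarrow> 'a set set \<Rightarrow> bool" where
  "finite_regular_CW X C \<longleftrightarrow>
     Hausdorff_space X \<and> finite C \<and> disjoint C \<and> \<Union>C = topspace X \<and>
     (\<forall>e\<in>C. \<exists>n \<Phi>. characteristic_map X n e \<Phi> \<and>
        \<Phi> ` unit_ball_boundary n \<subseteq> \<Union>{c \<in> C. \<exists>m<n. \<exists>\<Psi>. characteristic_map X m c \<Psi>})"

text \<open>The face poset contains the empty cell, represented by the empty set. Cells are ordered by
  inclusion of their closures.\<close>

definition face_poset :: "'a set set \<Rightarrow> 'a set set" where
  "face_poset C = insert {} C"

definition face_less :: "'a topology \<Rightarrow> 'a set \<Rightarrow> 'a set \<Rightarrow> bool" where
  "face_less X \<tau> \<rho> \<longleftrightarrow> X closure_of \<tau> \<subset> X closure_of \<rho>"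

definition subcomplex :: "'a topology \<Rightarrow> 'a set set \<Rightarrow> 'a set set \<Rightarrow> bool" where
  "subcomplex X C S \<longleftrightarrow>
     S \<subseteq> face_poset C \<and> {} \<in> S \<and> (\<forall>\<tau>\<in>S. X closure_of \<tau> \<subseteq> \<Union>S)"

text \<open>The interior cells of a set \<open>S\<close> of cells whose union is a ball of dimension \<open>m\<close> are those not
  contained in its boundary. The ball of dimension \<open>-1\<close> consists of the empty cell only and has
  no boundary cells; for \<open>m \<ge> 0\<close> the empty cell lies on the boundary.\<close>

definition interior_cells :: "'a topology \<Rightarrow> int \<Rightarrow> 'a set set \<Rightarrow> 'a set set" where
  "interior_cells X m S =
     (if m = -1 then S
      else {\<tau> \<in> S. \<not> \<tau> \<subseteq> ball_boundary (nat m) (subtopology X (\<Union>S))})"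

section \<open>CW-regular subdivisions of a simplex\<close>

definition restriction :: "'a set set \<Rightarrow> ('a set \<Rightarrow> 'v set) \<Rightarrow> 'v set \<Rightarrow> 'a set set" where
  "restriction C \<sigma> F = {\<tau> \<in> face_poset C. \<sigma> \<tau> \<subseteq> F}"

definition CW_regular_subdivision ::
    "'v set \<Rightarrow> 'a topology \<Rightarrow> 'a set set \<Rightarrow> ('a set \<Rightarrow> 'v set) \<Rightarrow> bool" where
  "CW_regular_subdivision V X C \<sigma> \<longleftrightarrow>
     finite_regular_CW X C \<and> \<sigma> \<in> face_poset C \<rightarrow> Pow V \<and>
     (\<forall>F\<subseteq>V.
        subcomplex X C (restriction C \<sigma> F) \<and>
        is_ball (int (card F) - 1) (subtopology X (\<Union>(restriction C \<sigma> F))) \<and>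
        {\<tau> \<in> face_poset C. \<sigma> \<tau> = F} =
          interior_cells X (int (card F) - 1) (restriction C \<sigma> F))"

section \<open>Barycentric subdivision\<close>

definition sd :: "'a topology \<Rightarrow> 'a set set \<Rightarrow> 'a set set set" where
  "sd X S =
     {c. c \<subseteq> S - {{}} \<and> finite c \<and> pairwise (\<lambda>\<tau> \<rho>. face_less X \<tau> \<rho> \<or> face_less X \<rho> \<tau>) c}"

text \<open>The map \<open>\<sigma>'\<close>, sending a chain to the carrier of its maximum; the maximum of the empty chain
  is the empty cell.\<close>

definition chain_max :: "'a topology \<Rightarrow> 'a set set \<Rightarrow> 'a set" where
  "chain_max X c =
     (if c = {} then {} else (THE \<tau>. \<tau> \<in> c \<and> (\<forall>\<rho>\<in>c. \<rho> = \<tau> \<or> face_less X \<rho> \<tau>)))"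

definition sd_carrier :: "'a topology \<Rightarrow> ('a set \<Rightarrow> 'v set) \<Rightarrow> 'a set set \<Rightarrow> 'v set" where
  "sd_carrier X \<sigma> c = \<sigma> (chain_max X c)"

section \<open>\<open>h\<close>-polynomials, local \<open>h\<close>-polynomials and local \<open>\<gamma>\<close>-vectors\<close>

text \<open>Simplicial complexes are given by their finite, nonempty set of faces, including the empty
  face; \<open>e\<close> below is the dimension plus one.\<close>

definition h_poly :: "'b set set \<Rightarrow> int poly" where
  "h_poly \<Delta> =
     (let e = Max (card ` \<Delta>)
      in \<Sum>i=0..e. of_nat (card {G \<in> \<Delta>. card G = i}) * [:0, 1:] ^ i * [:1, -1:] ^ (e - i))"

definition local_h_poly :: "'v set \<Rightarrow> 'b set set \<Rightarrow> ('b set \<Rightarrow> 'v set) \<Rightarrow> int poly" where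
  "local_h_poly V \<Delta> s =
     (\<Sum>F\<in>Pow V. (-1) ^ (card V - card F) * h_poly {G \<in> \<Delta>. s G \<subseteq> F})"

definition is_local_gamma_vector :: "nat \<Rightarrow> int poly \<Rightarrow> (nat \<Rightarrow> int) \<Rightarrow> bool" where
  "is_local_gamma_vector d p \<xi> \<longleftrightarrow>
     p = (\<Sum>k=0..d div 2. of_int (\<xi> k) * [:0, 1:] ^ k * [:1, 1:] ^ (d - 2 * k))"

section \<open>The restrictions of the barycentric subdivision\<close>

lemma chain_max_works:
  assumes "c \<in> sd X S" "c \<noteq> {}"
  shows "chain_max X c \<in> c \<and> (\<forall>\<rho>\<in>c. \<rho> = chain_max X c \<or> face_less X \<rho> (chain_max X c))"
proof -
  have fin: "finite c" and
    pw: "pairwise (\<lambda>\<tau> \<rho>. face_less X \<tau> \<rho> \<or> face_less X \<rho> \<tau>) c"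
    using assms by (auto simp: sd_def)
  obtain M where M: "M \<in> (\<lambda>\<tau>. X closure_of \<tau>) ` c"
    "\<And>B. B \<in> (\<lambda>\<tau>. X closure_of \<tau>) ` c \<Longrightarrow> M \<subseteq> B \<Longrightarrow> M = B"
    using finite_has_maximal[of "(\<lambda>\<tau>. X closure_of \<tau>) ` c"] fin assms(2) by auto
  then obtain \<tau> where \<tau>: "\<tau> \<in> c" "M = X closure_of \<tau>" by auto
  have max: "\<rho> = \<tau> \<or> face_less X \<rho> \<tau>" if "\<rho> \<in> c" for \<rho>
  proof (rule ccontr)
    assume "\<not> ?thesis"
    then have "face_less X \<tau> \<rho>" using pw \<tau>(1) that by (auto simp: pairwise_def)
    moreover have "X closure_of \<rho> \<in> (\<lambda>\<tau>. X closure_of \<tau>) ` c" using that by simp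
    ultimately show False using M(2) \<tau>(2) by (metis face_less_def psubset_eq)
  qed
  have "\<exists>!\<tau>. \<tau> \<in> c \<and> (\<forall>\<rho>\<in>c. \<rho> = \<tau> \<or> face_less X \<rho> \<tau>)"
  proof (rule ex1I[of _ \<tau>])
    show "\<tau> \<in> c \<and> (\<forall>\<rho>\<in>c. \<rho> = \<tau> \<or> face_less X \<rho> \<tau>)" using \<tau>(1) max by simp
    fix \<tau>' assume a: "\<tau>' \<in> c \<and> (\<forall>\<rho>\<in>c. \<rho> = \<tau>' \<or> face_less X \<rho> \<tau>')"
    show "\<tau>' = \<tau>"
    proof (rule ccontr)
      assume "\<tau>' \<noteq> \<tau>"
      then have "face_less X \<tau> \<tau>'" "face_less X \<tau>' \<tau>" using a \<tau>(1) max by auto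
      then show False by (simp add: face_less_def)
    qed
  qed
  from theI'[OF this] show ?thesis
    using assms(2) by (simp add: chain_max_def)
qed

lemma sd_restriction:
  assumes "CW_regular_subdivision V X C \<sigma>" "F \<subseteq> V"
  shows "{c \<in> sd X (face_poset C). sd_carrier X \<sigma> c \<subseteq> F} = sd X (restriction C \<sigma> F)"
proof -
  let ?R = "restriction C \<sigma> F"
  have sub: "subcomplex X C ?R" and cw: "finite_regular_CW X C"
    using assms by (auto simp: CW_regular_subdivision_def)
  have empty: "{} \<in> ?R" using sub by (simp add: subcomplex_def)
  have disj: "disjoint C" and un: "\<Union>C = topspace X"
    using cw by (auto simp: finite_regular_CW_def)
  have down: "\<rho> \<in> ?R" if "\<tau> \<in> ?R" "\<rho> \<in> C" "\<rho> \<noteq> {}" "face_less X \<rho> \<tau>" for \<rho> \<tau>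
  proof -
    have "\<rho> \<subseteq> X closure_of \<rho>"
      using un that(2) by (intro closure_of_subset) auto
    also have "\<dots> \<subseteq> X closure_of \<tau>" using that(4) by (auto simp: face_less_def)
    also have "\<dots> \<subseteq> \<Union>?R" using sub that(1) by (auto simp: subcomplex_def)
    finally have "\<rho> \<subseteq> \<Union>?R" .
    with \<open>\<rho> \<noteq> {}\<close> obtain x \<tau>' where x: "x \<in> \<rho>" "x \<in> \<tau>'" "\<tau>' \<in> ?R" by blast
    then have "\<tau>' \<in> C" by (auto simp: restriction_def face_poset_def)
    then have "\<tau>' = \<rho>" using disj x that(2) by (auto simp: disjoint_def)
    then show ?thesis using x by simp
  qed
  show ?thesis
  proof (intro set_eqI iffI)
    fix c assume c: "c \<in> {c \<in> sd X (face_poset C). sd_carrier X \<sigma> c \<subseteq> F}"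
    then have csd: "c \<in> sd X (face_poset C)" by simp
    have "c \<subseteq> ?R"
    proof (cases "c = {}")
      case False
      note m = chain_max_works[OF csd False]
      have max: "chain_max X c \<in> ?R"
        using c m csd by (auto simp: restriction_def sd_carrier_def sd_def)
      show ?thesis
      proof
        fix \<rho> assume \<rho>: "\<rho> \<in> c"
        then have cell: "\<rho> \<in> C" "\<rho> \<noteq> {}" using csd by (auto simp: sd_def face_poset_def)
        from m \<rho> consider "\<rho> = chain_max X c" | "face_less X \<rho> (chain_max X c)" by auto
        then show "\<rho> \<in> ?R"
        proof cases
          case 1 then show ?thesis using max by simp
        next
          case 2 then show ?thesis by (rule down[OF max cell])
        qed
      qed
    qed simp
    then show "c \<in> sd X ?R" using csd by (auto simp: sd_def)
  next
    fix c assume c: "c \<in> sd X ?R"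
    then have "c \<in> sd X (face_poset C)" by (auto simp: sd_def restriction_def)
    moreover have "chain_max X c \<in> ?R"
    proof (cases "c = {}")
      case True then show ?thesis using empty by (simp add: chain_max_def)
    next
      case False
      then show ?thesis using chain_max_works[OF c False] c by (auto simp: sd_def)
    qed
    ultimately show "c \<in> {c \<in> sd X (face_poset C). sd_carrier X \<sigma> c \<subseteq> F}"
      by (auto simp: sd_carrier_def restriction_def)
  qed
qed

lemma local_h_poly_sd:
  assumes "CW_regular_subdivision V X C \<sigma>"
  shows "local_h_poly V (sd X (face_poset C)) (sd_carrier X \<sigma>) =
    (\<Sum>F\<in>Pow V. (-1) ^ (card V - card F) * h_poly (sd X (restriction C \<sigma> F)))"
  unfolding local_h_poly_def using sd_restriction[OF assms] by (intro sum.cong) auto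

end

theory Submission
 imports Defs "HOL-Homology.Homology" "HOL-Library.Function_Algebras"
begin

text \<open>Write \<open>u \<tau>\<close> for the generating polynomial of the chains of cells with maximum \<open>\<tau>\<close>, weighted by
 \<open>x ^ card c * (1 - x) ^ (rk \<tau> - card c)\<close>, and let \<open>I F\<close> be the sum of \<open>u \<tau> * (1 - x) ^ (card F - rk \<tau>)\<close> over the cells
 with carrier \<open>F\<close>. Then the local \<open>h\<close>-polynomial is the sum over \<open>F \<subseteq> V\<close> of \<open>\<theta> F * d (card (V - F))\<close>, where \<open>d n\<close> is the
 \<open>n\<close>-th derangement polynomial and \<open>\<theta> F = I F - x * (\<Sum>G \<subset> F. I G * (1 - x) ^ (card F - card G - 1))\<close>.
 Derangement polynomials have nonnegative \<open>\<gamma>\<close>-vectors by a convolution recursion with Eulerian polynomials.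

 For \<open>\<theta> F\<close> one follows Karu's proof of the nonnegativity of the cd-index. The constant sheaf on the interior
 cells of the ball \<open>\<Gamma>\<^sub>F\<close> is Cohen--Macaulay: its cellular complexes on the stars of all cells are exact below
 the top degree. Dualising a skeleton and dividing by a generic linear map produces Cohen--Macaulay families
 of smaller dimension, and keeping track of dimensions expresses \<open>\<theta> F\<close> as a polynomial in \<open>x\<close> and \<open>1 + x\<close> with nonnegative coefficients.
 The exactness statements come from singular homology: a ball minus a boundary point is contractible relative to
 the ball, a ball minus an interior point retracts to the boundary, and the complement of a point of an open cell retracts to the
 complement of the star of that cell.\<close>

section \<open>Linear algebra\<close>

text \<open>The summands of the alternating sum have both signs, and \<open>I F\<close> is in
  general not symmetric. Subtracting x times the boundary contribution is what makes
  \<open>\<theta> F\<close> symmetric, and \<open>d\<close> is exactly the kernel that undoes this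
  correction. The recursion behind \<open>\<theta> F\<close> is that of the cd-index with c replaced
  by 1 + x and d by 2x: passing to the next skeleton multiplies by 1 + x and adds 2x times a
  polynomial of the same kind, attached to a family two dimensions lower. The stalks of that family
  are kernels of surjections, so a difference of dimensions becomes an actual dimension; this is
  where positivity is won. As such kernels are iterated, all families take values in functions on
  lists, and orthogonal complements stand in for dual spaces. A second obstacle is topological. A
  regular complex is only required to have cell boundaries covered by lower cells; that they are
  unions of cells rests on invariance of domain. Interior and boundary cells of a ball are told
  apart by relative homology, which also makes the boundary independent of the chosen
  homeomorphism.\<close>

instantiation "fun" :: (type, real_vector) real_vector
begin

definition scaleR_fun :: "real \<Rightarrow> ('a \<Rightarrow> 'b) \<Rightarrow> 'a \<Rightarrow> 'b" where
 "scaleR_fun r f = (\<lambda>x. r *\<^sub>R f x)"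

instance
 by standard (auto simp: scaleR_fun_def fun_eq_iff algebra_simps)

end

lemma scaleR_fun_apply [simp]: "(r *\<^sub>R f) x = r *\<^sub>R f x"
 by (simp add: scaleR_fun_def)

lemma sum_fun_apply': "(\<Sum>i\<in>A. f i) x = (\<Sum>i\<in>A. f i x)"
 by (induction A rule: infinite_finite_induct) auto

text \<open>The function spaces below have no finite-dimensional type, so finiteness is carried as a
  property of subsets; \<open>dim\<close> alone does not record it, being 0 for infinite
  bases.\<close>

definition fin_dim :: "'v::real_vector set \<Rightarrow> bool" where
 "fin_dim S \<longleftrightarrow> (\<exists>B. finite B \<and> S \<subseteq> span B)"

lemma fin_dim_subset: "fin_dim T \<Longrightarrow> S \<subseteq> T \<Longrightarrow> fin_dim S"
 unfolding fin_dim_def by blast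

lemma fin_dim_basis:
 fixes S :: "'v::real_vector set"
 assumes "fin_dim S"
 obtains B where "finite B" "B \<subseteq> S" "independent B" "S \<subseteq> span B" "card B = dim S"
proof -
 obtain B0 where B0: "finite B0" "S \<subseteq> span B0" using assms by (auto simp: fin_dim_def)
 obtain B where B: "B \<subseteq> S" "independent B" "S \<subseteq> span B" "card B = dim S"
  using real_vector.basis_exists[of S] by blast
 have "finite B" using real_vector.independent_span_bound[OF B0(1) B(2)] B(1) B0(2) by auto
 with B show ?thesis using that by blast
qed

lemma fin_dim_image:
 assumes "fin_dim S" "linear f"
 shows "fin_dim (f ` S)"
proof -
 obtain B where B: "finite B" "S \<subseteq> span B" using assms(1) by (auto simp: fin_dim_def)
 have "f ` S \<subseteq> span (f ` B)"
  using B(2) linear_span_image[OF assms(2), of B] by auto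
 then show ?thesis using B(1) unfolding fin_dim_def by blast
qed

text \<open>A basis of the kernel extends to one of \<open>S\<close>; the added vectors span a
  complement on which \<open>f\<close> is injective, so their images form a basis of the
  image.\<close>

lemma rank_nullity:
 fixes f :: "'v::real_vector \<Rightarrow> 'w::real_vector"
 assumes S: "subspace S" "fin_dim S" and f: "linear f"
 shows "dim S = dim {x \<in> S. f x = 0} + dim (f ` S)"
proof -
 let ?K = "{x \<in> S. f x = 0}"
 have subK: "subspace ?K"
  using S(1) f by (auto simp: subspace_def linear_add linear_scale linear_0)
 obtain BK where BK: "finite BK" "BK \<subseteq> ?K" "independent BK" "?K \<subseteq> span BK" "card BK = dim ?K"
  using fin_dim_basis fin_dim_subset[OF S(2), of ?K] by blast
 obtain B where B: "BK \<subseteq> B" "B \<subseteq> S" "independent B" "S \<subseteq> span B"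
  using real_vector.maximal_independent_subset_extend[of BK S] BK by auto
 obtain B0 where B0: "finite B0" "S \<subseteq> span B0" using S(2) by (auto simp: fin_dim_def)
 have finB: "finite B"
  using real_vector.independent_span_bound[OF B0(1) B(3)] B(2) B0(2) by auto
 have cardB: "card B = dim S"
  using real_vector.dim_unique[OF B(2) B(4) B(3)] by auto
 let ?R = "B - BK"
 have spanR: "span ?R \<subseteq> S" using B(2) S(1) by (meson Diff_subset real_vector.span_minimal subset_trans)
 have int: "x = 0" if "x \<in> span ?R" "f x = 0" for x
 proof -
  have "x \<in> ?K" using that spanR by auto
  then have "x \<in> span BK" using BK(4) by auto
  \<comment> \<open>Coordinates with respect to \<open>B\<close> are unique, so those of a common
    element vanish both outside \<open>?R\<close> and outside \<open>BK\<close>.\<close>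
  moreover have "span ?R \<inter> span BK = {0}"
  proof -
   have "y = 0" if y: "y \<in> span ?R" "y \<in> span BK" for y
   proof -
    let ?r = "real_vector.representation B y"
    have "?r = real_vector.representation ?R y" "?r = real_vector.representation BK y"
     using real_vector.representation_extend[OF B(3) y(1)] real_vector.representation_extend[OF B(3) y(2)] B(1)
     by (simp_all only: Diff_subset)
    then have "?r b = 0" for b
     using real_vector.representation_ne_zero[of ?R y b] real_vector.representation_ne_zero[of BK y b]
     by auto
    moreover have "y \<in> span B" using y(2) B(1) real_vector.span_mono by blast
    ultimately show ?thesis
     using real_vector.sum_nonzero_representation_eq[OF B(3), of y] by simp
   qed
   then show ?thesis by (auto simp: real_vector.span_zero)
  qed
  ultimately show ?thesis using that by auto
 qed
 have inj: "inj_on f (span ?R)"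
 proof (rule inj_onI)
  fix x y assume xy: "x \<in> span ?R" "y \<in> span ?R" "f x = f y"
  then have "x - y \<in> span ?R" "f (x - y) = 0"
   using f by (auto simp: real_vector.span_diff linear_diff)
  then show "x = y" using int by fastforce
 qed
 have indR: "independent ?R" using B(3) real_vector.independent_mono by blast
 have ind: "independent (f ` ?R)"
  using real_vector.linear_independent_injective_image[OF f indR inj] .
 have sp: "f ` S \<subseteq> span (f ` ?R)"
 proof -
  have "f ` S \<subseteq> span (f ` B)" using B(4) linear_span_image[OF f, of B] by auto
  also have "f ` B \<subseteq> insert 0 (f ` ?R)" using BK(2) by auto
  then have "span (f ` B) \<subseteq> span (insert 0 (f ` ?R))" by (rule real_vector.span_mono)
  also have "\<dots> = span (f ` ?R)" by (rule real_vector.span_insert_0)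
  finally show ?thesis .
 qed
 have "dim (f ` S) = card (f ` ?R)"
  using real_vector.dim_unique[of "f ` ?R" "f ` S", OF _ sp ind refl] B(2) by blast
 also have "\<dots> = card ?R"
  using inj by (meson card_image inj_on_subset real_vector.span_superset)
 finally have "dim (f ` S) = card ?R" .
 moreover have "card B = card BK + card ?R"
  using B(1) finB by (metis card_Diff_subset card_mono finite_subset le_add_diff_inverse)
 ultimately show ?thesis using cardB BK(5) by simp
qed

text \<open>Gram-Schmidt over a finite spanning set. Definiteness is asked for on \<open>C\<close>
  only, because the forms used later sum over finite index sets and are degenerate on the full
  function type.\<close>

lemma orthogonal_projection_exists:
 fixes ip :: "'v::real_vector \<Rightarrow> 'v \<Rightarrow> real"
 assumes lin: "\<And>y. linear (\<lambda>x. ip x y)" and sym: "\<And>x y. ip x y = ip y x"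
  and C: "subspace C" and pos: "\<And>x. x \<in> C \<Longrightarrow> ip x x = 0 \<Longrightarrow> x = 0"
  and Z: "subspace Z" "Z \<subseteq> C" "fin_dim Z" and c: "c \<in> C"
 shows "\<exists>z\<in>Z. \<forall>w\<in>Z. ip (c - z) w = 0"
proof -
 have diff: "ip (x - y) w = ip x w - ip y w" for x y w by (rule linear_diff[OF lin[of w]])
 have scal: "ip (r *\<^sub>R x) w = r * ip x w" for r x w using linear_scale[OF lin[of w], of r x] by simp
 have add: "ip (x + y) w = ip x w + ip y w" for x y w by (rule linear_add[OF lin[of w]])
 have zer: "ip x 0 = 0" for x using linear_0[OF lin[of x]] sym by simp
 obtain B where B: "finite B" "B \<subseteq> Z" "Z \<subseteq> span B" by (rule fin_dim_basis[OF Z(3)])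
 have orth_span: "(\<forall>w\<in>span A. ip x w = 0) \<longleftrightarrow> (\<forall>w\<in>A. ip x w = 0)" for x A
 proof
  assume "\<forall>w\<in>A. ip x w = 0"
  then have "A \<subseteq> {w. ip x w = 0}" by auto
  moreover have "subspace {w. ip x w = 0}"
   using zer linear_0[OF lin[of x]] by (auto simp: subspace_def sym[of x] add scal)
  ultimately show "\<forall>w\<in>span A. ip x w = 0" using real_vector.span_minimal by blast
 qed (auto intro: real_vector.span_base)
 have "B \<subseteq> C \<Longrightarrow> \<forall>c\<in>C. \<exists>z\<in>span B. \<forall>w\<in>B. ip (c - z) w = 0" using B(1)
 proof (induction B rule: finite_induct)
  case empty then show ?case by (auto intro: real_vector.span_zero)
 next
  case (insert a A)
  then have A: "A \<subseteq> C" "a \<in> C" and IH: "\<forall>c\<in>C. \<exists>z\<in>span A. \<forall>w\<in>A. ip (c - z) w = 0" by auto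
  have spC: "span A \<subseteq> C" using A(1) C real_vector.span_minimal by blast
  have spi: "span A \<subseteq> span (insert a A)" by (rule real_vector.span_mono) auto
  \<comment> \<open>Replace \<open>a\<close> by its component \<open>?b\<close> orthogonal to
    \<open>span A\<close>; a correction along \<open>?b\<close> keeps the orthogonality to
    \<open>A\<close> already achieved.\<close>
  obtain a0 where a0: "a0 \<in> span A" "\<forall>w\<in>A. ip (a - a0) w = 0" using IH A by blast
  let ?b = "a - a0"
  have bC: "?b \<in> C" using a0 A spC C by (auto simp: subspace_diff)
  have bsp: "?b \<in> span (insert a A)"
   using a0(1) spi by (meson insertI1 real_vector.span_base real_vector.span_diff subset_iff)
  show ?case
  proof
   fix c assume "c \<in> C"
   then obtain z where z: "z \<in> span A" "\<forall>w\<in>A. ip (c - z) w = 0" using IH by blast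
   show "\<exists>z\<in>span (insert a A). \<forall>w\<in>insert a A. ip (c - z) w = 0"
   proof (cases "?b = 0")
    case True
    then have "a \<in> span A" using a0 by simp
    then have "ip (c - z) a = 0" using z orth_span by blast
    then show ?thesis using z spi by auto
   next
    case False
    then have nz: "ip ?b ?b \<noteq> 0" using pos[OF bC] by blast
    define t where "t = ip (c - z) ?b / ip ?b ?b"
    let ?z = "z + t *\<^sub>R ?b"
    have *: "ip (c - ?z) w = ip (c - z) w - t * ip ?b w" for w
     by (simp add: diff add scal)
    have 1: "\<forall>w\<in>A. ip (c - ?z) w = 0" using z(2) a0(2) by (subst *) simp
    have "ip (c - ?z) ?b = 0" using nz by (subst *) (simp add: t_def)
    moreover have "ip (c - ?z) a0 = 0" using 1 a0(1) orth_span by blast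
    ultimately have "ip (c - ?z) (?b + a0) = 0" by (simp only: sym[of "c - ?z"] add)
    then have "ip (c - ?z) a = 0" by simp
    moreover have "?z \<in> span (insert a A)"
     using z(1) spi bsp by (meson real_vector.span_add real_vector.span_scale subset_iff)
    ultimately show ?thesis using 1 by blast
   qed
  qed
 qed
 then obtain z where z: "z \<in> span B" "\<forall>w\<in>B. ip (c - z) w = 0" using B Z(2) c by blast
 have "span B = Z" using B Z(1) by (simp add: real_vector.span_minimal subset_antisym)
 then show ?thesis using z orth_span by blast
qed

text \<open>Kernel vectors of \<open>f + t g\<close> for distinct nonzero \<open>t\<close> are linearly independent when \<open>f\<close> is
 injective.\<close>

lemma finite_singular_pencil:
 fixes f g :: "'v::real_vector \<Rightarrow> 'w::real_vector"
 assumes S: "subspace S" "fin_dim S" and f: "linear f" "\<And>x. x \<in> S \<Longrightarrow> f x = 0 \<Longrightarrow> x = 0"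
  and g: "linear g"
 shows "finite {t. \<exists>x\<in>S. x \<noteq> 0 \<and> f x + t *\<^sub>R g x = 0}"
proof -
 define T where "T = {t. \<exists>x\<in>S. x \<noteq> 0 \<and> f x + t *\<^sub>R g x = 0}"
 have nz: "t \<noteq> 0" if "t \<in> T" for t using that f(2) by (auto simp: T_def)
 have T: "\<forall>t\<in>T. \<exists>x. x \<in> S \<and> x \<noteq> 0 \<and> f x + t *\<^sub>R g x = 0" by (auto simp: T_def)
 obtain v where v: "\<And>t. t \<in> T \<Longrightarrow> v t \<in> S \<and> v t \<noteq> 0 \<and> f (v t) + t *\<^sub>R g (v t) = 0" 
  using bchoice[OF T] by auto
 have ind: "\<forall>a. (\<Sum>t\<in>A. a t *\<^sub>R v t) = 0 \<longrightarrow> (\<forall>t\<in>A. a t = 0)" if "finite A" "A \<subseteq> T" for A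
  using that
 proof (induction A rule: finite_induct)
  case (insert s A)
  show ?case
  proof (intro allI impI)
   fix a :: "real \<Rightarrow> real" assume a: "(\<Sum>t\<in>insert s A. a t *\<^sub>R v t) = 0"
   have gv: "g (v t) = - (1/t) *\<^sub>R f (v t)" if "t \<in> insert s A" for t
   proof -
    have "t \<in> T" using that insert.prems by auto
    then have "t \<noteq> 0" "t *\<^sub>R g (v t) = - f (v t)" using nz v[of t] by (auto simp: eq_neg_iff_add_eq_0 add.commute)
    then have "(1/t) *\<^sub>R (t *\<^sub>R g (v t)) = - (1/t) *\<^sub>R f (v t)" by simp
    then show ?thesis using \<open>t \<noteq> 0\<close> by simp
   qed
   \<comment> \<open>Applying \<open>g\<close> and the kernel equations gives a second relation,
     with coefficients \<open>a t / t\<close>, because \<open>f\<close> is injective on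
     \<open>S\<close>. Subtracting \<open>s\<close> times it from the original removes the term at
     \<open>s\<close>.\<close>
   have "0 = g (\<Sum>t\<in>insert s A. a t *\<^sub>R v t)" using a g by (simp add: linear_0)
   also have "\<dots> = (\<Sum>t\<in>insert s A. a t *\<^sub>R g (v t))" using g by (simp add: linear_sum linear_scale)
   also have "\<dots> = (\<Sum>t\<in>insert s A. - f ((a t / t) *\<^sub>R v t))"
    by (rule sum.cong) (auto simp: gv linear_scale[OF f(1)])
   also have "\<dots> = - f (\<Sum>t\<in>insert s A. (a t / t) *\<^sub>R v t)" 
    by (simp only: linear_sum[OF f(1)] sum_negf)
   finally have "f (\<Sum>t\<in>insert s A. (a t / t) *\<^sub>R v t) = 0" by simp
   moreover have "(\<Sum>t\<in>insert s A. (a t / t) *\<^sub>R v t) \<in> S"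
    using insert.prems v by (intro subspace_sum[OF S(1)] subspace_scale[OF S(1)]) auto
   ultimately have b: "(\<Sum>t\<in>insert s A. (a t / t) *\<^sub>R v t) = 0" using f(2) by blast
   have s: "s \<in> T" "s \<noteq> 0" using insert.prems nz by auto
   have "(\<Sum>t\<in>A. (a t - s * (a t / t)) *\<^sub>R v t) =
     (\<Sum>t\<in>insert s A. (a t - s * (a t / t)) *\<^sub>R v t)"
    using insert.hyps s(2) by (subst sum.insert) auto
   also have "\<dots> = (\<Sum>t\<in>insert s A. a t *\<^sub>R v t) - s *\<^sub>R (\<Sum>t\<in>insert s A. (a t / t) *\<^sub>R v t)"
    by (simp add: scaleR_left_diff_distrib sum_subtractf scaleR_right.sum del: sum.insert)
   also have "\<dots> = 0" using a b by simp
   finally have sum0: "(\<Sum>t\<in>A. (a t - s * (a t / t)) *\<^sub>R v t) = 0" .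
   have AT: "A \<subseteq> T" using insert.prems by simp
   have *: "\<forall>t\<in>A. a t - s * (a t / t) = 0"
    using spec[OF insert.IH[OF AT], of "\<lambda>t. a t - s * (a t / t)"] sum0 by blast
   have zero: "a t = 0" if "t \<in> A" for t
   proof -
    have "t \<noteq> s" "t \<noteq> 0" using that insert.hyps insert.prems nz by auto
    then show ?thesis using *[rule_format, OF that] by (simp add: field_simps)
   qed
   then have "(\<Sum>t\<in>A. a t *\<^sub>R v t) = 0" by (intro sum.neutral) auto
   then have "a s *\<^sub>R v s = 0" using a insert.hyps by simp
   then have "a s = 0" using v[OF s(1)] by simp
   then show "\<forall>t\<in>insert s A. a t = 0" using zero by auto
  qed
 qed simp
 obtain B where B: "finite B" "S \<subseteq> span B" using S(2) by (auto simp: fin_dim_def)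
 have bound: "card A \<le> card B" if A: "finite A" "A \<subseteq> T" for A
 proof -
  have inj: "inj_on v A"
  proof (rule inj_onI, rule ccontr)
   fix x y assume xy: "x \<in> A" "y \<in> A" "v x = v y" "x \<noteq> y"
   let ?a = "\<lambda>t. if t = x then 1 else if t = y then -1 else (0::real)"
   have "(\<Sum>t\<in>A. ?a t *\<^sub>R v t) = (\<Sum>t\<in>{x,y}. ?a t *\<^sub>R v t)"
    using xy A by (intro sum.mono_neutral_right) auto
   also have "\<dots> = 0" using xy by simp
   finally have "?a x = 0" using spec[OF ind[OF A], of ?a] xy(1) by blast
   then show False by simp
  qed
  have "independent (v ` A)"
  proof (rule real_vector.independent_if_scalars_zero)
   fix h x assume h: "(\<Sum>x\<in>v ` A. h x *\<^sub>R x) = 0" and x: "x \<in> v ` A"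
   have "(\<Sum>t\<in>A. h (v t) *\<^sub>R v t) = 0" using h inj by (simp add: sum.reindex)
   then have "\<forall>t\<in>A. h (v t) = 0" using spec[OF ind[OF A], of "\<lambda>t. h (v t)"] by blast
   then show "h x = 0" using x by blast
  qed (use A in auto)
  moreover have "v ` A \<subseteq> span B" using v A(2) B(2) by blast
  ultimately have "card (v ` A) \<le> card B" using real_vector.independent_span_bound[OF B(1)] by auto
  then show ?thesis using inj by (simp add: card_image)
 qed
 have "finite T"
 proof (rule ccontr)
  assume "infinite T"
  then obtain A where "A \<subseteq> T" "finite A" "card A = Suc (card B)"
   using infinite_arbitrarily_large by blast
  then show False using bound[of A] by simp
 qed
 then show ?thesis by (simp add: T_def)
qed

section \<open>Cellular posets and Cohen--Macaulay families\<close>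

text \<open>Supertrace argument: the diagonal entries of \<open>s eps + eps s\<close> are 1, while
  its alternating trace vanishes because \<open>s\<close> raises the rank by one and the two
  products contribute with opposite signs.\<close>

lemma euler_contraction:
 fixes s eps :: "'p \<Rightarrow> 'p \<Rightarrow> real"
 assumes "\<And>a b. s a b \<noteq> 0 \<Longrightarrow> rk a = Suc (rk b)"
  and s: "\<And>a. a \<in> I \<Longrightarrow> (\<Sum>c\<in>I. s a c * eps c a + eps a c * s c a) = 1"
 shows "(\<Sum>a\<in>I. (-1) ^ rk a) = (0::int)"
proof -
 have sgn: "(-1) ^ rk a * (eps a c * s c a) = - ((-1) ^ rk c * (s c a * eps a c))" for a c
  using assms(1)[of c a] by (cases "s c a = 0") auto
 have "(\<Sum>a\<in>I. (-1) ^ rk a) = (\<Sum>a\<in>I. (-1) ^ rk a * (\<Sum>c\<in>I. s a c * eps c a + eps a c * s c a))"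
  by (rule sum.cong) (auto simp: s)
 also have "\<dots> = (\<Sum>a\<in>I. \<Sum>c\<in>I. (-1) ^ rk a * (s a c * eps c a)) +
   (\<Sum>a\<in>I. \<Sum>c\<in>I. (-1) ^ rk a * (eps a c * s c a))"
  by (simp add: sum_distrib_left distrib_left sum.distrib)
 also have "(\<Sum>a\<in>I. \<Sum>c\<in>I. (-1) ^ rk a * (eps a c * s c a)) =
   - (\<Sum>a\<in>I. \<Sum>c\<in>I. (-1) ^ rk c * (s c a * eps a c))"
  by (simp only: sgn sum_negf)
 also have "(\<Sum>a\<in>I. \<Sum>c\<in>I. (-1) ^ rk c * (s c a * eps a c)) =
   (\<Sum>c\<in>I. \<Sum>a\<in>I. (-1) ^ rk c * (s c a * eps a c))"
  by (rule sum.swap)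
 finally have "(\<Sum>a\<in>I. (-1) ^ rk a) = (0::real)" by simp
 then have "real_of_int (\<Sum>a\<in>I. (-1) ^ rk a) = 0" by simp
 then show ?thesis by linarith
qed

text \<open>Abstract face poset with the empty face as \<open>bot\<close> and incidence numbers
  \<open>eps\<close>. Acyclicity of each nontrivial interval is stored as an explicit contraction,
  which yields both the Euler relation and primitives for cycles in a column of the double
  complex.\<close>

locale cell_poset =
 fixes P :: "'p set" and le :: "'p \<Rightarrow> 'p \<Rightarrow> bool" (infix "\<sqsubseteq>" 50)
  and rk :: "'p \<Rightarrow> nat" and eps :: "'p \<Rightarrow> 'p \<Rightarrow> real" and bot :: 'p
 assumes fin: "finite P"
  and le_refl: "x \<in> P \<Longrightarrow> x \<sqsubseteq> x"
  and le_trans: "x \<sqsubseteq> y \<Longrightarrow> y \<sqsubseteq> z \<Longrightarrow> x \<sqsubseteq> z"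
  and le_P: "x \<sqsubseteq> y \<Longrightarrow> x \<in> P \<and> y \<in> P"
  and rk_less: "x \<sqsubseteq> y \<Longrightarrow> x \<noteq> y \<Longrightarrow> rk x < rk y"
  and eps_le: "eps x y \<noteq> 0 \<Longrightarrow> x \<sqsubseteq> y \<and> rk y = Suc (rk x)"
  and eps_eps: "(\<Sum>y\<in>P. eps x y * eps y z) = 0"
  and contraction: "x \<sqsubseteq> y \<Longrightarrow> x \<noteq> y \<Longrightarrow>
   \<exists>s. (\<forall>a b. s a b \<noteq> 0 \<longrightarrow> rk a = Suc (rk b)) \<and>
     (\<forall>a b. x \<sqsubseteq> a \<and> a \<sqsubseteq> y \<and> x \<sqsubseteq> b \<and> b \<sqsubseteq> y \<longrightarrow>
      (\<Sum>c | x \<sqsubseteq> c \<and> c \<sqsubseteq> y. s a c * eps c b + eps a c * s c b) = (if a = b then 1 else 0))"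
  and bot_P: "bot \<in> P" and bot_le: "x \<in> P \<Longrightarrow> bot \<sqsubseteq> x" and rk_bot: "rk bot = 0"
begin

lemma rk_mono: "x \<sqsubseteq> y \<Longrightarrow> rk x \<le> rk y"
 using rk_less[of x y] by (cases "x = y") auto

lemma fin_interval: "finite {c. x \<sqsubseteq> c \<and> c \<sqsubseteq> y}"
 by (rule finite_subset[OF _ fin]) (auto dest: le_P)

text \<open>Intervals are Eulerian; this is what makes \<open>dual\<close> an involution.\<close>

lemma euler_interval:
 assumes "x \<sqsubseteq> y" "x \<noteq> y"
 shows "(\<Sum>a | x \<sqsubseteq> a \<and> a \<sqsubseteq> y. (-1) ^ rk a) = (0::int)"
proof -
 let ?I = "{a. x \<sqsubseteq> a \<and> a \<sqsubseteq> y}"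
 obtain s where s: "\<And>a b. s a b \<noteq> 0 \<Longrightarrow> rk a = Suc (rk b)"
  "\<And>a b. a \<in> ?I \<Longrightarrow> b \<in> ?I \<Longrightarrow> (\<Sum>c\<in>?I. s a c * eps c b + eps a c * s c b) = (if a = b then 1 else 0)"
 proof -
  obtain s where s: "\<forall>a b. s a b \<noteq> 0 \<longrightarrow> rk a = Suc (rk b)"
   "\<forall>a b. x \<sqsubseteq> a \<and> a \<sqsubseteq> y \<and> x \<sqsubseteq> b \<and> b \<sqsubseteq> y \<longrightarrow>
      (\<Sum>c | x \<sqsubseteq> c \<and> c \<sqsubseteq> y. s a c * eps c b + eps a c * s c b) = (if a = b then 1 else 0)"
   using contraction[OF assms] by (elim exE conjE)
  show ?thesis
  proof (rule that[of s])
   fix a b assume "a \<in> ?I" "b \<in> ?I"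
   then show "(\<Sum>c\<in>?I. s a c * eps c b + eps a c * s c b) = (if a = b then 1 else 0)"
    using s(2)[THEN spec, THEN spec, THEN mp, of a b] by simp
  qed (use s(1) in simp)
 qed
 show ?thesis
 proof (rule euler_contraction[where s=s and eps=eps])
  show "s a b \<noteq> 0 \<Longrightarrow> rk a = Suc (rk b)" for a b by (rule s(1))
  show "(\<Sum>c\<in>?I. s a c * eps c a + eps a c * s c a) = 1" if "a \<in> ?I" for a using s(2)[OF that that] by simp
 qed
qed

text \<open>Zeros are forced off the filter above \<open>x\<close> in rank \<open>k\<close>, so that
  direct sums of stalks become subspaces of one fixed function space.\<close>

definition chains :: "('p \<Rightarrow> 'w::real_vector set) \<Rightarrow> nat \<Rightarrow> 'p \<Rightarrow> ('p \<Rightarrow> 'w) set" where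
 "chains N k x = {z. \<forall>a. (x \<sqsubseteq> a \<and> rk a = k \<longrightarrow> z a \<in> N a) \<and> (\<not> (x \<sqsubseteq> a \<and> rk a = k) \<longrightarrow> z a = 0)}"

text \<open>The differential of a cosheaf includes the stalk at \<open>b\<close> into the larger
  stalk at a face \<open>a\<close>. Such inclusions are available only for \<open>a\<close> in the
  up-set \<open>U\<close>, hence the truncation.\<close>

definition bd :: "'p set \<Rightarrow> 'p \<Rightarrow> ('p \<Rightarrow> 'w::real_vector) \<Rightarrow> 'p \<Rightarrow> 'w" where
 "bd U x z = (\<lambda>a. if a \<in> U \<and> x \<sqsubseteq> a then \<Sum>b\<in>P. eps a b *\<^sub>R z b else 0)"

definition restr :: "'p \<Rightarrow> ('p \<Rightarrow> 'w::real_vector) \<Rightarrow> 'p \<Rightarrow> 'w" where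
 "restr x z = (\<lambda>a. if x \<sqsubseteq> a then z a else 0)"

text \<open>Raises the first index of a family on pairs \<open>a \<sqsubseteq> c\<close>, whereas
  \<open>bd\<close> lowers the second.\<close>

definition cobd :: "'p \<Rightarrow> ('p \<Rightarrow> 'p \<Rightarrow> 'w::real_vector) \<Rightarrow> 'p \<Rightarrow> 'p \<Rightarrow> 'w" where
 "cobd x g = (\<lambda>a c. if x \<sqsubseteq> a \<and> a \<sqsubseteq> c then \<Sum>b\<in>P. eps b a *\<^sub>R g b c else 0)"

lemma chainsD: "z \<in> chains N k x \<Longrightarrow> x \<sqsubseteq> a \<Longrightarrow> rk a = k \<Longrightarrow> z a \<in> N a"
 and chains_zero: "z \<in> chains N k x \<Longrightarrow> \<not> (x \<sqsubseteq> a \<and> rk a = k) \<Longrightarrow> z a = 0"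
 by (auto simp: chains_def)

lemma chainsI: "(\<And>a. x \<sqsubseteq> a \<Longrightarrow> rk a = k \<Longrightarrow> z a \<in> N a) \<Longrightarrow> (\<And>a. \<not> (x \<sqsubseteq> a \<and> rk a = k) \<Longrightarrow> z a = 0)
 \<Longrightarrow> z \<in> chains N k x"
 by (auto simp: chains_def)

lemma chains_in:
 assumes "\<And>a. subspace (N a)" "z \<in> chains N k x"
 shows "z a \<in> N a"
 using assms chainsD[OF assms(2), of a] chains_zero[OF assms(2), of a] subspace_0[OF assms(1)] by metis

lemma subspace_chains: "(\<And>a. subspace (N a)) \<Longrightarrow> subspace (chains N k x)"
 unfolding subspace_def chains_def by auto

lemma linear_bd: "linear (bd U x)"
 by (rule linearI) (auto simp: bd_def fun_eq_iff scaleR_right_distrib sum.distrib scaleR_right.sum mult.commute)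

lemma linear_restr: "linear (restr x)"
 by (rule linearI) (auto simp: restr_def fun_eq_iff)

lemma linear_cobd: "linear (cobd x)"
 by (rule linearI) (auto simp: cobd_def fun_eq_iff scaleR_right_distrib sum.distrib scaleR_right.sum mult.commute)

lemma bd_chains:
 assumes N: "\<And>a. subspace (N a)" "\<And>a b. a \<in> U \<Longrightarrow> a \<sqsubseteq> b \<Longrightarrow> N b \<subseteq> N a"
  and z: "z \<in> chains N (Suc k) x"
 shows "bd U x z \<in> chains N k x"
proof (rule chainsI)
 fix a assume a: "x \<sqsubseteq> a" "rk a = k"
 have "eps a b *\<^sub>R z b \<in> N a" if "a \<in> U" for b
 proof (cases "eps a b = 0")
  case False
  then have "a \<sqsubseteq> b" using eps_le by blast
  then have "z b \<in> N a" using chains_in[OF N(1) z] N(2)[OF that] by blast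
  then show ?thesis using N(1) by (simp add: subspace_scale)
 qed (use N(1) in \<open>simp add: subspace_0\<close>)
 then show "bd U x z a \<in> N a" using N(1) by (auto simp: bd_def subspace_0 intro: subspace_sum)
next
 fix a assume a: "\<not> (x \<sqsubseteq> a \<and> rk a = k)"
 have "eps a b *\<^sub>R z b = 0" if "x \<sqsubseteq> a" for b
  using eps_le[of a b] chains_zero[OF z, of b] a that by (cases "eps a b = 0") auto
 then show "bd U x z a = 0" unfolding bd_def by (simp add: sum.neutral del: scaleR_eq_0_iff)
qed

lemma bd_chains_0:
 assumes z: "z \<in> chains N k x" "k \<le> rk x"
 shows "bd U x z = 0"
proof -
 have "eps a b *\<^sub>R z b = 0" if "x \<sqsubseteq> a" for a b
 proof (cases "eps a b = 0")
  case False
  then have "rk b \<noteq> k" using eps_le[of a b] rk_mono[OF that] z(2) by auto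
  then show ?thesis using chains_zero[OF z(1)] by simp
 qed simp
 then show ?thesis unfolding bd_def fun_eq_iff by (simp add: sum.neutral del: scaleR_eq_0_iff)
qed

lemma bd_bd:
 assumes U: "U \<subseteq> P" "\<And>a b. a \<in> U \<Longrightarrow> a \<sqsubseteq> b \<Longrightarrow> b \<in> U"
 shows "bd U x (bd U x z) = 0"
proof
 fix a
 show "bd U x (bd U x z) a = 0 a"
 proof (cases "a \<in> U \<and> x \<sqsubseteq> a")
  case True
  have "bd U x (bd U x z) a = (\<Sum>b\<in>P. eps a b *\<^sub>R bd U x z b)" using True by (simp add: bd_def)
  also have "\<dots> = (\<Sum>b\<in>P. \<Sum>c\<in>P. (eps a b * eps b c) *\<^sub>R z c)"
  proof (rule sum.cong[OF refl])
   fix b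
   show "eps a b *\<^sub>R bd U x z b = (\<Sum>c\<in>P. (eps a b * eps b c) *\<^sub>R z c)"
   proof (cases "eps a b = 0")
    case False
    then have "b \<in> U" "x \<sqsubseteq> b" using eps_le True U le_trans by blast+
    then show ?thesis by (simp add: bd_def scaleR_right.sum)
   qed simp
  qed
  also have "\<dots> = (\<Sum>c\<in>P. (\<Sum>b\<in>P. eps a b * eps b c) *\<^sub>R z c)"
   by (subst sum.swap) (simp add: scaleR_left.sum)
  also have "\<dots> = 0" by (simp add: eps_eps)
  finally show ?thesis by simp
 qed (auto simp: bd_def)
qed

lemma restr_chains:
 assumes "z \<in> chains N k x" "x \<sqsubseteq> y"
 shows "restr y z \<in> chains N k y"
 using assms le_trans by (auto simp: chains_def restr_def)

lemma bd_restr: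
 assumes "x \<sqsubseteq> y"
 shows "bd U y (restr y z) = restr y (bd U x z)"
proof
 fix a
 have *: "eps a b *\<^sub>R restr y z b = eps a b *\<^sub>R z b" if "y \<sqsubseteq> a" for b
  using eps_le[of a b] le_trans[OF that] by (cases "eps a b = 0") (auto simp: restr_def)
 have "(\<Sum>b\<in>P. eps a b *\<^sub>R restr y z b) = (\<Sum>b\<in>P. eps a b *\<^sub>R z b)" if "y \<sqsubseteq> a"
  by (rule sum.cong[OF refl *[OF that]])
 then show "bd U y (restr y z) a = restr y (bd U x z) a"
  using le_trans[OF assms] unfolding bd_def restr_def[of y "\<lambda>a. if a \<in> U \<and> x \<sqsubseteq> a then _ a else _ a"] by auto
qed

text \<open>The two differentials act on different indices, hence commute without a sign and form a
  double complex on the pairs above \<open>x\<close>.\<close>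

lemma bd_cobd:
 assumes g: "\<And>b. \<not> x \<sqsubseteq> b \<Longrightarrow> g b = 0"
 shows "bd U a (cobd x g a) = cobd x (\<lambda>a. bd U a (g a)) a"
proof
 fix c
 show "bd U a (cobd x g a) c = cobd x (\<lambda>a. bd U a (g a)) a c"
 proof (cases "x \<sqsubseteq> a \<and> a \<sqsubseteq> c \<and> c \<in> U")
  case True
  have "bd U a (cobd x g a) c = (\<Sum>d\<in>P. eps c d *\<^sub>R cobd x g a d)" using True by (simp add: bd_def)
  also have "\<dots> = (\<Sum>d\<in>P. \<Sum>b\<in>P. (eps c d * eps b a) *\<^sub>R g b d)"
  proof (rule sum.cong[OF refl])
   fix d
   show "eps c d *\<^sub>R cobd x g a d = (\<Sum>b\<in>P. (eps c d * eps b a) *\<^sub>R g b d)"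
   proof (cases "eps c d = 0")
    case False
    then have "a \<sqsubseteq> d" using eps_le True le_trans by blast
    then show ?thesis using True by (simp add: cobd_def scaleR_right.sum)
   qed simp
  qed
  also have "\<dots> = (\<Sum>b\<in>P. \<Sum>d\<in>P. (eps c d * eps b a) *\<^sub>R g b d)" by (rule sum.swap)
  also have "\<dots> = (\<Sum>b\<in>P. eps b a *\<^sub>R bd U b (g b) c)"
  proof (rule sum.cong[OF refl])
   fix b
   show "(\<Sum>d\<in>P. (eps c d * eps b a) *\<^sub>R g b d) = eps b a *\<^sub>R bd U b (g b) c"
   proof (cases "eps b a = 0")
    case False
    then have "b \<sqsubseteq> c" using eps_le True le_trans by blast
    then show ?thesis using True by (simp add: bd_def scaleR_right.sum mult.commute)
   qed simp
  qed
  also have "\<dots> = cobd x (\<lambda>a. bd U a (g a)) a c" using True by (simp add: cobd_def)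
  finally show ?thesis .
 next
  case False
  have 1: "bd U a (cobd x g a) c = 0"
  proof (cases "c \<in> U \<and> a \<sqsubseteq> c")
   case True
   then have "\<not> x \<sqsubseteq> a" using False by blast
   then show ?thesis using True by (simp add: bd_def cobd_def)
  qed (auto simp: bd_def)
  have "eps b a *\<^sub>R bd U b (g b) c = 0" if "x \<sqsubseteq> a \<and> a \<sqsubseteq> c" for b
   using that False by (simp add: bd_def)
  then have "cobd x (\<lambda>a. bd U a (g a)) a c = 0" unfolding cobd_def by (simp add: sum.neutral del: scaleR_eq_0_iff)
  with 1 show ?thesis by simp
 qed
qed

lemma cobd_cobd:
 assumes g: "\<And>b. \<not> x \<sqsubseteq> b \<Longrightarrow> g b = 0"
 shows "cobd x (cobd x g) = 0"
proof (intro ext)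
 fix a c
 show "cobd x (cobd x g) a c = 0 a c"
 proof (cases "x \<sqsubseteq> a \<and> a \<sqsubseteq> c")
  case True
  have "cobd x (cobd x g) a c = (\<Sum>b\<in>P. eps b a *\<^sub>R cobd x g b c)" using True by (simp add: cobd_def)
  also have "\<dots> = (\<Sum>b\<in>P. \<Sum>d\<in>P. (eps d b * eps b a) *\<^sub>R g d c)"
  proof (rule sum.cong[OF refl])
   fix b
   show "eps b a *\<^sub>R cobd x g b c = (\<Sum>d\<in>P. (eps d b * eps b a) *\<^sub>R g d c)"
   proof (cases "eps b a = 0")
    case False
    then have bc: "b \<sqsubseteq> c" using eps_le True le_trans by blast
    show ?thesis
    proof (cases "x \<sqsubseteq> b")
     case True
     then show ?thesis using bc by (simp add: cobd_def scaleR_right.sum mult.commute)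
    next
     case nx: False
     have "(eps d b * eps b a) *\<^sub>R g d c = 0" for d
      using g[of d] eps_le[of d b] nx le_trans[of x d b] by (cases "eps d b = 0"; cases "x \<sqsubseteq> d") auto
     then have "(\<Sum>d\<in>P. (eps d b * eps b a) *\<^sub>R g d c) = 0" by (intro sum.neutral) blast
     then show ?thesis using nx by (simp add: cobd_def)
    qed
   qed simp
  qed
  also have "\<dots> = (\<Sum>d\<in>P. (\<Sum>b\<in>P. eps d b * eps b a) *\<^sub>R g d c)"
   by (subst sum.swap) (simp add: scaleR_left.sum)
  also have "\<dots> = 0" by (simp add: eps_eps)
  finally show ?thesis by simp
 qed (auto simp: cobd_def)
qed

end

text \<open>A Cohen--Macaulay family of dimension \<open>m\<close>: a cosheaf of subspaces on the up-set \<open>U\<close>, extended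
 by zero, whose chain complexes on all principal filters are exact below rank \<open>m\<close>.\<close>

locale cm_family = cell_poset P le rk eps bot
 for P :: "'p set" and le (infix "\<sqsubseteq>" 50) and rk eps bot +
 fixes N :: "'p \<Rightarrow> ('q \<Rightarrow> real) set" and U :: "'p set" and m :: nat and L :: "'q set"
 assumes U_P: "U \<subseteq> P" and U_up: "a \<in> U \<Longrightarrow> a \<sqsubseteq> b \<Longrightarrow> b \<in> U"
  and N_subspace: "subspace (N a)"
  and N_zero: "a \<notin> U \<or> m < rk a \<Longrightarrow> N a = {0}"
  and N_mono: "a \<in> U \<Longrightarrow> a \<sqsubseteq> b \<Longrightarrow> N b \<subseteq> N a"
  and fin_L: "finite L" and N_supp: "f \<in> N a \<Longrightarrow> l \<notin> L \<Longrightarrow> f l = 0"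
  and exact: "k < m \<Longrightarrow> z \<in> chains N k x \<Longrightarrow> bd U x z = 0 \<Longrightarrow> \<exists>y\<in>chains N (Suc k) x. bd U x y = z"
begin

text \<open>The first degree is an integer so that degree -1, where only 0 lives, is available at
  the start of the induction in \<open>cycles_exact\<close>.\<close>

definition dchains :: "int \<Rightarrow> nat \<Rightarrow> 'p \<Rightarrow> ('p \<Rightarrow> 'p \<Rightarrow> 'q \<Rightarrow> real) set" where
 "dchains k i x = {g. \<forall>a. (x \<sqsubseteq> a \<and> int (rk a) = k \<longrightarrow> g a \<in> chains N i a) \<and>
   (\<not> (x \<sqsubseteq> a \<and> int (rk a) = k) \<longrightarrow> g a = 0)}"

lemma dchainsI: "(\<And>a. x \<sqsubseteq> a \<Longrightarrow> int (rk a) = k \<Longrightarrow> g a \<in> chains N i a) \<Longrightarrow>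
  (\<And>a. \<not> (x \<sqsubseteq> a \<and> int (rk a) = k) \<Longrightarrow> g a = 0) \<Longrightarrow> g \<in> dchains k i x"
 and dchainsD: "g \<in> dchains k i x \<Longrightarrow> x \<sqsubseteq> a \<Longrightarrow> int (rk a) = k \<Longrightarrow> g a \<in> chains N i a"
 and dchains_zero: "g \<in> dchains k i x \<Longrightarrow> \<not> (x \<sqsubseteq> a \<and> int (rk a) = k) \<Longrightarrow> g a = 0"
 by (auto simp: dchains_def)

lemma dchains_in:
 assumes "g \<in> dchains k i x" shows "g a \<in> chains N i a"
 using dchainsD[OF assms, of a] dchains_zero[OF assms, of a] subspace_0[OF subspace_chains[OF N_subspace]]
 by (cases "x \<sqsubseteq> a \<and> int (rk a) = k") auto

lemma dchains_N: "g \<in> dchains k i x \<Longrightarrow> g a c \<in> N c"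
 using chains_in[OF N_subspace dchains_in] .

lemma dchains_zero2: "g \<in> dchains k i x \<Longrightarrow> \<not> (a \<sqsubseteq> c \<and> rk c = i) \<Longrightarrow> g a c = 0"
 using chains_zero[OF dchains_in] .

lemma dchains_diff: "g \<in> dchains k i x \<Longrightarrow> h \<in> dchains k i x \<Longrightarrow> g - h \<in> dchains k i x"
 unfolding dchains_def using subspace_diff[OF subspace_chains[OF N_subspace]] by auto

lemma cobd_dchains:
 assumes g: "g \<in> dchains k i x"
 shows "cobd x g \<in> dchains (k + 1) i x"
proof (rule dchainsI)
 fix a assume a: "x \<sqsubseteq> a" "int (rk a) = k + 1"
 show "cobd x g a \<in> chains N i a"
 proof (rule chainsI)
  fix c show "cobd x g a c \<in> N c"
   unfolding cobd_def
   by (auto intro!: subspace_sum[OF N_subspace] subspace_scale[OF N_subspace] dchains_N[OF g] subspace_0[OF N_subspace])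
 next
  fix c assume c: "\<not> (a \<sqsubseteq> c \<and> rk c = i)"
  then have "g b c = 0" if "a \<sqsubseteq> c" for b using dchains_zero2[OF g, of b c] that by blast
  then show "cobd x g a c = 0" by (simp add: cobd_def)
 qed
next
 fix a assume a: "\<not> (x \<sqsubseteq> a \<and> int (rk a) = k + 1)"
 have "eps b a *\<^sub>R g b c = 0" if "x \<sqsubseteq> a" for b c
 proof (cases "eps b a = 0")
  case False
  then have "int (rk b) \<noteq> k" using eps_le[of b a] a that by auto
  then show ?thesis using dchains_zero[OF g, of b] by simp
 qed simp
 then have "cobd x g a c = 0" for c unfolding cobd_def by (simp add: sum.neutral del: scaleR_eq_0_iff)
 then show "cobd x g a = 0" by (simp add: fun_eq_iff)
qed

text \<open>By induction along the diagonal of the double complex of pairs \<open>a \<sqsubseteq> c\<close>: the columns are contractible,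
 the rows exact.\<close>

lemma cycles_exact:
 assumes "g \<in> dchains (int k) i x" "k < i" "i \<le> m" "\<And>a. bd U a (g a) = 0" "cobd x g = 0"
 shows "\<exists>e\<in>dchains (int k - 1) i x. (\<forall>a. bd U a (e a) = 0) \<and> cobd x e = g"
 using assms
proof (induction k arbitrary: g i)
 have column: "\<exists>e\<in>dchains (int k - 1) i x. cobd x e = g"
  if g: "g \<in> dchains (int k) i x" and ki: "k < i" and dg: "cobd x g = 0" for g k i
 proof -
  have "\<forall>c. \<exists>s. x \<sqsubseteq> c \<and> x \<noteq> c \<longrightarrow> (\<forall>a b. s a b \<noteq> 0 \<longrightarrow> rk a = Suc (rk b)) \<and>
     (\<forall>a b. x \<sqsubseteq> a \<and> a \<sqsubseteq> c \<and> x \<sqsubseteq> b \<and> b \<sqsubseteq> c \<longrightarrow>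
      (\<Sum>d | x \<sqsubseteq> d \<and> d \<sqsubseteq> c. s a d * eps d b + eps a d * s d b) = (if a = b then 1 else 0))"
   using contraction by blast
  from choice[OF this] obtain s where s: "\<forall>c. x \<sqsubseteq> c \<and> x \<noteq> c \<longrightarrow> (\<forall>a b. s c a b \<noteq> 0 \<longrightarrow> rk a = Suc (rk b)) \<and>
     (\<forall>a b. x \<sqsubseteq> a \<and> a \<sqsubseteq> c \<and> x \<sqsubseteq> b \<and> b \<sqsubseteq> c \<longrightarrow>
      (\<Sum>d | x \<sqsubseteq> d \<and> d \<sqsubseteq> c. s c a d * eps d b + eps a d * s c d b) = (if a = b then 1 else 0))" ..
  have s1: "x \<sqsubseteq> c \<Longrightarrow> x \<noteq> c \<Longrightarrow> s c a b \<noteq> 0 \<Longrightarrow> rk a = Suc (rk b)"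
   and s2: "x \<sqsubseteq> c \<Longrightarrow> x \<noteq> c \<Longrightarrow> x \<sqsubseteq> a \<Longrightarrow> a \<sqsubseteq> c \<Longrightarrow> x \<sqsubseteq> b \<Longrightarrow> b \<sqsubseteq> c \<Longrightarrow>
      (\<Sum>d | x \<sqsubseteq> d \<and> d \<sqsubseteq> c. s c a d * eps d b + eps a d * s c d b) = (if a = b then 1 else 0)" for c a b
  proof -
   show "x \<sqsubseteq> c \<Longrightarrow> x \<noteq> c \<Longrightarrow> s c a b \<noteq> 0 \<Longrightarrow> rk a = Suc (rk b)" using s by simp
   assume c: "x \<sqsubseteq> c" "x \<noteq> c" "x \<sqsubseteq> a" "a \<sqsubseteq> c" "x \<sqsubseteq> b" "b \<sqsubseteq> c"
   show "(\<Sum>d | x \<sqsubseteq> d \<and> d \<sqsubseteq> c. s c a d * eps d b + eps a d * s c d b) = (if a = b then 1 else 0)"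
    using s[THEN spec, THEN mp, of c, THEN conjunct2, THEN spec, THEN spec, THEN mp, of a b] c by simp
  qed
  \<comment> \<open>For fixed \<open>c\<close> the first index runs through the interval from
    \<open>x\<close> to \<open>c\<close>. Its contraction is used transposed, as \<open>cobd\<close>
    applies \<open>eps\<close> transposed; the degenerate interval \<open>x = c\<close> contributes
    nothing because \<open>k < i\<close>.\<close>
  define e where "e = (\<lambda>a c. if x \<sqsubseteq> a \<and> a \<sqsubseteq> c \<and> x \<noteq> c
   then \<Sum>b | x \<sqsubseteq> b \<and> b \<sqsubseteq> c. s c b a *\<^sub>R g b c else 0)"
  have "e \<in> dchains (int k - 1) i x"
  proof (rule dchainsI)
   fix a assume a: "x \<sqsubseteq> a" "int (rk a) = int k - 1"
   show "e a \<in> chains N i a"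
   proof (rule chainsI)
    fix c show "e a c \<in> N c"
     unfolding e_def
     by (auto intro!: subspace_sum[OF N_subspace] subspace_scale[OF N_subspace] dchains_N[OF g] subspace_0[OF N_subspace])
   next
    fix c assume c: "\<not> (a \<sqsubseteq> c \<and> rk c = i)"
    then have "g b c = 0" if "a \<sqsubseteq> c" for b using dchains_zero2[OF g, of b c] that by blast
    then show "e a c = 0" by (simp add: e_def)
   qed
  next
   fix a assume a: "\<not> (x \<sqsubseteq> a \<and> int (rk a) = int k - 1)"
   have "s c b a *\<^sub>R g b c = 0" if "x \<sqsubseteq> a" "x \<sqsubseteq> c" "x \<noteq> c" for b c
   proof (cases "s c b a = 0")
    case False
    then have "rk b = Suc (rk a)" using s1 that by blast
    then have "int (rk b) \<noteq> int k" using a that by auto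
    then show ?thesis using dchains_zero[OF g, of b] by simp
   qed simp
   then have "e a c = 0" for c
    using le_trans[of x a c] unfolding e_def by (simp add: sum.neutral del: scaleR_eq_0_iff)
   then show "e a = 0" by (auto simp: fun_eq_iff)
  qed
  moreover have "cobd x e = g"
  proof (intro ext)
   fix a c l
   have "cobd x e a c = g a c"
   proof (cases "x \<sqsubseteq> a \<and> a \<sqsubseteq> c")
    case False
    then show ?thesis using dchains_zero[OF g, of a] dchains_zero2[OF g, of a c] by (auto simp: cobd_def)
   next
    case True
    show ?thesis
    proof (cases "x = c")
     case eq: True
     have "rk a \<le> rk x" "rk x \<le> rk a" using True eq rk_mono by auto
     then have "g a c = 0"
      using dchains_zero[OF g, of a] dchains_zero2[OF g, of a c] ki eq
      by (cases "int (rk a) = int k") auto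
     then show ?thesis using eq by (simp add: cobd_def e_def)
    next
     case ne: False
     let ?I = "{b. x \<sqsubseteq> b \<and> b \<sqsubseteq> c}"
     have xc: "x \<sqsubseteq> c" using True le_trans by blast
     have fI: "finite ?I" by (rule fin_interval)
     have IP: "?I \<subseteq> P" using le_P by blast
     have dg0: "(\<Sum>b'\<in>?I. eps b' b *\<^sub>R g b' c) = 0" if "b \<in> ?I" for b
     proof -
      have "(\<Sum>b'\<in>?I. eps b' b *\<^sub>R g b' c) = (\<Sum>b'\<in>P. eps b' b *\<^sub>R g b' c)"
      proof (rule sum.mono_neutral_left[OF fin IP], intro ballI)
       fix b' assume b': "b' \<in> P - ?I"
       show "eps b' b *\<^sub>R g b' c = 0"
        using b' that eps_le[of b' b] le_trans[of b' b c] dchains_zero[OF g, of b']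
        by (cases "eps b' b = 0") auto
      qed
      also have "\<dots> = cobd x g b c" using that by (simp add: cobd_def)
      finally show ?thesis using dg by simp
     qed
     have "cobd x e a c = (\<Sum>b\<in>P. eps b a *\<^sub>R e b c)" using True by (simp add: cobd_def)
     also have "\<dots> = (\<Sum>b\<in>?I. eps b a *\<^sub>R e b c)"
      by (rule sum.mono_neutral_right[OF fin IP]) (auto simp: e_def)
     also have "\<dots> = (\<Sum>b\<in>?I. \<Sum>b'\<in>?I. (s c b' b * eps b a) *\<^sub>R g b' c)"
      by (rule sum.cong[OF refl]) (simp add: e_def ne scaleR_right.sum mult.commute)
     also have "\<dots> = (\<Sum>b'\<in>?I. (\<Sum>b\<in>?I. s c b' b * eps b a) *\<^sub>R g b' c)"
      by (subst sum.swap) (simp add: scaleR_left.sum)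
     also have "\<dots> = (\<Sum>b'\<in>?I. ((if b' = a then 1 else 0) - (\<Sum>b\<in>?I. eps b' b * s c b a)) *\<^sub>R g b' c)"
     proof (rule sum.cong[OF refl])
      fix b' assume "b' \<in> ?I"
      then have "(\<Sum>b\<in>?I. s c b' b * eps b a) + (\<Sum>b\<in>?I. eps b' b * s c b a) = (if b' = a then 1 else 0)"
       using s2[OF xc ne, of b' a] True by (simp add: sum.distrib)
      then have "(\<Sum>b\<in>?I. s c b' b * eps b a) = (if b' = a then 1 else 0) - (\<Sum>b\<in>?I. eps b' b * s c b a)"
       by linarith
      then show "(\<Sum>b\<in>?I. s c b' b * eps b a) *\<^sub>R g b' c =
       ((if b' = a then 1 else 0) - (\<Sum>b\<in>?I. eps b' b * s c b a)) *\<^sub>R g b' c" by simp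
     qed
     also have "\<dots> = (\<Sum>b'\<in>?I. if b' = a then g b' c else 0) -
       (\<Sum>b'\<in>?I. \<Sum>b\<in>?I. s c b a *\<^sub>R eps b' b *\<^sub>R g b' c)"
      by (subst sum_subtractf[symmetric], rule sum.cong)
        (auto simp: scaleR_left_diff_distrib scaleR_left.sum mult.commute)
     also have "(\<Sum>b'\<in>?I. \<Sum>b\<in>?I. s c b a *\<^sub>R eps b' b *\<^sub>R g b' c) =
       (\<Sum>b\<in>?I. s c b a *\<^sub>R (\<Sum>b'\<in>?I. eps b' b *\<^sub>R g b' c))"
      by (subst sum.swap) (simp add: scaleR_right.sum)
     also have "\<dots> = 0" using dg0 by (intro sum.neutral) auto
     also have "(\<Sum>b'\<in>?I. if b' = a then g b' c else 0) = g a c"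
      using True fI by (simp add: sum.delta)
     finally show ?thesis by simp
    qed
   qed
   then show "cobd x e a c l = g a c l" by simp
  qed
  ultimately show ?thesis by blast
 qed
 {
  case 0
  obtain e where e: "e \<in> dchains (int 0 - 1) i x" "cobd x e = g"
   using column[OF 0(1,2,5)] by blast
  have "e a = 0" for a using dchains_zero[OF e(1), of a] by auto
  then have "bd U a (e a) = 0" for a by (simp add: linear_0[OF linear_bd])
  then show ?case using e by blast
 next
  case (Suc k)
  obtain j where j: "i = Suc j" using Suc.prems(2) by (cases i) auto
  \<comment> \<open>Zigzag: the boundary \<open>f\<close> of a column primitive \<open>e0\<close> is
    a cocycle one step down the diagonal, so by induction \<open>f = cobd x e1\<close> with
    \<open>e1\<close> made of cycles. The rows are exact, so \<open>e1\<close> lifts to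
    \<open>e2\<close>, and \<open>e0 - cobd x e2\<close> still maps to \<open>g\<close> but consists
    of cycles.\<close>
  obtain e0 where e0: "e0 \<in> dchains (int k) i x" "cobd x e0 = g"
   using column[OF Suc.prems(1,2,5)] by auto
  have z0: "\<And>b. \<not> x \<sqsubseteq> b \<Longrightarrow> e0 b = 0" using dchains_zero[OF e0(1)] by blast
  define f where "f = (\<lambda>a. bd U a (e0 a))"
  have fD: "f \<in> dchains (int k) j x"
  proof (rule dchainsI)
   fix a
   show "f a \<in> chains N j a"
    unfolding f_def by (rule bd_chains[OF N_subspace N_mono]) (use dchains_in[OF e0(1), of a] j in simp_all)
   show "f a = 0" if "\<not> (x \<sqsubseteq> a \<and> int (rk a) = int k)"
    using dchains_zero[OF e0(1) that] by (simp add: f_def linear_0[OF linear_bd])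
  qed
  have f0: "bd U a (f a) = 0" for a unfolding f_def by (rule bd_bd[OF U_P U_up])
  have "cobd x f = 0"
  proof
   fix a
   have "cobd x f a = bd U a (cobd x e0 a)"
    unfolding f_def by (rule bd_cobd[where x=x and g=e0 and U=U and a=a, OF z0, symmetric])
   also have "\<dots> = 0" by (simp only: e0(2) Suc.prems(4))
   finally show "cobd x f a = 0 a" by simp
  qed
  then have "\<exists>e\<in>dchains (int k - 1) j x. (\<forall>a. bd U a (e a) = 0) \<and> cobd x e = f"
   by (intro Suc.IH[OF fD _ _ f0]) (use Suc.prems(2,3) j in simp_all)
  then obtain e1 where e1: "e1 \<in> dchains (int k - 1) j x" "\<And>a. bd U a (e1 a) = 0" "cobd x e1 = f"
   by blast
  have "\<exists>y. y \<in> chains N i a \<and> bd U a y = e1 a" for a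
  proof -
   have "j < m" using Suc.prems(3) j by simp
   from exact[OF this dchains_in[OF e1(1)] e1(2)] show ?thesis unfolding j by blast
  qed
  then have "\<exists>y. \<forall>a. y a \<in> chains N i a \<and> bd U a (y a) = e1 a" by (intro choice) blast
  then obtain y where y: "\<And>a. y a \<in> chains N i a" "\<And>a. bd U a (y a) = e1 a" by auto
  define e2 where "e2 = (\<lambda>a. if x \<sqsubseteq> a \<and> int (rk a) = int k - 1 then y a else 0)"
  have e2D: "e2 \<in> dchains (int k - 1) i x"
   by (rule dchainsI) (auto simp: e2_def y(1))
  have z2: "\<And>b. \<not> x \<sqsubseteq> b \<Longrightarrow> e2 b = 0" by (auto simp: e2_def)
  have b2: "(\<lambda>a. bd U a (e2 a)) = e1"
  proof
   fix a show "bd U a (e2 a) = e1 a"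
    using y(2) dchains_zero[OF e1(1), of a] by (auto simp: e2_def linear_0[OF linear_bd])
  qed
  have "e0 - cobd x e2 \<in> dchains (int (Suc k) - 1) i x"
   using dchains_diff[OF e0(1)] cobd_dchains[OF e2D] by simp
  moreover have "bd U a ((e0 - cobd x e2) a) = 0" for a
  proof -
   have "bd U a ((e0 - cobd x e2) a) = f a - bd U a (cobd x e2 a)"
    by (simp add: linear_diff[OF linear_bd] f_def)
   also have "bd U a (cobd x e2 a) = f a" 
   proof -
    have "bd U a (cobd x e2 a) = cobd x (\<lambda>a. bd U a (e2 a)) a" by (rule bd_cobd) (rule z2)
    also have "\<dots> = f a" by (simp only: b2 e1(3))
    finally show ?thesis .
   qed
   finally show ?thesis by (simp only: diff_self)
  qed
  moreover have "cobd x (e0 - cobd x e2) = g"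
  proof -
   have "cobd x (cobd x e2) = 0" by (rule cobd_cobd) (rule z2)
   then show ?thesis by (simp only: linear_diff[OF linear_cobd] e0(2)) simp
  qed
  ultimately show ?case by blast
 }
qed

end

section \<open>Dimension counts and generic linear combinations\<close>

lemma subspace_eq_if_dim_eq:
 fixes S T :: "'v::real_vector set"
 assumes "subspace S" "S \<subseteq> T" "fin_dim T" "dim S = dim T"
 shows "S = T"
proof (rule ccontr)
 assume "S \<noteq> T"
 then obtain x where x: "x \<in> T" "x \<notin> S" using assms(2) by blast
 obtain B where B: "finite B" "B \<subseteq> S" "independent B" "S \<subseteq> span B" "card B = dim S"
  using fin_dim_subset[OF assms(3,2)] by (rule fin_dim_basis)
 obtain BT where BT: "finite BT" "BT \<subseteq> T" "independent BT" "T \<subseteq> span BT" "card BT = dim T"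
  using assms(3) by (rule fin_dim_basis)
 have "span B = S" using B assms(1) by (simp add: real_vector.span_minimal subset_antisym)
 then have "independent (insert x B)" using x B(3) by (simp add: real_vector.independent_insertI)
 moreover have "insert x B \<subseteq> span BT" using x B(2) assms(2) BT(4) by blast
 ultimately have "card (insert x B) \<le> card BT" using real_vector.independent_span_bound[OF BT(1)] by blast
 moreover have "x \<notin> B" using x B(2) by blast
 ultimately show False using B BT assms(4) by simp
qed

lemma dim_zero_space: "dim {0::'v::real_vector} = 0"
 using real_vector.dim_unique[of "{}" "{0::'v}" 0] by (simp add: real_vector.independent_empty)

text \<open>If \<open>c\<close> works for the old spaces and \<open>d\<close> for the new one, then
  \<open>c + t d\<close> works for all of them once \<open>t\<close> avoids finitely many
  values.\<close>

lemma generic_combination: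
 fixes S :: "'j \<Rightarrow> ('p \<Rightarrow> 'w::real_vector) set" and P :: "'p set"
 assumes "finite J" "\<And>j. j \<in> J \<Longrightarrow> subspace (S j) \<and> fin_dim (S j)"
  and "\<And>j. j \<in> J \<Longrightarrow> \<exists>c::'p \<Rightarrow> real. \<forall>b\<in>S j. (\<Sum>a\<in>P. c a *\<^sub>R b a) = 0 \<longrightarrow> b = 0"
 shows "\<exists>c::'p \<Rightarrow> real. \<forall>j\<in>J. \<forall>b\<in>S j. (\<Sum>a\<in>P. c a *\<^sub>R b a) = 0 \<longrightarrow> b = 0"
 using assms
proof (induction J rule: finite_induct)
 case (insert j J)
 define al where "al = (\<lambda>(c::'p \<Rightarrow> real) (b::'p \<Rightarrow> 'w). \<Sum>a\<in>P. c a *\<^sub>R b a)"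
 have lin: "linear (al c)" for c
  by (rule linearI) (auto simp: al_def scaleR_right_distrib sum.distrib scaleR_right.sum mult.commute)
 have al_add: "al (\<lambda>a. c a + t * d a) b = al c b + t *\<^sub>R al d b" for c d t b
  by (simp add: al_def scaleR_left_distrib sum.distrib scaleR_right.sum)
 have "\<exists>c. \<forall>j\<in>J. \<forall>b\<in>S j. al c b = 0 \<longrightarrow> b = 0"
  unfolding al_def by (rule insert.IH) (use insert.prems in auto)
 then obtain c where c: "\<forall>j\<in>J. \<forall>b\<in>S j. al c b = 0 \<longrightarrow> b = 0" ..
 have "\<exists>d. \<forall>b\<in>S j. al d b = 0 \<longrightarrow> b = 0" unfolding al_def by (rule insert.prems(2)) simp
 then obtain d where d: "\<forall>b\<in>S j. al d b = 0 \<longrightarrow> b = 0" ..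
 \<comment> \<open>On the old spaces the pencil is based at \<open>c\<close>; on the new one it is
   based at \<open>d\<close> with parameter \<open>1 / t\<close>, which is why
   \<open>inverse\<close> and \<open>t \<noteq> 0\<close> appear.\<close>
 let ?bad1 = "\<lambda>i. {t. \<exists>b\<in>S i. b \<noteq> 0 \<and> al c b + t *\<^sub>R al d b = 0}"
 let ?bad2 = "{t. \<exists>b\<in>S j. b \<noteq> 0 \<and> al d b + t *\<^sub>R al c b = 0}"
 have f1: "finite (?bad1 i)" if "i \<in> J" for i
  by (rule finite_singular_pencil) (use insert.prems(1)[of i] that c lin in auto)
 have f2: "finite ?bad2"
  by (rule finite_singular_pencil) (use insert.prems(1)[of j] d lin in auto)
 define A B where "A = (\<Union>i\<in>J. ?bad1 i)" and "B = ?bad2"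
 have "finite (A \<union> inverse ` B \<union> {0})"
  unfolding A_def B_def using f1 f2 insert.hyps(1) by simp
 then have "\<exists>t. t \<notin> A \<union> inverse ` B \<union> {0}" by (rule ex_new_if_finite[OF infinite_UNIV_char_0])
 then obtain t where t: "t \<notin> A" "t \<notin> inverse ` B" "t \<noteq> 0" by auto
 have tB: "inverse t \<notin> B" using t(2) imageI[of "inverse t" B inverse] by auto
 let ?c = "\<lambda>a. c a + t * d a"
 have "b = 0" if i: "i \<in> insert j J" "b \<in> S i" "al ?c b = 0" for i b
 proof (cases "i = j")
  case True
  have "al c b + t *\<^sub>R al d b = 0" using i(3) al_add by simp
  then have "inverse t *\<^sub>R (al c b + t *\<^sub>R al d b) = 0" by simp
  then have "al d b + inverse t *\<^sub>R al c b = 0"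
   using t(3) by (simp add: scaleR_right_distrib add.commute)
  then show ?thesis using i(2) True tB unfolding B_def by auto
 next
  case False
  then have "i \<in> J" using i(1) by blast
  then have "t \<notin> ?bad1 i" using t(1) unfolding A_def by auto
  moreover have "al c b + t *\<^sub>R al d b = 0" using i(3) al_add by simp
  ultimately show ?thesis using i(2) by auto
 qed
 then have "\<forall>i\<in>insert j J. \<forall>b\<in>S i. al ?c b = 0 \<longrightarrow> b = 0" by blast
 then show ?case unfolding al_def by (intro exI[of _ ?c])
qed simp

context cell_poset
begin

lemma dim_chains:
 fixes N :: "'p \<Rightarrow> 'w::real_vector set"
 assumes N: "\<And>a. subspace (N a)" and fd: "\<And>A. A \<subseteq> P \<Longrightarrow> fin_dim {z. \<forall>a. (a \<in> A \<longrightarrow> z a \<in> N a) \<and> (a \<notin> A \<longrightarrow> z a = 0)}"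
 shows "dim (chains N k x) = (\<Sum>a | x \<sqsubseteq> a \<and> rk a = k. dim (N a))"
proof -
 define Q where "Q = (\<lambda>A. {z. \<forall>a. (a \<in> A \<longrightarrow> z a \<in> N a) \<and> (a \<notin> A \<longrightarrow> z a = 0)})"
 have subQ: "subspace (Q A)" for A unfolding Q_def subspace_def
  using subspace_0[OF N] subspace_add[OF N] subspace_scale[OF N] by simp
 have "dim (Q A) = (\<Sum>a\<in>A. dim (N a))" if "finite A" "A \<subseteq> P" for A
  using that
 proof (induction A rule: finite_induct)
  case empty
  have "Q {} = {0}" by (auto simp: Q_def fun_eq_iff)
  then show ?case by (simp add: dim_zero_space)
 next
  case (insert a A)
  have lin: "linear (\<lambda>z::'p \<Rightarrow> 'w. z a)" by (rule linearI) auto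
  have ker: "{z \<in> Q (insert a A). z a = 0} = Q A"
   using insert.hyps subspace_0[OF N] by (auto simp: Q_def)
  have "(\<lambda>z. z a) ` Q (insert a A) = N a"
  proof
   show "N a \<subseteq> (\<lambda>z. z a) ` Q (insert a A)"
   proof
    fix v assume "v \<in> N a"
    then have "(\<lambda>b. if b = a then v else 0) \<in> Q (insert a A)"
     using subspace_0[OF N] by (auto simp: Q_def)
    then show "v \<in> (\<lambda>z. z a) ` Q (insert a A)" by (rule rev_image_eqI) simp
   qed
  qed (auto simp: Q_def)
  then have "dim (Q (insert a A)) = dim (Q A) + dim (N a)"
   using rank_nullity[OF subQ _ lin, of "insert a A"] fd[of "insert a A"] insert.prems ker
   by (simp add: Q_def)
  then show ?case using insert by simp
 qed
 moreover have "chains N k x = Q {a. x \<sqsubseteq> a \<and> rk a = k}" by (auto simp: chains_def Q_def)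
 moreover have "{a. x \<sqsubseteq> a \<and> rk a = k} \<subseteq> P" using le_P by blast
 ultimately show ?thesis using finite_subset[OF _ fin] by simp
qed

end

section \<open>Cycles, their dimensions, and the dual of a skeleton\<close>

context cm_family
begin

definition ip :: "('p \<Rightarrow> 'q \<Rightarrow> real) \<Rightarrow> ('p \<Rightarrow> 'q \<Rightarrow> real) \<Rightarrow> real" where
 "ip u v = (\<Sum>a\<in>P. \<Sum>l\<in>L. u a l * v a l)"

lemma ip_sym: "ip u v = ip v u"
 by (simp add: ip_def mult.commute)

lemma linear_ip: "linear (\<lambda>u. ip u v)"
 by (rule linearI) (simp_all add: ip_def distrib_right sum.distrib sum_distrib_left mult.assoc)

lemma linear_ip': "linear (ip u)"
 by (rule linearI) (simp_all add: ip_def distrib_left sum.distrib sum_distrib_left ac_simps)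

lemma ip_pos:
 assumes "z \<in> chains N k x" "ip z z = 0"
 shows "z = 0"
proof -
 have "\<forall>a\<in>P. \<forall>l\<in>L. z a l * z a l = 0"
  using assms(2) fin fin_L unfolding ip_def
  by (simp add: sum_nonneg_eq_0_iff sum_nonneg)
 moreover have "z a = 0" if "a \<notin> P" for a using chains_zero[OF assms(1), of a] le_P that by blast
 moreover have "z a l = 0" if "l \<notin> L" for a l using N_supp chains_in[OF N_subspace assms(1)] that by blast
 ultimately show ?thesis by (simp add: fun_eq_iff) (metis zero_fun_apply)
qed

lemma fin_dim_supp: "fin_dim {z. \<forall>a l. a \<notin> P \<or> l \<notin> L \<longrightarrow> z a l = (0::real)}"
proof -
 let ?e = "\<lambda>(a, l) a' l'. if a' = a \<and> l' = l then 1 else (0::real)"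
 have "z \<in> span (?e ` (P \<times> L))" if z: "\<forall>a l. a \<notin> P \<or> l \<notin> L \<longrightarrow> z a l = 0" for z
 proof -
  have "z = (\<Sum>p\<in>P \<times> L. (case p of (a, l) \<Rightarrow> z a l) *\<^sub>R ?e p)"
  proof (intro ext)
   fix a l
   have "(\<Sum>p\<in>P \<times> L. (case p of (a, l) \<Rightarrow> z a l) *\<^sub>R ?e p) a l =
     (\<Sum>p\<in>P \<times> L. if p = (a, l) then z a l else 0)"
    unfolding sum_fun_apply' by (rule sum.cong) (auto simp: split_beta)
   also have "\<dots> = z a l" using fin fin_L z by (auto simp: sum.delta)
   finally show "z a l = (\<Sum>p\<in>P \<times> L. (case p of (a, l) \<Rightarrow> z a l) *\<^sub>R ?e p) a l" by simp
  qed
  also have "\<dots> \<in> span (?e ` (P \<times> L))"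
   by (intro real_vector.span_sum real_vector.span_scale real_vector.span_base) auto
  finally show ?thesis .
 qed
 moreover have "finite (?e ` (P \<times> L))" using fin fin_L by simp
 ultimately show ?thesis unfolding fin_dim_def by blast
qed

lemma chains_supp:
 assumes "z \<in> chains N k x" "a \<notin> P \<or> l \<notin> L"
 shows "z a l = 0"
proof (cases "a \<in> P")
 case True
 then show ?thesis using N_supp[OF chains_in[OF N_subspace assms(1)]] assms(2) by blast
next
 case False
 then have "z a = 0" using chains_zero[OF assms(1), of a] le_P by blast
 then show ?thesis by simp
qed

lemma fin_dim_chains: "fin_dim (chains N k x)"
 by (rule fin_dim_subset[OF fin_dim_supp]) (use chains_supp in blast)

lemma sub_chains: "subspace (chains N k x)"
 by (rule subspace_chains[OF N_subspace])

definition cyc :: "nat \<Rightarrow> 'p \<Rightarrow> ('p \<Rightarrow> 'q \<Rightarrow> real) set" where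
 "cyc k x = {z \<in> chains N k x. bd U x z = 0}"

lemma subspace_cyc: "subspace (cyc k x)"
 unfolding cyc_def using sub_chains[of k x]
 by (auto simp: subspace_def linear_add[OF linear_bd] linear_scale[OF linear_bd] linear_0[OF linear_bd])

lemma fin_dim_cyc: "fin_dim (cyc k x)"
 by (rule fin_dim_subset[OF fin_dim_chains]) (auto simp: cyc_def)

lemma bd_image: "k < m \<Longrightarrow> bd U x ` chains N (Suc k) x = cyc k x"
proof
 show "bd U x ` chains N (Suc k) x \<subseteq> cyc k x"
  using bd_chains[OF N_subspace N_mono] bd_bd[OF U_P U_up] by (auto simp: cyc_def)
 show "cyc k x \<subseteq> bd U x ` chains N (Suc k) x" if "k < m"
  using exact[OF that] by (fastforce simp: cyc_def)
qed

lemma dim_chains': "dim (chains N k x) = (\<Sum>a | x \<sqsubseteq> a \<and> rk a = k. dim (N a))"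
proof (rule dim_chains[OF N_subspace])
 fix A :: "'p set" assume A: "A \<subseteq> P"
 show "fin_dim {z. \<forall>a. (a \<in> A \<longrightarrow> z a \<in> N a) \<and> (a \<notin> A \<longrightarrow> z a = 0)}"
 proof (rule fin_dim_subset[OF fin_dim_supp], safe)
  fix z :: "'p \<Rightarrow> 'q \<Rightarrow> real" and a l
  assume z: "\<forall>a. (a \<in> A \<longrightarrow> z a \<in> N a) \<and> (a \<notin> A \<longrightarrow> z a = 0)"
  show "z a l = 0" if "a \<notin> P" using z A that by (metis subsetD zero_fun_apply)
  show "z a l = 0" if "l \<notin> L" using z N_supp that by (metis zero_fun_apply)
 qed
qed

text \<open>Exactness below \<open>m\<close> turns rank-nullity into a recursion in
  \<open>k\<close>; its solution is the alternating sum later abstracted as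
  \<open>dual\<close>.\<close>

lemma dim_cyc:
 "k \<le> m \<Longrightarrow> int (dim (cyc k x)) = (\<Sum>a | x \<sqsubseteq> a \<and> rk a \<le> k. (-1) ^ (k - rk a) * int (dim (N a)))"
proof (induction k)
 case 0
 have "cyc 0 x = chains N 0 x" using bd_chains_0[of _ N 0 x] by (auto simp: cyc_def)
 then show ?case by (simp add: dim_chains')
next
 case (Suc k)
 have f: "finite {a. x \<sqsubseteq> a \<and> Q a}" for Q by (rule finite_subset[OF _ fin]) (auto dest: le_P)
 have "dim (chains N (Suc k) x) = dim (cyc (Suc k) x) + dim (cyc k x)"
  using rank_nullity[OF sub_chains fin_dim_chains linear_bd, of "Suc k" x U x] bd_image[of k x] Suc.prems
  by (simp add: cyc_def)
 then have "int (dim (cyc (Suc k) x)) = int (dim (chains N (Suc k) x)) - int (dim (cyc k x))" by simp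
 also have "\<dots> = (\<Sum>a | x \<sqsubseteq> a \<and> rk a = Suc k. (-1) ^ (Suc k - rk a) * int (dim (N a))) +
   (\<Sum>a | x \<sqsubseteq> a \<and> rk a \<le> k. (-1) ^ (Suc k - rk a) * int (dim (N a)))"
  using Suc by (simp add: dim_chains' Suc_diff_le sum_negf)
 also have "\<dots> = (\<Sum>a\<in>{a. x \<sqsubseteq> a \<and> rk a = Suc k} \<union> {a. x \<sqsubseteq> a \<and> rk a \<le> k}.
   (-1) ^ (Suc k - rk a) * int (dim (N a)))"
  by (rule sum.union_disjoint[symmetric]) (auto simp: f)
 also have "{a. x \<sqsubseteq> a \<and> rk a = Suc k} \<union> {a. x \<sqsubseteq> a \<and> rk a \<le> k} = {a. x \<sqsubseteq> a \<and> rk a \<le> Suc k}" by auto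
 finally show ?case .
qed

text \<open>The dual of the canonical sheaf of the \<open>i\<close>-skeleton, realised by orthogonal complements.\<close>

definition can :: "nat \<Rightarrow> 'p \<Rightarrow> ('p \<Rightarrow> 'q \<Rightarrow> real) set" where
 "can i x = {b \<in> chains N (Suc i) x. \<forall>z\<in>cyc (Suc i) x. ip b z = 0}"

lemma subspace_can: "subspace (can i x)"
 unfolding can_def using sub_chains[of "Suc i" x]
 by (auto simp: subspace_def linear_add[OF linear_ip] linear_scale[OF linear_ip] linear_0[OF linear_ip])

lemma fin_dim_can: "fin_dim (can i x)"
 by (rule fin_dim_subset[OF fin_dim_chains]) (auto simp: can_def)

text \<open>An element supported above \<open>y\<close> pairs with a cycle above \<open>x\<close>
  only through the restriction of that cycle to the filter of \<open>y\<close>, which is again a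
  cycle.\<close>

lemma can_mono:
 assumes "x \<sqsubseteq> y" shows "can i y \<subseteq> can i x"
proof
 fix b assume b: "b \<in> can i y"
 then have by': "b \<in> chains N (Suc i) y" by (simp add: can_def)
 have "b \<in> chains N (Suc i) x"
  using chains_in[OF N_subspace by'] chains_zero[OF by'] le_trans[OF assms] by (intro chainsI) blast+
 moreover have "ip b z = 0" if z: "z \<in> cyc (Suc i) x" for z
 proof -
  have "restr y z \<in> cyc (Suc i) y"
   using z restr_chains[OF _ assms] bd_restr[OF assms, of U z] linear_0[OF linear_restr, of y]
   by (auto simp: cyc_def)
  then have "ip b (restr y z) = 0" using b by (simp add: can_def)
  moreover have "ip b (restr y z) = ip b z"
   unfolding ip_def restr_def using chains_zero[OF by'] by (intro sum.cong refl) auto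
  ultimately show ?thesis by simp
 qed
 ultimately show "b \<in> can i x" by (simp add: can_def)
qed

text \<open>Such a \<open>b\<close> is itself a cycle, so it is orthogonal to itself.\<close>

lemma can_bd_inj:
 assumes "b \<in> can i x" "bd U x b = 0" shows "b = 0"
proof -
 have "b \<in> cyc (Suc i) x" using assms by (simp add: can_def cyc_def)
 then have "ip b b = 0" using assms by (simp add: can_def)
 then show ?thesis using ip_pos assms by (auto simp: can_def)
qed

lemma chains_decomp:
 assumes "c \<in> chains N (Suc i) x"
 obtains z b where "z \<in> cyc (Suc i) x" "b \<in> can i x" "c = z + b"
proof -
 obtain z where z: "z \<in> cyc (Suc i) x" "\<forall>w\<in>cyc (Suc i) x. ip (c - z) w = 0"
 proof -
  have "cyc (Suc i) x \<subseteq> chains N (Suc i) x" by (auto simp: cyc_def)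
  then have "\<exists>z\<in>cyc (Suc i) x. \<forall>w\<in>cyc (Suc i) x. ip (c - z) w = 0"
   by (intro orthogonal_projection_exists[OF linear_ip ip_sym sub_chains _ subspace_cyc _ fin_dim_cyc assms])
    (rule ip_pos)
  then show ?thesis using that by blast
 qed
 then have "c - z \<in> can i x"
  using assms subspace_diff[OF sub_chains] by (auto simp: can_def cyc_def)
 then show ?thesis using that[of z "c - z"] z by simp
qed

text \<open>Adding a cycle does not change the boundary, so by \<open>chains_decomp\<close> the
  complement \<open>can\<close> already hits every boundary; with \<open>can_bd_inj\<close> it is
  mapped isomorphically onto \<open>cyc i x\<close>.\<close>

lemma bd_can: "i < m \<Longrightarrow> bd U x ` can i x = cyc i x"
proof -
 assume i: "i < m"
 have "bd U x ` can i x = bd U x ` chains N (Suc i) x"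
 proof
  show "bd U x ` chains N (Suc i) x \<subseteq> bd U x ` can i x"
  proof safe
   fix c assume "c \<in> chains N (Suc i) x"
   then obtain z b where zb: "z \<in> cyc (Suc i) x" "b \<in> can i x" "c = z + b" by (rule chains_decomp)
   then have "bd U x c = bd U x b" by (simp add: linear_add[OF linear_bd] cyc_def)
   then show "bd U x c \<in> bd U x ` can i x" using zb(2) by blast
  qed
 qed (auto simp: can_def)
 then show ?thesis using bd_image[OF i] by simp
qed

lemma dim_can: "i < m \<Longrightarrow> dim (can i x) = dim (cyc i x)"
proof -
 assume i: "i < m"
 have "{b \<in> can i x. bd U x b = 0} = {0}"
  using can_bd_inj subspace_0[OF subspace_can] linear_0[OF linear_bd] by auto
 then show ?thesis
  using rank_nullity[OF subspace_can fin_dim_can linear_bd, of i x U x] bd_can[OF i]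
  by (simp add: dim_zero_space)
qed

text \<open>An element of \<open>can\<close> is determined by its boundary, which in rank
  \<open>i\<close> above \<open>x\<close> could only sit at \<open>x\<close> itself and is cut off
  there outside \<open>U\<close>.\<close>

lemma can_zero:
 assumes "i < rk x \<or> i = rk x \<and> x \<notin> U"
 shows "can i x = {0}"
proof -
 have "b = 0" if b: "b \<in> can i x" for b
 proof (rule can_bd_inj[OF b])
  have c: "bd U x b \<in> chains N i x"
   using bd_chains[OF N_subspace N_mono] b by (auto simp: can_def)
  show "bd U x b = 0"
  proof
   fix a
   show "bd U x b a = 0 a"
   proof (cases "x \<sqsubseteq> a \<and> rk a = i")
    case True
    then have "x = a" using rk_less[of x a] assms by (cases "x = a") auto
    then have "a \<notin> U" using True assms by auto
    then show ?thesis by (simp add: bd_def)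
   qed (use chains_zero[OF c] in simp)
  qed
 qed
 then show ?thesis using subspace_0[OF subspace_can] by auto
qed

text \<open>The linear dual of \<open>cycles_exact\<close>.\<close>

lemma can_exact:
 assumes ki: "k < i" and im: "i < m" and b: "b \<in> chains (can i) k x" "bd P x b = 0"
 shows "\<exists>y\<in>chains (can i) (Suc k) x. bd P x y = b"
proof -
 have subC: "subspace (chains (can i) j y)" for j y by (rule subspace_chains[OF subspace_can])
 define V where "V = chains (\<lambda>a. chains N (Suc i) a) k x"
 define ip2 where "ip2 = (\<lambda>u v. \<Sum>a\<in>P. ip (u a) (v a))"
 have lin2: "linear (\<lambda>u. ip2 u v)" for v
  by (rule linearI) (simp_all add: ip2_def linear_add[OF linear_ip] linear_scale[OF linear_ip] sum.distrib sum_distrib_left)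
 have sym2: "ip2 u v = ip2 v u" for u v unfolding ip2_def by (rule sum.cong[OF refl ip_sym])
 have subV: "subspace V" unfolding V_def by (rule subspace_chains[OF sub_chains])
 have CV: "chains (can i) k x \<subseteq> V" unfolding V_def chains_def[of _ k] by (auto simp: can_def)
 have inV: "u a \<in> chains N (Suc i) a" if "u \<in> V" for u a
  using that unfolding V_def by (rule chains_in[of "\<lambda>a. chains N (Suc i) a", OF sub_chains])
 have ip_nn: "ip u u \<ge> 0" for u unfolding ip_def by (intro sum_nonneg) auto
 have pos2: "u = 0" if "u \<in> V" "ip2 u u = 0" for u
 proof
  fix a
  have "\<forall>a\<in>P. ip (u a) (u a) = 0"
   using that(2) fin ip_nn unfolding ip2_def by (simp add: sum_nonneg_eq_0_iff)
  moreover have "u a \<in> chains N (Suc i) a" by (rule inV[OF that(1)])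
  ultimately have "a \<in> P \<Longrightarrow> u a = 0" using ip_pos by blast
  moreover have "a \<notin> P \<Longrightarrow> u a = 0" using that(1) le_P unfolding V_def chains_def by blast
  ultimately show "u a = 0 a" by (cases "a \<in> P") auto
 qed
 define S where "S = bd P x ` chains (can i) (Suc k) x"
 have up: "\<And>a b. a \<in> P \<Longrightarrow> a \<sqsubseteq> b \<Longrightarrow> b \<in> P" using le_P by blast
 have bdC: "bd P x y \<in> chains (can i) j x" if "y \<in> chains (can i) (Suc j) x" for y j
  using bd_chains[OF subspace_can can_mono that] .
 have SV: "S \<subseteq> V" using bdC CV unfolding S_def by blast
 have subS: "subspace S" unfolding S_def by (rule linear_subspace_image[OF linear_bd subC])
 have fdS: "fin_dim S"
 proof -
  have "fin_dim {z::'p \<Rightarrow> 'p \<Rightarrow> 'q \<Rightarrow> real. \<forall>a c l. a \<notin> P \<or> c \<notin> P \<or> l \<notin> L \<longrightarrow> z a c l = 0}"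
  proof -
   let ?e = "\<lambda>(a, c, l) a' c' l'. if a' = a \<and> c' = c \<and> l' = l then 1 else (0::real)"
   have "z \<in> span (?e ` (P \<times> P \<times> L))"
    if z: "\<forall>a c l. a \<notin> P \<or> c \<notin> P \<or> l \<notin> L \<longrightarrow> z a c l = 0" for z
   proof -
    have "z = (\<Sum>p\<in>P \<times> P \<times> L. (case p of (a, c, l) \<Rightarrow> z a c l) *\<^sub>R ?e p)"
    proof (intro ext)
     fix a c l
     have "(\<Sum>p\<in>P \<times> P \<times> L. (case p of (a, c, l) \<Rightarrow> z a c l) *\<^sub>R ?e p) a c l =
       (\<Sum>p\<in>P \<times> P \<times> L. if p = (a, c, l) then z a c l else 0)"
      unfolding sum_fun_apply' by (rule sum.cong) (auto simp: split_beta)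
     also have "\<dots> = z a c l" using fin fin_L z by (auto simp: sum.delta)
     finally show "z a c l = (\<Sum>p\<in>P \<times> P \<times> L. (case p of (a, c, l) \<Rightarrow> z a c l) *\<^sub>R ?e p) a c l" by simp
    qed
    also have "\<dots> \<in> span (?e ` (P \<times> P \<times> L))"
     by (intro real_vector.span_sum real_vector.span_scale real_vector.span_base) auto
    finally show ?thesis .
   qed
   moreover have "finite (?e ` (P \<times> P \<times> L))" using fin fin_L by simp
   ultimately show ?thesis unfolding fin_dim_def by blast
  qed
  moreover have "u a c l = 0" if u: "u \<in> V" and "a \<notin> P \<or> c \<notin> P \<or> l \<notin> L" for u a c l
  proof (cases "a \<in> P")
   case True
   have "u a \<in> chains N (Suc i) a" by (rule inV[OF u])
   then show ?thesis using chains_supp that True by blast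
  next
   case False
   then have "u a = 0" using u le_P unfolding V_def chains_def by blast
   then show ?thesis by simp
  qed
  ultimately show ?thesis using SV by (elim fin_dim_subset) blast
 qed
 obtain s where s: "s \<in> S" "\<forall>w\<in>S. ip2 (b - s) w = 0"
  using orthogonal_projection_exists[of ip2 V S b, OF lin2 sym2 subV pos2 subS SV fdS] CV b(1) by blast
 \<comment> \<open>\<open>c\<close> is the part of \<open>b\<close> orthogonal to all boundaries,
   and it is still a cycle; the goal becomes \<open>c = 0\<close>.\<close>
 define c where "c = b - s"
 obtain y where y: "y \<in> chains (can i) (Suc k) x" "s = bd P x y" using s(1) unfolding S_def by blast
 have cC: "c \<in> chains (can i) k x" unfolding c_def y(2) using b(1) bdC[OF y(1)] subspace_diff[OF subC] by blast
 have bc: "bd P x c = 0"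
  unfolding c_def y(2) linear_diff[OF linear_bd] b(2) using bd_bd[OF subset_refl up] by simp
 have c0: "\<And>a. \<not> x \<sqsubseteq> a \<Longrightarrow> c a = 0" using chains_zero[OF cC] by blast
 have ccan: "c a \<in> can i a" for a using chains_in[OF subspace_can cC] .
 have cN: "c a \<in> chains N (Suc i) a" for a using ccan by (simp add: can_def)
 have cD: "c \<in> dchains (int k) (Suc i) x"
  by (rule dchainsI) (use cN chains_zero[OF cC] in auto)
 define w where "w = cobd x c"
 have wD: "w \<in> dchains (int k + 1) (Suc i) x" unfolding w_def by (rule cobd_dchains[OF cD])
 \<comment> \<open>\<open>c\<close> is orthogonal to the boundary of the chain concentrated at
   \<open>a\<close> whose value is the \<open>can\<close>-part \<open>v\<close> of
   \<open>w a\<close>. By adjointness this pairing equals \<open>ip v v\<close>, so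
   \<open>v = 0\<close> and \<open>w a\<close> is a cycle.\<close>
 have w_cyc: "bd U a (w a) = 0" for a
 proof (cases "x \<sqsubseteq> a \<and> rk a = Suc k")
  case True
  obtain z v where zv: "z \<in> cyc (Suc i) a" "v \<in> can i a" "w a = z + v"
   using chains_decomp[OF dchains_in[OF wD]] .
  define y' where "y' = (\<lambda>a'. if a' = a then v else 0)"
  have y'C: "y' \<in> chains (can i) (Suc k) x"
   by (rule chainsI) (use zv(2) True subspace_0[OF subspace_can] in \<open>auto simp: y'_def\<close>)
  have bdy': "bd P x y' a' = (if x \<sqsubseteq> a' then eps a' a *\<^sub>R v else 0)" for a'
  proof -
   have "(\<Sum>d\<in>P. eps a' d *\<^sub>R y' d) = (\<Sum>d\<in>P. if d = a then eps a' a *\<^sub>R v else 0)"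
    by (rule sum.cong) (auto simp: y'_def)
   also have "\<dots> = eps a' a *\<^sub>R v" using True le_P[of x a] fin by (simp add: sum.delta)
   finally show ?thesis using le_P by (auto simp: bd_def)
  qed
  have "0 = ip2 c (bd P x y')" using s(2) y'C unfolding S_def c_def by simp
  also have "\<dots> = (\<Sum>d\<in>P. eps d a * ip (c d) v)"
   unfolding ip2_def
  proof (rule sum.cong[OF refl])
   fix d
   show "ip (c d) (bd P x y' d) = eps d a * ip (c d) v"
    using c0[of d] by (cases "x \<sqsubseteq> d") (auto simp: bdy' linear_scale[OF linear_ip'] linear_0[OF linear_ip] linear_0[OF linear_ip'])
  qed
  also have "\<dots> = ip (\<Sum>d\<in>P. eps d a *\<^sub>R c d) v"
   by (simp add: linear_sum[OF linear_ip] linear_scale[OF linear_ip])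
  also have "\<dots> = ip (w a) v"
   unfolding ip_def
  proof (intro sum.cong refl)
   fix e l
   have "w a e l = (\<Sum>d\<in>P. eps d a *\<^sub>R c d) e l" if "a \<sqsubseteq> e"
    using True that by (simp add: w_def cobd_def sum_fun_apply')
   moreover have "v e l = 0" if "\<not> a \<sqsubseteq> e"
    using zv(2) chains_zero[of v N "Suc i" a e] that by (auto simp: can_def)
   ultimately show "(\<Sum>d\<in>P. eps d a *\<^sub>R c d) e l * v e l = w a e l * v e l" by (cases "a \<sqsubseteq> e") auto
  qed
  also have "\<dots> = ip v v"
   using zv ip_sym[of z v] by (simp add: linear_add[OF linear_ip] can_def)
  finally have "v = 0" using ip_pos zv(2) by (auto simp: can_def)
  then show ?thesis using zv by (simp add: cyc_def)
 next
  case False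
  then have "w a = 0" using dchains_zero[OF wD, of a] by auto
  then show ?thesis by (simp add: linear_0[OF linear_bd])
 qed
 define g where "g = (\<lambda>a. bd U a (c a))"
 have gD: "g \<in> dchains (int k) i x"
 proof (rule dchainsI)
  fix a
  show "g a \<in> chains N i a" unfolding g_def by (rule bd_chains[OF N_subspace N_mono cN])
  show "g a = 0" if "\<not> (x \<sqsubseteq> a \<and> int (rk a) = int k)"
   using dchains_zero[OF cD that] by (simp add: g_def linear_0[OF linear_bd])
 qed
 have g1: "bd U a (g a) = 0" for a unfolding g_def by (rule bd_bd[OF U_P U_up])
 have g2: "cobd x g = 0"
 proof
  fix a
  have "cobd x g a = bd U a (w a)"
   unfolding g_def w_def by (rule bd_cobd[where x=x and g=c and U=U and a=a, OF c0, symmetric])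
  also have "\<dots> = 0" by (rule w_cyc)
  finally show "cobd x g a = 0 a" by simp
 qed
 obtain e where e: "e \<in> dchains (int k - 1) i x" "\<And>a. bd U a (e a) = 0" "cobd x e = g"
  using cycles_exact[OF gD ki less_imp_le[OF im] g1 g2] by blast
 \<comment> \<open>Lifting \<open>e\<close> along the exact rows gives \<open>h\<close> such that
   \<open>c a - cobd x h a\<close> is a cycle, hence orthogonal to \<open>c a\<close>, which lies in
   \<open>can i a\<close>.\<close>
 have "\<exists>h. h \<in> chains N (Suc i) a \<and> bd U a h = e a" for a
  using exact[OF im dchains_in[OF e(1)] e(2)] by blast
 then have "\<exists>h0. \<forall>a. h0 a \<in> chains N (Suc i) a \<and> bd U a (h0 a) = e a" by (intro choice) blast
 then obtain h0 where h0: "\<And>a. h0 a \<in> chains N (Suc i) a" "\<And>a. bd U a (h0 a) = e a" by auto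
 define h where "h = (\<lambda>a. if x \<sqsubseteq> a then h0 a else 0)"
 have hz: "\<And>a. \<not> x \<sqsubseteq> a \<Longrightarrow> h a = 0" by (simp add: h_def)
 have hN: "h a \<in> chains N (Suc i) a" for a using h0(1) subspace_0[OF sub_chains] by (auto simp: h_def)
 have hb: "(\<lambda>a. bd U a (h a)) = e"
 proof
  fix a show "bd U a (h a) = e a"
   using h0(2)[of a] dchains_zero[OF e(1), of a] by (auto simp: h_def linear_0[OF linear_bd])
 qed
 have diag: "ip (c a) (c a) = (\<Sum>d\<in>P. eps d a * ip (c a) (h d))" for a
 proof (cases "x \<sqsubseteq> a \<and> rk a = k")
  case True
  have "c a - cobd x h a \<in> cyc (Suc i) a"
  proof -
   have "cobd x h a \<in> chains N (Suc i) a"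
   proof (rule chainsI)
    fix f show "cobd x h a f \<in> N f"
     unfolding cobd_def
     by (auto intro!: subspace_sum[OF N_subspace] subspace_scale[OF N_subspace] chains_in[OF N_subspace hN] subspace_0[OF N_subspace])
   next
    fix f assume f: "\<not> (a \<sqsubseteq> f \<and> rk f = Suc i)"
    then have "h d f = 0" if "a \<sqsubseteq> f" for d using chains_zero[OF hN, of d f] that by blast
    then show "cobd x h a f = 0" by (simp add: cobd_def)
   qed
   then have "c a - cobd x h a \<in> chains N (Suc i) a" using cN subspace_diff[OF sub_chains] by blast
   moreover have "bd U a (c a - cobd x h a) = 0"
   proof -
    have "bd U a (cobd x h a) = g a"
    proof -
     have "bd U a (cobd x h a) = cobd x (\<lambda>a. bd U a (h a)) a" by (rule bd_cobd) (rule hz)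
     also have "\<dots> = g a" by (simp only: hb e(3))
     finally show ?thesis .
    qed
    then show ?thesis by (simp only: linear_diff[OF linear_bd]) (simp add: g_def)
   qed
   ultimately show ?thesis by (simp add: cyc_def)
  qed
  then have "ip (c a) (c a - cobd x h a) = 0" using ccan by (simp add: can_def)
  then have "ip (c a) (c a) = ip (c a) (cobd x h a)" by (simp add: linear_diff[OF linear_ip'])
  also have "\<dots> = ip (c a) (\<Sum>d\<in>P. eps d a *\<^sub>R h d)"
   unfolding ip_def
  proof (intro sum.cong refl)
   fix f l
   have "cobd x h a f l = (\<Sum>d\<in>P. eps d a *\<^sub>R h d) f l" if "a \<sqsubseteq> f"
    using True that by (simp add: cobd_def sum_fun_apply')
   moreover have "c a f l = 0" if "\<not> a \<sqsubseteq> f" using chains_zero[OF cN, of a f] that by simp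
   ultimately show "c a f l * cobd x h a f l = c a f l * (\<Sum>d\<in>P. eps d a *\<^sub>R h d) f l"
    by (cases "a \<sqsubseteq> f") auto
  qed
  also have "\<dots> = (\<Sum>d\<in>P. eps d a * ip (c a) (h d))"
   by (simp add: linear_sum[OF linear_ip'] linear_scale[OF linear_ip'])
  finally show ?thesis .
 next
  case False
  then have "c a = 0" using chains_zero[OF cC] by blast
  then show ?thesis by (simp add: linear_0[OF linear_ip])
 qed
 \<comment> \<open>Moving the incidence numbers to the other argument pairs \<open>h\<close> with
   the boundary of \<open>c\<close>, which is zero.\<close>
 have "ip2 c c = (\<Sum>a\<in>P. \<Sum>d\<in>P. eps d a * ip (c a) (h d))" unfolding ip2_def by (simp only: diag)
 also have "\<dots> = (\<Sum>d\<in>P. ip (\<Sum>a\<in>P. eps d a *\<^sub>R c a) (h d))"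
  by (subst sum.swap) (simp add: linear_sum[OF linear_ip] linear_scale[OF linear_ip])
 also have "\<dots> = 0"
 proof (rule sum.neutral, intro ballI)
  fix d assume d: "d \<in> P"
  show "ip (\<Sum>a\<in>P. eps d a *\<^sub>R c a) (h d) = 0"
  proof (cases "x \<sqsubseteq> d")
   case True
   then have "(\<Sum>a\<in>P. eps d a *\<^sub>R c a) = bd P x c d" using d by (simp add: bd_def)
   then show ?thesis using bc by (simp add: linear_0[OF linear_ip])
  qed (simp add: hz linear_0[OF linear_ip'])
 qed
 finally have "c = 0" using pos2 cC CV by blast
 then show ?thesis using y unfolding c_def by auto
qed

end

section \<open>Division by a generic linear map\<close>

context cm_family
begin

text \<open>On \<open>can i a\<close> with \<open>a \<in> U\<close> this is a linear map into
  \<open>N a\<close>. The coefficients are one global choice, so the maps at different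
  \<open>a\<close> are compatible with the inclusions.\<close>

definition lcomb :: "('p \<Rightarrow> real) \<Rightarrow> ('p \<Rightarrow> 'q \<Rightarrow> real) \<Rightarrow> 'q \<Rightarrow> real" where
 "lcomb c b = (\<Sum>d\<in>P. c d *\<^sub>R b d)"

lemma linear_lcomb: "linear (lcomb c)"
 by (rule linearI) (auto simp: lcomb_def scaleR_right_distrib sum.distrib scaleR_right.sum mult.commute)

definition generic :: "('p \<Rightarrow> real) \<Rightarrow> nat \<Rightarrow> bool" where
 "generic c i \<longleftrightarrow> (\<forall>a\<in>{a \<in> U. rk a = i}. \<forall>b\<in>can i a. lcomb c b = 0 \<longrightarrow> b = 0)"

lemma genericD: "generic c i \<Longrightarrow> a \<in> U \<Longrightarrow> rk a = i \<Longrightarrow> b \<in> can i a \<Longrightarrow> lcomb c b = 0 \<Longrightarrow> b = 0"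
 unfolding generic_def by blast

text \<open>For a single \<open>a\<close> of rank \<open>i\<close> the incidence numbers
  \<open>eps a\<close> serve as coefficients: if that combination vanishes, so does the boundary,
  whose only possible value in rank \<open>i\<close> sits at \<open>a\<close>.\<close>

lemma ex_generic: "\<exists>c. generic c i"
 unfolding generic_def lcomb_def
proof (rule generic_combination)
 show "finite {a \<in> U. rk a = i}" using finite_subset[OF U_P fin] by simp
 show "subspace (can i a) \<and> fin_dim (can i a)" for a using subspace_can fin_dim_can by blast
 fix a assume a: "a \<in> {a \<in> U. rk a = i}"
 have "b = 0" if b: "b \<in> can i a" and 0: "(\<Sum>d\<in>P. eps a d *\<^sub>R b d) = 0" for b
 proof (rule can_bd_inj[OF b])
  have c: "bd U a b \<in> chains N i a"
   by (rule bd_chains[OF N_subspace N_mono]) (use b in \<open>simp_all add: can_def\<close>)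
  show "bd U a b = 0"
  proof
   fix d
   show "bd U a b d = 0 d"
   proof (cases "a \<sqsubseteq> d \<and> rk d = i")
    case True
    then have "a = d" using rk_less[of a d] a by (cases "a = d") auto
    then show ?thesis using 0 by (simp add: bd_def)
   qed (use chains_zero[OF c] in simp)
  qed
 qed
 then show "\<exists>c. \<forall>b\<in>can i a. (\<Sum>d\<in>P. c d *\<^sub>R b d) = 0 \<longrightarrow> b = 0" by blast
qed

lemma lcomb_in:
 assumes "a \<in> U" "b \<in> can i a" shows "lcomb c b \<in> N a"
 unfolding lcomb_def
proof (intro subspace_sum[OF N_subspace] subspace_scale[OF N_subspace])
 fix d
 have b: "b \<in> chains N (Suc i) a" using assms(2) by (simp add: can_def)
 show "b d \<in> N a"
 proof (cases "a \<sqsubseteq> d")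
  case True then show ?thesis using chains_in[OF N_subspace b, of d] N_mono[OF assms(1)] by blast
 next
  case False
  then have "b d = 0" using chains_zero[OF b] by blast
  then show ?thesis using subspace_0[OF N_subspace, of a] by metis
 qed
qed

lemma fin_dim_N: "fin_dim (N a)"
proof (cases "a \<in> P")
 case True
 have "linear (\<lambda>z::'p \<Rightarrow> 'q \<Rightarrow> real. z a)" by (rule linearI) auto
 then have "fin_dim ((\<lambda>z. z a) ` chains N (rk a) a)" by (rule fin_dim_image[OF fin_dim_chains])
 moreover have "N a \<subseteq> (\<lambda>z. z a) ` chains N (rk a) a"
 proof
  fix v assume v: "v \<in> N a"
  have "(\<lambda>b. if b = a then v else 0) \<in> chains N (rk a) a"
   by (rule chainsI) (use v True subspace_0[OF N_subspace] le_refl in auto)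
  then show "v \<in> (\<lambda>z. z a) ` chains N (rk a) a" by (rule rev_image_eqI) simp
 qed
 ultimately show ?thesis by (rule fin_dim_subset)
next
 case False
 then have "N a = {0}" using N_zero U_P by blast
 then show ?thesis unfolding fin_dim_def by (intro exI[of _ "{0}"]) (simp add: real_vector.span_superset)
qed

text \<open>In rank \<open>i\<close> source and target have equal dimension, so injectivity
  suffices. Further down, exactness at the bottom rank of the filter makes \<open>N a\<close> the
  sum of the stalks at the elements covering \<open>a\<close>, where surjectivity is already
  known.\<close>

lemma lcomb_surj:
 assumes i: "i < m" and c: "generic c i"
  and a: "a \<in> U" "rk a \<le> i"
 shows "lcomb c ` can i a = N a"
 using a
proof (induction "i - rk a" arbitrary: a)
 case 0
 then have rk: "rk a = i" by simp
 have sub: "lcomb c ` can i a \<subseteq> N a" using lcomb_in 0 by blast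
 have aP: "a \<in> P" using 0 U_P by blast
 have "cyc i a = chains N i a" using bd_chains_0[of _ N i a] rk by (auto simp: cyc_def)
 then have "dim (can i a) = (\<Sum>d | a \<sqsubseteq> d \<and> rk d = i. dim (N d))" using dim_can[OF i] dim_chains' by simp
 also have "{d. a \<sqsubseteq> d \<and> rk d = i} = {a}"
 proof -
  have "d = a" if "a \<sqsubseteq> d" "rk d = i" for d using rk_less[OF that(1)] that(2) rk by (cases "a = d") auto
  then show ?thesis using rk le_refl[OF aP] by auto
 qed
 finally have d1: "dim (can i a) = dim (N a)" by simp
 have "{b \<in> can i a. lcomb c b = 0} = {0}"
  using genericD[OF c 0(2) rk] subspace_0[OF subspace_can] linear_0[OF linear_lcomb] by auto
 then have "dim (can i a) = dim (lcomb c ` can i a)"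
  using rank_nullity[OF subspace_can fin_dim_can linear_lcomb, of i a c] by (simp add: dim_zero_space)
 then have "dim (lcomb c ` can i a) = dim (N a)" using d1 by metis
 then show ?case
  by (rule subspace_eq_if_dim_eq[OF linear_subspace_image[OF linear_lcomb subspace_can] sub fin_dim_N])
next
 case (Suc n)
 have aP: "a \<in> P" using Suc U_P by blast
 show ?case
 proof
  show "lcomb c ` can i a \<subseteq> N a" using lcomb_in Suc by blast
  show "N a \<subseteq> lcomb c ` can i a"
  proof
   fix w assume w: "w \<in> N a"
   let ?z = "\<lambda>b. if b = a then w else 0"
   have z: "?z \<in> chains N (rk a) a"
    by (rule chainsI) (use w aP subspace_0[OF N_subspace] le_refl in auto)
   have "rk a < m" using Suc i by simp
   from exact[OF this z] bd_chains_0[OF z] obtain y where y: "y \<in> chains N (Suc (rk a)) a" "bd U a y = ?z"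
    by auto
   have "w = (\<Sum>b\<in>P. eps a b *\<^sub>R y b)"
    using fun_cong[OF y(2), of a] Suc.prems le_refl[OF aP] by (simp add: bd_def)
   also have "\<dots> \<in> lcomb c ` can i a"
   proof (intro subspace_sum subspace_scale linear_subspace_image[OF linear_lcomb subspace_can])
    fix b
    show "y b \<in> lcomb c ` can i a"
    proof (cases "a \<sqsubseteq> b \<and> rk b = Suc (rk a)")
     case True
     then have "b \<in> U" using U_up Suc.prems by blast
     moreover have "n = i - rk b" using Suc.hyps(2) True by simp
     ultimately have "lcomb c ` can i b = N b" using Suc.hyps(1)[of b] True Suc.hyps(2) by simp
     then have "y b \<in> lcomb c ` can i b" using chains_in[OF N_subspace y(1)] by simp
     then show ?thesis using can_mono[of a b] True by blast
    next
     case False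
     then have "y b = 0" using chains_zero[OF y(1)] by blast
     moreover have "0 \<in> lcomb c ` can i a"
      by (rule subspace_0[OF linear_subspace_image[OF linear_lcomb subspace_can]])
     ultimately show ?thesis by metis
    qed
   qed
   finally show "w \<in> lcomb c ` can i a" .
  qed
 qed
qed

text \<open>In ranks up to \<open>i\<close> this is the kernel of a surjection from
  \<open>can i a\<close> onto \<open>N a\<close>. Off \<open>U\<close> the target is zero, so no
  condition is imposed there and the kernels live on all of \<open>P\<close>.\<close>

definition res :: "('p \<Rightarrow> real) \<Rightarrow> nat \<Rightarrow> 'p \<Rightarrow> ('p \<Rightarrow> 'q \<Rightarrow> real) set" where
 "res c i a = {b \<in> can i a. a \<in> U \<longrightarrow> lcomb c b = 0}"

lemma subspace_res: "subspace (res c i a)"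
 unfolding res_def using subspace_can[of i a]
 by (auto simp: subspace_def linear_add[OF linear_lcomb] linear_scale[OF linear_lcomb] linear_0[OF linear_lcomb])

lemma res_mono:
 assumes "a \<sqsubseteq> b" shows "res c i b \<subseteq> res c i a"
 using can_mono[OF assms, of i] U_up[OF _ assms] unfolding res_def by blast

text \<open>Long exact sequence of the kernel, chased by hand: \<open>lcomb\<close> of a primitive
  \<open>y\<close> in \<open>can\<close> is a cycle of \<open>N\<close> and bounds some
  \<open>w\<close>; lifting \<open>w\<close> through the surjection and subtracting the boundary of
  the lift moves \<open>y\<close> into the kernel. The lift happens in rank \<open>k + 2\<close>,
  which must not exceed \<open>i\<close>.\<close>

lemma res_exact:
 assumes i: "i < m" and c: "generic c i"
  and k: "Suc k < i" and z: "z \<in> chains (res c i) k x" "bd P x z = 0"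
 shows "\<exists>y\<in>chains (res c i) (Suc k) x. bd P x y = z"
proof -
 have zc: "z \<in> chains (can i) k x"
  by (rule chainsI) (use chainsD[OF z(1)] chains_zero[OF z(1)] in \<open>auto simp: res_def\<close>)
 obtain y where y: "y \<in> chains (can i) (Suc k) x" "bd P x y = z"
  using can_exact[OF _ i zc z(2)] k by auto
 have yc: "y a \<in> can i a" for a by (rule chains_in[OF subspace_can y(1)])
 define w0 where "w0 = (\<lambda>a. if a \<in> U then lcomb c (y a) else 0)"
 have w0: "w0 \<in> chains N (Suc k) x"
 proof (rule chainsI)
  fix a show "w0 a \<in> N a" using lcomb_in[OF _ yc] subspace_0[OF N_subspace] by (auto simp: w0_def)
  show "w0 a = 0" if "\<not> (x \<sqsubseteq> a \<and> rk a = Suc k)"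
   using chains_zero[OF y(1) that] by (simp only: w0_def linear_0[OF linear_lcomb] if_cancel)
 qed
 have comm: "(\<Sum>b\<in>P. eps a b *\<^sub>R (if b \<in> U then lcomb c (v b) else 0)) = lcomb c (\<Sum>b\<in>P. eps a b *\<^sub>R v b)"
  if "a \<in> U" for v a
 proof -
  have "(\<Sum>b\<in>P. eps a b *\<^sub>R (if b \<in> U then lcomb c (v b) else 0)) = (\<Sum>b\<in>P. eps a b *\<^sub>R lcomb c (v b))"
   using U_up[OF that] eps_le[of a] by (intro sum.cong) auto
  also have "\<dots> = lcomb c (\<Sum>b\<in>P. eps a b *\<^sub>R v b)"
   by (simp only: linear_sum[OF linear_lcomb] linear_scale[OF linear_lcomb])
  finally show ?thesis .
 qed
 have w0b: "bd U x w0 = 0"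
 proof
  fix a
  show "bd U x w0 a = 0 a"
  proof (cases "a \<in> U \<and> x \<sqsubseteq> a")
   case True
   then have aP: "a \<in> P" using U_P by blast
   have "bd U x w0 a = lcomb c (\<Sum>b\<in>P. eps a b *\<^sub>R y b)"
    using True comm[of a y] by (simp add: bd_def w0_def)
   also have "(\<Sum>b\<in>P. eps a b *\<^sub>R y b) = z a" using fun_cong[OF y(2), of a] True aP by (simp add: bd_def)
   also have "lcomb c (z a) = 0" using chains_in[OF subspace_res z(1), of a] True by (simp add: res_def)
   finally show ?thesis by simp
  qed (auto simp: bd_def)
 qed
 have "Suc k < m" using k i by simp
 from exact[OF this w0 w0b] obtain w where w: "w \<in> chains N (Suc (Suc k)) x" "bd U x w = w0" ..
 have "\<exists>v. v \<in> can i a \<and> (a \<in> U \<longrightarrow> lcomb c v = w a)" if ra: "rk a \<le> i" for a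
 proof (cases "a \<in> U")
  case True
  have "w a \<in> N a" by (rule chains_in[OF N_subspace w(1)])
  then obtain v where "v \<in> can i a" "w a = lcomb c v" unfolding lcomb_surj[OF i c True ra, symmetric] ..
  then show ?thesis by metis
 next
  case False
  then show ?thesis by (intro exI[of _ 0] conjI subspace_0[OF subspace_can]) simp
 qed
 then have "\<forall>a. \<exists>v. rk a \<le> i \<longrightarrow> v \<in> can i a \<and> (a \<in> U \<longrightarrow> lcomb c v = w a)" by simp
 from choice[OF this] obtain v0 where v00: "\<forall>a. rk a \<le> i \<longrightarrow> v0 a \<in> can i a \<and> (a \<in> U \<longrightarrow> lcomb c (v0 a) = w a)" ..
 have v0: "rk a \<le> i \<Longrightarrow> v0 a \<in> can i a" "rk a \<le> i \<Longrightarrow> a \<in> U \<Longrightarrow> lcomb c (v0 a) = w a" for a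
  using spec[OF v00, of a] by simp_all
 define v where "v = (\<lambda>a. if x \<sqsubseteq> a \<and> rk a = Suc (Suc k) then v0 a else 0)"
 have vC: "v \<in> chains (can i) (Suc (Suc k)) x"
  by (rule chainsI) (use v0(1) k in \<open>auto simp: v_def\<close>)
 have vw: "(if a \<in> U then lcomb c (v a) else 0) = w a" for a
 proof (cases "x \<sqsubseteq> a \<and> rk a = Suc (Suc k)")
  case True
  have "w a = 0" if "a \<notin> U" using chains_in[OF N_subspace w(1), of a] N_zero[of a] that by simp
  then show ?thesis using True v0(2)[of a] k by (simp add: v_def)
 next
  case False
  then have "w a = 0" "v a = 0" using chains_zero[OF w(1)] by (auto simp: v_def)
  then show ?thesis by (simp only: linear_0[OF linear_lcomb] if_cancel)
 qed
 have bdv: "bd P x v \<in> chains (can i) (Suc k) x" by (rule bd_chains[OF subspace_can can_mono vC])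
 have up: "\<And>a b. a \<in> P \<Longrightarrow> a \<sqsubseteq> b \<Longrightarrow> b \<in> P" using le_P by blast
 have y': "y - bd P x v \<in> chains (can i) (Suc k) x"
  by (rule subspace_diff[OF subspace_chains[OF subspace_can] y(1) bdv])
 have "y - bd P x v \<in> chains (res c i) (Suc k) x"
 proof (rule chainsI)
  fix a assume a: "x \<sqsubseteq> a" "rk a = Suc k"
  have "lcomb c ((y - bd P x v) a) = 0" if "a \<in> U"
  proof -
   have "lcomb c (bd P x v a) = lcomb c (\<Sum>b\<in>P. eps a b *\<^sub>R v b)" using a le_P by (simp add: bd_def)
   also have "\<dots> = (\<Sum>b\<in>P. eps a b *\<^sub>R (if b \<in> U then lcomb c (v b) else 0))"
    by (rule comm[OF that, symmetric])
   also have "\<dots> = (\<Sum>b\<in>P. eps a b *\<^sub>R w b)" by (simp only: vw)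
   also have "\<dots> = w0 a" using fun_cong[OF w(2), of a] that a by (simp add: bd_def)
   also have "\<dots> = lcomb c (y a)" using that by (simp add: w0_def)
   finally have "lcomb c (y a) - lcomb c (bd P x v a) = 0" by simp
   then show ?thesis by (simp only: minus_apply linear_diff[OF linear_lcomb])
  qed
  then show "(y - bd P x v) a \<in> res c i a"
   using chains_in[OF subspace_can y', of a] by (simp only: res_def) blast
 qed (use chains_zero[OF y'] in blast)
 moreover have "bd P x (y - bd P x v) = z"
 proof -
  have "bd P x (bd P x v) = 0" by (rule bd_bd[OF subset_refl]) (rule up)
  then show ?thesis using y(2) by (simp only: linear_diff[OF linear_bd] diff_zero)
 qed
 ultimately show ?thesis by blast
qed

lemma dim_res:
 assumes i: "i < m" and c: "generic c i"
  and a: "rk a \<le> i"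
 shows "int (dim (res c i a)) =
  (\<Sum>b | a \<sqsubseteq> b \<and> rk b \<le> i. (-1) ^ (i - rk b) * int (dim (N b))) - int (dim (N a))"
proof -
 have "dim (can i a) = dim (res c i a) + dim (N a)"
 proof (cases "a \<in> U")
  case True
  then show ?thesis
   using rank_nullity[OF subspace_can fin_dim_can linear_lcomb, of i a c] lcomb_surj[OF i c True a]
   by (simp add: res_def)
 next
  case False
  then show ?thesis using N_zero[of a] by (simp add: res_def dim_zero_space)
 qed
 then show ?thesis using dim_can[OF i, of a] dim_cyc[of i a] i by simp
qed

text \<open>In rank \<open>i\<close> genericity makes \<open>lcomb\<close> injective on
  \<open>U\<close>; in the remaining cases \<open>can\<close> is already zero.\<close>

lemma res_zero:
 assumes c: "generic c i"
  and a: "i \<le> rk a"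
 shows "res c i a = {0}"
proof (cases "a \<in> U \<and> rk a = i")
 case True
 then show ?thesis using genericD[OF c, of a] subspace_0[OF subspace_res[of c i a]] unfolding res_def by blast
next
 case False
 then have "can i a = {0}" using a by (intro can_zero) auto
 then show ?thesis using subspace_0[OF subspace_res[of c i a]] unfolding res_def by auto
qed

end

text \<open>Turns the index into the head of a list. Values of iterated kernels thereby stay
  functions on lists, and one induction can range over all families.\<close>

definition flat :: "('p \<Rightarrow> 'p list \<Rightarrow> real) \<Rightarrow> 'p list \<Rightarrow> real" where
 "flat z = (\<lambda>l. case l of [] \<Rightarrow> 0 | a # l' \<Rightarrow> z a l')"

lemma linear_flat: "linear flat"
 by (rule linearI) (auto simp: flat_def fun_eq_iff split: list.split)

lemma flat_eq_0: "flat z = 0 \<Longrightarrow> z = 0"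
proof (intro ext)
 fix a l assume "flat z = 0"
 from fun_cong[OF this, of "a # l"] show "z a l = 0 a l" by (simp add: flat_def)
qed

text \<open>The generic kernel on the skeleton of rank \<open>Suc j\<close>, transported by
  \<open>flat\<close>. What matters afterwards is that the reflected dimensions minus the original
  ones are realised by actual vector spaces.\<close>

lemma cm_family_step:
 fixes N :: "'p \<Rightarrow> ('p list \<Rightarrow> real) set" and bt :: 'p and le :: "'p \<Rightarrow> 'p \<Rightarrow> bool"
 assumes "cm_family P le rk eps bt N U m L" and j: "Suc j < m"
 shows "\<exists>N' L'. cm_family P le rk eps bt N' P j (L' :: 'p list set) \<and>
  (\<forall>a. rk a \<le> Suc j \<longrightarrow> int (dim (N' a)) =
   (\<Sum>b | le a b \<and> rk b \<le> Suc j. (-1) ^ (Suc j - rk b) * int (dim (N b))) - int (dim (N a)))"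
proof -
 interpret cm_family P le rk eps bt N U m L by fact
 obtain c where c: "generic c (Suc j)"
  using ex_generic[of "Suc j"] by blast
 let ?R = "res c (Suc j)"
 let ?L = "{a # l | a l. a \<in> P \<and> l \<in> L}"
 have inj: "inj flat"
  using flat_eq_0 linear_injective_0[OF linear_flat] by blast
 have supp: "z a l = 0" if "z \<in> ?R x" "a \<notin> P \<or> l \<notin> L" for z a l x
  using that chains_supp[of z "Suc (Suc j)" x a l] by (auto simp: res_def can_def)
 have "cm_family P le rk eps bt (\<lambda>a. flat ` ?R a) P j ?L"
 proof
  fix a b
  show "a \<in> P \<Longrightarrow> le a b \<Longrightarrow> b \<in> P" using le_P by blast
  show "subspace (flat ` ?R a)" by (rule linear_subspace_image[OF linear_flat subspace_res])
  show "le a b \<Longrightarrow> flat ` ?R b \<subseteq> flat ` ?R a" using res_mono[of a b c "Suc j"] by blast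
  show "finite ?L" using finite_image_set2[of "\<lambda>a. a \<in> P" "\<lambda>l. l \<in> L" "(#)"] fin fin_L by simp
  show "f l = 0" if f: "f \<in> flat ` ?R a" and l: "l \<notin> ?L" for f l
  proof -
   obtain z where z: "z \<in> ?R a" "f = flat z" using f by blast
   show ?thesis
   proof (cases l)
    case (Cons d l')
    then have "d \<notin> P \<or> l' \<notin> L" using l by auto
    then show ?thesis using supp[OF z(1)] Cons z(2) by (simp add: flat_def)
   qed (simp add: z flat_def)
  qed
  show "flat ` ?R a = {0}" if "a \<notin> P \<or> j < rk a"
  proof -
   have "?R a = {0}"
   proof (cases "a \<in> P")
    case True
    then show ?thesis using that res_zero[OF c, of a] by simp
   next
    case False
    have "z = 0" if z: "z \<in> ?R a" for z
    proof -
     have zc: "z \<in> chains N (Suc (Suc j)) a" using z by (simp add: res_def can_def)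
     have "z d = 0" for d by (rule chains_zero[OF zc]) (use le_P False in blast)
     then show ?thesis by (simp add: fun_eq_iff)
    qed
    then show ?thesis using subspace_0[OF subspace_res] by blast
   qed
   then show ?thesis by (simp add: linear_0[OF linear_flat])
  qed
 next
  fix k x and z :: "'p \<Rightarrow> 'p list \<Rightarrow> real"
  assume k: "k < j" and z: "z \<in> chains (\<lambda>a. flat ` ?R a) k x" "bd P x z = 0"
  have "\<forall>a. \<exists>u. u \<in> ?R a \<and> z a = flat u"
   using chains_in[of "\<lambda>a. flat ` ?R a", OF linear_subspace_image[OF linear_flat subspace_res] z(1)] by blast
  from choice[OF this] obtain u where u: "\<And>a. u a \<in> ?R a" "\<And>a. z a = flat (u a)" by blast
  have "u \<in> chains ?R k x"
  proof (rule chainsI)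
   show "u a \<in> ?R a" for a by (rule u(1))
   show "u a = 0" if "\<not> (le x a \<and> rk a = k)" for a
    using chains_zero[OF z(1) that] u(2)[of a] flat_eq_0 by metis
  qed
  moreover have bdf: "bd P x (\<lambda>a. flat (v a)) a = flat (bd P x v a)" for v a
   by (simp add: bd_def linear_sum[OF linear_flat] linear_scale[OF linear_flat] linear_0[OF linear_flat])
  have "bd P x u = 0"
  proof
   fix a
   have "z = (\<lambda>a. flat (u a))" using u(2) by blast
   then have "flat (bd P x u a) = 0" using bdf[of u a] fun_cong[OF z(2), of a] by simp
   then show "bd P x u a = 0 a" using flat_eq_0 by force
  qed
  ultimately obtain y where y: "y \<in> chains ?R (Suc k) x" "bd P x y = u"
   using res_exact[OF j c, of k u x] k by auto
  have "(\<lambda>a. flat (y a)) \<in> chains (\<lambda>a. flat ` ?R a) (Suc k) x"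
   by (rule chainsI) (use chainsD[OF y(1)] chains_zero[OF y(1)] linear_0[OF linear_flat] in auto)
  moreover have "bd P x (\<lambda>a. flat (y a)) = z"
   using bdf[of y] y(2) u(2) by (simp add: fun_eq_iff)
  ultimately show "\<exists>y\<in>chains (\<lambda>a. flat ` ?R a) (Suc k) x. bd P x y = z" by blast
 qed simp
 moreover have dm: "dim (flat ` ?R a) = dim (?R a)" for a
 proof -
  have "fin_dim (?R a)" by (rule fin_dim_subset[OF fin_dim_can]) (auto simp: res_def)
  moreover have "{z \<in> ?R a. flat z = 0} = {0}"
   using flat_eq_0 subspace_0[OF subspace_res] linear_0[OF linear_flat] by blast
  ultimately show ?thesis using rank_nullity[OF subspace_res _ linear_flat, of c "Suc j" a] by (simp add: dim_zero_space)
 qed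
 ultimately show ?thesis
  by (intro exI[of _ "\<lambda>a. flat ` ?R a"] exI[of _ ?L] conjI allI impI) (simp_all only: dm dim_res[OF j c])
qed

section \<open>Polynomials with nonnegative \<open>\<gamma>\<close>-vector\<close>

abbreviation pX :: "int poly" where "pX \<equiv> [:0, 1:]"
abbreviation pY :: "int poly" where "pY \<equiv> [:1, -1:]"
abbreviation pZ :: "int poly" where "pZ \<equiv> [:1, 1:]"

text \<open>The cone over the basis polynomials, given by generators so that sums and products
  follow by rule induction without bookkeeping of coefficients.\<close>

inductive gamma_nonneg :: "nat \<Rightarrow> int poly \<Rightarrow> bool" where
 gamma_nonneg_0: "gamma_nonneg n 0"
| gamma_nonneg_step: "gamma_nonneg n p \<Longrightarrow> 2 * k \<le> n \<Longrightarrow> gamma_nonneg n (p + pX ^ k * pZ ^ (n - 2 * k))"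

lemma gamma_nonneg_base: "2 * k \<le> n \<Longrightarrow> gamma_nonneg n (pX ^ k * pZ ^ (n - 2 * k))"
 using gamma_nonneg_step[OF gamma_nonneg_0] by simp

lemma gamma_nonneg_add: "gamma_nonneg n p \<Longrightarrow> gamma_nonneg n q \<Longrightarrow> gamma_nonneg n (p + q)"
proof (induction rule: gamma_nonneg.induct)
 case (gamma_nonneg_step n p k)
 have "gamma_nonneg n (p + q + pX ^ k * pZ ^ (n - 2 * k))"
  using gamma_nonneg_step by (intro gamma_nonneg.gamma_nonneg_step) auto
 also have "p + q + pX ^ k * pZ ^ (n - 2 * k) = p + pX ^ k * pZ ^ (n - 2 * k) + q" by (simp only: ac_simps)
 finally show ?case .
qed simp

lemma gamma_nonneg_mult:
 assumes "gamma_nonneg a p" "gamma_nonneg b q"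
 shows "gamma_nonneg (a + b) (p * q)"
 using assms(1)
proof (induction rule: gamma_nonneg.induct)
 case (gamma_nonneg_step a p k)
 have "gamma_nonneg (a + b) (pX ^ k * pZ ^ (a - 2 * k) * q)"
  using assms(2)
 proof (induction rule: gamma_nonneg.induct)
  case (gamma_nonneg_step b q l)
  have "pX ^ k * pZ ^ (a - 2 * k) * (pX ^ l * pZ ^ (b - 2 * l)) = pX ^ (k + l) * (pZ ^ (a - 2 * k) * pZ ^ (b - 2 * l))"
   by (simp only: power_add ac_simps)
  also have "pZ ^ (a - 2 * k) * pZ ^ (b - 2 * l) = pZ ^ (a + b - 2 * (k + l))"
   using gamma_nonneg_step.hyps \<open>2 * k \<le> a\<close> by (simp flip: power_add)
  finally have "pX ^ k * pZ ^ (a - 2 * k) * (q + pX ^ l * pZ ^ (b - 2 * l)) =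
   pX ^ k * pZ ^ (a - 2 * k) * q + pX ^ (k + l) * pZ ^ (a + b - 2 * (k + l))"
   by (simp only: distrib_left)
  moreover have "2 * (k + l) \<le> a + b" using gamma_nonneg_step.hyps \<open>2 * k \<le> a\<close> by simp
  ultimately show ?case by (simp only: gamma_nonneg.gamma_nonneg_step[OF gamma_nonneg_step.IH])
 qed (simp add: gamma_nonneg_0)
 then show ?case using gamma_nonneg_step.IH by (simp only: distrib_right gamma_nonneg_add)
qed (simp add: gamma_nonneg_0)

lemma gamma_nonneg_1: "gamma_nonneg 0 1"
 using gamma_nonneg_base[of 0 0] by simp

lemma gamma_nonneg_pZ: "gamma_nonneg n p \<Longrightarrow> gamma_nonneg (Suc n) (pZ * p)"
 using gamma_nonneg_mult[OF gamma_nonneg_base[of 0 1]] by simp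

lemma gamma_nonneg_pX: "gamma_nonneg n p \<Longrightarrow> gamma_nonneg (Suc (Suc n)) (pX * p)"
 using gamma_nonneg_mult[OF gamma_nonneg_base[of 1 2]] by simp

lemma gamma_nonneg_of_nat: "gamma_nonneg n p \<Longrightarrow> gamma_nonneg n (of_nat k * p)"
 by (induction k) (auto simp: algebra_simps gamma_nonneg_0 gamma_nonneg_add)

lemma gamma_nonneg_sum: "(\<And>i. i \<in> A \<Longrightarrow> gamma_nonneg n (p i)) \<Longrightarrow> gamma_nonneg n (\<Sum>i\<in>A. p i)"
 by (induction A rule: infinite_finite_induct) (auto simp: gamma_nonneg_0 gamma_nonneg_add)

lemma gamma_nonneg_imp_coeffs:
 assumes "gamma_nonneg n p"
 shows "\<exists>c. (\<forall>k. 0 \<le> c k) \<and> p = (\<Sum>k=0..n div 2. of_int (c k) * pX ^ k * pZ ^ (n - 2 * k))"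
 using assms
proof (induction rule: gamma_nonneg.induct)
 case (gamma_nonneg_0 n)
 show ?case by (intro exI[of _ "\<lambda>_. 0"]) simp
next
 case (gamma_nonneg_step n p k)
 then obtain c where c: "\<forall>k. 0 \<le> c k" "p = (\<Sum>k=0..n div 2. of_int (c k) * pX ^ k * pZ ^ (n - 2 * k))" by blast
 let ?c = "\<lambda>j. c j + (if j = k then 1 else 0)"
 have "(\<Sum>j=0..n div 2. of_int (?c j) * pX ^ j * pZ ^ (n - 2 * j)) =
  p + (\<Sum>j=0..n div 2. if j = k then pX ^ j * pZ ^ (n - 2 * j) else 0)"
  unfolding c(2) sum.distrib[symmetric] by (intro sum.cong refl) (auto simp: distrib_right)
 also have "(\<Sum>j=0..n div 2. if j = k then pX ^ j * pZ ^ (n - 2 * j) else 0) = pX ^ k * pZ ^ (n - 2 * k)"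
  using gamma_nonneg_step.hyps by (subst sum.delta) auto
 finally have "p + pX ^ k * pZ ^ (n - 2 * k) = (\<Sum>j=0..n div 2. of_int (?c j) * pX ^ j * pZ ^ (n - 2 * j))" ..
 moreover have "\<forall>j. 0 \<le> ?c j" using c(1) by auto
 ultimately show ?case by (intro exI[of _ ?c] conjI)
qed

text \<open>The basis polynomials have pairwise different orders of vanishing at \<open>0\<close>.\<close>

lemma gamma_coeffs_unique:
 fixes c e :: "nat \<Rightarrow> int"
 assumes "(\<Sum>k=0..n div 2. of_int (c k) * pX ^ k * pZ ^ (n - 2 * k)) =
   (\<Sum>k=0..n div 2. of_int (e k) * pX ^ k * pZ ^ (n - 2 * k))"
  and "j \<le> n div 2"
 shows "c j = e j"
 using assms(2)
proof (induction j rule: less_induct)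
 case (less j)
 define a where "a = (\<lambda>k. c k - e k)"
 let ?t = "\<lambda>k. of_int (a k) * pX ^ k * pZ ^ (n - 2 * k)"
 \<comment> \<open>The coefficients below \<open>j\<close> agree by induction, so the difference is
   \<open>pX ^ j * S\<close>; evaluating \<open>S\<close> at 0 isolates coefficient
   \<open>j\<close>.\<close>
 define S where "S = (\<Sum>k=j..n div 2. of_int (a k) * pX ^ (k - j) * pZ ^ (n - 2 * k))"
 have a0: "a k = 0" if "k < j" for k using less.IH[OF that] that less.prems by (simp add: a_def)
 have "pX ^ j * S = (\<Sum>k=j..n div 2. ?t k)"
  unfolding S_def sum_distrib_left
 proof (rule sum.cong[OF refl])
  fix k assume "k \<in> {j..n div 2}"
  then have "pX ^ k = pX ^ j * pX ^ (k - j)" unfolding power_add[symmetric] by simp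
  then show "pX ^ j * (of_int (a k) * pX ^ (k - j) * pZ ^ (n - 2 * k)) = ?t k" by (simp only: ac_simps)
 qed
 also have "\<dots> = (\<Sum>k=0..n div 2. ?t k)"
  by (rule sum.mono_neutral_left) (auto simp: a0)
 also have "\<dots> = 0"
  unfolding a_def of_int_diff left_diff_distrib sum_subtractf assms(1) by (rule diff_self)
 finally have "pX ^ j * S = 0" .
 moreover have "pX \<noteq> 0" by simp
 then have "pX ^ j \<noteq> 0" by (rule power_not_zero)
 ultimately have "S = 0" by (metis mult_eq_0_iff)
 then have "poly S 0 = 0" by (simp only: poly_0)
 moreover have "poly S 0 = (\<Sum>k=j..n div 2. if k = j then a k else 0)"
  unfolding S_def poly_sum by (rule sum.cong) (auto simp: of_int_poly power_0_left)
 moreover have "\<dots> = a j" using less.prems by (simp add: sum.delta)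
 ultimately show ?case by (simp add: a_def)
qed

section \<open>Weighted chain polynomials of a cell poset\<close>

locale flag_poset = cell_poset P le rk eps bot
 for P :: "'p set" and le (infix "\<sqsubseteq>" 50) and rk eps bot +
 fixes u :: "'p \<Rightarrow> int poly"
 assumes u_bot: "u bot = 1"
  and u_rec: "a \<in> P \<Longrightarrow> a \<noteq> bot \<Longrightarrow> u a = pX * (\<Sum>b | b \<sqsubseteq> a \<and> b \<noteq> a. u b * pY ^ (rk a - 1 - rk b))"
begin

text \<open>With \<open>q\<close> the stalk dimensions this is an h-polynomial of the family
  truncated at rank \<open>j\<close>: chains of faces, weighted by the stalk at their
  maximum.\<close>

definition hsum :: "('p \<Rightarrow> int) \<Rightarrow> nat \<Rightarrow> int poly" where
 "hsum q j = (\<Sum>a | a \<in> P \<and> rk a \<le> j. of_int (q a) * u a * pY ^ (j - rk a))"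

text \<open>The alternating sum of \<open>dim_cyc\<close> as an operator on integer functions: the
  numerical shadow of dualising the skeleton of rank \<open>j\<close>.\<close>

definition dual :: "('p \<Rightarrow> int) \<Rightarrow> nat \<Rightarrow> 'p \<Rightarrow> int" where
 "dual q j a = (\<Sum>b | a \<sqsubseteq> b \<and> rk b \<le> j. (-1) ^ (j - rk b) * q b)"

text \<open>\<open>dual q j - q\<close> is the dimension function produced by
  \<open>cm_family_step\<close>. It vanishes in rank \<open>j\<close> by \<open>dual_top\<close>,
  whence the exponent \<open>j - 1 - rk a\<close>.\<close>

definition defect :: "('p \<Rightarrow> int) \<Rightarrow> nat \<Rightarrow> int poly" where
 "defect q j = (\<Sum>a | a \<in> P \<and> rk a < j. of_int (dual q j a - q a) * u a * pY ^ (j - 1 - rk a))"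

text \<open>For the indicator of the interior cells of a ball \<open>dual\<close> is constantly 1,
  so \<open>defect\<close> is the boundary sum and this becomes \<open>\<theta> F\<close>.\<close>

definition gpoly :: "('p \<Rightarrow> int) \<Rightarrow> nat \<Rightarrow> int poly" where
 "gpoly q j = hsum q j - pX * defect q j"

text \<open>By \<open>bsum_closed\<close> this agrees with the sum over all faces of
  \<open>a\<close> including \<open>a\<close>, as the h-polynomial of a cone agrees with that of its
  base. The value at \<open>bot\<close> is set by hand, no proper faces being left.\<close>

definition bsum :: "'p \<Rightarrow> int poly" where
 "bsum a = (if a = bot then 1 else \<Sum>b | b \<sqsubseteq> a \<and> b \<noteq> a. u b * pY ^ (rk a - 1 - rk b))"

definition dsum :: "('p \<Rightarrow> int) \<Rightarrow> nat \<Rightarrow> int poly" where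
 "dsum q j = (\<Sum>a | a \<in> P \<and> rk a \<le> j. of_int (q a) * (- pY) ^ (j - rk a) * bsum a)"

lemma finP: "finite {a. a \<in> P \<and> Q a}" "finite {b. a \<sqsubseteq> b \<and> Q b}" "finite {b. b \<sqsubseteq> a \<and> Q b}"
 by (rule finite_subset[OF _ fin], auto dest: le_P)+

lemma rk_0: "a \<in> P \<Longrightarrow> rk a = 0 \<longleftrightarrow> a = bot"
 using rk_less[OF bot_le, of a] rk_bot by (cases "a = bot") auto

text \<open>Splitting off the top term adds \<open>pX * bsum b\<close> to
  \<open>pY * bsum b\<close>, and \<open>pX + pY = 1\<close>.\<close>

lemma bsum_closed:
 assumes "b \<in> P"
 shows "(\<Sum>a | a \<sqsubseteq> b. u a * pY ^ (rk b - rk a)) = bsum b"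
proof (cases "b = bot")
 case True
 have "{a. a \<sqsubseteq> bot} = {bot}"
  using rk_mono[of _ bot] rk_0 rk_bot le_P le_refl[OF bot_P] by auto
 then show ?thesis using True by (simp add: bsum_def u_bot)
next
 case False
 have "{a. a \<sqsubseteq> b} = insert b {a. a \<sqsubseteq> b \<and> a \<noteq> b}" using le_refl[OF assms] by auto
 then have "(\<Sum>a | a \<sqsubseteq> b. u a * pY ^ (rk b - rk a)) = u b + (\<Sum>a | a \<sqsubseteq> b \<and> a \<noteq> b. u a * pY ^ (rk b - rk a))"
  using finP by simp
 also have "(\<Sum>a | a \<sqsubseteq> b \<and> a \<noteq> b. u a * pY ^ (rk b - rk a)) =
   (\<Sum>a | a \<sqsubseteq> b \<and> a \<noteq> b. pY * (u a * pY ^ (rk b - 1 - rk a)))"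
 proof (rule sum.cong[OF refl])
  fix a assume "a \<in> {a. a \<sqsubseteq> b \<and> a \<noteq> b}"
  then have "rk b - rk a = Suc (rk b - 1 - rk a)" using rk_less[of a b] by force
  then show "u a * pY ^ (rk b - rk a) = pY * (u a * pY ^ (rk b - 1 - rk a))"
   by (simp only: power_Suc ac_simps)
 qed
 also have "\<dots> = pY * bsum b" using False by (simp only: bsum_def if_False sum_distrib_left)
 also have "u b = pX * bsum b" using u_rec[OF assms False] False by (simp add: bsum_def)
 also have "pX * bsum b + pY * bsum b = bsum b" by (simp flip: distrib_right)
 finally show ?thesis .
qed

lemma dual_top: "a \<in> P \<Longrightarrow> rk a = j \<Longrightarrow> dual q j a = q a"
proof -
 assume a: "a \<in> P" "rk a = j"
 have "b = a" if "a \<sqsubseteq> b" "rk b \<le> j" for b using rk_less[OF that(1)] that(2) a by (cases "a = b") auto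
 then have "{b. a \<sqsubseteq> b \<and> rk b \<le> j} = {a}" using le_refl[OF a(1)] a(2) by auto
 then show ?thesis using a by (simp add: dual_def)
qed

text \<open>The factor \<open>pY\<close> restores the exponents of \<open>hsum\<close>. Rank
  \<open>j\<close> may then be included since \<open>dual_top\<close> kills it, and exchanging the
  summations collects the inner sums into \<open>bsum\<close>.\<close>

lemma pY_defect: "pY * defect q j = dsum q j - hsum q j"
proof -
 have "pY * defect q j = (\<Sum>a | a \<in> P \<and> rk a < j. of_int (dual q j a - q a) * u a * pY ^ (j - rk a))"
  unfolding defect_def sum_distrib_left
 proof (rule sum.cong[OF refl])
  fix a assume "a \<in> {a. a \<in> P \<and> rk a < j}"
  then have "rk a < j" by simp
  then have "j - rk a = Suc (j - 1 - rk a)" by linarith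
  then show "pY * (of_int (dual q j a - q a) * u a * pY ^ (j - 1 - rk a)) =
   of_int (dual q j a - q a) * u a * pY ^ (j - rk a)" by (simp only: power_Suc ac_simps)
 qed
 also have "\<dots> = (\<Sum>a | a \<in> P \<and> rk a \<le> j. of_int (dual q j a - q a) * u a * pY ^ (j - rk a))"
 proof (rule sum.mono_neutral_left[OF finP(1)])
  show "\<forall>a\<in>{a. a \<in> P \<and> rk a \<le> j} - {a. a \<in> P \<and> rk a < j}.
    of_int (dual q j a - q a) * u a * pY ^ (j - rk a) = 0"
  proof
   fix a assume "a \<in> {a. a \<in> P \<and> rk a \<le> j} - {a. a \<in> P \<and> rk a < j}"
   then have "a \<in> P" "rk a = j" by auto
   then show "of_int (dual q j a - q a) * u a * pY ^ (j - rk a) = 0" by (simp add: dual_top)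
  qed
 qed auto
 also have "\<dots> = (\<Sum>a | a \<in> P \<and> rk a \<le> j. of_int (dual q j a) * u a * pY ^ (j - rk a)) - hsum q j"
  unfolding hsum_def sum_subtractf[symmetric] by (intro sum.cong refl) (simp only: of_int_diff left_diff_distrib)
 also have "(\<Sum>a | a \<in> P \<and> rk a \<le> j. of_int (dual q j a) * u a * pY ^ (j - rk a)) =
   (\<Sum>a | a \<in> P \<and> rk a \<le> j. \<Sum>b | b \<in> P \<and> rk b \<le> j.
    if a \<sqsubseteq> b then of_int ((-1) ^ (j - rk b) * q b) * (u a * pY ^ (j - rk a)) else 0)"
 proof (rule sum.cong[OF refl])
  fix a
  have "of_int (dual q j a) * u a * pY ^ (j - rk a) =
    (\<Sum>b | a \<sqsubseteq> b \<and> rk b \<le> j. of_int ((-1) ^ (j - rk b) * q b) * (u a * pY ^ (j - rk a)))"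
   unfolding dual_def of_int_sum sum_distrib_right by (simp only: mult.assoc)
  also have "\<dots> = (\<Sum>b | b \<in> P \<and> rk b \<le> j.
    if a \<sqsubseteq> b then of_int ((-1) ^ (j - rk b) * q b) * (u a * pY ^ (j - rk a)) else 0)"
   using le_P by (intro sum.mono_neutral_cong_left finP) auto
  finally show "of_int (dual q j a) * u a * pY ^ (j - rk a) = \<dots>" .
 qed
 also have "\<dots> = (\<Sum>b | b \<in> P \<and> rk b \<le> j. \<Sum>a | a \<in> P \<and> rk a \<le> j.
    if a \<sqsubseteq> b then of_int ((-1) ^ (j - rk b) * q b) * (u a * pY ^ (j - rk a)) else 0)"
  by (rule sum.swap)
 also have "\<dots> = dsum q j"
  unfolding dsum_def
 proof (rule sum.cong[OF refl])
  fix b assume b: "b \<in> {b. b \<in> P \<and> rk b \<le> j}"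
  have "(\<Sum>a | a \<in> P \<and> rk a \<le> j. if a \<sqsubseteq> b then of_int ((-1) ^ (j - rk b) * q b) * (u a * pY ^ (j - rk a)) else 0) =
    (\<Sum>a | a \<sqsubseteq> b. of_int ((-1) ^ (j - rk b) * q b) * (u a * pY ^ (j - rk a)))"
  proof -
   have rj: "rk a \<le> j" "a \<in> P" if "a \<sqsubseteq> b" for a using rk_mono[OF that] le_P[OF that] b by auto
   show ?thesis by (rule sum.mono_neutral_cong_right[OF finP(1)]) (auto simp: rj)
  qed
  also have "\<dots> = (\<Sum>a | a \<sqsubseteq> b. of_int (q b) * (- pY) ^ (j - rk b) * (u a * pY ^ (rk b - rk a)))"
  proof (rule sum.cong[OF refl])
   fix a assume "a \<in> {a. a \<sqsubseteq> b}"
   then have "j - rk a = (j - rk b) + (rk b - rk a)" using rk_mono[of a b] b by simp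
   then have "pY ^ (j - rk a) = pY ^ (j - rk b) * pY ^ (rk b - rk a)" by (simp only: power_add)
   moreover have "(- pY) ^ (j - rk b) = (-1) ^ (j - rk b) * pY ^ (j - rk b)" by (rule power_minus)
   ultimately show "of_int ((-1) ^ (j - rk b) * q b) * (u a * pY ^ (j - rk a)) =
     of_int (q b) * (- pY) ^ (j - rk b) * (u a * pY ^ (rk b - rk a))"
    by (simp only: of_int_mult of_int_power of_int_minus of_int_1 ac_simps)
  qed
  also have "\<dots> = of_int (q b) * (- pY) ^ (j - rk b) * bsum b"
   using bsum_closed[of b] b by (simp only: sum_distrib_left[symmetric]) simp
  finally show "(\<Sum>a | a \<in> P \<and> rk a \<le> j. if a \<sqsubseteq> b then of_int ((-1) ^ (j - rk b) * q b) * (u a * pY ^ (j - rk a)) else 0) =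
    of_int (q b) * (- pY) ^ (j - rk b) * bsum b" .
 qed
 finally show ?thesis .
qed

lemma sum_rk_Suc:
 "(\<Sum>a | a \<in> P \<and> rk a \<le> Suc j. F a) = (\<Sum>a | a \<in> P \<and> rk a \<le> j. F a) + (\<Sum>a | a \<in> P \<and> rk a = Suc j. F a :: int poly)"
proof -
 have "{a. a \<in> P \<and> rk a \<le> Suc j} = {a. a \<in> P \<and> rk a \<le> j} \<union> {a. a \<in> P \<and> rk a = Suc j}" by auto
 then show ?thesis by (simp only:) (rule sum.union_disjoint; auto simp: finP)
qed

text \<open>The cd-index recursion under c = 1 + x, d = 2x. The new rank contributes
  \<open>pX * E\<close> to \<open>hsum\<close> and \<open>E\<close> to \<open>dsum\<close>; these
  cancel in \<open>gpoly\<close> as \<open>pX + pY = 1\<close>. The computation takes place after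
  multiplication by \<open>pY\<close>, which is cancelled at the end.\<close>

lemma gpoly_Suc: "gpoly q (Suc j) = pZ * gpoly q j + 2 * (pX * defect q j)"
proof -
 define E where "E = (\<Sum>a | a \<in> P \<and> rk a = Suc j. of_int (q a) * bsum a)"
 have "(\<Sum>a | a \<in> P \<and> rk a = Suc j. of_int (q a) * u a * pY ^ (Suc j - rk a)) = pX * E"
  unfolding E_def sum_distrib_left
 proof (rule sum.cong[OF refl])
  fix a assume a: "a \<in> {a. a \<in> P \<and> rk a = Suc j}"
  then have ne: "a \<noteq> bot" using rk_bot by auto
  then have "u a = pX * bsum a" using u_rec[of a] a by (simp add: bsum_def)
  then show "of_int (q a) * u a * pY ^ (Suc j - rk a) = pX * (of_int (q a) * bsum a)"
   using a by (simp add: ac_simps)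
 qed
 moreover have "(\<Sum>a | a \<in> P \<and> rk a \<le> j. of_int (q a) * u a * pY ^ (Suc j - rk a)) = pY * hsum q j"
  unfolding hsum_def sum_distrib_left
  by (intro sum.cong refl) (auto simp: Suc_diff_le simp del: mult_pCons_left mult_pCons_right)
 ultimately have H: "hsum q (Suc j) = pY * hsum q j + pX * E"
  unfolding hsum_def[of q "Suc j"] sum_rk_Suc by simp
 have "(\<Sum>a | a \<in> P \<and> rk a = Suc j. of_int (q a) * (- pY) ^ (Suc j - rk a) * bsum a) = E"
  unfolding E_def by (intro sum.cong refl) auto
 moreover have "(\<Sum>a | a \<in> P \<and> rk a \<le> j. of_int (q a) * (- pY) ^ (Suc j - rk a) * bsum a) = - pY * dsum q j"
  unfolding dsum_def sum_distrib_left
  by (intro sum.cong refl) (auto simp: Suc_diff_le simp del: mult_pCons_left mult_pCons_right)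
 ultimately have D: "dsum q (Suc j) = - pY * dsum q j + E"
  unfolding dsum_def[of q "Suc j"] sum_rk_Suc by simp
 define Y where "Y = pY"
 define Xv where "Xv = pX"
 have XY: "Xv = 1 - Y" "pZ = 2 - Y" by (simp_all add: Y_def Xv_def numeral_poly one_pCons)
 have d: "Y * defect q j = dsum q j - hsum q j" "Y * defect q (Suc j) = dsum q (Suc j) - hsum q (Suc j)"
  using pY_defect unfolding Y_def by blast+
 have "Y * gpoly q (Suc j) = Y * hsum q (Suc j) - Xv * (Y * defect q (Suc j))"
  unfolding gpoly_def Xv_def[symmetric] by (simp only: right_diff_distrib ac_simps)
 also have "\<dots> = Y * (hsum q j + Xv * dsum q j)"
  unfolding d H D Y_def[symmetric] Xv_def[symmetric] XY by (simp add: algebra_simps)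
 also have "\<dots> = Y * (pZ * gpoly q j + 2 * (pX * defect q j))"
 proof -
  have "Y * (pZ * gpoly q j + 2 * (pX * defect q j)) =
   pZ * (Y * hsum q j - Xv * (Y * defect q j)) + 2 * Xv * (Y * defect q j)"
   unfolding gpoly_def Xv_def[symmetric] by (simp add: algebra_simps)
  then show ?thesis unfolding d XY by (simp add: algebra_simps)
 qed
 finally have eq: "Y * gpoly q (Suc j) = Y * (pZ * gpoly q j + 2 * (pX * defect q j))" .
 have "Y \<noteq> 0" by (simp add: Y_def)
 then show ?thesis using mult_left_cancel[of Y] eq by blast
qed

text \<open>Exchanging the sums leaves an alternating count over the interval from \<open>a\<close>
  to \<open>c\<close>, which is zero unless \<open>a = c\<close>.\<close>

lemma dual_dual:
 assumes "a \<in> P" "rk a \<le> j"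
 shows "dual (dual q j) j a = q a"
proof -
 let ?S = "{b. a \<sqsubseteq> b \<and> rk b \<le> j}"
 have fS: "finite ?S" by (rule finP)
 have "dual (dual q j) j a = (\<Sum>b\<in>?S. \<Sum>c\<in>?S. if b \<sqsubseteq> c then (-1) ^ (j - rk b) * ((-1) ^ (j - rk c) * q c) else 0)"
  unfolding dual_def[of "dual q j"]
 proof (rule sum.cong[OF refl])
  fix b assume b: "b \<in> ?S"
  have "(\<Sum>c | b \<sqsubseteq> c \<and> rk c \<le> j. (-1) ^ (j - rk b) * ((-1) ^ (j - rk c) * q c)) =
   (\<Sum>c\<in>?S. if b \<sqsubseteq> c then (-1) ^ (j - rk b) * ((-1) ^ (j - rk c) * q c) else 0)"
   using b le_trans[of a b] by (intro sum.mono_neutral_cong_left fS) auto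
  then show "(-1) ^ (j - rk b) * dual q j b = (\<Sum>c\<in>?S. if b \<sqsubseteq> c then (-1) ^ (j - rk b) * ((-1) ^ (j - rk c) * q c) else 0)"
   unfolding dual_def[of q] sum_distrib_left .
 qed
 also have "\<dots> = (\<Sum>c\<in>?S. \<Sum>b\<in>?S. if b \<sqsubseteq> c then (-1) ^ (j - rk b) * ((-1) ^ (j - rk c) * q c) else 0)"
  by (rule sum.swap)
 also have "\<dots> = (\<Sum>c\<in>?S. if c = a then q a else 0)"
 proof (rule sum.cong[OF refl])
  fix c assume c: "c \<in> ?S"
  have sg: "(-1) ^ (j - rk b) * ((-1) ^ (j - rk c) * q c) = (-1) ^ rk b * ((-1) ^ rk c * q c)" if "rk b \<le> j" for b
   using that c by (simp add: minus_one_power_iff)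
  have "(\<Sum>b\<in>?S. if b \<sqsubseteq> c then (-1) ^ (j - rk b) * ((-1) ^ (j - rk c) * q c) else 0) =
   (\<Sum>b | a \<sqsubseteq> b \<and> b \<sqsubseteq> c. (-1) ^ rk b * ((-1) ^ rk c * q c))"
  proof -
   have rj: "rk b \<le> j" if "b \<sqsubseteq> c" for b using rk_mono[OF that] c by simp
   show ?thesis by (rule sum.mono_neutral_cong_right[OF fS]) (auto simp: rj sg)
  qed
  also have "\<dots> = (\<Sum>b | a \<sqsubseteq> b \<and> b \<sqsubseteq> c. (-1) ^ rk b) * ((-1) ^ rk c * q c)" by (simp only: sum_distrib_right)
  also have "\<dots> = (if c = a then q a else 0)"
  proof (cases "c = a")
   case True
   have "{b. a \<sqsubseteq> b \<and> b \<sqsubseteq> a} = {a}"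
   proof -
    have "b = a" if "a \<sqsubseteq> b" "b \<sqsubseteq> a" for b using rk_less[OF that(1)] rk_mono[OF that(2)] by (cases "a = b") auto
    then show ?thesis using le_refl[OF assms(1)] by auto
   qed
   then show ?thesis using True by (simp add: minus_one_power_iff)
  next
   case False
   then show ?thesis using euler_interval[of a c] c by simp
  qed
  finally show "(\<Sum>b\<in>?S. if b \<sqsubseteq> c then (-1) ^ (j - rk b) * ((-1) ^ (j - rk c) * q c) else 0) = (if c = a then q a else 0)" .
 qed
 also have "\<dots> = q a" using fS assms le_refl by simp
 finally show ?thesis .
qed

text \<open>By \<open>dual_dual\<close> the function \<open>dual q - q\<close> changes sign under
  \<open>dual\<close> at level \<open>Suc i\<close>. It vanishes in rank \<open>Suc i\<close>, so
  going down one level flips all signs and makes it self-dual.\<close>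

lemma defect_self_dual:
 assumes q': "\<And>a. a \<in> P \<Longrightarrow> rk a \<le> Suc i \<Longrightarrow> q' a = dual q (Suc i) a - q a"
 shows "defect q' i = 0"
proof -
 have "dual q' i a = q' a" if a: "a \<in> P" "rk a < i" for a
 proof -
  have "dual q' i a = (\<Sum>b | a \<sqsubseteq> b \<and> rk b \<le> Suc i. - ((-1) ^ (Suc i - rk b) * q' b))"
   unfolding dual_def
  proof (rule sum.mono_neutral_cong_left[OF finP(2)])
   show "{b. a \<sqsubseteq> b \<and> rk b \<le> i} \<subseteq> {b. a \<sqsubseteq> b \<and> rk b \<le> Suc i}" by auto
   show "\<forall>b\<in>{b. a \<sqsubseteq> b \<and> rk b \<le> Suc i} - {b. a \<sqsubseteq> b \<and> rk b \<le> i}. - ((-1) ^ (Suc i - rk b) * q' b) = 0"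
    using q' dual_top le_P by (auto simp: le_Suc_eq)
   show "(-1) ^ (i - rk b) * q' b = - ((-1) ^ (Suc i - rk b) * q' b)" if "b \<in> {b. a \<sqsubseteq> b \<and> rk b \<le> i}" for b
    using that by (simp add: Suc_diff_le)
  qed
  also have "\<dots> = (\<Sum>b | a \<sqsubseteq> b \<and> rk b \<le> Suc i. (-1) ^ (Suc i - rk b) * q b - (-1) ^ (Suc i - rk b) * dual q (Suc i) b)"
  proof (rule sum.cong[OF refl])
   fix b assume "b \<in> {b. a \<sqsubseteq> b \<and> rk b \<le> Suc i}"
   then have "q' b = dual q (Suc i) b - q b" using q'[of b] le_P[of a b] by simp
   then show "- ((-1) ^ (Suc i - rk b) * q' b) =
     (-1) ^ (Suc i - rk b) * q b - (-1) ^ (Suc i - rk b) * dual q (Suc i) b"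
    by (simp only: right_diff_distrib minus_diff_eq)
  qed
  also have "\<dots> = dual q (Suc i) a - dual (dual q (Suc i)) (Suc i) a"
   unfolding sum_subtractf dual_def ..
  also have "\<dots> = q' a" using dual_dual[of a "Suc i" q] q'[of a] a by simp
  finally show ?thesis .
 qed
 then show ?thesis unfolding defect_def by (intro sum.neutral) auto
qed

text \<open>Two nested inductions: over families by dimension, and within a family over skeleta
  through \<open>gpoly_Suc\<close>. The summand \<open>defect q j\<close> is \<open>hsum\<close> of
  the family from \<open>cm_family_step\<close>, and equals its \<open>gpoly\<close> because that
  family has zero defect.\<close>

theorem gpoly_gamma_nonneg:
 fixes N :: "'p \<Rightarrow> ('p list \<Rightarrow> real) set"
 assumes "cm_family P le rk eps bot N U m L"
 shows "gamma_nonneg m (gpoly (\<lambda>a. int (dim (N a))) m)"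
 using assms
proof (induction m arbitrary: N U L rule: less_induct)
 case (less m)
 define q where "q = (\<lambda>a. int (dim (N a)))"
 have "gamma_nonneg j (gpoly q j)" if "j \<le> m" for j
  using that
 proof (induction j)
  case 0
  have "{a. a \<in> P \<and> rk a \<le> 0} = {bot}" using rk_0 bot_P rk_bot by auto
  then have "gpoly q 0 = of_nat (dim (N bot)) * 1"
   by (simp add: gpoly_def hsum_def defect_def u_bot q_def rk_bot)
  then show ?case using gamma_nonneg_of_nat[OF gamma_nonneg_1, of "dim (N bot)"] by (simp only:)
 next
  case (Suc j)
  have 1: "gamma_nonneg (Suc j) (pZ * gpoly q j)" using Suc by (intro gamma_nonneg_pZ) simp
  have 2: "gamma_nonneg (Suc j) (pX * defect q j)"
  proof (cases j)
   case 0
   then show ?thesis by (simp add: defect_def gamma_nonneg_0)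
  next
   case (Suc i)
   then have im: "Suc i < m" using \<open>Suc j \<le> m\<close> by simp
   obtain N' L' where N': "cm_family P le rk eps bot N' P i (L' :: 'p list set)"
    "\<forall>a. rk a \<le> Suc i \<longrightarrow> int (dim (N' a)) =
     (\<Sum>b | a \<sqsubseteq> b \<and> rk b \<le> Suc i. (-1) ^ (Suc i - rk b) * int (dim (N b))) - int (dim (N a))"
    using cm_family_step[OF less.prems im] by blast
   define q' where "q' = (\<lambda>a. int (dim (N' a)))"
   have q': "q' a = dual q (Suc i) a - q a" if "rk a \<le> Suc i" for a
    using N'(2) that by (simp add: q'_def q_def dual_def)
   have "gamma_nonneg i (gpoly q' i)" unfolding q'_def using less.IH[OF _ N'(1)] im by simp
   moreover have "gpoly q' i = defect q j"
   proof -
    have "gpoly q' i = hsum q' i" using defect_self_dual[of i q' q] q' by (simp add: gpoly_def)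
    also have "\<dots> = defect q j" unfolding hsum_def defect_def Suc using q'
     by (intro sum.cong) auto
    finally show ?thesis .
   qed
   ultimately have "gamma_nonneg i (defect q j)" by simp
   from gamma_nonneg_pX[OF this] show ?thesis using Suc by simp
  qed
  have "gpoly q (Suc j) = pZ * gpoly q j + (pX * defect q j + pX * defect q j)"
   unfolding gpoly_Suc by (simp only: mult_2)
  then show ?case using gamma_nonneg_add[OF 1 gamma_nonneg_add[OF 2 2]] by (simp only:)
 qed
 then show ?case by (simp add: q_def)
qed

end

section \<open>Eulerian and derangement polynomials\<close>

text \<open>The equation expresses each coefficient of \<open>Z\<close> through earlier ones, so
  uniqueness is a strong induction.\<close>

lemma fps_linear_ode_zero:
 fixes Z :: "real fps"
 assumes "fps_deriv Z = G * Z" "fps_nth Z 0 = 0"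
 shows "Z = 0"
proof -
 have "fps_nth Z n = 0" for n
 proof (induction n rule: less_induct)
  case (less n)
  show ?case
  proof (cases n)
   case 0 then show ?thesis using assms(2) by simp
  next
   case (Suc m)
   have "of_nat (Suc m) * fps_nth Z (Suc m) = fps_nth (G * Z) m"
    unfolding assms(1)[symmetric] by (simp add: fps_deriv_def)
   also have "\<dots> = 0" unfolding fps_mult_nth using less Suc by (intro sum.neutral) auto
   finally show ?thesis using Suc by simp
  qed
 qed
 then show ?thesis by (simp add: fps_eq_iff)
qed

definition egf :: "(nat \<Rightarrow> real) \<Rightarrow> real fps" where
 "egf f = Abs_fps (\<lambda>n. f n / fact n)"

lemma egf_mult: "egf f * egf g = egf (\<lambda>n. \<Sum>k\<le>n. of_nat (n choose k) * f k * g (n - k))"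
proof (rule fps_ext)
 fix n
 have "(\<Sum>k=0..n. f k / fact k * (g (n - k) / fact (n - k))) =
  (\<Sum>k\<le>n. of_nat (n choose k) * f k * g (n - k)) / fact n"
  unfolding sum_divide_distrib atMost_atLeast0
  by (rule sum.cong) (auto simp: binomial_fact field_simps)
 then show "fps_nth (egf f * egf g) n = fps_nth (egf (\<lambda>n. \<Sum>k\<le>n. of_nat (n choose k) * f k * g (n - k))) n"
  by (simp add: egf_def fps_mult_nth)
qed

lemma egf_deriv: "fps_deriv (egf f) = egf (\<lambda>n. f (Suc n))"
 by (rule fps_ext) (simp add: egf_def del: of_nat_Suc)

lemma egf_add: "egf f + egf g = egf (\<lambda>n. f n + g n)" and egf_diff: "egf f - egf g = egf (\<lambda>n. f n - g n)"
 by (rule fps_ext, simp add: egf_def add_divide_distrib diff_divide_distrib)+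

lemma egf_const: "fps_const c * egf f = egf (\<lambda>n. c * f n)"
 by (rule fps_ext) (simp add: egf_def)

lemma egf_one: "1 = egf (\<lambda>n. if n = 0 then 1 else 0)"
 by (rule fps_ext) (simp add: egf_def)

lemma egf_inj: "egf f = egf g \<Longrightarrow> f n = g n"
 by (simp add: egf_def fps_eq_iff)

text \<open>For positive index the descent polynomial of permutations, split at the position of the
  largest entry; in this form the \<open>\<gamma>\<close>-nonnegativity of each summand is visible.
  Index 0 gets the value 0 so that the generating function has no constant term.\<close>

fun eulerian :: "nat \<Rightarrow> int poly" where
 "eulerian 0 = 0"
| "eulerian (Suc n) = (if n = 0 then 1 else pZ * eulerian n) +
   pX * (\<Sum>k\<in>{1..<n}. of_nat (n choose k) * eulerian k * eulerian (n - k))"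

text \<open>Derangements by excedances, split at the cycle through a marked point: a cycle on
  \<open>m + 1\<close> points contributes \<open>pX * eulerian m\<close>, and \<open>k < n\<close>
  excludes fixed points.\<close>

fun derangement :: "nat \<Rightarrow> int poly" where
 "derangement 0 = 1"
| "derangement (Suc n) = pX * (\<Sum>k<n. of_nat (n choose k) * derangement k * eulerian (n - k))"

declare eulerian.simps(2)[simp del] derangement.simps(2)[simp del]

text \<open>Degree parameters add up: \<open>eulerian k * eulerian (n - k)\<close> has parameter
  \<open>n - 2\<close>, and \<open>pX\<close> raises it by 2.\<close>

lemma eulerian_gamma: "gamma_nonneg n (eulerian (Suc n))"
proof (induction n rule: less_induct)
 case (less n)
 show ?case
 proof (cases n)
  case 0
  then show ?thesis using gamma_nonneg_1 by (simp add: eulerian.simps)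
 next
  case (Suc m)
  have 1: "gamma_nonneg n (pZ * eulerian n)"
   using gamma_nonneg_pZ[OF less[of m]] Suc by simp
  have 2: "gamma_nonneg n (pX * (\<Sum>k\<in>{1..<n}. of_nat (n choose k) * eulerian k * eulerian (n - k)))"
  proof -
   have "gamma_nonneg (n - 2) (of_nat (n choose k) * eulerian k * eulerian (n - k))" if k: "k \<in> {1..<n}" for k
   proof -
    have a: "gamma_nonneg (k - 1) (eulerian k)" using less[of "k - 1"] k by auto
    have b: "gamma_nonneg (n - k - 1) (eulerian (n - k))" using less[of "n - Suc k"] k Suc_diff_Suc[of k n] by simp
    have "gamma_nonneg ((k - 1) + (n - k - 1)) (of_nat (n choose k) * eulerian k * eulerian (n - k))"
     unfolding mult.assoc by (intro gamma_nonneg_of_nat gamma_nonneg_mult a b)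
    moreover have "(k - 1) + (n - k - 1) = n - 2" using k by auto
    ultimately show ?thesis by simp
   qed
   then have s: "gamma_nonneg (n - 2) (\<Sum>k\<in>{1..<n}. of_nat (n choose k) * eulerian k * eulerian (n - k))"
    by (intro gamma_nonneg_sum) auto
   show ?thesis
   proof (cases "n = 1")
    case True
    then show ?thesis using gamma_nonneg_sum[of "{}" n "\<lambda>_. 0"] by simp
   next
    case False
    then have "2 + (n - 2) = n" using Suc by simp
    then show ?thesis using gamma_nonneg_pX[OF s] by simp
   qed
  qed
  show ?thesis using gamma_nonneg_add[OF 1 2] Suc by (simp add: eulerian.simps)
 qed
qed

lemma derangement_gamma: "gamma_nonneg n (derangement n)"
proof (induction n rule: less_induct)
 case (less n)
 show ?case
 proof (cases n)
  case 0
  then show ?thesis using gamma_nonneg_1 by simp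
 next
  case (Suc m)
  have t: "gamma_nonneg (m - 1) (of_nat (m choose k) * derangement k * eulerian (m - k))" if k: "k < m" for k
  proof -
   have a: "gamma_nonneg k (derangement k)" using less[of k] k Suc by simp
   have b: "gamma_nonneg (m - k - 1) (eulerian (m - k))" using eulerian_gamma[of "m - Suc k"] k Suc_diff_Suc[of k m] by simp
   have "gamma_nonneg (k + (m - k - 1)) (of_nat (m choose k) * derangement k * eulerian (m - k))"
    unfolding mult.assoc by (intro gamma_nonneg_of_nat gamma_nonneg_mult a b)
   moreover have "k + (m - k - 1) = m - 1" using k by simp
   ultimately show ?thesis by simp
  qed
  show ?thesis
  proof (cases "m = 0")
   case True
   then show ?thesis using gamma_nonneg_sum[of "{}" n "\<lambda>_. 0"] Suc by (simp add: derangement.simps)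
  next
   case False
   have "gamma_nonneg (m - 1) (\<Sum>k<m. of_nat (m choose k) * derangement k * eulerian (m - k))"
    using t by (intro gamma_nonneg_sum) auto
   from gamma_nonneg_pX[OF this] show ?thesis
    using False Suc by (simp add: derangement.simps)
  qed
 qed
qed

text \<open>With \<open>A\<close>, \<open>D\<close> the exponential generating functions of the Eulerian and derangement polynomials and
 \<open>Q = (exp ((1 - x) t) - 1) / (1 - x)\<close>, the recursions say \<open>A' = (1 + A) (1 + x A)\<close> and \<open>D' = x D A\<close>; both
 \<open>A - (1 + x A) Q\<close> and \<open>D (1 - x Q) - exp (- x t)\<close> then solve homogeneous linear equations.\<close>

lemma derangement_identity_eval:
 fixes x :: int
 shows "poly (derangement m - pX * (\<Sum>k<m. of_nat (m choose k) * derangement k * pY ^ (m - k - 1))) x = (- x) ^ m"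
proof -
 \<comment> \<open>Evaluation at an integer \<open>x\<close> allows exponential generating functions
   over the reals, where factorials are invertible.\<close>
 define y where "y = real_of_int (1 - x)"
 define r where "r = real_of_int x"
 define a where "a = (\<lambda>n. real_of_int (poly (eulerian n) x))"
 define d where "d = (\<lambda>n. real_of_int (poly (derangement n) x))"
 define q where "q = (\<lambda>n. if n = 0 then 0 else y ^ (n - 1))"
 let ?A = "egf a" and ?D = "egf d" and ?Q = "egf q" and ?c = "fps_const r"
 have a0: "a 0 = 0" by (simp add: a_def)
 have aS: "a (Suc n) = (if n = 0 then 1 else 0) + (1 + r) * a n + r * (\<Sum>k\<le>n. of_nat (n choose k) * a k * a (n - k))" for n
 proof -
  have "(\<Sum>k\<le>n. of_nat (n choose k) * a k * a (n - k)) = (\<Sum>k\<in>{1..<n}. of_nat (n choose k) * a k * a (n - k))"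
  proof (rule sum.mono_neutral_right)
   show "\<forall>k\<in>{..n} - {1..<n}. of_nat (n choose k) * a k * a (n - k) = 0"
   proof
    fix k assume "k \<in> {..n} - {1..<n}"
    then have "k = 0 \<or> k = n" by auto
    then show "of_nat (n choose k) * a k * a (n - k) = 0" using a0 by auto
   qed
  qed auto
  then show ?thesis using a0
   by (auto simp: a_def r_def eulerian.simps poly_sum of_nat_poly algebra_simps)
 qed
 have dS: "d (Suc n) = r * (\<Sum>k\<le>n. of_nat (n choose k) * d k * a (n - k))" for n
 proof -
  have "(\<Sum>k\<le>n. of_nat (n choose k) * d k * a (n - k)) = (\<Sum>k<n. of_nat (n choose k) * d k * a (n - k))"
   using a0 by (simp add: lessThan_Suc_atMost[symmetric])
  then show ?thesis by (simp add: d_def a_def r_def derangement.simps poly_sum of_nat_poly mult.assoc)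
 qed
 have A': "fps_deriv ?A = 1 + ?A + ?c * ?A + ?c * (?A * ?A)"
  unfolding egf_deriv egf_one egf_mult egf_const egf_add aS by (simp add: algebra_simps)
 have D': "fps_deriv ?D = ?c * (?D * ?A)"
  unfolding egf_deriv egf_mult egf_const dS ..
 have Q': "fps_deriv ?Q = 1 + fps_const (1 - r) * ?Q"
 proof -
  have "(\<lambda>n. q (Suc n)) = (\<lambda>n. (if n = 0 then 1 else 0) + (1 - r) * q n)"
   by (rule ext) (auto simp: q_def y_def r_def power_eq_if)
  then show ?thesis unfolding egf_deriv egf_one egf_const egf_add by simp
 qed
 have cc: "fps_const (1 - r) = 1 - ?c" by (simp add: fps_const_sub[symmetric] del: fps_const_sub)
 define Z where "Z = ?A - (1 + ?c * ?A) * ?Q"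
 have "fps_deriv Z = (1 + ?c * ?A) * Z"
  unfolding Z_def by (simp add: A' Q' cc) (simp add: algebra_simps)
 moreover have "fps_nth Z 0 = 0" by (simp add: Z_def egf_def a0 q_def)
 ultimately have "Z = 0" by (rule fps_linear_ode_zero)
 then have AQ: "?A = (1 + ?c * ?A) * ?Q" by (simp add: Z_def)
 define Y where "Y = ?D * (1 - ?c * ?Q) - egf (\<lambda>n. (- r) ^ n)"
 have E': "fps_deriv (egf (\<lambda>n. (- r) ^ n)) = - (?c * egf (\<lambda>n. (- r) ^ n))"
  unfolding egf_deriv egf_const by (rule fps_ext) (simp add: egf_def)
 have "fps_deriv (?D * (1 - ?c * ?Q)) = ?c * ?D * (?A - ?c * ?A * ?Q - 1 - ?Q + ?c * ?Q)"
  by (simp add: D' Q' cc) (simp add: algebra_simps)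
 also have "?A - ?c * ?A * ?Q - 1 - ?Q + ?c * ?Q = - (1 - ?c * ?Q)"
  using AQ by (simp add: algebra_simps)
 finally have f: "fps_deriv (?D * (1 - ?c * ?Q)) = ?c * ?D * - (1 - ?c * ?Q)" .
 have "fps_deriv Y = (- ?c) * Y"
  unfolding Y_def fps_deriv_sub E' f by (simp add: algebra_simps del: fps_const_neg)
 moreover have "fps_nth Y 0 = 0" by (simp add: Y_def egf_def d_def q_def)
 ultimately have "Y = 0" by (rule fps_linear_ode_zero)
 then have "?D - ?c * (?D * ?Q) = egf (\<lambda>n. (- r) ^ n)" by (simp add: Y_def algebra_simps)
 then have "d m - r * (\<Sum>k\<le>m. of_nat (m choose k) * d k * q (m - k)) = (- r) ^ m"
  unfolding egf_mult egf_const egf_diff by (rule egf_inj)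
 moreover have "(\<Sum>k\<le>m. of_nat (m choose k) * d k * q (m - k)) = (\<Sum>k<m. of_nat (m choose k) * d k * y ^ (m - k - 1))"
  by (simp add: lessThan_Suc_atMost[symmetric] q_def)
 ultimately have "d m - r * (\<Sum>k<m. of_nat (m choose k) * d k * y ^ (m - k - 1)) = (- r) ^ m" by simp
 then have "real_of_int (poly (derangement m - pX * (\<Sum>k<m. of_nat (m choose k) * derangement k * pY ^ (m - k - 1))) x)
  = real_of_int ((- x) ^ m)"
  by (simp add: d_def r_def y_def poly_sum of_nat_poly mult.assoc)
 then show ?thesis by (simp only: of_int_eq_iff)
qed

text \<open>Agreement at all integers gives equality of polynomials. The identity says that
  convolution with \<open>derangement\<close> undoes the passage from \<open>I\<close> to
  \<open>\<theta>\<close> up to powers of \<open>- pX\<close>.\<close>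

lemma derangement_identity:
 "derangement m - pX * (\<Sum>k<m. of_nat (m choose k) * derangement k * pY ^ (m - k - 1)) = (- pX) ^ m"
 unfolding poly_eq_poly_eq_iff[symmetric]
 by (rule ext, rule trans[OF derangement_identity_eval]) simp

section \<open>Sums over subsets and the local alternating sum\<close>

lemma sum_subsets_card:
 assumes "finite A"
 shows "(\<Sum>B\<in>Pow A. f (card B)) = (\<Sum>k\<le>card A. of_nat (card A choose k) * (f k :: 'b::comm_ring_1))"
proof -
 have "(\<Sum>B\<in>Pow A. f (card B)) = (\<Sum>k\<le>card A. \<Sum>B | B \<in> Pow A \<and> card B = k. f (card B))"
  using assms by (intro sum.group[symmetric]) (auto simp: card_mono)
 also have "\<dots> = (\<Sum>k\<le>card A. of_nat (card A choose k) * f k)"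
  using n_subsets[OF assms] by (intro sum.cong) auto
 finally show ?thesis .
qed

lemma sum_supersets:
 assumes "finite V" "G \<subseteq> V"
 shows "(\<Sum>F | G \<subseteq> F \<and> F \<subseteq> V. g (card (V - F)) (card (F - G))) =
  (\<Sum>k\<le>card (V - G). of_nat (card (V - G) choose k) * (g k (card (V - G) - k) :: 'b::comm_ring_1))"
proof -
 have "(\<Sum>F | G \<subseteq> F \<and> F \<subseteq> V. g (card (V - F)) (card (F - G))) =
  (\<Sum>B\<in>Pow (V - G). g (card B) (card (V - G) - card B))"
 proof (rule sum.reindex_bij_witness[of _ "\<lambda>B. V - B" "\<lambda>F. V - F"])
  fix F assume F: "F \<in> {F. G \<subseteq> F \<and> F \<subseteq> V}"
  then have "F - G = (V - G) - (V - F)" by auto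
  moreover have "card ((V - G) - (V - F)) = card (V - G) - card (V - F)"
   using F assms by (intro card_Diff_subset) (auto intro: finite_subset[of _ V])
  ultimately show "g (card (V - F)) (card (V - G) - card (V - F)) = g (card (V - F)) (card (F - G))" by simp
 qed (use assms in auto)
 also have "\<dots> = (\<Sum>k\<le>card (V - G). of_nat (card (V - G) choose k) * g k (card (V - G) - k))"
  using sum_subsets_card[of "V - G" "\<lambda>k. g k (card (V - G) - k)"] assms by simp
 finally show ?thesis .
qed

text \<open>Two expressions linear in \<open>I\<close> are compared through their coefficients at
  \<open>I G\<close>: in the alternating sum the binomial theorem gives
  \<open>(pY - 1) ^ card (V - G)\<close>, and in the sum of \<open>?th F\<close> times derangement
  polynomials \<open>derangement_identity\<close> gives the same power of
  \<open>- pX\<close>.\<close>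

lemma local_sum_gamma_nonneg:
 fixes I :: "'v set \<Rightarrow> int poly"
 assumes V: "finite V"
  and theta: "\<And>F. F \<subseteq> V \<Longrightarrow> gamma_nonneg (card F) (I F - pX * (\<Sum>G | G \<subset> F. I G * pY ^ (card F - card G - 1)))"
 shows "gamma_nonneg (card V) (\<Sum>F\<in>Pow V. (-1) ^ (card V - card F) * (\<Sum>G\<in>Pow F. I G * pY ^ (card F - card G)))"
proof -
 let ?th = "\<lambda>F. I F - pX * (\<Sum>G | G \<subset> F. I G * pY ^ (card F - card G - 1))"
 have fin: "finite F" if "F \<subseteq> V" for F using finite_subset[OF that V] .
 have cd: "card (F - G) = card F - card G" if "G \<subseteq> F" "F \<subseteq> V" for F G
  using that fin[of G] by (intro card_Diff_subset) auto
 have swap: "(\<Sum>F\<in>Pow V. \<Sum>G\<in>Pow F. h F G) = (\<Sum>G\<in>Pow V. \<Sum>F | G \<subseteq> F \<and> F \<subseteq> V. h F G)" for h :: "'v set \<Rightarrow> 'v set \<Rightarrow> int poly"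
 proof -
  have "(\<Sum>F\<in>Pow V. \<Sum>G\<in>Pow F. h F G) = (\<Sum>F\<in>Pow V. \<Sum>G\<in>Pow V. if G \<subseteq> F then h F G else 0)"
   using V by (intro sum.cong refl sum.mono_neutral_cong_left) auto
  also have "\<dots> = (\<Sum>G\<in>Pow V. \<Sum>F\<in>Pow V. if G \<subseteq> F then h F G else 0)" by (rule sum.swap)
  also have "\<dots> = (\<Sum>G\<in>Pow V. \<Sum>F | G \<subseteq> F \<and> F \<subseteq> V. h F G)"
   using V by (intro sum.cong refl sum.mono_neutral_cong_right) auto
  finally show ?thesis .
 qed
 have "(\<Sum>F\<in>Pow V. (-1) ^ (card V - card F) * (\<Sum>G\<in>Pow F. I G * pY ^ (card F - card G))) =
  (\<Sum>G\<in>Pow V. \<Sum>F | G \<subseteq> F \<and> F \<subseteq> V. I G * ((-1) ^ card (V - F) * pY ^ card (F - G)))"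
  unfolding swap[symmetric] sum_distrib_left using cd by (intro sum.cong refl) (auto simp: mult_ac)
 also have "\<dots> = (\<Sum>G\<in>Pow V. I G * (- pX) ^ card (V - G))"
 proof (rule sum.cong[OF refl])
  fix G assume G: "G \<in> Pow V"
  then have GV: "G \<subseteq> V" by simp
  have "(\<Sum>F | G \<subseteq> F \<and> F \<subseteq> V. (-1) ^ card (V - F) * pY ^ card (F - G)) =
   (\<Sum>k\<le>card (V - G). of_nat (card (V - G) choose k) * ((-1) ^ k * pY ^ (card (V - G) - k)))"
   by (rule sum_supersets[OF V GV, of "\<lambda>a b. (-1) ^ a * pY ^ b"])
  also have "\<dots> = ((-1) + pY) ^ card (V - G)" unfolding binomial_ring mult.assoc ..
  also have "(-1) + pY = - pX" by (simp add: one_pCons)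
  finally show "(\<Sum>F | G \<subseteq> F \<and> F \<subseteq> V. I G * ((-1) ^ card (V - F) * pY ^ card (F - G))) = I G * (- pX) ^ card (V - G)"
   by (simp add: sum_distrib_left[symmetric])
 qed
 also have "\<dots> = (\<Sum>F\<in>Pow V. ?th F * derangement (card (V - F)))"
 proof -
  have "(\<Sum>F\<in>Pow V. ?th F * derangement (card (V - F))) =
   (\<Sum>F\<in>Pow V. I F * derangement (card (V - F))) -
   (\<Sum>F\<in>Pow V. \<Sum>G\<in>Pow F. if G = F then 0 else I G * (pX * (derangement (card (V - F)) * pY ^ (card (F - G) - 1))))"
  proof -
   have "pX * (\<Sum>G | G \<subset> F. I G * pY ^ (card F - card G - 1)) * derangement (card (V - F)) =
    (\<Sum>G\<in>Pow F. if G = F then 0 else I G * (pX * (derangement (card (V - F)) * pY ^ (card (F - G) - 1))))"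
    if F: "F \<in> Pow V" for F
    unfolding sum_distrib_left sum_distrib_right
   proof (rule sum.mono_neutral_cong_left)
    show "finite (Pow F)" using F fin[of F] by simp
    show "{G. G \<subset> F} \<subseteq> Pow F" by blast
    show "\<forall>G\<in>Pow F - {G. G \<subset> F}. (if G = F then 0 else I G * (pX * (derangement (card (V - F)) * pY ^ (card (F - G) - 1)))) = 0"
    proof
     fix G assume "G \<in> Pow F - {G. G \<subset> F}"
     then have "G = F" by blast
     then show "(if G = F then 0 else I G * (pX * (derangement (card (V - F)) * pY ^ (card (F - G) - 1)))) = 0" by (rule if_P)
    qed
   next
    fix G assume G: "G \<in> {G. G \<subset> F}"
    have ne: "\<not> G = F" using G by blast
    have cdG: "card (F - G) = card F - card G" by (rule cd) (use G F in auto)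
    show "pX * (I G * pY ^ (card F - card G - 1)) * derangement (card (V - F)) =
     (if G = F then 0 else I G * (pX * (derangement (card (V - F)) * pY ^ (card (F - G) - 1))))"
     unfolding if_not_P[OF ne] cdG by (simp only: ac_simps)
   qed
   then show ?thesis by (simp add: left_diff_distrib sum_subtractf)
  qed
  also have "\<dots> = (\<Sum>G\<in>Pow V. I G * derangement (card (V - G)) -
   (\<Sum>F | G \<subseteq> F \<and> F \<subseteq> V. if G = F then 0 else I G * (pX * (derangement (card (V - F)) * pY ^ (card (F - G) - 1)))))"
   unfolding swap by (simp add: sum_subtractf)
  also have "\<dots> = (\<Sum>G\<in>Pow V. I G * (- pX) ^ card (V - G))"
  proof (rule sum.cong[OF refl])
   fix G assume G: "G \<in> Pow V"
   let ?m = "card (V - G)"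
   have "(\<Sum>F | G \<subseteq> F \<and> F \<subseteq> V. if G = F then 0 else I G * (pX * (derangement (card (V - F)) * pY ^ (card (F - G) - 1)))) =
    (\<Sum>F | G \<subseteq> F \<and> F \<subseteq> V. if card (F - G) = 0 then 0 else I G * (pX * (derangement (card (V - F)) * pY ^ (card (F - G) - 1))))"
   proof (rule sum.cong[OF refl])
    fix F assume F: "F \<in> {F. G \<subseteq> F \<and> F \<subseteq> V}"
    then have "G = F \<longleftrightarrow> card (F - G) = 0" using fin[of F] by auto
    then show "(if G = F then 0 else I G * (pX * (derangement (card (V - F)) * pY ^ (card (F - G) - 1)))) =
     (if card (F - G) = 0 then 0 else I G * (pX * (derangement (card (V - F)) * pY ^ (card (F - G) - 1))))" by simp
   qed
   also have "\<dots> = (\<Sum>k\<le>?m. of_nat (?m choose k) * (if ?m - k = 0 then 0 else I G * (pX * (derangement k * pY ^ (?m - k - 1)))))"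
    using sum_supersets[OF V, of G "\<lambda>a b. if b = 0 then 0 else I G * (pX * (derangement a * pY ^ (b - 1)))"] G by simp
   also have "\<dots> = (\<Sum>k<?m. of_nat (?m choose k) * (I G * (pX * (derangement k * pY ^ (?m - k - 1)))))"
    by (simp add: lessThan_Suc_atMost[symmetric])
   also have "\<dots> = I G * (pX * (\<Sum>k<?m. of_nat (?m choose k) * derangement k * pY ^ (?m - k - 1)))"
    by (simp add: sum_distrib_left mult_ac)
   finally have s: "(\<Sum>F | G \<subseteq> F \<and> F \<subseteq> V. if G = F then 0 else I G * (pX * (derangement (card (V - F)) * pY ^ (card (F - G) - 1)))) =
    I G * (pX * (\<Sum>k<?m. of_nat (?m choose k) * derangement k * pY ^ (?m - k - 1)))" .
   show "I G * derangement ?m - (\<Sum>F | G \<subseteq> F \<and> F \<subseteq> V. if G = F then 0 else I G * (pX * (derangement (card (V - F)) * pY ^ (card (F - G) - 1)))) =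
    I G * (- pX) ^ ?m"
    unfolding s right_diff_distrib[symmetric] derangement_identity ..
  qed
  finally show ?thesis ..
 qed
 also have "gamma_nonneg (card V) \<dots>"
 proof (rule gamma_nonneg_sum)
  fix F assume F: "F \<in> Pow V"
  have "card F + card (V - F) = card V" using F V cd[of F V] card_mono[OF V, of F] by auto
  then show "gamma_nonneg (card V) (?th F * derangement (card (V - F)))"
   using gamma_nonneg_mult[OF theta derangement_gamma, of F "card (V - F)"] F by simp
 qed
 finally show ?thesis .
qed

section \<open>Relative singular homology on the chain level\<close>

abbreviation "bnd \<equiv> chain_boundary"
abbreviation "oball \<equiv> unit_ball_interior"
abbreviation "sphr \<equiv> unit_ball_boundary"

abbreviation schain :: "'a topology \<Rightarrow> nat \<Rightarrow> 'a set \<Rightarrow> 'a chain \<Rightarrow> bool" where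
 "schain X p A \<equiv> singular_chain p (subtopology X A)"

text \<open>Relative cycles as bare chains, so that diagram chases need no quotient groups. In
  degree 0 the truncated \<open>p - 1\<close> is harmless, the boundary of a 0-chain being
  0.\<close>

definition rcyc :: "'a topology \<Rightarrow> nat \<Rightarrow> 'a set \<Rightarrow> 'a set \<Rightarrow> 'a chain \<Rightarrow> bool" where
 "rcyc X p A B c \<longleftrightarrow> schain X p A c \<and> schain X (p - 1) B (bnd p c)"

definition rbdr :: "'a topology \<Rightarrow> nat \<Rightarrow> 'a set \<Rightarrow> 'a set \<Rightarrow> 'a chain \<Rightarrow> bool" where
 "rbdr X p A B c \<longleftrightarrow> (\<exists>d e. schain X (Suc p) A d \<and> schain X p B e \<and> c = bnd (Suc p) d + e)"

text \<open>The pair is acyclic in every degree, 0 included: \<open>A\<close> and \<open>B\<close>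
  are homologically indistinguishable.\<close>

definition hvan :: "'a topology \<Rightarrow> 'a set \<Rightarrow> 'a set \<Rightarrow> bool" where
 "hvan X A B \<longleftrightarrow> (\<forall>p c. rcyc X p A B c \<longrightarrow> rbdr X p A B c)"

lemma singular_relcycle_rcyc: "B \<subseteq> A \<Longrightarrow> singular_relcycle p (subtopology X A) B = rcyc X p A B"
 by (intro ext) (simp add: singular_relcycle rcyc_def subtopology_subtopology inf.absorb2)

lemma singular_relboundary_rbdr: "B \<subseteq> A \<Longrightarrow> singular_relboundary p (subtopology X A) B = rbdr X p A B"
 by (intro ext) (auto simp: singular_relboundary rbdr_def subtopology_subtopology inf.absorb2)

lemma schain_mono: "schain X p A c \<Longrightarrow> A \<subseteq> B \<Longrightarrow> schain X p B c"
 by (rule singular_chain_mono)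

lemma rcyc_mono: "rcyc X p A B c \<Longrightarrow> A \<subseteq> A' \<Longrightarrow> B \<subseteq> B' \<Longrightarrow> rcyc X p A' B' c"
 unfolding rcyc_def using schain_mono by blast

lemma rbdr_mono: "rbdr X p A B c \<Longrightarrow> A \<subseteq> A' \<Longrightarrow> B \<subseteq> B' \<Longrightarrow> rbdr X p A' B' c"
 unfolding rbdr_def using schain_mono by blast

lemma rbdr_add:
 assumes "rbdr X p A B c" "rbdr X p A B c'" shows "rbdr X p A B (c + c')"
proof -
 obtain d e d' e' where "schain X (Suc p) A d" "schain X p B e" "c = bnd (Suc p) d + e"
  "schain X (Suc p) A d'" "schain X p B e'" "c' = bnd (Suc p) d' + e'"
  using assms unfolding rbdr_def by auto
 then show ?thesis unfolding rbdr_def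
  by (intro exI[of _ "d + d'"] exI[of _ "e + e'"])
   (auto simp: chain_boundary_add intro: singular_chain_add)
qed

lemma rbdr_cmul:
 assumes "rbdr X p A B c" shows "rbdr X p A B (frag_cmul n c)"
proof -
 obtain d e where "schain X (Suc p) A d" "schain X p B e" "c = bnd (Suc p) d + e"
  using assms unfolding rbdr_def by auto
 then show ?thesis unfolding rbdr_def
  by (intro exI[of _ "frag_cmul n d"] exI[of _ "frag_cmul n e"])
   (auto simp: chain_boundary_cmul frag_cmul_distrib2 intro: singular_chain_cmul)
qed

lemma rbdr_minus: "rbdr X p A B c \<Longrightarrow> rbdr X p A B (- c)"
 using rbdr_cmul[where n="-1" and c=c] by simp

lemma rbdr_diff: "rbdr X p A B c \<Longrightarrow> rbdr X p A B c' \<Longrightarrow> rbdr X p A B (c - c')"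
 using rbdr_add[of X p A B c "- c'"] rbdr_minus[of X p A B c'] by simp

lemma rbdr_schain: "schain X p B c \<Longrightarrow> rbdr X p A B c"
 unfolding rbdr_def by (intro exI[of _ 0] exI[of _ c]) auto

lemma rbdr_boundary: "schain X (Suc p) A d \<Longrightarrow> rbdr X p A B (bnd (Suc p) d)"
 unfolding rbdr_def by (intro exI[of _ d] exI[of _ 0]) auto

lemma rbdr_sum: "(\<And>i. i \<in> I \<Longrightarrow> rbdr X p A B (f i)) \<Longrightarrow> rbdr X p A B (sum f I)"
proof (induction I rule: infinite_finite_induct)
 case (insert i I) then show ?case using rbdr_add by (metis insertCI sum.insert)
qed (auto intro: rbdr_schain)

lemma bdry_bdry: "schain X (Suc p) A d \<Longrightarrow> bnd p (bnd (Suc p) d) = 0"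
 by (rule chain_boundary_boundary_alt)

lemma hvanD: "hvan X A B \<Longrightarrow> rcyc X p A B c \<Longrightarrow> rbdr X p A B c"
 unfolding hvan_def by blast

text \<open>Together with \<open>hvan_left\<close> and \<open>hvan_right\<close> this is
  two-out-of-three for the pairs of a triple, its long exact sequence being chased on
  chains.\<close>

lemma hvan_trans:
 assumes "hvan X A B" "hvan X B C" "C \<subseteq> B" "B \<subseteq> A"
 shows "hvan X A C"
 unfolding hvan_def
proof (intro allI impI)
 fix p c assume c: "rcyc X p A C c"
 obtain d e where de: "schain X (Suc p) A d" "schain X p B e" "c = bnd (Suc p) d + e"
  using hvanD[OF assms(1) rcyc_mono[OF c subset_refl assms(3)]] unfolding rbdr_def by blast
 have "bnd p c = bnd p e" using de(3) bdry_bdry[OF de(1)] by (simp add: chain_boundary_add)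
 then have "rcyc X p B C e" using c de(2) by (simp add: rcyc_def)
 then have "rbdr X p A C e" using hvanD[OF assms(2)] rbdr_mono[OF _ assms(4) subset_refl] by blast
 then show "rbdr X p A C c" unfolding de(3) by (intro rbdr_add rbdr_boundary[OF de(1)])
qed

lemma hvan_left:
 assumes "hvan X A C" "hvan X B C" "C \<subseteq> B" "B \<subseteq> A"
 shows "hvan X A B"
 unfolding hvan_def
proof (intro allI impI)
 fix p c assume c: "rcyc X p A B c"
 show "rbdr X p A B c"
 proof (cases p)
  case 0
  then have "rcyc X p A C c" using c by (simp add: rcyc_def chain_boundary_def)
  then show ?thesis using hvanD[OF assms(1)] rbdr_mono[OF _ subset_refl assms(3)] by blast
 next
  case (Suc q)
  have "rcyc X q B C (bnd p c)"
   using c Suc bdry_bdry[where X=X and p=q and A=A and d=c] by (simp add: rcyc_def)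
  then obtain d e where de: "schain X p B d" "schain X q C e" "bnd p c = bnd p d + e"
   using hvanD[OF assms(2)] Suc unfolding rbdr_def by blast
  have "rcyc X p A C (c - d)"
   using c de schain_mono[OF de(1) assms(4)] Suc
   by (auto simp: rcyc_def chain_boundary_diff intro: singular_chain_diff)
  then have "rbdr X p A B (c - d)" using hvanD[OF assms(1)] rbdr_mono[OF _ subset_refl assms(3)] by blast
  from rbdr_add[OF this rbdr_schain[OF de(1)]] show ?thesis by simp
 qed
qed

lemma hvan_right:
 assumes "hvan X A B" "hvan X A C" "C \<subseteq> B" "B \<subseteq> A"
 shows "hvan X B C"
 unfolding hvan_def
proof (intro allI impI)
 fix p c assume c: "rcyc X p B C c"
 obtain d e where de: "schain X (Suc p) A d" "schain X p C e" "c = bnd (Suc p) d + e"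
  using hvanD[OF assms(2) rcyc_mono[OF c assms(4) subset_refl]] unfolding rbdr_def by blast
 have "schain X p B (c - e)" using c schain_mono[OF de(2) assms(3)] by (auto simp: rcyc_def intro: singular_chain_diff)
 then have "rcyc X (Suc p) A B d" using de by (simp add: rcyc_def)
 then obtain f g where fg: "schain X (Suc (Suc p)) A f" "schain X (Suc p) B g" "d = bnd (Suc (Suc p)) f + g"
  using hvanD[OF assms(1)] unfolding rbdr_def by blast
 have "bnd (Suc p) d = bnd (Suc p) g"
  using fg(3) bdry_bdry[OF fg(1)] by (simp add: chain_boundary_add)
 then show "rbdr X p B C c" unfolding rbdr_def using de fg by auto
qed

text \<open>\<open>h\<close> is a homotopy of maps of pairs from the identity to a map into
  \<open>B\<close>, so each relative cycle is homologous to a chain in \<open>B\<close>. Points of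
  \<open>B\<close> may move within \<open>B\<close>.\<close>

lemma hvan_homotopy:
 assumes BA: "B \<subseteq> A"
  and h: "continuous_map (prod_topology (top_of_set {0..1::real}) (subtopology X A)) (subtopology X A) h"
  and h0: "\<And>x. x \<in> A \<Longrightarrow> h (0, x) = x" and h1: "\<And>x. x \<in> A \<Longrightarrow> h (1, x) \<in> B"
  and hB: "\<And>t x. 0 \<le> t \<Longrightarrow> t \<le> 1 \<Longrightarrow> x \<in> B \<Longrightarrow> h (t, x) \<in> B"
 shows "hvan X A B"
 unfolding hvan_def
proof (intro allI impI)
 fix p c assume c: "rcyc X p A B c"
 let ?T = "subtopology X A"
 let ?g = "\<lambda>x. h (1, x)"
 have "homotopic_with (\<lambda>f. f \<in> B \<rightarrow> B) ?T ?T (\<lambda>x. h (0, x)) ?g"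
  unfolding homotopic_with_def using h hB by (intro exI[of _ h]) auto
 from homotopic_imp_homologous_rel_chain_maps[OF this] c
 have "homologous_rel p ?T B (chain_map p (\<lambda>x. h (0, x)) c) (chain_map p ?g c)"
  by (simp add: singular_relcycle_rcyc[OF BA])
 moreover have "chain_map p (\<lambda>x. h (0, x)) c = c"
  using c h0 by (intro chain_map_id_gen[of p ?T]) (auto simp: rcyc_def)
 ultimately have "rbdr X p A B (c - chain_map p ?g c)"
  by (simp add: homologous_rel_def singular_relboundary_rbdr[OF BA])
 moreover have "schain X p B (chain_map p ?g c)"
 proof (rule singular_chain_chain_map)
  show "schain X p A c" using c by (simp add: rcyc_def)
  have "continuous_map ?T (prod_topology (top_of_set {0..1::real}) ?T) (\<lambda>x. (1, x))"
   by (intro continuous_map_pairedI) (simp_all add: continuous_map_const)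
  from continuous_map_compose[OF this h] have "continuous_map ?T ?T ?g" by (simp add: o_def)
  then show "continuous_map ?T (subtopology X B) ?g"
   using h1 by (auto simp: continuous_map_in_subtopology)
 qed
 ultimately show "rbdr X p A B c" using rbdr_add rbdr_schain by (metis diff_add_cancel)
qed

text \<open>With \<open>U\<close> closed and \<open>T\<close> open relative to \<open>A\<close>, the
  closure and interior condition of excision is just \<open>U \<subseteq> T\<close>.\<close>

lemma excision_surj:
 assumes U: "closedin (subtopology X A) U" and T: "openin (subtopology X A) T" and "U \<subseteq> T" "A \<subseteq> topspace X"
  and c: "rcyc X p A T c"
 obtains c' where "rcyc X p (A - U) (T - U) c'" "rbdr X p A T (c - c')"
proof -
 let ?Y = "subtopology X A"
 have TA: "T \<subseteq> A" using openin_subset[OF T] by auto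
 have cl: "?Y closure_of U \<subseteq> ?Y interior_of T"
  using U T assms(3) by (simp add: closure_of_closedin interior_of_openin)
 have s: "subtopology ?Y A = ?Y" "subtopology ?Y (A - U) = subtopology X (A - U)"
  by (simp_all add: subtopology_subtopology Int_absorb1 inf.absorb2 Diff_subset)
 from excised_relcycle_exists[OF cl TA, of p c] c TA
 obtain c' where "singular_relcycle p (subtopology ?Y (A - U)) (T - U) c'" "homologous_rel p (subtopology ?Y A) T c c'"
  by (auto simp: s singular_relcycle_rcyc)
 moreover have "T - U \<subseteq> A - U" using TA by auto
 ultimately show ?thesis using that[of c'] TA
  by (simp add: s singular_relcycle_rcyc homologous_rel_def singular_relboundary_rbdr)
qed

text \<open>Injectivity comes from the excision isomorphism of relative homology groups, translated
  back to chains through homology classes.\<close>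

lemma excision_inj:
 assumes U: "closedin (subtopology X A) U" and T: "openin (subtopology X A) T" and "U \<subseteq> T" "A \<subseteq> topspace X"
  and c: "rcyc X p (A - U) (T - U) c" "rbdr X p A T c"
 shows "rbdr X p (A - U) (T - U) c"
proof -
 let ?Y = "subtopology X A"
 have TA: "T \<subseteq> A" using openin_subset[OF T] by auto
 have TU: "T - U \<subseteq> A - U" using TA by auto
 have cl: "?Y closure_of U \<subseteq> ?Y interior_of T"
  using U T assms(3) by (simp add: closure_of_closedin interior_of_openin)
 have s: "subtopology ?Y A = ?Y" "subtopology ?Y (A - U) = subtopology X (A - U)"
  by (simp_all add: subtopology_subtopology Int_absorb1 inf.absorb2 Diff_subset)
 let ?X1 = "subtopology X (A - U)"
 let ?f = "hom_induced (int p) ?X1 (T - U) ?Y T id"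
 have iso: "?f \<in> iso (relative_homology_group (int p) ?X1 (T - U)) (relative_homology_group (int p) ?Y T)"
  using homology_excision_axiom[OF cl TA, of "int p"] by (simp add: s)
 have rel: "singular_relcycle p ?X1 (T - U) c" using c(1) by (simp add: singular_relcycle_rcyc[OF TU])
 have cont: "continuous_map ?X1 ?Y id"
  using continuous_map_from_subtopology_mono[of X A X id "A - U"]
  by (auto simp: continuous_map_in_subtopology continuous_map_from_subtopology)
 have "?f (homologous_rel_set p ?X1 (T - U) c) = homologous_rel_set p ?Y T (chain_map p id c)"
  by (rule hom_induced_chain_map[OF cont _ rel]) auto
 also have "chain_map p id c = c" using c(1) by (intro chain_map_id_gen[of p ?X1]) (auto simp: rcyc_def)
 also have "homologous_rel_set p ?Y T c = singular_relboundary_set p ?Y T"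
  using c(2) homologous_rel_set_eq_relboundary[of p ?Y T c] unfolding singular_relboundary_rbdr[OF TA] by blast
 finally have 1: "?f (homologous_rel_set p ?X1 (T - U) c) = \<one>\<^bsub>relative_homology_group (int p) ?Y T\<^esub>"
  by (simp only: one_relative_homology_group)
 have car: "homologous_rel_set p ?X1 (T - U) c \<in> carrier (relative_homology_group (int p) ?X1 (T - U))"
  using rel by (auto simp: carrier_relative_homology_group)
 interpret group_hom "relative_homology_group (int p) ?X1 (T - U)" "relative_homology_group (int p) ?Y T" ?f
  using iso by (simp add: group_hom_def group_hom_axioms_def iso_def)
 have inj: "inj_on ?f (carrier (relative_homology_group (int p) ?X1 (T - U)))" using iso by (simp add: iso_def bij_betw_def)
 have "homologous_rel_set p ?X1 (T - U) c = \<one>\<^bsub>relative_homology_group (int p) ?X1 (T - U)\<^esub>"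
  by (rule inj_onD[OF inj _ car]) (simp_all only: 1 hom_one group.is_monoid[OF group_relative_homology_group, THEN monoid.one_closed])
 then show ?thesis using homologous_rel_set_eq_relboundary[of p ?X1 "T - U" c]
  unfolding one_relative_homology_group singular_relboundary_rbdr[OF TU] by blast
qed

lemma hvan_excision:
 assumes U: "closedin (subtopology X A) U" and T: "openin (subtopology X A) T" and "U \<subseteq> T" "A \<subseteq> topspace X"
  and van: "hvan X (A - U) (T - U)"
 shows "hvan X A T"
 unfolding hvan_def
proof (intro allI impI)
 fix p c assume "rcyc X p A T c"
 then obtain c' where c': "rcyc X p (A - U) (T - U) c'" "rbdr X p A T (c - c')"
  using excision_surj[OF assms(1-4)] by blast
 have "rbdr X p A T c'" using rbdr_mono[OF hvanD[OF van c'(1)]] by blast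
 from rbdr_add[OF c'(2) this] show "rbdr X p A T c" by simp
qed

text \<open>Chain-level form of: the class of \<open>z\<close> is a basis of the infinite cyclic
  relative group in degree \<open>p\<close>.\<close>

definition hgen :: "'a topology \<Rightarrow> nat \<Rightarrow> 'a set \<Rightarrow> 'a set \<Rightarrow> 'a chain \<Rightarrow> bool" where
 "hgen X p A B z \<longleftrightarrow> rcyc X p A B z \<and> (\<forall>c. rcyc X p A B c \<longrightarrow> (\<exists>n. rbdr X p A B (c - frag_cmul n z))) \<and>
  (\<forall>n. rbdr X p A B (frag_cmul n z) \<longrightarrow> n = 0)"

lemma class_hom: "homologous_rel_set p Y S \<in> hom (relcycle_group p Y S) (relative_homology_group (int p) Y S)"
 using normal.r_coset_hom_Mod[OF normal_subgroup_singular_relboundary_relcycle[of p Y S]]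
 by (simp add: right_coset_singular_relboundary nontrivial_relative_homology_group)

lemma hgen_exists:
 assumes BA: "B \<subseteq> A" and iso: "relative_homology_group (int p) (subtopology X A) B \<cong> integer_group"
 shows "\<exists>z. hgen X p A B z"
proof -
 let ?Y = "subtopology X A"
 let ?G = "relative_homology_group (int p) ?Y B"
 obtain f where f: "f \<in> iso ?G integer_group" using iso by (auto simp: is_iso_def)
 define ph where "ph = (\<lambda>c. f (homologous_rel_set p ?Y B c))"
 have car: "homologous_rel_set p ?Y B c \<in> carrier ?G" if "rcyc X p A B c" for c
  using that by (auto simp: carrier_relative_homology_group singular_relcycle_rcyc[OF BA])
 have add: "ph (c + d) = ph c + ph d" if "rcyc X p A B c" "rcyc X p A B d" for c d
 proof -
  have "homologous_rel_set p ?Y B (c + d) = homologous_rel_set p ?Y B c \<otimes>\<^bsub>?G\<^esub> homologous_rel_set p ?Y B d"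
   using hom_mult[OF class_hom[of p ?Y B], of c d] that by (simp add: singular_relcycle_rcyc[OF BA])
  then show ?thesis using hom_mult[of f ?G integer_group] f car[OF that(1)] car[OF that(2)]
   by (simp add: ph_def iso_def)
 qed
 have rc: "rcyc X p A B (frag_cmul n c)" if "rcyc X p A B c" for n c
  using that singular_relcycle_cmul by (metis singular_relcycle_rcyc[OF BA])
 have cm: "ph (frag_cmul n c) = n * ph c" if c: "rcyc X p A B c" for n c
 proof -
  have z: "ph 0 = 0" using add[of 0 0] by (simp add: rcyc_def)
  have nat: "ph (frag_cmul (int k) c) = int k * ph c" for k
  proof (induction k)
   case (Suc k)
   have "frag_cmul (int (Suc k)) c = c + frag_cmul (int k) c" by (simp add: frag_cmul_distrib)
   then show ?case using Suc add[OF c rc[OF c]] by (simp add: algebra_simps)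
  qed (simp add: z)
  show ?thesis
  proof (cases n)
   case (nonneg k) then show ?thesis using nat by simp
  next
   case (neg k)
   have "ph (frag_cmul n c) + ph (frag_cmul (int (Suc k)) c) = ph (frag_cmul n c + frag_cmul (int (Suc k)) c)"
    using add[OF rc[OF c] rc[OF c]] by simp
   also have "frag_cmul n c + frag_cmul (int (Suc k)) c = 0"
    using frag_cmul_distrib[of n "int (Suc k)" c] neg by simp
   finally have "ph (frag_cmul n c) + int (Suc k) * ph c = 0" unfolding z nat .
   then show ?thesis unfolding neg by (simp only: eq_neg_iff_add_eq_0 mult_minus_left)
  qed
 qed
 have inj: "inj_on f (carrier ?G)" and "f ` carrier ?G = UNIV" using f by (auto simp: iso_iff)
 then have "(1::int) \<in> f ` carrier ?G" by simp
 then obtain Z where Z: "f Z = 1" "Z \<in> carrier ?G" by (rule imageE) simp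
 then obtain z where z: "rcyc X p A B z" "ph z = 1"
  by (auto simp: carrier_relative_homology_group singular_relcycle_rcyc[OF BA] ph_def)
 interpret group_hom ?G integer_group f using f by (simp add: group_hom_def group_hom_axioms_def iso_def)
 have ker: "rbdr X p A B c \<longleftrightarrow> ph c = 0" if c: "rcyc X p A B c" for c
 proof -
  have "ph c = 0 \<longleftrightarrow> homologous_rel_set p ?Y B c = \<one>\<^bsub>?G\<^esub>"
   using inj_on_eq_iff[OF inj car[OF c] group.is_monoid[OF group_relative_homology_group, THEN monoid.one_closed]] hom_one unfolding ph_def by simp
  then show ?thesis using homologous_rel_set_eq_relboundary[of p ?Y B c]
   unfolding one_relative_homology_group singular_relboundary_rbdr[OF BA] by blast
 qed
 have dif: "rcyc X p A B (c - d)" if "rcyc X p A B c" "rcyc X p A B d" for c d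
  using that singular_relcycle_diff by (metis singular_relcycle_rcyc[OF BA])
 show ?thesis unfolding hgen_def
 proof (intro exI[of _ z] conjI allI impI)
  fix c assume c: "rcyc X p A B c"
  have "ph (c - frag_cmul (ph c) z) = 0"
   using add[OF dif[OF c rc[OF z(1)]] rc[OF z(1)], of "ph c" "ph c"] cm[OF z(1), of "ph c"] z(2) by simp
  then show "\<exists>n. rbdr X p A B (c - frag_cmul n z)" using ker[OF dif[OF c rc[OF z(1)]]] by blast
 next
  fix n assume "rbdr X p A B (frag_cmul n z)"
  then show "n = 0" using ker[OF rc[OF z(1)]] cm[OF z(1)] z(2) by simp
 qed (rule z(1))
qed

lemma trivial_homology_rbdr:
 assumes BA: "B \<subseteq> A" and "trivial_group (relative_homology_group (int p) (subtopology X A) B)"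
  and c: "rcyc X p A B c"
 shows "rbdr X p A B c"
proof -
 let ?Y = "subtopology X A"
 have "homologous_rel_set p ?Y B c \<in> carrier (relative_homology_group (int p) ?Y B)"
  using c by (auto simp: carrier_relative_homology_group singular_relcycle_rcyc[OF BA])
 then have "homologous_rel_set p ?Y B c = singular_relboundary_set p ?Y B"
  using assms(2) by (simp add: trivial_group_def)
 then show ?thesis using homologous_rel_set_eq_relboundary[of p ?Y B c]
  unfolding singular_relboundary_rbdr[OF BA] by blast
qed

section \<open>Closed cells\<close>

definition nsq :: "nat \<Rightarrow> (nat \<Rightarrow> real) \<Rightarrow> real" where
 "nsq n x = (\<Sum>i<n. x i ^ 2)"

definition bset :: "nat \<Rightarrow> (nat \<Rightarrow> real) set" where
 "bset n = {x. (\<forall>i\<ge>n. x i = 0) \<and> nsq n x \<le> 1}"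

lemma Euclidean_top_of_set: "Euclidean_space n = top_of_set {x. \<forall>i\<ge>n. x i = 0}"
 by (simp add: Euclidean_space_def euclidean_product_topology)

lemma unit_ball_top_of_set: "unit_ball n = top_of_set (bset n)"
 unfolding unit_ball_def Euclidean_top_of_set subtopology_subtopology
 by (rule arg_cong[of _ _ "subtopology _"]) (auto simp: bset_def nsq_def)

lemma topspace_unit_ball [simp]: "topspace (unit_ball n) = bset n"
 by (simp add: unit_ball_top_of_set)

lemma unit_ball_interior_eq: "oball n = {x \<in> bset n. nsq n x < 1}"
 by (auto simp: unit_ball_interior_def bset_def nsq_def topspace_Euclidean_space)

lemma unit_ball_boundary_eq: "sphr n = {x \<in> bset n. nsq n x = 1}"
 by (auto simp: unit_ball_boundary_def bset_def nsq_def topspace_Euclidean_space)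

lemma nsq_nonneg: "0 \<le> nsq n x"
 by (simp add: nsq_def sum_nonneg)

lemma nsq_scale: "nsq n (\<lambda>i. c * x i) = c ^ 2 * nsq n x"
 by (simp add: nsq_def power_mult_distrib sum_distrib_left)

lemma nsq_eq_0: "x \<in> bset n \<Longrightarrow> nsq n x = 0 \<longleftrightarrow> x = (\<lambda>i. 0)"
proof
 assume x: "x \<in> bset n" and 0: "nsq n x = 0"
 have "x i = 0" for i
 proof (cases "i < n")
  case True
  then show ?thesis using 0 by (simp add: nsq_def sum_nonneg_eq_0_iff)
 qed (use x in \<open>simp add: bset_def\<close>)
 then show "x = (\<lambda>i. 0)" by blast
qed (simp add: nsq_def)

lemma continuous_coord: "continuous_on S f \<Longrightarrow> continuous_on S (\<lambda>x. f x (i::nat) :: real)"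
 using continuous_on_compose2[OF continuous_on_product_coordinates[of i], of S f] by simp

lemma continuous_nsq: "continuous_on S f \<Longrightarrow> continuous_on S (\<lambda>x. nsq n (f x))"
 unfolding nsq_def by (intro continuous_on_sum continuous_on_power continuous_coord)

lemma continuous_on_pair_fun:
 fixes f :: "'a::topological_space \<Rightarrow> nat \<Rightarrow> real"
 shows "(\<And>i. continuous_on S (\<lambda>x. f x i)) \<Longrightarrow> continuous_on S f"
 by (rule continuous_on_coordinatewise_then_product)

lemma compact_unit_ball: "compact_space (unit_ball n)"
proof -
 have "compact (PiE UNIV (\<lambda>i. if i < n then {-1..1} else {0::real}))"
 proof -
  have "compactin (product_topology (\<lambda>i. euclideanreal) UNIV) (PiE UNIV (\<lambda>i. if i < n then {-1..1} else {0::real}))"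
   by (subst compactin_PiE) auto
  then show ?thesis by (simp add: euclidean_product_topology)
 qed
 moreover have "bset n \<subseteq> PiE UNIV (\<lambda>i. if i < n then {-1..1} else {0::real})"
 proof
  fix x assume x: "x \<in> bset n"
  have "x i \<in> {-1..1}" if "i < n" for i
  proof -
   have "(x i)\<^sup>2 \<le> nsq n x" unfolding nsq_def by (rule member_le_sum) (use that in auto)
   then have "(x i)\<^sup>2 \<le> 1" using x by (simp add: bset_def)
   then show ?thesis by (simp add: abs_square_le_1 abs_le_iff)
  qed
  then show "x \<in> PiE UNIV (\<lambda>i. if i < n then {-1..1} else {0::real})"
   using x by (auto simp: bset_def)
 qed
 moreover have "closed (bset n)"
 proof -
  have "bset n = (\<Inter>i\<in>{n..}. {x. x i = 0}) \<inter> {x. nsq n x \<le> 1}" by (auto simp: bset_def)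
  moreover have "closed {x::nat \<Rightarrow> real. x i = 0}" for i
   by (intro closed_Collect_eq continuous_coord continuous_intros)
  moreover have "closed {x. nsq n x \<le> 1}"
   by (intro closed_Collect_le continuous_nsq continuous_intros)
  ultimately show ?thesis by (simp add: closed_INT closed_Int)
 qed
 ultimately have "compact (bset n)" by (metis compact_Int_closed inf.absorb2)
 then show ?thesis by (simp add: unit_ball_top_of_set compact_space_subtopology)
qed

text \<open>One closed cell with a chosen characteristic map, outside of any complex; a whole ball
  can therefore be treated as a single cell.\<close>

locale cell =
 fixes X :: "'a topology" and n :: nat and e :: "'a set" and \<Phi> :: "(nat \<Rightarrow> real) \<Rightarrow> 'a"
 assumes haus: "Hausdorff_space X" and char: "characteristic_map X n e \<Phi>"
begin

definition cl :: "'a set" where "cl = \<Phi> ` bset n"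
definition fr :: "'a set" where "fr = \<Phi> ` sphr n"
definition inv\<Phi> :: "'a \<Rightarrow> nat \<Rightarrow> real" where "inv\<Phi> = inv_into (bset n) \<Phi>"

lemma emb: "embedding_map (unit_ball n) X \<Phi>"
 using char by (simp add: characteristic_map_def)

lemma e_eq: "e = \<Phi> ` oball n"
 using char by (simp add: characteristic_map_def)

lemma homeo: "homeomorphic_map (unit_ball n) (subtopology X cl) \<Phi>"
 using emb by (simp add: embedding_map_def cl_def)

lemma inj: "inj_on \<Phi> (bset n)"
 using homeo homeomorphic_imp_injective_map by fastforce

lemma cl_topspace: "cl \<subseteq> topspace X"
proof -
 have "\<Phi> ` bset n = topspace X \<inter> cl" using homeomorphic_imp_surjective_map[OF homeo] by simp
 then show ?thesis unfolding cl_def by blast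
qed

lemma cont\<Phi>: "continuous_map (unit_ball n) X \<Phi>"
 using homeomorphic_imp_continuous_map[OF homeo] by (simp add: continuous_map_in_subtopology)

lemma inv\<Phi>_in: "x \<in> cl \<Longrightarrow> inv\<Phi> x \<in> bset n" and \<Phi>_inv: "x \<in> cl \<Longrightarrow> \<Phi> (inv\<Phi> x) = x"
 and inv_\<Phi>: "y \<in> bset n \<Longrightarrow> inv\<Phi> (\<Phi> y) = y"
 unfolding cl_def inv\<Phi>_def by (auto simp: inv_into_into f_inv_into_f inv_into_f_f inj)

lemma continv: "continuous_map (subtopology X cl) (unit_ball n) inv\<Phi>"
proof -
 obtain g where g: "homeomorphic_maps (unit_ball n) (subtopology X cl) \<Phi> g"
  using homeo homeomorphic_map_maps by blast
 have "continuous_map (subtopology X cl) (unit_ball n) g" using g by (simp add: homeomorphic_maps_def)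
 moreover have "inv\<Phi> x = g x" if "x \<in> topspace (subtopology X cl)" for x
 proof -
  have x: "x \<in> cl" using that by simp
  have "g (\<Phi> (inv\<Phi> x)) = inv\<Phi> x" using g inv\<Phi>_in[OF x] by (auto simp: homeomorphic_maps_def)
  then show ?thesis using \<Phi>_inv[OF x] by simp
 qed
 ultimately show ?thesis using continuous_map_eq by metis
qed

lemma cl_eq: "cl = e \<union> fr"
proof -
 have "bset n = oball n \<union> sphr n"
  by (auto simp: unit_ball_interior_eq unit_ball_boundary_eq) (auto simp: bset_def)
 then show ?thesis unfolding cl_def fr_def e_eq by (simp add: image_Un)
qed

lemma e_fr: "e \<inter> fr = {}"
proof -
 have "\<Phi> ` (oball n \<inter> sphr n) = e \<inter> fr"
  unfolding e_eq fr_def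
  by (rule inj_on_image_Int[OF inj]) (auto simp: unit_ball_interior_eq unit_ball_boundary_eq)
 moreover have "oball n \<inter> sphr n = {}"
  by (auto simp: unit_ball_interior_eq unit_ball_boundary_eq)
 ultimately show ?thesis by simp
qed

lemma zero_bset: "(\<lambda>i. 0) \<in> bset n"
 by (simp add: bset_def nsq_def)

lemma e_nonempty: "e \<noteq> {}"
proof -
 have "(\<lambda>i. 0) \<in> oball n" using zero_bset by (simp add: unit_ball_interior_eq nsq_def)
 then show ?thesis unfolding e_eq by blast
qed

lemma compact_image: "closedin (unit_ball n) K \<Longrightarrow> closedin X (\<Phi> ` K)"
 using compactin_imp_closedin[OF haus image_compactin[OF closedin_compact_space[OF compact_unit_ball] cont\<Phi>]] .

lemma closed_cl: "closedin X cl"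
 unfolding cl_def using compact_image[OF closedin_topspace[of "unit_ball n"]] by simp

lemma closed_fr: "closedin X fr"
 unfolding fr_def
proof (rule compact_image)
 have "closedin (unit_ball n) {x \<in> topspace (unit_ball n). nsq n x \<in> {1}}"
  unfolding unit_ball_top_of_set
  by (rule closedin_continuous_map_preimage[of _ euclideanreal])
   (auto intro: continuous_nsq continuous_intros)
 then show "closedin (unit_ball n) (sphr n)" by (simp add: unit_ball_boundary_eq)
qed

text \<open>A point of the closed ball is the limit of its shrunk copies, which lie in the open
  ball.\<close>

lemma closure_e: "X closure_of e = cl"
proof
 have "e \<subseteq> cl" using cl_eq by blast
 then show "X closure_of e \<subseteq> cl" using closed_cl by (simp add: closure_of_minimal)
 show "cl \<subseteq> X closure_of e"
 proof -
  have "bset n \<subseteq> closure (oball n)"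
  proof
   fix x assume x: "x \<in> bset n"
   let ?f = "\<lambda>t::real. \<lambda>i. (1 - t) * x i"
   have cont: "continuous_on {0..1} ?f" by (intro continuous_on_pair_fun continuous_intros)
   have im: "?f ` {0<..<1} \<subseteq> oball n"
   proof safe
    fix t :: real assume t: "t \<in> {0<..<1}"
    have "nsq n (?f t) = (1 - t)\<^sup>2 * nsq n x" by (rule nsq_scale)
    also have "\<dots> \<le> (1 - t)\<^sup>2 * 1" using x by (intro mult_left_mono) (auto simp: bset_def)
    also have "\<dots> < 1" using t by (simp add: power_less_one_iff abs_square_less_1)
    finally show "?f t \<in> oball n" using x by (auto simp: unit_ball_interior_eq bset_def)
   qed
   have cl: "?f ` closure {0<..<1} \<subseteq> closure (?f ` {0<..<1})"
    by (rule image_closure_subset) (use cont in \<open>auto intro: closure_subset[THEN subsetD]\<close>)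
   have "(0::real) \<in> closure {0<..<1}" by simp
   then have "?f 0 \<in> ?f ` closure {0<..<1}" by (rule imageI)
   then have "?f 0 \<in> closure (?f ` {0<..<1})" by (rule subsetD[OF cl])
   moreover have "?f 0 = x" by simp
   ultimately have "x \<in> closure (?f ` {0<..<1})" by (simp only:)
   then show "x \<in> closure (oball n)" using closure_mono[OF im] by blast
  qed
  then have "bset n \<subseteq> unit_ball n closure_of oball n"
   unfolding unit_ball_top_of_set closure_of_subtopology
   by (auto simp: unit_ball_interior_eq Int_absorb1 inf.absorb2 subset_iff)
  then have "cl \<subseteq> \<Phi> ` (unit_ball n closure_of oball n)" unfolding cl_def by blast
  also have "\<dots> \<subseteq> X closure_of e"
   unfolding e_eq using continuous_map_image_closure_subset[OF cont\<Phi>] by blast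
  finally show ?thesis .
 qed
qed

text \<open>Lets deformations of subsets of a closed cell be written in ball coordinates.\<close>

lemma hvan_cell_homotopy:
 assumes "B \<subseteq> A" "A \<subseteq> cl"
  and cont: "continuous_on ({0..1::real} \<times> inv\<Phi> ` A) h"
  and h: "\<And>t y. 0 \<le> t \<Longrightarrow> t \<le> 1 \<Longrightarrow> y \<in> inv\<Phi> ` A \<Longrightarrow> h (t, y) \<in> inv\<Phi> ` A"
  and hB: "\<And>t y. 0 \<le> t \<Longrightarrow> t \<le> 1 \<Longrightarrow> y \<in> inv\<Phi> ` B \<Longrightarrow> h (t, y) \<in> inv\<Phi> ` B"
  and h0: "\<And>y. y \<in> inv\<Phi> ` A \<Longrightarrow> h (0, y) = y" and h1: "\<And>y. y \<in> inv\<Phi> ` A \<Longrightarrow> h (1, y) \<in> inv\<Phi> ` B"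
 shows "hvan X A B"
proof (rule hvan_homotopy[OF assms(1), where h="\<lambda>(t, x). \<Phi> (h (t, inv\<Phi> x))"])
 let ?I = "top_of_set {0..1::real}"
 let ?S = "inv\<Phi> ` A"
 have Sb: "?S \<subseteq> bset n" using inv\<Phi>_in assms(2) by blast
 have im: "\<Phi> ` (inv\<Phi> ` C) = C" if "C \<subseteq> A" for C
  using \<Phi>_inv that assms(2) by (force simp: image_image)
 have c1: "continuous_map (subtopology X A) (top_of_set ?S) inv\<Phi>"
 proof -
  have "continuous_map (subtopology X A) (unit_ball n) inv\<Phi>"
   by (rule continuous_map_from_subtopology_mono[OF continv assms(2)])
  then have "continuous_map (subtopology X A) (subtopology (unit_ball n) ?S) inv\<Phi>"
   by (auto simp: continuous_map_in_subtopology)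
  then show ?thesis using Sb by (simp add: unit_ball_top_of_set subtopology_subtopology inf.absorb2)
 qed
 have "continuous_map (prod_topology ?I (subtopology X A)) (prod_topology ?I (top_of_set ?S)) (\<lambda>(t, x). (t, inv\<Phi> x))"
  unfolding split_beta
  by (intro continuous_map_pairedI continuous_map_fst continuous_map_compose[OF continuous_map_snd c1, unfolded o_def])
 moreover have "continuous_map (prod_topology ?I (top_of_set ?S)) (top_of_set ?S) h"
  using cont h by auto
 moreover have "continuous_map (top_of_set ?S) (subtopology X A) \<Phi>"
 proof -
  have "continuous_map (subtopology (unit_ball n) ?S) X \<Phi>" by (rule continuous_map_from_subtopology[OF cont\<Phi>])
  then show ?thesis using Sb im[OF subset_refl]
   by (auto simp: unit_ball_top_of_set subtopology_subtopology inf.absorb2 continuous_map_in_subtopology)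
 qed
 ultimately have "continuous_map (prod_topology ?I (subtopology X A)) (subtopology X A) (\<Phi> \<circ> (h \<circ> (\<lambda>(t, x). (t, inv\<Phi> x))))"
  by (meson continuous_map_compose)
 moreover have "\<Phi> \<circ> (h \<circ> (\<lambda>(t, x). (t, inv\<Phi> x))) = (\<lambda>(t, x). \<Phi> (h (t, inv\<Phi> x)))" by auto
 ultimately show "continuous_map (prod_topology ?I (subtopology X A)) (subtopology X A) (\<lambda>(t, x). \<Phi> (h (t, inv\<Phi> x)))"
  by simp
 fix x
 show "x \<in> A \<Longrightarrow> (case (0, x) of (t, x) \<Rightarrow> \<Phi> (h (t, inv\<Phi> x))) = x"
  using h0[of "inv\<Phi> x"] \<Phi>_inv assms(2) by auto
 show "x \<in> A \<Longrightarrow> (case (1, x) of (t, x) \<Rightarrow> \<Phi> (h (t, inv\<Phi> x))) \<in> B"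
  using h1[of "inv\<Phi> x"] im[OF assms(1)] by auto
 fix t :: real
 show "0 \<le> t \<Longrightarrow> t \<le> 1 \<Longrightarrow> x \<in> B \<Longrightarrow> (case (t, x) of (t, x) \<Rightarrow> \<Phi> (h (t, inv\<Phi> x))) \<in> B"
  using hB[of t "inv\<Phi> x"] im[OF assms(1)] by auto
qed

text \<open>Shrinking to the centre decreases the norm at once, so it never runs into a deleted
  boundary point; at time 1 everything sits at the centre, which is not that point.\<close>

lemma hvan_cl_minus:
 assumes "x \<in> fr" shows "hvan X cl (cl - {x})"
proof (rule hvan_cell_homotopy[where h="\<lambda>(t, y) i. (1 - t) * y i"])
 obtain w where w: "w \<in> sphr n" "x = \<Phi> w" using assms by (auto simp: fr_def)
 have wb: "w \<in> bset n" "nsq n w = 1" using w by (auto simp: unit_ball_boundary_eq)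
 have i1: "inv\<Phi> ` cl = bset n" unfolding cl_def by (force simp: inv_\<Phi> image_image)
 have i2: "inv\<Phi> ` (cl - {x}) = bset n - {w}"
 proof -
  have "cl - {x} = \<Phi> ` (bset n - {w})"
   unfolding cl_def w(2) using inj_on_image_set_diff[OF inj, of "bset n" "{w}"] wb by auto
  then show ?thesis by (force simp: inv_\<Phi> image_image)
 qed
 have sc: "(\<lambda>i. (1 - t) * y i) \<in> bset n" "0 < t \<Longrightarrow> nsq n (\<lambda>i. (1 - t) * y i) < 1"
  if "y \<in> bset n" "0 \<le> t" "t \<le> 1" for t y
 proof -
  have "nsq n (\<lambda>i. (1 - t) * y i) = (1 - t)\<^sup>2 * nsq n y" by (rule nsq_scale)
  moreover have "(1 - t)\<^sup>2 * nsq n y \<le> (1 - t)\<^sup>2 * 1" using that by (intro mult_left_mono) (auto simp: bset_def)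
  moreover have "(1 - t)\<^sup>2 \<le> 1" using that by (simp add: power_le_one)
  moreover have "0 < t \<Longrightarrow> (1 - t)\<^sup>2 < 1" using that by (simp add: power_less_one_iff abs_square_less_1)
  ultimately show "(\<lambda>i. (1 - t) * y i) \<in> bset n" "0 < t \<Longrightarrow> nsq n (\<lambda>i. (1 - t) * y i) < 1"
   using that by (auto simp: bset_def)
 qed
 show "continuous_on ({0..1} \<times> inv\<Phi> ` cl) (\<lambda>(t, y) i. (1 - t) * y i)"
  unfolding split_beta
  by (rule continuous_on_pair_fun)
   (intro continuous_on_mult continuous_on_diff continuous_on_const continuous_on_fst continuous_on_snd
    continuous_coord continuous_on_id)
 fix y
 show "(case (t, y) of (t, y) \<Rightarrow> \<lambda>i. (1 - t) * y i) \<in> inv\<Phi> ` cl" if "0 \<le> t" "t \<le> 1" "y \<in> inv\<Phi> ` cl" for t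
  using sc(1)[of y t] that unfolding i1 by simp
 show "(case (t, y) of (t, y) \<Rightarrow> \<lambda>i. (1 - t) * y i) \<in> inv\<Phi> ` (cl - {x})"
  if "0 \<le> t" "t \<le> 1" "y \<in> inv\<Phi> ` (cl - {x})" for t
  using sc[of y t] that wb(2) unfolding i2 by (cases "t = 0") auto
 show "(case (0, y) of (t, y) \<Rightarrow> \<lambda>i. (1 - t) * y i) = y" by simp
 show "(case (1, y) of (t, y) \<Rightarrow> \<lambda>i. (1 - t) * y i) \<in> inv\<Phi> ` (cl - {x})" if "y \<in> inv\<Phi> ` cl"
  using sc[of y 1] that wb(2) unfolding i1 i2 by auto
qed auto


end

lemma diff_telescope: "(a - b) + (b - c) = a - (c::'a::ab_group_add)"
 by simp

text \<open>If \<open>B\<close> and \<open>C\<close> agree homologically, cycles modulo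
  \<open>B\<close> may be replaced by cycles modulo \<open>C\<close>; \<open>rbdr_lift\<close> does
  the same for boundaries.\<close>

lemma rcyc_lift:
 assumes "hvan X B C" "C \<subseteq> B" "B \<subseteq> A" "rcyc X p A B c"
 obtains c' where "rcyc X p A C c'" "rbdr X p A B (c - c')"
proof (cases p)
 case 0
 then have "rcyc X p A C c" using assms(4) by (simp add: rcyc_def chain_boundary_def)
 moreover have "rbdr X p A B (c - c)" using rbdr_schain[of _ X B 0 A] by simp
 ultimately show ?thesis using that by blast
next
 case (Suc q)
 have "rcyc X q B C (bnd p c)"
  using assms(4) Suc bdry_bdry[where X=X and p=q and A=A and d=c] by (simp add: rcyc_def)
 then obtain d e where de: "schain X p B d" "schain X q C e" "bnd p c = bnd p d + e"
  using hvanD[OF assms(1)] Suc unfolding rbdr_def by blast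
 have "rcyc X p A C (c - d)"
  using assms(4) de schain_mono[OF de(1) assms(3)] Suc
  by (auto simp: rcyc_def chain_boundary_diff intro: singular_chain_diff)
 moreover have "rbdr X p A B (c - (c - d))" using rbdr_schain[OF de(1)] by simp
 ultimately show ?thesis using that by blast
qed

lemma rbdr_lift:
 assumes "hvan X B C" "B \<subseteq> A" "rcyc X p A C c" "rbdr X p A B c"
 shows "rbdr X p A C c"
proof -
 obtain d e where de: "schain X (Suc p) A d" "schain X p B e" "c = bnd (Suc p) d + e"
  using assms(4) unfolding rbdr_def by blast
 have "bnd p c = bnd p e" using de(3) bdry_bdry[OF de(1)] by (simp add: chain_boundary_add)
 then have "rcyc X p B C e" using assms(3) de(2) by (simp add: rcyc_def)
 then have "rbdr X p A C e" using hvanD[OF assms(1)] rbdr_mono[OF _ assms(2) subset_refl] by blast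
 then show ?thesis unfolding de(3) by (intro rbdr_add rbdr_boundary[OF de(1)])
qed

section \<open>Homology of the ball modulo its sphere\<close>

lemma contractible_unit_ball: "contractible_space (unit_ball n)"
proof -
 have "homotopic_with (\<lambda>x. True) (unit_ball n) (unit_ball n) id (\<lambda>x i. 0)"
  unfolding homotopic_with_def
 proof (intro exI[of _ "\<lambda>(t, y) i. (1 - t) * y i"] conjI ballI allI)
  have "continuous_on ({0..1::real} \<times> bset n) (\<lambda>(t, y) i. (1 - t) * y i)"
   unfolding split_beta
   by (rule continuous_on_pair_fun)
    (intro continuous_on_mult continuous_on_diff continuous_on_const continuous_on_fst continuous_on_snd
     continuous_coord continuous_on_id)
  moreover have "(\<lambda>i. (1 - t) * y i) \<in> bset n" if "y \<in> bset n" "0 \<le> t" "t \<le> 1" for t y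
  proof -
   have "nsq n (\<lambda>i. (1 - t) * y i) = (1 - t)\<^sup>2 * nsq n y" by (rule nsq_scale)
   also have "\<dots> \<le> 1 * 1" using that by (intro mult_mono) (auto simp: bset_def power_le_one nsq_nonneg)
   finally show ?thesis using that by (auto simp: bset_def)
  qed
  ultimately show "continuous_map (prod_topology (top_of_set {0..1}) (unit_ball n)) (unit_ball n) (\<lambda>(t, y) i. (1 - t) * y i)"
   by (auto simp: unit_ball_top_of_set)
 qed auto
 then show ?thesis unfolding contractible_space_def by blast
qed

lemma subtopology_boundary: "subtopology (unit_ball (Suc k)) (sphr (Suc k)) = nsphere k"
proof -
 have "bset (Suc k) \<inter> sphr (Suc k) = {x. \<forall>i\<ge>Suc k. x i = 0} \<inter> {x. (\<Sum>i\<le>k. (x i)\<^sup>2) = 1}"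
  by (auto simp: unit_ball_boundary_eq bset_def nsq_def lessThan_Suc_atMost)
 then show ?thesis unfolding nsphere_def unit_ball_top_of_set Euclidean_top_of_set subtopology_subtopology by simp
qed

text \<open>Contractibility of the ball reduces the pair to the reduced homology of the sphere, one
  degree lower. Dimension 0 is separate because its sphere is empty.\<close>

lemma unit_ball_homology:
 "relative_homology_group (int n) (unit_ball n) (sphr n) \<cong> integer_group"
 "p \<noteq> int n \<Longrightarrow> trivial_group (relative_homology_group p (unit_ball n) (sphr n))"
proof -
 have "relative_homology_group (int n) (unit_ball n) (sphr n) \<cong> integer_group \<and>
  (p \<noteq> int n \<longrightarrow> trivial_group (relative_homology_group p (unit_ball n) (sphr n)))"
 proof (cases n)
  case 0
  have b: "sphr 0 = {}" by (auto simp: unit_ball_boundary_eq nsq_def)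
  have t: "topspace (unit_ball 0) = {\<lambda>i. 0}" by (auto simp: bset_def nsq_def)
  have "homology_group 0 (unit_ball 0) \<cong> integer_group"
   by (rule isomorphic_integer_zeroth_homology_group[OF contractible_imp_path_connected_space[OF contractible_unit_ball]])
    (simp only: t insert_not_empty not_False_eq_True)
  then show ?thesis using 0 b homology_dimension_axiom[OF t, of p] by simp
 next
  case (Suc k)
  have ne: "topspace (unit_ball n) \<inter> sphr n \<noteq> {}"
  proof -
   have "(\<lambda>i. if i = 0 then 1 else 0) \<in> sphr (Suc k)"
    by (auto simp: unit_ball_boundary_eq bset_def nsq_def if_distrib[of "\<lambda>x. x ^ 2"] cong: if_cong)
   then show ?thesis using Suc by (auto simp: unit_ball_boundary_eq)
  qed
  have iso: "relative_homology_group q (unit_ball n) (sphr n) \<cong> reduced_homology_group (q - 1) (nsphere k)" for q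
   using isomorphic_group_relative_homology_of_contractible[OF contractible_unit_ball ne, of q]
   unfolding Suc subtopology_boundary .
  have "relative_homology_group (int n) (unit_ball n) (sphr n) \<cong> integer_group"
   using iso_trans[OF iso[of "int n"]] reduced_homology_group_nsphere(1)[of k] Suc by simp
  moreover have "trivial_group (relative_homology_group p (unit_ball n) (sphr n))" if "p \<noteq> int n"
   using isomorphic_group_triviality[OF iso[of p]] reduced_homology_group_nsphere(2)[of "p - 1" k] that Suc by simp
  ultimately show ?thesis by blast
 qed
 then show "relative_homology_group (int n) (unit_ball n) (sphr n) \<cong> integer_group"
  "p \<noteq> int n \<Longrightarrow> trivial_group (relative_homology_group p (unit_ball n) (sphr n))" by blast+
qed

section \<open>Radial deformations and the attachment of one cell\<close>

context cell
begin

lemma fr_cl: "fr \<subseteq> cl" using cl_eq by blast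
lemma e_cl: "e \<subseteq> cl" using cl_eq by blast

lemma group_iso:
 "relative_homology_group p (unit_ball n) (sphr n) \<cong> relative_homology_group p (subtopology X cl) fr"
 by (rule is_isoI, rule homeomorphic_map_relative_homology_iso[OF homeo])
  (auto simp: fr_def unit_ball_boundary_eq)

lemma hgen_cl: "\<exists>z. hgen X n cl fr z"
proof (rule hgen_exists[OF fr_cl])
 have "relative_homology_group (int n) (subtopology X cl) fr \<cong> relative_homology_group (int n) (unit_ball n) (sphr n)"
  using group.iso_sym[OF group_relative_homology_group group_iso] .
 from iso_trans[OF this unit_ball_homology(1)]
 show "relative_homology_group (int n) (subtopology X cl) fr \<cong> integer_group" .
qed

lemma rbdr_cl: "p \<noteq> n \<Longrightarrow> rcyc X p cl fr c \<Longrightarrow> rbdr X p cl fr c"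
 by (rule trivial_homology_rbdr[OF fr_cl])
  (use isomorphic_group_triviality[OF group_iso[of "int p"]] unit_ball_homology(2)[of "int p" n] in auto)

lemma inv_e: "inv\<Phi> ` e = oball n" and inv_cl: "inv\<Phi> ` cl = bset n"
 unfolding e_eq cl_def by (force simp: inv_\<Phi> image_image unit_ball_interior_eq)+

lemma cell_continuous:
 assumes "C \<subseteq> cl" and cont: "continuous_on ({0..1::real} \<times> inv\<Phi> ` C) h"
  and h: "\<And>t y. 0 \<le> t \<Longrightarrow> t \<le> 1 \<Longrightarrow> y \<in> inv\<Phi> ` C \<Longrightarrow> h (t, y) \<in> bset n"
 shows "continuous_map (prod_topology (top_of_set {0..1}) (subtopology X C)) X (\<lambda>(t, x). \<Phi> (h (t, inv\<Phi> x)))"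
proof -
 let ?I = "top_of_set {0..1::real}"
 let ?S = "inv\<Phi> ` C"
 have Sb: "?S \<subseteq> bset n" using inv\<Phi>_in assms(1) by blast
 have c1: "continuous_map (subtopology X C) (top_of_set ?S) inv\<Phi>"
 proof -
  have "continuous_map (subtopology X C) (unit_ball n) inv\<Phi>"
   by (rule continuous_map_from_subtopology_mono[OF continv assms(1)])
  then have "continuous_map (subtopology X C) (subtopology (unit_ball n) ?S) inv\<Phi>"
   by (auto simp: continuous_map_in_subtopology)
  then show ?thesis using Sb by (simp add: unit_ball_top_of_set subtopology_subtopology inf.absorb2)
 qed
 have "continuous_map (prod_topology ?I (subtopology X C)) (prod_topology ?I (top_of_set ?S)) (\<lambda>(t, x). (t, inv\<Phi> x))"
  unfolding split_beta
  by (intro continuous_map_pairedI continuous_map_fst continuous_map_compose[OF continuous_map_snd c1, unfolded o_def])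
 moreover have "continuous_map (prod_topology ?I (top_of_set ?S)) (unit_ball n) h"
  using cont h by (auto simp: unit_ball_top_of_set)
 ultimately have "continuous_map (prod_topology ?I (subtopology X C)) X (\<Phi> \<circ> (h \<circ> (\<lambda>(t, x). (t, inv\<Phi> x))))"
  using cont\<Phi> by (meson continuous_map_compose)
 moreover have "\<Phi> \<circ> (h \<circ> (\<lambda>(t, x). (t, inv\<Phi> x))) = (\<lambda>(t, x). \<Phi> (h (t, inv\<Phi> x)))" by auto
 ultimately show ?thesis by simp
qed

text \<open>Straight radial push to the sphere, ending at \<open>y\<close> divided by its norm; it
  makes sense only away from the centre.\<close>

definition rad :: "real \<times> (nat \<Rightarrow> real) \<Rightarrow> nat \<Rightarrow> real" where
 "rad = (\<lambda>(t, y) i. ((1 - t) + t / sqrt (nsq n y)) * y i)"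

lemma nsq_rad:
 assumes "y \<in> bset n" "y \<noteq> (\<lambda>i. 0)" "0 \<le> t" "t \<le> 1"
 shows "rad (t, y) \<in> bset n" "t = 1 \<Longrightarrow> nsq n (rad (t, y)) = 1" "nsq n y = 1 \<Longrightarrow> rad (t, y) = y"
  "0 < (1 - t) + t / sqrt (nsq n y)"
proof -
 define s where "s = sqrt (nsq n y)"
 have "0 < nsq n y" using nsq_eq_0[OF assms(1)] assms(2) nsq_nonneg[of n y] by linarith
 then have s: "0 < s" "s \<le> 1" "s\<^sup>2 = nsq n y" using assms(1) by (auto simp: s_def bset_def)
 have "nsq n (rad (t, y)) = ((1 - t) + t / s)\<^sup>2 * s\<^sup>2" unfolding s(3) by (simp add: rad_def nsq_scale s_def)
 also have "\<dots> = (((1 - t) + t / s) * s)\<^sup>2" by (simp add: power_mult_distrib)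
 also have "((1 - t) + t / s) * s = (1 - t) * s + t" using s by (simp add: field_simps)
 finally have eq: "nsq n (rad (t, y)) = ((1 - t) * s + t)\<^sup>2" .
 have "(1 - t) * s \<le> (1 - t) * 1" using assms s by (intro mult_left_mono) auto
 then have "(1 - t) * s + t \<le> 1" by simp
 moreover have "0 \<le> (1 - t) * s + t" using assms s by simp
 ultimately have "nsq n (rad (t, y)) \<le> 1" unfolding eq by (simp add: power_le_one)
 then show "rad (t, y) \<in> bset n" using assms(1) by (auto simp: bset_def rad_def)
 show "t = 1 \<Longrightarrow> nsq n (rad (t, y)) = 1" unfolding eq by simp
 show "nsq n y = 1 \<Longrightarrow> rad (t, y) = y" by (simp add: rad_def)
 have "0 \<le> t / s" using s assms by simp
 moreover have "t = 1 \<Longrightarrow> 0 < t / s" using s by simp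
 ultimately show "0 < (1 - t) + t / sqrt (nsq n y)" unfolding s_def[symmetric] using assms(4)
  by (cases "t = 1") (auto intro: add_pos_nonneg)
qed

lemma inv_fr: "x \<in> cl \<Longrightarrow> x \<in> fr \<longleftrightarrow> nsq n (inv\<Phi> x) = 1"
 unfolding fr_def cl_def by (auto simp: unit_ball_boundary_eq inv_\<Phi>)

text \<open>The deleted set \<open>K\<close> is a parameter because two shapes occur, the centre
  alone and a segment from the centre to the sphere; what matters is that pushing outwards never
  enters \<open>K\<close>. Continuity follows by pasting along the closed sets \<open>Z\<close> and
  \<open>cl\<close>.\<close>

lemma radial_hvan:
 assumes Z: "closedin X Z" "fr \<subseteq> Z" "Z \<inter> e = {}"
  and K: "K \<subseteq> bset n" "(\<lambda>i. 0) \<in> K" "\<And>t y. y \<in> bset n \<Longrightarrow> y \<notin> K \<Longrightarrow> 0 \<le> t \<Longrightarrow> t \<le> 1 \<Longrightarrow> rad (t, y) \<notin> K"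
 shows "hvan X (Z \<union> e - \<Phi> ` K) (Z - \<Phi> ` K)"
proof (rule hvan_homotopy[where h="\<lambda>(t, x). if x \<in> Z then x else \<Phi> (rad (t, inv\<Phi> x))"])
 let ?A = "Z \<union> e - \<Phi> ` K"
 let ?I = "top_of_set {0..1::real}"
 let ?h = "\<lambda>(t, x). if x \<in> Z then x else \<Phi> (rad (t, inv\<Phi> x))"
 let ?f = "\<lambda>b. if b then snd else (\<lambda>(t, x). \<Phi> (rad (t, inv\<Phi> x)))"
 let ?T = "\<lambda>b. {0..1::real} \<times> (?A \<inter> (if b then Z else cl))"
 have AX: "?A \<subseteq> topspace X" using closedin_subset[OF Z(1)] cl_topspace e_cl by blast
 have Zcl: "Z \<inter> cl = fr" using Z cl_eq by blast
 have invK: "inv\<Phi> x \<notin> K" if "x \<in> ?A \<inter> cl" for x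
  using that \<Phi>_inv[of x] by (metis DiffD2 Int_iff imageI)
 have radA: "\<Phi> (rad (t, inv\<Phi> x)) \<in> ?A \<inter> cl" "t = 1 \<Longrightarrow> \<Phi> (rad (t, inv\<Phi> x)) \<in> fr" if x: "x \<in> ?A \<inter> cl" and t: "0 \<le> t" "t \<le> 1" for t x
 proof -
  have y: "inv\<Phi> x \<in> bset n" "inv\<Phi> x \<notin> K" using invK[OF x] inv\<Phi>_in x by auto
  then have ne: "inv\<Phi> x \<noteq> (\<lambda>i. 0)" using K(2) by auto
  note r = nsq_rad[OF y(1) ne t] K(3)[OF y t]
  have "\<Phi> (rad (t, inv\<Phi> x)) \<notin> \<Phi> ` K"
   using inj_on_image_mem_iff[OF inj r(1) K(1)] r(5) by simp
  moreover have c: "\<Phi> (rad (t, inv\<Phi> x)) \<in> cl" using r(1) by (simp add: cl_def)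
  ultimately show "\<Phi> (rad (t, inv\<Phi> x)) \<in> ?A \<inter> cl" using cl_eq Z(2) by blast
  assume "t = 1"
  then show "\<Phi> (rad (t, inv\<Phi> x)) \<in> fr" using inv_fr[OF c] r(1,2) by (simp add: inv_\<Phi>)
 qed
 have radZ: "\<Phi> (rad (t, inv\<Phi> x)) = x" if x: "x \<in> ?A" "x \<in> Z" "x \<in> cl" and t: "0 \<le> t" "t \<le> 1" for t x
 proof -
  have f: "x \<in> fr" using x Zcl by blast
  have y: "inv\<Phi> x \<in> bset n" "inv\<Phi> x \<notin> K" using invK inv\<Phi>_in x by auto
  then have ne: "inv\<Phi> x \<noteq> (\<lambda>i. 0)" using K(2) by auto
  have "rad (t, inv\<Phi> x) = inv\<Phi> x" using nsq_rad(3)[OF y(1) ne t] inv_fr[OF x(3)] f by simp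
  then show ?thesis using \<Phi>_inv[OF x(3)] by simp
 qed
 show "continuous_map (prod_topology ?I (subtopology X ?A)) (subtopology X ?A) ?h"
 proof (rule pasting_lemma_closed[where I=UNIV and T="?T" and f="?f"])
  show "finite (UNIV :: bool set)" by simp
  show "closedin (prod_topology ?I (subtopology X ?A)) (?T b)" for b
  proof -
   have "closedin (subtopology X ?A) (?A \<inter> (if b then Z else cl))"
    using Z(1) closed_cl by (simp add: closedin_subtopology_Int_closed)
   then show ?thesis by (auto simp: closedin_prod_Times_iff)
  qed
  show "continuous_map (subtopology (prod_topology ?I (subtopology X ?A)) (?T b)) (subtopology X ?A) (?f b)" for b
  proof (cases b)
   case True
   then show ?thesis
    by (auto intro: continuous_map_from_subtopology continuous_map_snd)
  next
   case False
   let ?C = "?A \<inter> cl"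
   have "continuous_map (prod_topology ?I (subtopology X ?C)) X (\<lambda>(t, x). \<Phi> (rad (t, inv\<Phi> x)))"
   proof (rule cell_continuous)
    have yb: "y \<in> bset n \<and> y \<noteq> (\<lambda>i. 0)" if "y \<in> inv\<Phi> ` ?C" for y
    proof -
     from that obtain x where x: "x \<in> ?C" "y = inv\<Phi> x" by blast
     then show ?thesis using invK[OF x(1)] inv\<Phi>_in[of x] K(2) by auto
    qed
    then have nz: "nsq n y \<noteq> 0" if "y \<in> inv\<Phi> ` ?C" for y using that nsq_eq_0 by blast
    show "continuous_on ({0..1} \<times> inv\<Phi> ` ?C) rad"
     unfolding rad_def split_beta
     by (rule continuous_on_pair_fun)
      (intro continuous_on_mult continuous_on_add continuous_on_diff continuous_on_divide continuous_on_real_sqrt continuous_nsq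
       continuous_on_const continuous_on_fst continuous_on_snd continuous_coord continuous_on_id; use nz in auto)
    show "rad (t, y) \<in> bset n" if "0 \<le> t" "t \<le> 1" "y \<in> inv\<Phi> ` ?C" for t y
     using nsq_rad(1) yb that by blast
   qed auto
   moreover have "subtopology (prod_topology ?I (subtopology X ?A)) ({0..1} \<times> ?C) = prod_topology ?I (subtopology X ?C)"
    by (simp add: subtopology_Times subtopology_subtopology inf.absorb2)
   ultimately have "continuous_map (subtopology (prod_topology ?I (subtopology X ?A)) ({0..1} \<times> ?C)) X
     (\<lambda>(t, x). \<Phi> (rad (t, inv\<Phi> x)))" by (simp only:)
   moreover have "(\<lambda>(t, x). \<Phi> (rad (t, inv\<Phi> x))) \<in>
     topspace (subtopology (prod_topology ?I (subtopology X ?A)) ({0..1} \<times> ?C)) \<rightarrow> ?A"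
   proof
    fix p assume "p \<in> topspace (subtopology (prod_topology ?I (subtopology X ?A)) ({0..1} \<times> ?C))"
    then obtain t x where p: "p = (t, x)" "x \<in> ?C" "0 \<le> t" "t \<le> 1" by auto
    then show "(case p of (t, x) \<Rightarrow> \<Phi> (rad (t, inv\<Phi> x))) \<in> ?A" using radA(1)[OF p(2-4)] by simp
   qed
   ultimately show ?thesis using False unfolding continuous_map_in_subtopology by (simp only: if_False)
  qed
  show "?f i x = ?f j x" if "x \<in> topspace (prod_topology ?I (subtopology X ?A)) \<inter> ?T i \<inter> ?T j" for i j x
   using that radZ by (cases i; cases j) auto
  show "\<exists>j. j \<in> UNIV \<and> x \<in> ?T j \<and> ?h x = ?f j x" if "x \<in> topspace (prod_topology ?I (subtopology X ?A))" for x
  proof (cases "snd x \<in> Z")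
   case True
   then show ?thesis using that by (intro exI[of _ True]) (auto simp: split_beta)
  next
   case False
   then have "snd x \<in> cl" using that e_cl by auto
   then show ?thesis using that False by (intro exI[of _ False]) (auto simp: split_beta)
  qed
 qed
 fix x
 show "(case (0::real, x) of (t, x) \<Rightarrow> if x \<in> Z then x else \<Phi> (rad (t, inv\<Phi> x))) = x" if "x \<in> ?A"
  using that e_cl \<Phi>_inv by (auto simp: rad_def)
 show "(case (1::real, x) of (t, x) \<Rightarrow> if x \<in> Z then x else \<Phi> (rad (t, inv\<Phi> x))) \<in> Z - \<Phi> ` K" if "x \<in> ?A"
  using that radA[of x 1] e_cl Z(2) by auto
qed (auto)

lemma hvan_center:
 assumes Z: "closedin X Z" "fr \<subseteq> Z" "Z \<inter> e = {}"
 shows "hvan X (Z \<union> e - {\<Phi> (\<lambda>i. 0)}) Z"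
proof -
 have "\<Phi> (\<lambda>i. 0) \<in> e" unfolding e_eq using zero_bset by (auto simp: unit_ball_interior_eq nsq_def)
 then have "\<Phi> (\<lambda>i. 0) \<notin> Z" using Z(3) by blast
 then have Zc: "Z - \<Phi> ` {\<lambda>i. 0} = Z" by blast
 have "hvan X (Z \<union> e - \<Phi> ` {\<lambda>i. 0}) (Z - \<Phi> ` {\<lambda>i. 0})"
 proof (rule radial_hvan[OF Z])
  fix t y assume y: "y \<in> bset n" "y \<notin> {\<lambda>i. 0}" and t: "0 \<le> t" "t \<le> (1::real)"
  then obtain i where i: "y i \<noteq> 0" by auto
  have "rad (t, y) i \<noteq> 0" using nsq_rad(4)[OF y(1) _ t] y(2) i by (auto simp: rad_def)
  then show "rad (t, y) \<notin> {\<lambda>i. 0}" by auto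
 qed (use zero_bset in auto)
 then show ?thesis unfolding Zc by simp
qed

text \<open>With only \<open>x\<close> deleted the centre obstructs a radial push. Deleting the
  whole segment \<open>K\<close> from the centre to \<open>x\<close> removes the obstruction, and
  excision of \<open>Z - {x}\<close> reduces the comparison of the two deletions to the open cell,
  which contracts to a point off \<open>K\<close>.\<close>

lemma hvan_minus_fr:
 assumes Z: "closedin X Z" "fr \<subseteq> Z" "Z \<inter> e = {}" and x: "x \<in> fr"
 shows "hvan X (Z \<union> e - {x}) (Z - {x})"
proof -
 obtain w where w: "w \<in> bset n" "nsq n w = 1" "x = \<Phi> w" using x by (auto simp: fr_def unit_ball_boundary_eq)
 define K where "K = (\<lambda>s i. s * w i) ` {0..1::real}"
 have w0: "w \<noteq> (\<lambda>i. 0)" using w(2) by (auto simp: nsq_def)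
 have Kb: "K \<subseteq> bset n"
 proof
  fix y assume "y \<in> K"
  then obtain s where s: "0 \<le> s" "s \<le> 1" "y = (\<lambda>i. s * w i)" by (auto simp: K_def)
  then have "nsq n y \<le> 1" using w by (simp add: nsq_scale power_le_one)
  then show "y \<in> bset n" using s w by (auto simp: bset_def)
 qed
 have Kmem: "y \<in> K" if "y \<in> bset n" "y = (\<lambda>i. c * w i)" "0 \<le> c" for y c
 proof -
  have "c\<^sup>2 \<le> 1" using that(1) w(2) nsq_scale[of n c w] unfolding that(2) by (simp add: bset_def)
  then have "c \<le> 1" using that(3) by (simp add: abs_square_le_1)
  then show ?thesis using that by (auto simp: K_def)
 qed
 have Kfr: "\<Phi> ` K \<inter> Z = {x}"
 proof -
  have "\<Phi> y = x" if yK: "y \<in> K" and yZ: "\<Phi> y \<in> Z" for y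
  proof -
   obtain s where s: "0 \<le> s" "s \<le> 1" "y = (\<lambda>i. s * w i)" using yK by (auto simp: K_def)
   have yb: "y \<in> bset n" using yK Kb by blast
   have "\<Phi> y \<in> cl" using yb by (simp add: cl_def)
   then have "\<Phi> y \<in> fr" using yZ Z cl_eq by blast
   then have "nsq n y = 1" using inv_fr[OF \<open>\<Phi> y \<in> cl\<close>] inv_\<Phi>[OF yb] by simp
   then have "s\<^sup>2 = 1" using s(3) w(2) by (simp add: nsq_scale)
   then have "s = 1" using s(1) by (simp add: power2_eq_1_iff)
   then show ?thesis using s(3) w(3) by simp
  qed
  moreover have "w \<in> K" using Kmem[OF w(1), of 1] by simp
  ultimately show ?thesis using w(3) x Z(2) by auto
 qed
 have Zx: "Z - \<Phi> ` K = Z - {x}" using Kfr by blast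
 let ?A = "Z \<union> e - {x}"
 let ?T = "Z \<union> e - \<Phi> ` K"
 have v1: "hvan X ?T (Z - {x})"
  unfolding Zx[symmetric]
 proof (rule radial_hvan[OF Z Kb])
  show "(\<lambda>i. 0) \<in> K" using Kmem[OF zero_bset, of 0] by simp
  fix t y assume y: "y \<in> bset n" "y \<notin> K" and t: "0 \<le> t" "t \<le> (1::real)"
  show "rad (t, y) \<notin> K"
  proof
   assume "rad (t, y) \<in> K"
   then obtain s where s: "0 \<le> s" "rad (t, y) = (\<lambda>i. s * w i)" by (auto simp: K_def)
   have y0: "y \<noteq> (\<lambda>i. 0)" using y(2) Kmem[OF zero_bset, of 0] by auto
   let ?c = "(1 - t) + t / sqrt (nsq n y)"
   have c: "0 < ?c" by (rule nsq_rad(4)[OF y(1) y0 t])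
   have "?c * y i = s * w i" for i using fun_cong[OF s(2), of i] by (simp add: rad_def)
   then have "y i = (s / ?c) * w i" for i using c by (simp add: field_simps)
   then have "y = (\<lambda>i. (s / ?c) * w i)" by blast
   moreover have "0 \<le> s / ?c" using s(1) c by simp
   ultimately show False using Kmem[OF y(1)] y(2) by blast
  qed
 qed
 have AX: "?A \<subseteq> topspace X" using closedin_subset[OF Z(1)] cl_topspace e_cl by blast
 have xK: "x \<in> \<Phi> ` K" using Kfr by blast
 have TA: "?T = ?A - \<Phi> ` K" using xK by blast
 have clK: "closedin X (\<Phi> ` K)"
 proof (rule compact_image)
  have "compact K" unfolding K_def
   by (rule compact_continuous_image)
    (rule continuous_on_pair_fun, intro continuous_on_mult continuous_on_const continuous_on_id, simp)
  then have "closed K" by (rule compact_imp_closed)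
  then show "closedin (unit_ball n) K" using Kb by (auto simp: unit_ball_top_of_set closedin_closed_subtopology closedin_subset_topspace closed_subset)
 qed
 have v2: "hvan X ?A ?T"
 proof (rule hvan_excision[where U="Z - {x}"])
  have "closedin (subtopology X ?A) (?A \<inter> Z)" using Z(1) by (rule closedin_subtopology_Int_closed)
  moreover have "?A \<inter> Z = Z - {x}" by blast
  ultimately show "closedin (subtopology X ?A) (Z - {x})" by simp
  have "openin (subtopology X ?A) (?A \<inter> (topspace X - \<Phi> ` K))"
   using clK by (intro openin_subtopology_Int2) auto
  moreover have "?A \<inter> (topspace X - \<Phi> ` K) = ?T" using AX TA by blast
  ultimately show "openin (subtopology X ?A) ?T" by simp
  show "Z - {x} \<subseteq> ?T" using Zx by blast
  show "?A \<subseteq> topspace X" by (rule AX)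
  have xe: "x \<notin> e" using x e_fr by blast
  have 1: "?A - (Z - {x}) = e" using Z(3) xe by blast
  have 2: "?T - (Z - {x}) = e - \<Phi> ` K" using Z(3) xK by blast
  show "hvan X (?A - (Z - {x})) (?T - (Z - {x}))"
   unfolding 1 2
  \<comment> \<open>The target \<open>- w / 2\<close> lies opposite to \<open>K\<close>: if a point
    on the way to it were a nonnegative multiple of \<open>w\<close>, so would be its starting
    point.\<close>
  proof (rule hvan_cell_homotopy[where h="\<lambda>(t, y) i. (1 - t) * y i + t * (- w i / 2)"])
   show "e \<subseteq> cl" by (rule e_cl)
   have ie: "inv\<Phi> ` (e - \<Phi> ` K) = oball n - K"
   proof -
    have "e - \<Phi> ` K = \<Phi> ` (oball n - K)"
    proof
     show "e - \<Phi> ` K \<subseteq> \<Phi> ` (oball n - K)" unfolding e_eq by blast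
     have "\<Phi> y \<notin> \<Phi> ` K" if "y \<in> oball n - K" for y
      using inj_on_image_mem_iff[OF inj _ Kb, of y] that by (auto simp: unit_ball_interior_eq)
     moreover have "\<Phi> y \<in> e" if "y \<in> oball n - K" for y
      unfolding e_eq using that by (intro imageI) simp
     ultimately show "\<Phi> ` (oball n - K) \<subseteq> e - \<Phi> ` K"
      by (intro image_subsetI DiffI)
    qed
    then show ?thesis by (force simp: image_image inv_\<Phi> unit_ball_interior_eq)
   qed
   have wh: "nsq n (\<lambda>i. - w i / 2) = 1/4"
    using nsq_scale[of n "-1/2" w] w(2) by (simp add: power2_eq_square)
   have stay: "(\<lambda>i. (1 - t) * y i + t * (- w i / 2)) \<in> oball n"
    if y: "y \<in> oball n" and t: "0 \<le> t" "t \<le> 1" for t y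
   proof -
    have "nsq n (\<lambda>i. (1 - t) * y i + t * (- w i / 2)) < 1"
    proof -
     have conv: "((1 - t) * a + t * b)\<^sup>2 \<le> (1 - t) * a\<^sup>2 + t * b\<^sup>2" for a b :: real
     proof -
      have "(1 - t) * a\<^sup>2 + t * b\<^sup>2 - ((1 - t) * a + t * b)\<^sup>2 = t * (1 - t) * (a - b)\<^sup>2"
       by (simp add: power2_eq_square algebra_simps)
      moreover have "0 \<le> t * (1 - t) * (a - b)\<^sup>2" using t by simp
      ultimately show ?thesis by linarith
     qed
     have "nsq n (\<lambda>i. (1 - t) * y i + t * (- w i / 2)) \<le> (\<Sum>i<n. (1 - t) * (y i)\<^sup>2 + t * (- w i / 2)\<^sup>2)"
      unfolding nsq_def by (intro sum_mono conv)
     also have "\<dots> = (1 - t) * nsq n y + t * nsq n (\<lambda>i. - w i / 2)"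
      by (simp only: nsq_def sum.distrib sum_distrib_left)
     also have "\<dots> < 1"
     proof (cases "t = 1")
      case False
      then have "(1 - t) * nsq n y < (1 - t) * 1" using y t by (intro mult_strict_left_mono) (auto simp: unit_ball_interior_eq)
      moreover define a where "a = (1 - t) * nsq n y"
      ultimately have "a < 1 - t" by simp
      then have "a + t * (1 / 4) < 1" using t by linarith
      then show ?thesis unfolding wh a_def .
     next
      case True
      then show ?thesis unfolding wh by simp
     qed
     finally show ?thesis .
    qed
    then show ?thesis using y w(1) by (auto simp: unit_ball_interior_eq bset_def)
   qed
   have avoid: "(\<lambda>i. (1 - t) * y i + t * (- w i / 2)) \<notin> K"
    if y: "y \<in> bset n" "t < 1 \<Longrightarrow> y \<notin> K" and t: "0 \<le> t" "t \<le> 1" for t y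
   proof
    assume "(\<lambda>i. (1 - t) * y i + t * (- w i / 2)) \<in> K"
    then obtain s where s: "0 \<le> s" "(\<lambda>i. (1 - t) * y i + t * (- w i / 2)) = (\<lambda>i. s * w i)" by (auto simp: K_def)
    have eq: "(1 - t) * y i = (s + t / 2) * w i" for i
     using fun_cong[OF s(2), of i] by (simp add: field_simps)
    show False
    proof (cases "t = 1")
     case True
     then have "(s + 1 / 2) * w i = 0" for i using eq[of i] by simp
     then have "w i = 0" for i using s(1) by (metis add_nonneg_pos half_gt_zero less_irrefl mult_eq_0_iff zero_less_one)
     then show False using w0 by blast
    next
     case False
     then have t1: "t < 1" using t by simp
     then have "y i = ((s + t / 2) / (1 - t)) * w i" for i using eq[of i] by (simp add: field_simps)
     then have "y = (\<lambda>i. ((s + t / 2) / (1 - t)) * w i)" by blast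
     moreover have "0 \<le> (s + t / 2) / (1 - t)" using s(1) t t1 by simp
     ultimately have "y \<in> K" using Kmem[OF y(1)] by blast
     then show False using y(2)[OF t1] by blast
    qed
   qed
   show "continuous_on ({0..1} \<times> inv\<Phi> ` e) (\<lambda>(t, y) i. (1 - t) * y i + t * (- w i / 2))"
    unfolding split_beta
    by (rule continuous_on_pair_fun)
     (intro continuous_on_add continuous_on_mult continuous_on_diff continuous_on_const continuous_on_fst continuous_on_snd
      continuous_coord continuous_on_id)
   fix y
   show "(case (t, y) of (t, y) \<Rightarrow> \<lambda>i. (1 - t) * y i + t * (- w i / 2)) \<in> inv\<Phi> ` e"
    if "0 \<le> t" "t \<le> 1" "y \<in> inv\<Phi> ` e" for t
    using stay[of y t] that unfolding inv_e by simp
   show "(case (t, y) of (t, y) \<Rightarrow> \<lambda>i. (1 - t) * y i + t * (- w i / 2)) \<in> inv\<Phi> ` (e - \<Phi> ` K)"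
    if "0 \<le> t" "t \<le> 1" "y \<in> inv\<Phi> ` (e - \<Phi> ` K)" for t
    using stay[of y t] avoid[of y t] that unfolding ie by (auto simp: unit_ball_interior_eq)
   show "(case (0, y) of (t, y) \<Rightarrow> \<lambda>i. (1 - t) * y i + t * (- w i / 2)) = y" by simp
   show "(case (1, y) of (t, y) \<Rightarrow> \<lambda>i. (1 - t) * y i + t * (- w i / 2)) \<in> inv\<Phi> ` (e - \<Phi> ` K)"
    if "y \<in> inv\<Phi> ` e"
    using stay[of y 1] avoid[of y 1] that unfolding ie inv_e by (auto simp: unit_ball_interior_eq)
  qed auto
 qed
 show ?thesis by (rule hvan_trans[OF v2 v1]) (use Zx TA in auto)
qed

text \<open>The relative homology of an attached cell is that of the cell itself. The bridge is the
  complement \<open>?T\<close> of the centre: it retracts to \<open>Z\<close>, and modulo it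
  \<open>Z\<close> can be excised, leaving the open cell and the punctured open cell. The same
  comparison is made for \<open>cl\<close> and \<open>fr\<close>.\<close>

lemma
 assumes Z: "closedin X Z" "fr \<subseteq> Z" "Z \<inter> e = {}"
 shows attach_hgen: "hgen X n cl fr z \<Longrightarrow> hgen X n (Z \<union> e) Z z"
  and attach_rbdr: "p \<noteq> n \<Longrightarrow> rcyc X p (Z \<union> e) Z c \<Longrightarrow> rbdr X p (Z \<union> e) Z c"
proof -
 let ?c = "\<Phi> (\<lambda>i. 0)"
 let ?A = "Z \<union> e"
 let ?T = "Z \<union> e - {?c}"
 have ce: "?c \<in> e" unfolding e_eq using zero_bset by (auto simp: unit_ball_interior_eq nsq_def)
 have cZ: "?c \<notin> Z" and cfr: "?c \<notin> fr" using ce Z e_fr by blast+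
 have AX: "?A \<subseteq> topspace X" using closedin_subset[OF Z(1)] cl_topspace e_cl by blast
 have ZT: "Z \<subseteq> ?T" using cZ by blast
 have closed_pt: "closedin X {?c}" using ce e_cl cl_topspace haus by (meson Hausdorff_imp_t1_space closedin_t1_singleton subset_iff)
 have vT: "hvan X ?T Z" by (rule hvan_center[OF Z])
 have cle: "fr \<union> e = cl" using cl_eq by blast
 have vcl: "hvan X (cl - {?c}) fr"
  using hvan_center[OF closed_fr subset_refl] e_fr unfolding cle by blast
 have exc: "closedin (subtopology X A') Z'" "openin (subtopology X A') (A' - {?c})"
  if "A' = Z' \<union> e" "closedin X Z'" for A' Z'
 proof -
  have "closedin (subtopology X A') (A' \<inter> Z')" using that(2) by (rule closedin_subtopology_Int_closed)
  then show "closedin (subtopology X A') Z'" using that(1) by (simp add: Int_absorb1)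
  have AX': "A' \<subseteq> topspace X" using that closedin_subset[OF that(2)] e_cl cl_topspace by blast
  have "openin (subtopology X A') (A' \<inter> (topspace X - {?c}))" using closed_pt by (intro openin_subtopology_Int2) auto
  moreover have "A' \<inter> (topspace X - {?c}) = A' - {?c}" using AX' by blast
  ultimately show "openin (subtopology X A') (A' - {?c})" by simp
 qed
 have fc: "fr \<subseteq> cl - {?c}" using cfr fr_cl by blast
 note excA = exc[OF refl Z(1)]
 note excl = exc[OF cle[symmetric] closed_fr]
 have d1: "?A - Z = e" "?T - Z = e - {?c}" using Z(3) by blast+
 have d2: "cl - fr = e" "cl - {?c} - fr = e - {?c}" using cl_eq e_fr by blast+
 have clA: "cl \<subseteq> ?A" "cl - {?c} \<subseteq> ?T" using cl_eq Z(2) by blast+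
 have reduce: "\<exists>c''. rcyc X p cl fr c'' \<and> rbdr X p ?A ?T (c - c'')" if c: "rcyc X p ?A Z c" for p c
 proof -
  have "rcyc X p ?A ?T c" by (rule rcyc_mono[OF c subset_refl ZT])
  from excision_surj[OF excA ZT AX this]
  obtain c' where c': "rcyc X p e (e - {?c}) c'" "rbdr X p ?A ?T (c - c')" unfolding d1 .
  have "rcyc X p cl (cl - {?c}) c'" using rcyc_mono[OF c'(1)] e_cl by blast
  from rcyc_lift[OF vcl fc Diff_subset this]
  obtain c'' where c'': "rcyc X p cl fr c''" "rbdr X p cl (cl - {?c}) (c' - c'')" .
  have "rbdr X p ?A ?T (c' - c'')" by (rule rbdr_mono[OF c''(2) clA])
  from rbdr_add[OF c'(2) this] have "rbdr X p ?A ?T (c - c'')" by simp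
  with c''(1) show ?thesis by blast
 qed
 have cdist: "frag_cmul k (a - b) = frag_cmul k a - frag_cmul k b" for k and a b :: "'a chain"
  by (metis (no_types) add_diff_cancel_right' diff_add_cancel frag_cmul_distrib2)
 have frT: "fr \<subseteq> ?T" using Z(2) ZT by blast
 have TA: "?T \<subseteq> ?A" by blast
 {
  fix p c assume "p \<noteq> n" and c: "rcyc X p ?A Z c"
  obtain c'' where c'': "rcyc X p cl fr c''" "rbdr X p ?A ?T (c - c'')" using reduce[OF c] by blast
  have "rbdr X p ?A ?T c''" by (rule rbdr_mono[OF rbdr_cl[OF \<open>p \<noteq> n\<close> c''(1)] clA(1) frT])
  from rbdr_add[OF c''(2) this] have "rbdr X p ?A ?T c" by simp
  then show "rbdr X p ?A Z c" by (rule rbdr_lift[OF vT TA c])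
 }
 assume z: "hgen X n cl fr z"
 then have zc: "rcyc X n cl fr z" by (simp add: hgen_def)
 have zA: "rcyc X n ?A Z z" by (rule rcyc_mono[OF zc clA(1) Z(2)])
 show "hgen X n ?A Z z"
  unfolding hgen_def
 proof (intro conjI allI impI)
  show "rcyc X n ?A Z z" by (rule zA)
  fix c assume c: "rcyc X n ?A Z c"
  obtain c'' where c'': "rcyc X n cl fr c''" "rbdr X n ?A ?T (c - c'')" using reduce[OF c] by blast
  obtain k where k: "rbdr X n cl fr (c'' - frag_cmul k z)" using z c''(1) unfolding hgen_def by blast
  from rbdr_add[OF c''(2) rbdr_mono[OF k clA(1) frT]] have "rbdr X n ?A ?T (c - frag_cmul k z)"
   by (simp only: diff_telescope)
  moreover have "rcyc X n ?A Z (c - frag_cmul k z)"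
   using c zA by (auto simp: rcyc_def chain_boundary_diff chain_boundary_cmul intro: singular_chain_diff singular_chain_cmul)
  ultimately show "\<exists>k. rbdr X n ?A Z (c - frag_cmul k z)" using rbdr_lift[OF vT TA] by blast
 next
  \<comment> \<open>\<open>z\<close> need not be supported in the open cell, so it is traded for an
    excised representative \<open>z'\<close>, to which \<open>excision_inj\<close> applies.\<close>
  fix k assume k: "rbdr X n ?A Z (frag_cmul k z)"
  have "rcyc X n cl (cl - {?c}) z" by (rule rcyc_mono[OF zc subset_refl fc])
  from excision_surj[OF excl fc cl_topspace this]
  obtain z' where z': "rcyc X n e (e - {?c}) z'" "rbdr X n cl (cl - {?c}) (z - z')" unfolding d2 .
  have "rbdr X n ?A ?T (frag_cmul k z)" by (rule rbdr_mono[OF k subset_refl ZT])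
  moreover have "rbdr X n ?A ?T (frag_cmul k (z - z'))" by (rule rbdr_cmul[OF rbdr_mono[OF z'(2) clA]])
  ultimately have "rbdr X n ?A ?T (frag_cmul k z - frag_cmul k (z - z'))" by (rule rbdr_diff)
  then have "rbdr X n ?A ?T (frag_cmul k z')" unfolding cdist by (simp only: diff_diff_eq2 diff_add_cancel add_diff_cancel_left')
  moreover have "rcyc X n e (e - {?c}) (frag_cmul k z')"
   using z'(1) by (auto simp: rcyc_def chain_boundary_cmul intro: singular_chain_cmul)
  ultimately have "rbdr X n e (e - {?c}) (frag_cmul k z')"
   using excision_inj[OF excA ZT AX, unfolded d1] by blast
  then have "rbdr X n cl (cl - {?c}) (frag_cmul k z')" using rbdr_mono e_cl by blast
  from rbdr_add[OF this rbdr_cmul[OF z'(2), of k]]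
  have "rbdr X n cl (cl - {?c}) (frag_cmul k z)" unfolding cdist by (simp only: add_diff_cancel_left' diff_add_cancel add.commute[of "frag_cmul k z'"])
  moreover have "rcyc X n cl fr (frag_cmul k z)"
   using zc by (auto simp: rcyc_def chain_boundary_cmul intro: singular_chain_cmul)
  ultimately have "rbdr X n cl fr (frag_cmul k z)" using rbdr_lift[OF vcl Diff_subset] by blast
  then show "k = 0" using z unfolding hgen_def by blast
 qed
qed

end

section \<open>Regular CW-complexes\<close>

lemma finite_max_ex:
 fixes f :: "'b \<Rightarrow> nat"
 assumes "finite A" "A \<noteq> {}"
 obtains e where "e \<in> A" "\<And>e'. e' \<in> A \<Longrightarrow> f e' \<le> f e"
proof -
 have "Max (f ` A) \<in> f ` A" using assms by (intro Max_in) auto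
 then obtain e where "e \<in> A" "f e = Max (f ` A)" by auto
 then show ?thesis using assms that[of e] by simp
qed

lemma nsq_L2: "sqrt (nsq n x) = L2_set x {..<n}"
 by (simp add: nsq_def L2_set_def)

text \<open>\<open>H\<close> adds \<open>(1 - |y|) a\<close> to \<open>y\<close>, which is nothing
  on the sphere. It is injective because \<open>|a| < 1\<close> makes the added term a strict
  contraction.\<close>

lemma recenter_ball:
 assumes a: "a \<in> oball n"
 obtains H where "homeomorphic_map (unit_ball n) (unit_ball n) H" "H (\<lambda>i. 0) = a"
  "\<And>y. y \<in> sphr n \<Longrightarrow> H y = y"
proof -
 define N where "N = (\<lambda>y. L2_set y {..<n})"
 have N_le: "y \<in> bset n \<longleftrightarrow> (\<forall>i\<ge>n. y i = 0) \<and> N y \<le> 1" for y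
  by (simp add: bset_def N_def nsq_L2[symmetric])
 have ab: "a \<in> bset n" and Na: "N a < 1"
  using a by (auto simp: unit_ball_interior_eq N_def nsq_L2[symmetric])
 have N0: "0 \<le> N y" for y by (simp add: N_def L2_set_nonneg)
 have tri: "N (\<lambda>i. x i + y i) \<le> N x + N y" for x y unfolding N_def by (rule L2_set_triangle_ineq)
 have scal: "N (\<lambda>i. c * x i) = \<bar>c\<bar> * N x" for c x
  unfolding N_def nsq_L2[symmetric] nsq_scale by (simp add: real_sqrt_mult)
 have rtri: "N x - N y \<le> N (\<lambda>i. x i - y i)" for x y
  using tri[of "\<lambda>i. x i - y i" y] by simp
 have Nsym: "N (\<lambda>i. x i - y i) = N (\<lambda>i. y i - x i)" for x y
  using scal[of "-1" "\<lambda>i. x i - y i"] by simp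
 define H where "H = (\<lambda>y i. y i + (1 - N y) * a i)"
 have Hb: "H y \<in> bset n" if y: "y \<in> bset n" for y
 proof -
  have "N (H y) \<le> N y + \<bar>1 - N y\<bar> * N a" unfolding H_def using tri[of y "\<lambda>i. (1 - N y) * a i"] scal by simp
  also have "\<dots> \<le> N y + (1 - N y) * 1" using y Na N0[of a] by (intro add_left_mono mult_mono) (auto simp: N_le)
  finally show ?thesis using y ab by (auto simp: N_le H_def)
 qed
 have inj: "inj_on H (bset n)"
 proof (rule inj_onI)
  fix y z assume yz: "y \<in> bset n" "z \<in> bset n" "H y = H z"
  have "y i - z i = (N y - N z) * a i" for i
   using fun_cong[OF yz(3), of i] by (simp add: H_def algebra_simps)
  then have "N (\<lambda>i. y i - z i) = \<bar>N y - N z\<bar> * N a" by (simp add: scal)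
  also have "\<dots> \<le> N (\<lambda>i. y i - z i) * N a"
   using rtri[of y z] rtri[of z y] Nsym[of y z] N0[of a] by (intro mult_right_mono) auto
  finally have "N (\<lambda>i. y i - z i) * (1 - N a) \<le> 0" by (simp add: algebra_simps)
  then have "N (\<lambda>i. y i - z i) = 0" using Na N0[of "\<lambda>i. y i - z i"] by (simp add: mult_le_0_iff)
  then have "nsq n (\<lambda>i. y i - z i) = 0" unfolding N_def nsq_L2[symmetric] by simp
  moreover have "(\<lambda>i. y i - z i) \<in> bset n" using yz(1,2) \<open>nsq n (\<lambda>i. y i - z i) = 0\<close> by (simp add: bset_def)
  ultimately have "(\<lambda>i. y i - z i) = (\<lambda>i. 0)" using nsq_eq_0 by blast
  then show "y = z" by (simp add: fun_eq_iff)
 qed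
 have surj: "w \<in> H ` bset n" if w: "w \<in> bset n" for w
 proof (cases "w = a")
  case True
  have "H (\<lambda>i. 0) = a" by (simp add: H_def N_def L2_set_def)
  moreover have "(\<lambda>i. 0) \<in> bset n" by (simp add: bset_def nsq_def)
  ultimately show ?thesis using True by (metis imageI)
 next
  case False
  define v where "v = (\<lambda>i. w i - a i)"
  have v0: "N v > 0"
  proof (rule ccontr)
   assume "\<not> N v > 0"
   then have "nsq n v = 0" using N0[of v] unfolding N_def nsq_L2[symmetric] by simp
   moreover then have "v \<in> bset n" using w ab by (simp add: bset_def v_def)
   ultimately have "v = (\<lambda>i. 0)" using nsq_eq_0 by blast
   then show False using False by (simp add: v_def fun_eq_iff)
  qed
  \<comment> \<open>The ray from \<open>a\<close> through \<open>w\<close> is prolonged until it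
    meets the sphere at a parameter \<open>s\<close>; the exit point divided by \<open>s\<close> has
    norm \<open>1 / s\<close> and is mapped to \<open>w\<close>.\<close>
  define ph where "ph = (\<lambda>s::real. N (\<lambda>i. a i + s * v i))"
  have cont: "continuous_on {1..S} ph" for S
   unfolding ph_def N_def nsq_L2[symmetric]
   by (intro continuous_on_real_sqrt continuous_nsq)
    (rule continuous_on_pair_fun, intro continuous_on_add continuous_on_mult continuous_on_const continuous_on_id)
  define S where "S = max 1 ((1 + N a) / N v)"
  have "ph 1 \<le> 1" using w by (simp add: ph_def v_def N_le)
  moreover have "1 \<le> ph S"
  proof -
   have "S * N v = N (\<lambda>i. S * v i)" using scal[of S v] by (simp add: S_def)
   also have "\<dots> = N (\<lambda>i. (a i + S * v i) + (-1) * a i)" by simp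
   also have "\<dots> \<le> ph S + N (\<lambda>i. (-1) * a i)" unfolding ph_def by (rule tri)
   also have "N (\<lambda>i. (-1) * a i) = N a" using scal[of "-1" a] by simp
   finally have "S * N v \<le> ph S + N a" .
   moreover have "(1 + N a) / N v \<le> S" by (simp add: S_def)
   then have "1 + N a \<le> S * N v" using v0 by (simp add: pos_divide_le_eq)
   ultimately show ?thesis by simp
  qed
  ultimately obtain s where s: "1 \<le> s" "ph s = 1"
   using IVT'[of ph 1 1 S] cont by (auto simp: S_def)
  define y where "y = (\<lambda>i. (1 / s) * (a i + s * v i))"
  have Ny: "N y = 1 / s" using s scal[of "1 / s" "\<lambda>i. a i + s * v i"] by (simp add: y_def ph_def)
  have yb: "y \<in> bset n" using Ny s w ab by (auto simp: N_le y_def v_def)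
  have "H y i = w i" for i
   unfolding H_def Ny using s by (simp add: y_def v_def field_simps)
  then have "w = H y" by (simp add: fun_eq_iff)
  then show ?thesis using yb by blast
 qed
 have im: "H ` bset n = bset n" using Hb surj by blast
 have "continuous_on (bset n) H"
  unfolding H_def N_def nsq_L2[symmetric]
  by (rule continuous_on_pair_fun)
   (intro continuous_on_add continuous_on_mult continuous_on_diff continuous_on_const continuous_on_real_sqrt
    continuous_nsq continuous_coord continuous_on_id)
 then have "continuous_map (unit_ball n) (unit_ball n) H" using Hb by (auto simp: unit_ball_top_of_set)
 moreover have "Hausdorff_space (unit_ball n)" unfolding unit_ball_top_of_set
  by (simp add: Hausdorff_space_subtopology)
 ultimately have "homeomorphic_map (unit_ball n) (unit_ball n) H"
  using im inj by (intro continuous_imp_homeomorphic_map compact_unit_ball) simp_all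
 moreover have "H (\<lambda>i. 0) = a" by (simp add: H_def N_def L2_set_def)
 moreover have "H y = y" if "y \<in> sphr n" for y
  using that by (simp add: H_def N_def nsq_L2[symmetric] unit_ball_boundary_eq)
 ultimately show ?thesis using that by blast
qed

context cell
begin

lemma cl_closure: "cl = X closure_of e" using closure_e ..
lemma fr_closure: "fr = X closure_of e - e" using closure_e cl_eq e_fr by blast

text \<open>\<open>hvan_center\<close> deletes only the centre; precomposing the characteristic map
  with \<open>recenter_ball\<close> makes \<open>x\<close> the centre and leaves \<open>e\<close>
  and \<open>fr\<close> unchanged.\<close>

lemma hvan_minus_e:
 assumes Z: "closedin X Z" "fr \<subseteq> Z" "Z \<inter> e = {}" and x: "x \<in> e"
 shows "hvan X (Z \<union> e - {x}) Z"
proof -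
 obtain a where a: "a \<in> oball n" "x = \<Phi> a" using x unfolding e_eq by blast
 obtain H where H: "homeomorphic_map (unit_ball n) (unit_ball n) H" "H (\<lambda>i. 0) = a"
  "\<And>y. y \<in> sphr n \<Longrightarrow> H y = y" using recenter_ball[OF a(1)] by blast
 have Hs: "H ` bset n = bset n" using homeomorphic_imp_surjective_map[OF H(1)] by simp
 have Hi: "inj_on H (bset n)" using homeomorphic_imp_injective_map[OF H(1)] by simp
 have bd: "H ` sphr n = sphr n" using H(3) by (force simp: image_iff)
 have "oball n = bset n - sphr n"
  by (auto simp: unit_ball_interior_eq unit_ball_boundary_eq) (auto simp: bset_def)
 then have int: "H ` oball n = oball n"
  using inj_on_image_set_diff[OF Hi, of "bset n" "sphr n"] Hs bd
  by (auto simp: unit_ball_boundary_eq)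
 have "embedding_map (unit_ball n) X (\<Phi> \<circ> H)"
 proof -
  have "homeomorphic_map (unit_ball n) (subtopology X cl) (\<Phi> \<circ> H)"
   by (rule homeomorphic_map_compose[OF H(1) homeo])
  moreover have "(\<Phi> \<circ> H) ` bset n = cl" unfolding image_comp[symmetric] Hs cl_def ..
  ultimately show ?thesis by (simp add: embedding_map_def)
 qed
 then have "characteristic_map X n e (\<Phi> \<circ> H)"
  unfolding characteristic_map_def image_comp[symmetric] int using e_eq by simp
 then interpret c2: cell X n e "\<Phi> \<circ> H" by (simp add: cell_def haus)
 have "c2.fr = fr" unfolding c2.fr_closure fr_closure ..
 then show ?thesis using c2.hvan_center[of Z] Z H(2) a(2) by simp
qed

end

text \<open>Compared with \<open>finite_regular_CW\<close>, dimensions are fixed and cell boundaries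
  are unions of cells. The cells need not cover \<open>X\<close>, so subcomplexes are instances
  inside the same space.\<close>

locale regcw =
 fixes X :: "'a topology" and C :: "'a set set" and dm :: "'a set \<Rightarrow> nat"
 assumes haus: "Hausdorff_space X" and finC: "finite C" and disj: "disjoint C"
  and cells: "e \<in> C \<Longrightarrow> \<exists>\<Phi>. characteristic_map X (dm e) e \<Phi>"
  and bdry: "e \<in> C \<Longrightarrow> \<exists>D\<subseteq>C. X closure_of e - e = \<Union>D \<and> (\<forall>d\<in>D. dm d < dm e)"
begin

definition bdc :: "'a set \<Rightarrow> 'a set set" where
 "bdc e = {d \<in> C. d \<subseteq> X closure_of e - e}"

definition sub :: "'a set set \<Rightarrow> bool" where
 "sub S \<longleftrightarrow> S \<subseteq> C \<and> (\<forall>e\<in>S. bdc e \<subseteq> S)"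

definition below :: "'a set \<Rightarrow> 'a set \<Rightarrow> bool" where
 "below d e \<longleftrightarrow> d \<in> C \<and> e \<in> C \<and> (d = e \<or> d \<in> bdc e)"

lemma cellI: "e \<in> C \<Longrightarrow> \<exists>\<Phi>. cell X (dm e) e \<Phi>"
 using cells[of e] haus by (simp add: cell_def)

lemma cell_ne: "e \<in> C \<Longrightarrow> e \<noteq> {}"
 using cellI cell.e_nonempty by blast

lemma bdc_C: "bdc e \<subseteq> C" by (auto simp: bdc_def)

lemma bdc_finite: "finite (bdc e)" using finite_subset[OF bdc_C finC] .

lemma cell_eq: "d \<in> C \<Longrightarrow> e \<in> C \<Longrightarrow> x \<in> d \<Longrightarrow> x \<in> e \<Longrightarrow> d = e"
 using disj by (auto simp: disjoint_def)

lemma bdc_un: "e \<in> C \<Longrightarrow> X closure_of e - e = \<Union>(bdc e)"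
 and bdc_dm: "e \<in> C \<Longrightarrow> d \<in> bdc e \<Longrightarrow> dm d < dm e"
proof -
 assume e: "e \<in> C"
 obtain D where D: "D \<subseteq> C" "X closure_of e - e = \<Union>D" "\<forall>d\<in>D. dm d < dm e"
  using bdry[OF e] by (elim exE conjE)
 have "bdc e = D"
 proof
  show "D \<subseteq> bdc e" unfolding bdc_def D(2) using D(1) by auto
  show "bdc e \<subseteq> D"
  proof
   fix d assume d: "d \<in> bdc e"
   have dC: "d \<in> C" using d bdc_C by (rule rev_subsetD)
   then obtain x where x: "x \<in> d" using cell_ne[OF dC] by auto
   have "d \<subseteq> \<Union>D" using d unfolding bdc_def D(2) by simp
   then obtain d' where d': "d' \<in> D" "x \<in> d'" using x by auto
   have "d' = d" by (rule cell_eq[OF _ dC d'(2) x]) (use d' D(1) in auto)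
   then show "d \<in> D" using d' by simp
  qed
 qed
 then show "X closure_of e - e = \<Union>(bdc e)" "d \<in> bdc e \<Longrightarrow> dm d < dm e"
  by (simp_all only: D(2) bspec[OF D(3)])
qed

lemma e_closure: "e \<in> C \<Longrightarrow> e \<subseteq> X closure_of e"
proof -
 assume "e \<in> C"
 then obtain \<Phi> where "cell X (dm e) e \<Phi>" using cellI by blast
 then interpret c: cell X "dm e" e \<Phi> .
 show ?thesis using c.e_cl unfolding c.cl_closure .
qed

lemma closure_un: "e \<in> C \<Longrightarrow> X closure_of e = e \<union> \<Union>(bdc e)"
 using bdc_un[of e] e_closure[of e] by blast

lemma bdc_trans: "e \<in> C \<Longrightarrow> d \<in> bdc e \<Longrightarrow> bdc d \<subseteq> bdc e"
proof
 fix c assume e: "e \<in> C" and d: "d \<in> bdc e" and c: "c \<in> bdc d"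
 have dC: "d \<in> C" using d bdc_C by blast
 have "d \<subseteq> X closure_of e" using d by (auto simp: bdc_def)
 then have "X closure_of d \<subseteq> X closure_of e" using closure_of_minimal[of d "X closure_of e" X] by simp
 then have "c \<subseteq> X closure_of e" using c by (auto simp: bdc_def)
 moreover have "c \<inter> e = {}"
 proof (rule ccontr)
  assume "c \<inter> e \<noteq> {}"
  then obtain x where "x \<in> c" "x \<in> e" by auto
  moreover have "c \<in> C" using c bdc_C by (rule rev_subsetD)
  ultimately have "c = e" using cell_eq e by simp
  then show False using bdc_dm[OF e d] bdc_dm[OF dC c] by simp
 qed
 ultimately show "c \<in> bdc e" using c by (auto simp: bdc_def)
qed

lemma subC: "sub S \<Longrightarrow> S \<subseteq> C" by (simp add: sub_def)

lemma sub_un: "sub S \<Longrightarrow> \<Union>S = (\<Union>e\<in>S. X closure_of e)"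
proof -
 assume S: "sub S"
 have "e \<subseteq> X closure_of e" "X closure_of e \<subseteq> \<Union>S" if "e \<in> S" for e
 proof -
  have "e \<in> C" "bdc e \<subseteq> S" using S that by (auto simp: sub_def)
  then show "e \<subseteq> X closure_of e" "X closure_of e \<subseteq> \<Union>S"
   using closure_un[of e] that by auto
 qed
 then show ?thesis by blast
qed

lemma sub_closed: "sub S \<Longrightarrow> closedin X (\<Union>S)"
 unfolding sub_un using finite_subset[OF subC finC] by (intro closedin_Union) auto

lemma sub_Union_mem: "sub S \<Longrightarrow> e \<in> C \<Longrightarrow> x \<in> e \<Longrightarrow> x \<in> \<Union>S \<Longrightarrow> e \<in> S"
proof -
 assume S: "sub S" and e: "e \<in> C" "x \<in> e" "x \<in> \<Union>S"
 then obtain d where d: "d \<in> S" "x \<in> d" by auto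
 then have "d = e" using cell_eq[of d e x] subC[OF S] e by auto
 then show "e \<in> S" using d by simp
qed

lemma sub_disj: "sub S \<Longrightarrow> e \<in> C \<Longrightarrow> e \<notin> S \<Longrightarrow> \<Union>S \<inter> e = {}"
 using sub_Union_mem by blast

lemma sub_fr: "sub S \<Longrightarrow> e \<in> C \<Longrightarrow> bdc e \<subseteq> S \<Longrightarrow> X closure_of e - e \<subseteq> \<Union>S"
 using bdc_un by blast

lemma sub_Union: "sub S \<Longrightarrow> \<Union>S \<subseteq> topspace X"
 using closedin_subset[OF sub_closed] .

lemma below_refl: "e \<in> C \<Longrightarrow> below e e" by (simp add: below_def)

lemma below_trans: "below c d \<Longrightarrow> below d e \<Longrightarrow> below c e"
 unfolding below_def using bdc_trans[of e d] by auto

lemma below_dm: "below d e \<Longrightarrow> d \<noteq> e \<Longrightarrow> dm d < dm e"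
 unfolding below_def using bdc_dm by blast

lemma below_closure: "d \<in> C \<Longrightarrow> e \<in> C \<Longrightarrow> below d e \<longleftrightarrow> X closure_of d \<subseteq> X closure_of e"
proof
 assume e: "d \<in> C" "e \<in> C"
 assume "below d e"
 then have "d \<subseteq> X closure_of e" using e_closure by (auto simp: below_def bdc_def)
 then show "X closure_of d \<subseteq> X closure_of e" using closure_of_minimal[of d "X closure_of e" X] by simp
next
 assume e: "d \<in> C" "e \<in> C" and sub: "X closure_of d \<subseteq> X closure_of e"
 then have de: "d \<subseteq> X closure_of e" using e_closure by blast
 show "below d e"
 proof (cases "d \<inter> e = {}")
  case True
  then have "d \<in> bdc e" using de e by (auto simp: bdc_def)
  then show ?thesis using e by (simp add: below_def)
 next
  case False
  then obtain x where "x \<in> d" "x \<in> e" by auto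
  then have "d = e" using cell_eq e by simp
  then show ?thesis using e by (simp add: below_def)
 qed
qed

lemma sub_remove:
 assumes S: "sub S" and e: "e \<in> S" and max: "\<And>e'. e' \<in> S \<Longrightarrow> e \<in> bdc e' \<Longrightarrow> False"
 shows "sub (S - {e})"
 unfolding sub_def
proof (intro conjI ballI subsetI)
 fix d assume "d \<in> S - {e}" then show "d \<in> C" using S by (auto simp: sub_def)
next
 fix d c assume dc: "d \<in> S - {e}" "c \<in> bdc d"
 then have "c \<in> S" using S by (auto simp: sub_def)
 moreover have "c \<noteq> e" using max[of d] dc by auto
 ultimately show "c \<in> S - {e}" by simp
qed

lemma sub_minus_star: "sub S \<Longrightarrow> sub {e \<in> S. \<not> below s e}"
proof -
 assume S: "sub S"
 show ?thesis unfolding sub_def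
 proof (intro conjI ballI subsetI)
  fix d assume "d \<in> {e \<in> S. \<not> below s e}" then show "d \<in> C" using S by (auto simp: sub_def)
 next
  fix d c assume dc: "d \<in> {e \<in> S. \<not> below s e}" "c \<in> bdc d"
  then have "c \<in> S" "d \<in> C" "c \<in> C" using S by (auto simp: sub_def)
  then have "below c d" using dc by (simp add: below_def)
  then show "c \<in> {e \<in> S. \<not> below s e}" using below_trans[of s c d] dc \<open>c \<in> S\<close> by auto
 qed
qed

lemma attach:
 assumes S: "sub S" and e: "e \<in> C" "e \<notin> S" "bdc e \<subseteq> S"
 shows attach_p: "p \<noteq> dm e \<Longrightarrow> rcyc X p (\<Union>S \<union> e) (\<Union>S) c \<Longrightarrow> rbdr X p (\<Union>S \<union> e) (\<Union>S) c"
  and attach_gen: "hgen X (dm e) (X closure_of e) (X closure_of e - e) z \<Longrightarrow> hgen X (dm e) (\<Union>S \<union> e) (\<Union>S) z"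
  and attach_e: "x \<in> e \<Longrightarrow> hvan X (\<Union>S \<union> e - {x}) (\<Union>S)"
  and attach_fr: "x \<in> X closure_of e - e \<Longrightarrow> hvan X (\<Union>S \<union> e - {x}) (\<Union>S - {x})"
proof -
 obtain \<Phi> where "cell X (dm e) e \<Phi>" using cellI[OF e(1)] by blast
 then interpret c: cell X "dm e" e \<Phi> .
 note Z = sub_closed[OF S] sub_fr[OF S e(1,3), folded c.fr_closure] sub_disj[OF S e(1,2)]
 show "p \<noteq> dm e \<Longrightarrow> rcyc X p (\<Union>S \<union> e) (\<Union>S) c \<Longrightarrow> rbdr X p (\<Union>S \<union> e) (\<Union>S) c"
  by (rule c.attach_rbdr[OF Z])
 show "hgen X (dm e) (X closure_of e) (X closure_of e - e) z \<Longrightarrow> hgen X (dm e) (\<Union>S \<union> e) (\<Union>S) z"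
  using c.attach_hgen[OF Z] unfolding c.cl_closure c.fr_closure .
 show "x \<in> e \<Longrightarrow> hvan X (\<Union>S \<union> e - {x}) (\<Union>S)" by (rule c.hvan_minus_e[OF Z])
 show "x \<in> X closure_of e - e \<Longrightarrow> hvan X (\<Union>S \<union> e - {x}) (\<Union>S - {x})"
  using c.hvan_minus_fr[OF Z] unfolding c.fr_closure .
qed

text \<open>The star of \<open>s\<close> is removed by decreasing dimension. As long as
  \<open>x\<close> lies on the frontier of the removed cell \<open>attach_fr\<close> applies; the
  last cell is \<open>s\<close> itself, where \<open>attach_e\<close> takes over.\<close>

lemma hvan_minus_star:
 assumes "sub S" "s \<in> S" "x \<in> s"
 shows "hvan X (\<Union>S - {x}) (\<Union>{e \<in> S. \<not> below s e})"
 using assms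
proof (induction "card S" arbitrary: S rule: less_induct)
 case less
 have finS: "finite S" using finite_subset[OF subC[OF less.prems(1)] finC] .
 have sC: "s \<in> C" using less.prems subC by blast
 let ?st = "{e \<in> S. below s e}"
 have "?st \<noteq> {}" using less.prems(2) below_refl[OF sC] by blast
 then obtain e where e: "e \<in> ?st" "\<And>e'. e' \<in> ?st \<Longrightarrow> dm e' \<le> dm e"
  using finite_max_ex[of ?st dm] finS by auto
 have eC: "e \<in> C" "e \<in> S" using e(1) subC[OF less.prems(1)] by blast+
 have max: "e \<notin> bdc e'" if "e' \<in> S" for e'
 proof
  assume b: "e \<in> bdc e'"
  have e'C: "e' \<in> C" using that subC[OF less.prems(1)] by blast
  have "below e e'" using b e'C eC by (simp add: below_def)
  then have "e' \<in> ?st" using that below_trans e(1) by blast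
  then show False using e(2) bdc_dm[OF e'C b] by fastforce
 qed
 have sub': "sub (S - {e})" using sub_remove[OF less.prems(1) eC(2)] max by blast
 have bd: "bdc e \<subseteq> S - {e}" using less.prems(1) eC bdc_dm[OF eC(1)] unfolding sub_def by blast
 have un: "\<Union>(S - {e}) \<union> e = \<Union>S" using eC by blast
 show ?case
 proof (cases "e = s")
  case True
  have "{e \<in> S. \<not> below s e} = S - {e}"
  proof -
   have "e' = s" if "e' \<in> S" "below s e'" for e' using e(2)[of e'] that below_dm[of s e'] True by fastforce
   then show ?thesis using True below_refl[OF sC] by blast
  qed
  then show ?thesis using attach_e[OF sub' eC(1) _ bd, of x] less.prems(3) True unfolding un by simp
 next
  case False
  have "s \<in> bdc e" using e(1) False by (auto simp: below_def)
  then have xf: "x \<in> X closure_of e - e" using less.prems(3) by (auto simp: bdc_def)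
  have 1: "hvan X (\<Union>S - {x}) (\<Union>(S - {e}) - {x})"
   using attach_fr[OF sub' eC(1) _ bd xf] unfolding un by simp
  have 2: "hvan X (\<Union>(S - {e}) - {x}) (\<Union>{e' \<in> S - {e}. \<not> below s e'})"
  proof (rule less.hyps[OF _ sub'])
   show "card (S - {e}) < card S" by (rule card_Diff1_less[OF finS eC(2)])
   show "s \<in> S - {e}" using less.prems(2) False by simp
  qed (rule less.prems(3))
  have 3: "{e' \<in> S - {e}. \<not> below s e'} = {e' \<in> S. \<not> below s e'}" using e(1) by blast
  have xn: "x \<notin> \<Union>{e' \<in> S. \<not> below s e'}"
   using cell_eq[OF sC _ less.prems(3)] subC[OF less.prems(1)] below_refl[OF sC] by blast
  show ?thesis
   by (rule hvan_trans[OF 1 2[unfolded 3]]) (use 3 xn in blast)+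
 qed
qed

end

section \<open>Cellular chains\<close>

lemma frag_cmul_diff_distrib2: "frag_cmul n (a - b) = frag_cmul n a - frag_cmul n b"
 using frag_cmul_distrib2[of n "a - b" b] by simp

context regcw
begin

text \<open>An orientation of the cell, fixed once and for all.\<close>

definition zc :: "'a set \<Rightarrow> 'a chain" where
 "zc e = (SOME z. hgen X (dm e) (X closure_of e) (X closure_of e - e) z)"

definition zsum :: "'a set set \<Rightarrow> ('a set \<Rightarrow> int) \<Rightarrow> 'a chain" where
 "zsum K m = (\<Sum>e\<in>K. frag_cmul (m e) (zc e))"

lemma zc: "e \<in> C \<Longrightarrow> hgen X (dm e) (X closure_of e) (X closure_of e - e) (zc e)"
proof -
 assume "e \<in> C"
 then obtain \<Phi> where "cell X (dm e) e \<Phi>" using cellI by blast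
 then interpret c: cell X "dm e" e \<Phi> .
 show ?thesis unfolding zc_def using c.hgen_cl unfolding c.cl_closure c.fr_closure by (rule someI_ex)
qed

lemma zc_rcyc: "e \<in> C \<Longrightarrow> rcyc X (dm e) (X closure_of e) (\<Union>(bdc e)) (zc e)"
 using zc[of e] bdc_un[of e] by (simp add: hgen_def)

lemma zc_schain: "sub S \<Longrightarrow> e \<in> S \<Longrightarrow> schain X (dm e) (\<Union>S) (zc e)"
proof -
 assume S: "sub S" "e \<in> S"
 then have "schain X (dm e) (X closure_of e) (zc e)" using zc_rcyc[of e] subC by (auto simp: rcyc_def)
 moreover have "X closure_of e \<subseteq> \<Union>S" using S sub_un[OF S(1)] by auto
 ultimately show ?thesis by (rule schain_mono)
qed

lemma zsum_schain: "sub S \<Longrightarrow> (\<And>e. e \<in> K \<Longrightarrow> m e \<noteq> 0 \<Longrightarrow> e \<in> S \<and> dm e = k) \<Longrightarrow> schain X k (\<Union>S) (zsum K m)"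
proof -
 assume S: "sub S" and K: "\<And>e. e \<in> K \<Longrightarrow> m e \<noteq> 0 \<Longrightarrow> e \<in> S \<and> dm e = k"
 have "schain X k (\<Union>S) (frag_cmul (m e) (zc e))" if "e \<in> K" for e
 proof (cases "m e = 0")
  case False
  then show ?thesis using zc_schain[OF S, of e] K[OF that False] by (auto intro: singular_chain_cmul)
 qed simp
 then show ?thesis unfolding zsum_def by (rule singular_chain_sum)
qed

lemma zsum_insert: "finite K \<Longrightarrow> e \<notin> K \<Longrightarrow> zsum (insert e K) m = frag_cmul (m e) (zc e) + zsum K m"
 by (simp add: zsum_def)

lemma zsum_cong: "(\<And>e. e \<in> K \<Longrightarrow> m e = m' e) \<Longrightarrow> zsum K m = zsum K m'"
 unfolding zsum_def by (rule sum.cong) simp_all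

lemma sub_Un: "sub Z \<Longrightarrow> T \<subseteq> C \<Longrightarrow> (\<And>e. e \<in> T \<Longrightarrow> bdc e \<subseteq> Z) \<Longrightarrow> sub (Z \<union> T)"
 by (fastforce simp: sub_def)

text \<open>The relative group in degree \<open>k\<close> is free on the cells of \<open>T\<close>,
  which are attached one at a time. For independence, homology in degree \<open>k + 1\<close>
  vanishes because only a \<open>k\<close>-cell was attached.\<close>

lemma gen:
 assumes Z: "sub Z" and "finite T" and "\<And>e. e \<in> T \<Longrightarrow> e \<in> C \<and> dm e = k \<and> bdc e \<subseteq> Z \<and> e \<notin> Z"
 shows "(\<forall>c. rcyc X k (\<Union>(Z \<union> T)) (\<Union>Z) c \<longrightarrow> (\<exists>m. rbdr X k (\<Union>(Z \<union> T)) (\<Union>Z) (c - zsum T m))) \<and>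
  (\<forall>m. rbdr X k (\<Union>(Z \<union> T)) (\<Union>Z) (zsum T m) \<longrightarrow> (\<forall>e\<in>T. m e = 0))"
 using assms(2,3)
proof (induction T rule: finite_induct)
 case empty
 then show ?case by (auto simp: rcyc_def zsum_def intro: rbdr_schain)
next
 case (insert t T)
 let ?S = "Z \<union> T"
 have t: "t \<in> C" "dm t = k" "bdc t \<subseteq> Z" "t \<notin> Z" using insert.prems[of t] by auto
 have T: "e \<in> C \<and> dm e = k \<and> bdc e \<subseteq> Z \<and> e \<notin> Z" if "e \<in> T" for e using insert.prems[of e] that by simp
 have IH1: "\<And>c. rcyc X k (\<Union>?S) (\<Union>Z) c \<Longrightarrow> (\<exists>m. rbdr X k (\<Union>?S) (\<Union>Z) (c - zsum T m))"
  and IH2: "\<And>m. rbdr X k (\<Union>?S) (\<Union>Z) (zsum T m) \<Longrightarrow> (\<forall>e\<in>T. m e = 0)"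
  using insert.IH[OF T] by auto
 have S: "sub ?S" by (rule sub_Un[OF Z]) (use T in auto)
 have tS: "t \<notin> ?S" "bdc t \<subseteq> ?S" using t insert.hyps by auto
 have un: "\<Union>(Z \<union> insert t T) = \<Union>?S \<union> t" by auto
 have ZS: "\<Union>Z \<subseteq> \<Union>?S" "\<Union>?S \<subseteq> \<Union>?S \<union> t" by auto
 note g = attach_gen[OF S t(1) tS zc[OF t(1)], unfolded t(2)]
 have zt: "schain X (k - 1) (\<Union>Z) (bnd k (zc t))"
  by (rule schain_mono[where A="\<Union>(bdc t)"]) (use zc_rcyc[OF t(1)] t in \<open>auto simp: rcyc_def\<close>)
 show ?case unfolding un
 proof (intro conjI allI impI)
  fix c assume c: "rcyc X k (\<Union>?S \<union> t) (\<Union>Z) c"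
  then have "rcyc X k (\<Union>?S \<union> t) (\<Union>?S) c" by (rule rcyc_mono) (use ZS in auto)
  then obtain n where "rbdr X k (\<Union>?S \<union> t) (\<Union>?S) (c - frag_cmul n (zc t))" using g unfolding hgen_def by blast
  then obtain d e where de: "schain X (Suc k) (\<Union>?S \<union> t) d" "schain X k (\<Union>?S) e"
   "c - frag_cmul n (zc t) = bnd (Suc k) d + e" unfolding rbdr_def by blast
  have "bnd k (c - frag_cmul n (zc t)) = bnd k e"
   unfolding de(3) chain_boundary_add bdry_bdry[OF de(1)] by simp
  then have "bnd k e = bnd k c - frag_cmul n (bnd k (zc t))"
   by (simp add: chain_boundary_diff chain_boundary_cmul)
  then have "schain X (k - 1) (\<Union>Z) (bnd k e)"
   using c zt by (auto simp: rcyc_def intro!: singular_chain_diff singular_chain_cmul)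
  then have "rcyc X k (\<Union>?S) (\<Union>Z) e" using de(2) by (simp add: rcyc_def)
  then obtain m where m: "rbdr X k (\<Union>?S) (\<Union>Z) (e - zsum T m)" using IH1 by blast
  have "zsum (insert t T) (m(t := n)) = frag_cmul n (zc t) + zsum T m"
   using insert.hyps unfolding zsum_insert[OF insert.hyps] zsum_def by (auto intro!: sum.cong)
  then have eq: "c - zsum (insert t T) (m(t := n)) = bnd (Suc k) d + (e - zsum T m)"
   using de(3) by (simp add: algebra_simps)
  show "\<exists>m. rbdr X k (\<Union>?S \<union> t) (\<Union>Z) (c - zsum (insert t T) m)"
   by (rule exI[of _ "m(t := n)"], unfold eq, rule rbdr_add[OF rbdr_boundary[OF de(1)] rbdr_mono[OF m]])
    (use ZS in auto)
 next
  fix m assume a: "rbdr X k (\<Union>?S \<union> t) (\<Union>Z) (zsum (insert t T) m)"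
  have zT: "schain X k (\<Union>?S) (zsum T m)" by (rule zsum_schain[OF S]) (use T in auto)
  have "rbdr X k (\<Union>?S \<union> t) (\<Union>?S) (zsum (insert t T) m)" by (rule rbdr_mono[OF a]) (use ZS in auto)
  from rbdr_diff[OF this rbdr_schain[OF zT]]
  have "rbdr X k (\<Union>?S \<union> t) (\<Union>?S) (frag_cmul (m t) (zc t))" unfolding zsum_insert[OF insert.hyps] by simp
  then have mt: "m t = 0" using g unfolding hgen_def by blast
  then have "rbdr X k (\<Union>?S \<union> t) (\<Union>Z) (zsum T m)" using a unfolding zsum_insert[OF insert.hyps] by simp
  then obtain d e where de: "schain X (Suc k) (\<Union>?S \<union> t) d" "schain X k (\<Union>Z) e"
   "zsum T m = bnd (Suc k) d + e" unfolding rbdr_def by blast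
  have "bnd (Suc k) d = zsum T m - e" using de(3) by simp
  then have "schain X k (\<Union>?S) (bnd (Suc k) d)"
   using zT schain_mono[OF de(2) ZS(1)] by (simp add: singular_chain_diff)
  then have "rcyc X (Suc k) (\<Union>?S \<union> t) (\<Union>?S) d" using de(1) by (simp add: rcyc_def)
  then have "rbdr X (Suc k) (\<Union>?S \<union> t) (\<Union>?S) d" by (rule attach_p[OF S t(1) tS, rotated]) (use t in simp)
  then obtain q d' where q: "schain X (Suc (Suc k)) (\<Union>?S \<union> t) q" "schain X (Suc k) (\<Union>?S) d'"
   "d = bnd (Suc (Suc k)) q + d'" unfolding rbdr_def by blast
  have "bnd (Suc k) d = bnd (Suc k) d'"
   unfolding q(3) chain_boundary_add bdry_bdry[OF q(1)] by simp
  then have "rbdr X k (\<Union>?S) (\<Union>Z) (zsum T m)" using q(2) de(2,3) unfolding rbdr_def by auto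
  then show "\<forall>e\<in>insert t T. m e = 0" using IH2 mt by blast
 qed
qed

text \<open>Cells are stripped off by decreasing dimension; each contributes homology only in its
  own dimension, which is never \<open>p\<close>.\<close>

lemma van:
 assumes "sub Y" "sub Z" "Z \<subseteq> Y" "\<And>e. e \<in> Y \<Longrightarrow> e \<notin> Z \<Longrightarrow> dm e \<noteq> p" "rcyc X p (\<Union>Y) (\<Union>Z) c"
 shows "rbdr X p (\<Union>Y) (\<Union>Z) c"
 using assms
proof (induction "card (Y - Z)" arbitrary: Y c rule: less_induct)
 case less
 have finY: "finite Y" using finite_subset[OF subC[OF less.prems(1)] finC] .
 show ?case
 proof (cases "Y = Z")
  case True
  then show ?thesis using less.prems(5) by (auto simp: rcyc_def intro: rbdr_schain)
 next
  case False
  then have "Y - Z \<noteq> {}" using less.prems(3) by auto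
  then obtain e where e: "e \<in> Y - Z" "\<And>e'. e' \<in> Y - Z \<Longrightarrow> dm e' \<le> dm e"
   using finite_max_ex[of "Y - Z" dm] finY by auto
  have eC: "e \<in> C" using e subC[OF less.prems(1)] by auto
  have sub': "sub (Y - {e})"
  proof (rule sub_remove[OF less.prems(1)])
   fix e' assume e': "e' \<in> Y" "e \<in> bdc e'"
   then have "e' \<notin> Z" using less.prems(2) e(1) by (auto simp: sub_def)
   moreover have "dm e < dm e'" using bdc_dm[of e' e] e' subC[OF less.prems(1)] by auto
   ultimately show False using e(2)[of e'] e'(1) by auto
  qed (use e in simp)
  have bd: "bdc e \<subseteq> Y - {e}" using less.prems(1) e bdc_dm[OF eC] by (fastforce simp: sub_def)
  have un: "\<Union>(Y - {e}) \<union> e = \<Union>Y" using e by auto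
  have ZS: "\<Union>Z \<subseteq> \<Union>(Y - {e})" "Z \<subseteq> Y - {e}" using e less.prems(3) by auto
  have "rcyc X p (\<Union>(Y - {e}) \<union> e) (\<Union>(Y - {e})) c" unfolding un
   by (rule rcyc_mono[OF less.prems(5)]) (use ZS in auto)
  then have "rbdr X p (\<Union>(Y - {e}) \<union> e) (\<Union>(Y - {e})) c"
   by (rule attach_p[OF sub' eC _ bd, rotated 2]) (use less.prems(4)[of e] e in auto)
  then obtain d e' where de: "schain X (Suc p) (\<Union>Y) d" "schain X p (\<Union>(Y - {e})) e'"
   "c = bnd (Suc p) d + e'" unfolding rbdr_def un by blast
  have "bnd p c = bnd p e'"
   unfolding de(3) chain_boundary_add bdry_bdry[OF de(1)] by simp
  then have "rcyc X p (\<Union>(Y - {e})) (\<Union>Z) e'" using less.prems(5) de(2) by (simp add: rcyc_def)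
  then have "rbdr X p (\<Union>(Y - {e})) (\<Union>Z) e'"
  proof (rule less.hyps[OF _ sub' less.prems(2) ZS(2), rotated 2])
   show "card (Y - {e} - Z) < card (Y - Z)" using e finY by (intro psubset_card_mono) auto
  qed (use less.prems(4) in auto)
  then have "rbdr X p (\<Union>Y) (\<Union>Z) e'" by (rule rbdr_mono) auto
  then show ?thesis unfolding de(3) by (rule rbdr_add[OF rbdr_boundary[OF de(1)]])
 qed
qed

definition cdim :: "nat \<Rightarrow> 'a set set" where "cdim k = {e \<in> C. dm e = k}"

text \<open>The incidence number: the coefficient of \<open>zc d\<close> in an expansion of the
  boundary of \<open>zc e\<close> modulo cells of lower dimension. Such an expansion exists by
  \<open>gen\<close>.\<close>

definition inc :: "'a set \<Rightarrow> 'a set \<Rightarrow> int" where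
 "inc d e = (if e \<in> C \<and> d \<in> bdc e \<and> dm e = Suc (dm d)
   then (SOME m. rbdr X (dm d) (\<Union>(bdc e)) (\<Union>{c \<in> bdc e. dm c < dm d})
    (bnd (dm e) (zc e) - zsum {c \<in> bdc e. dm c = dm d} m)) d else 0)"

lemma inc_nz: "inc d e \<noteq> 0 \<Longrightarrow> d \<in> C \<and> e \<in> C \<and> d \<in> bdc e \<and> dm e = Suc (dm d)"
 using bdc_C by (auto simp: inc_def split: if_splits)

lemma zsum_cdim:
 assumes "K \<subseteq> cdim k" "\<And>d. d \<in> cdim k \<Longrightarrow> d \<notin> K \<Longrightarrow> m d = 0"
 shows "zsum (cdim k) m = zsum K m"
 unfolding zsum_def using assms finC by (intro sum.mono_neutral_right) (auto simp: cdim_def)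

lemma bd_zc:
 assumes e: "e \<in> C" "dm e = Suc j"
 shows "rbdr X j (\<Union>(bdc e)) (\<Union>{c \<in> bdc e. dm c < j}) (bnd (Suc j) (zc e) - zsum (cdim j) (\<lambda>d. inc d e))"
proof -
 let ?Z = "{c \<in> bdc e. dm c < j}" and ?T = "{c \<in> bdc e. dm c = j}"
 have un: "?Z \<union> ?T = bdc e" using bdc_dm[OF e(1)] e(2) by fastforce
 have Z: "sub ?Z" unfolding sub_def
 proof (intro conjI ballI subsetI)
  fix d assume "d \<in> ?Z" then show "d \<in> C" using bdc_C by auto
 next
  fix d c assume dc: "d \<in> ?Z" "c \<in> bdc d"
  then have "d \<in> C" using bdc_C by auto
  then have "dm c < dm d" by (rule bdc_dm[OF _ dc(2)])
  then show "c \<in> ?Z" using bdc_trans[OF e(1), of d] dc by auto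
 qed
 have T: "d \<in> C \<and> dm d = j \<and> bdc d \<subseteq> ?Z \<and> d \<notin> ?Z" if "d \<in> ?T" for d
 proof -
  have "d \<in> C" using that bdc_C by auto
  then show ?thesis using that bdc_trans[OF e(1), of d] bdc_dm[of d] by auto
 qed
 have finT: "finite ?T" using bdc_finite by simp
 note g = gen[OF Z finT T, unfolded un]
 have "schain X (Suc j) (X closure_of e) (zc e)" "schain X j (\<Union>(bdc e)) (bnd (Suc j) (zc e))"
  using zc_rcyc[OF e(1)] e(2) by (auto simp: rcyc_def)
 then have "rcyc X j (\<Union>(bdc e)) (\<Union>?Z) (bnd (Suc j) (zc e))"
  using bdry_bdry[where d="zc e" and A="X closure_of e" and p=j and X=X] by (simp add: rcyc_def)
 then have ex: "\<exists>m. rbdr X j (\<Union>(bdc e)) (\<Union>?Z) (bnd (Suc j) (zc e) - zsum ?T m)"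
  using g[THEN conjunct1, THEN spec, THEN mp] by simp
 have "zsum (cdim j) (\<lambda>d. inc d e) = zsum ?T (\<lambda>d. inc d e)"
  by (rule zsum_cdim) (use inc_nz bdc_C in \<open>auto simp: cdim_def\<close>)
 also have "\<dots> = zsum ?T (SOME m. rbdr X j (\<Union>(bdc e)) (\<Union>?Z) (bnd (Suc j) (zc e) - zsum ?T m))"
  by (rule zsum_cong) (auto simp: inc_def e)
 finally show ?thesis using someI_ex[OF ex] by simp
qed

text \<open>The inequality is strict: stage 0 is \<open>L\<close> itself, and stage
  \<open>Suc k\<close> adds exactly \<open>top_cells Y L k\<close>.\<close>

definition sk :: "'a set set \<Rightarrow> 'a set set \<Rightarrow> nat \<Rightarrow> 'a set set" where
 "sk Y L k = L \<union> {e \<in> Y. dm e < k}"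

definition top_cells :: "'a set set \<Rightarrow> 'a set set \<Rightarrow> nat \<Rightarrow> 'a set set" where
 "top_cells Y L k = {e \<in> Y - L. dm e = k}"

context
 fixes Y L
 assumes Y: "sub Y" and L: "sub L" and LY: "L \<subseteq> Y"
begin

lemma sk_sub: "sub (sk Y L k)"
 unfolding sub_def
proof (intro conjI ballI subsetI)
 fix d assume "d \<in> sk Y L k" then show "d \<in> C" using subC[OF Y] subC[OF L] by (auto simp: sk_def)
next
 fix d c assume dc: "d \<in> sk Y L k" "c \<in> bdc d"
 show "c \<in> sk Y L k"
 proof (cases "d \<in> L")
  case True then show ?thesis using dc L by (auto simp: sub_def sk_def)
 next
  case False
  then have d: "d \<in> Y" "dm d < k" using dc by (auto simp: sk_def)
  then have "d \<in> C" using subC[OF Y] by auto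
  then have "dm c < k" using bdc_dm[of d c] dc d by auto
  then show ?thesis using d dc Y by (auto simp: sub_def sk_def)
 qed
qed

lemma sk_top: "sk Y L k \<union> top_cells Y L k = sk Y L (Suc k)"
 by (auto simp: sk_def top_cells_def)

lemma sk_mono: "j \<le> k \<Longrightarrow> \<Union>(sk Y L j) \<subseteq> \<Union>(sk Y L k)" "\<Union>L \<subseteq> \<Union>(sk Y L k)" "\<Union>(sk Y L k) \<subseteq> \<Union>Y"
 using LY by (fastforce simp: sk_def)+

lemma sk_gen:
 "rcyc X k (\<Union>(sk Y L (Suc k))) (\<Union>(sk Y L k)) c \<Longrightarrow>
   \<exists>m. rbdr X k (\<Union>(sk Y L (Suc k))) (\<Union>(sk Y L k)) (c - zsum (top_cells Y L k) m)"
 "rbdr X k (\<Union>(sk Y L (Suc k))) (\<Union>(sk Y L k)) (zsum (top_cells Y L k) m) \<Longrightarrow> e \<in> top_cells Y L k \<Longrightarrow> m e = 0"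
proof -
 have fin: "finite (top_cells Y L k)" using finite_subset[OF subC[OF Y] finC] by (simp add: top_cells_def)
 have "e \<in> C \<and> dm e = k \<and> bdc e \<subseteq> sk Y L k \<and> e \<notin> sk Y L k" if e: "e \<in> top_cells Y L k" for e
 proof -
  have "e \<in> C" "e \<in> Y" using e subC[OF Y] by (auto simp: top_cells_def)
  then show ?thesis using e Y bdc_dm[of e] by (auto simp: top_cells_def sk_def sub_def)
 qed
 note g = gen[OF sk_sub fin this, unfolded sk_top]
 show "rcyc X k (\<Union>(sk Y L (Suc k))) (\<Union>(sk Y L k)) c \<Longrightarrow>
   \<exists>m. rbdr X k (\<Union>(sk Y L (Suc k))) (\<Union>(sk Y L k)) (c - zsum (top_cells Y L k) m)"
  using g by simp
 show "rbdr X k (\<Union>(sk Y L (Suc k))) (\<Union>(sk Y L k)) (zsum (top_cells Y L k) m) \<Longrightarrow> e \<in> top_cells Y L k \<Longrightarrow> m e = 0"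
  using g by simp
qed

lemma bd_sk:
 assumes e: "e \<in> Y" "dm e = Suc j"
 shows "rbdr X j (\<Union>(sk Y L (Suc j))) (\<Union>(sk Y L j)) (bnd (Suc j) (zc e) - zsum (cdim j) (\<lambda>d. inc d e))"
proof -
 have eC: "e \<in> C" using e subC[OF Y] by auto
 have "bdc e \<subseteq> Y" using Y e by (auto simp: sub_def)
 then show ?thesis
  by (intro rbdr_mono[OF bd_zc[OF eC e(2)]] Union_mono) (use bdc_dm[OF eC] e(2) in \<open>auto simp: sk_def\<close>)
qed

lemma zsum_swap: "(\<Sum>e\<in>K. frag_cmul (n e) (zsum J (\<lambda>d. inc d e))) = zsum J (\<lambda>d. \<Sum>e\<in>K. inc d e * n e)"
proof -
 have s: "frag_cmul (sum g K) z = (\<Sum>e\<in>K. frag_cmul (g e) z)" for g :: "'a set \<Rightarrow> int" and z :: "'a chain"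
  by (induction K rule: infinite_finite_induct) (auto simp: frag_cmul_distrib)
 show ?thesis unfolding zsum_def frag_cmul_sum s
  by (subst sum.swap) (simp add: mult.commute)
qed

lemma bd_zsum_sk:
 assumes K: "\<And>e. e \<in> K \<Longrightarrow> e \<in> Y \<and> dm e = Suc j"
 shows "rbdr X j (\<Union>(sk Y L (Suc j))) (\<Union>(sk Y L j))
  (bnd (Suc j) (zsum K n) - zsum (cdim j) (\<lambda>d. \<Sum>e\<in>K. inc d e * n e))"
proof -
 have eq: "bnd (Suc j) (zsum K n) - zsum (cdim j) (\<lambda>d. \<Sum>e\<in>K. inc d e * n e) =
  (\<Sum>e\<in>K. frag_cmul (n e) (bnd (Suc j) (zc e) - zsum (cdim j) (\<lambda>d. inc d e)))"
  unfolding zsum_swap[symmetric] zsum_def[of K] chain_boundary_sum chain_boundary_cmul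
  by (simp add: sum_subtractf[symmetric] frag_cmul_diff_distrib2 chain_boundary_cmul)
 show ?thesis unfolding eq by (intro rbdr_sum rbdr_cmul bd_sk) (use K in auto)
qed

lemma red_sk:
 assumes m: "\<And>d. m d \<noteq> 0 \<Longrightarrow> d \<in> Y"
 shows "rbdr X k (\<Union>(sk Y L (Suc k))) (\<Union>(sk Y L k)) (zsum (cdim k) m - zsum (top_cells Y L k) m)"
proof -
 have "zsum (cdim k) m = zsum (cdim k \<inter> Y) m" by (rule zsum_cdim) (use m in auto)
 also have "cdim k \<inter> Y = top_cells Y L k \<union> (cdim k \<inter> L)"
  using LY subC[OF Y] by (auto simp: cdim_def top_cells_def)
 also have "zsum \<dots> m = zsum (top_cells Y L k) m + zsum (cdim k \<inter> L) m"
  unfolding zsum_def using finite_subset[OF subC[OF Y] finC] finC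
  by (intro sum.union_disjoint) (auto simp: top_cells_def cdim_def)
 finally have eq: "zsum (cdim k) m - zsum (top_cells Y L k) m = zsum (cdim k \<inter> L) m" by simp
 have "schain X k (\<Union>(sk Y L k)) (zsum (cdim k \<inter> L) m)"
  by (rule zsum_schain[OF sk_sub]) (auto simp: cdim_def sk_def)
 then show ?thesis unfolding eq by (rule rbdr_schain)
qed

end

lemma sub_C: "sub C" using bdc_C by (auto simp: sub_def)

lemma sub_empty: "sub {}" by (simp add: sub_def)

text \<open>As the singular boundary squares to zero, the expansion of \<open>bnd (zc e)\<close> has
  the same boundary as a chain of the lower skeleton; uniqueness of coefficients in
  \<open>sk_gen\<close> makes the coefficient at \<open>d\<close> vanish.\<close>

lemma inc_inc: "(\<Sum>c\<in>C. inc d c * inc c e) = 0"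
proof (cases "d \<in> C \<and> e \<in> C \<and> dm e = Suc (Suc (dm d))")
 case False
 have "inc d c * inc c e = 0" for c using inc_nz[of d c] inc_nz[of c e] False
  by (cases "inc d c = 0"; cases "inc c e = 0") auto
 then show ?thesis by (intro sum.neutral ballI)
next
 case True
 define j where "j = dm d"
 have e: "e \<in> C" "dm e = Suc (Suc j)" and d: "d \<in> C" using True by (auto simp: j_def)
 note S = sub_C sub_empty empty_subsetI[of C]
 let ?A = "\<lambda>k. \<Union>(sk C {} k)"
 obtain w w' where w: "schain X (Suc (Suc j)) (?A (Suc (Suc j))) w" "schain X (Suc j) (?A (Suc j)) w'"
  "bnd (Suc (Suc j)) (zc e) - zsum (cdim (Suc j)) (\<lambda>d. inc d e) = bnd (Suc (Suc j)) w + w'"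
  using bd_sk[OF S e] unfolding rbdr_def by blast
 have ze: "schain X (Suc (Suc j)) (X closure_of e) (zc e)"
  using zc_rcyc[OF e(1)] e(2) by (auto simp: rcyc_def)
 have "bnd (Suc j) (bnd (Suc (Suc j)) (zc e) - zsum (cdim (Suc j)) (\<lambda>d. inc d e)) = bnd (Suc j) w'"
  unfolding w(3) chain_boundary_add bdry_bdry[OF w(1)] by simp
 then have b: "bnd (Suc j) (zsum (cdim (Suc j)) (\<lambda>d. inc d e)) = bnd (Suc j) (- w')"
  unfolding chain_boundary_diff bdry_bdry[OF ze] chain_boundary_minus by (simp add: minus_equation_iff)
 let ?m = "\<lambda>d. \<Sum>c\<in>cdim (Suc j). inc d c * inc c e"
 have 1: "rbdr X j (?A (Suc j)) (?A j) (bnd (Suc j) (- w') - zsum (cdim j) ?m)"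
  using bd_zsum_sk[OF S, of "cdim (Suc j)" j "\<lambda>d. inc d e"] unfolding b by (auto simp: cdim_def)
 have 2: "rbdr X j (?A (Suc j)) (?A j) (bnd (Suc j) (- w'))"
  by (rule rbdr_boundary) (use singular_chain_cmul[OF w(2), of "-1"] in simp)
 have 3: "rbdr X j (?A (Suc j)) (?A j) (zsum (cdim j) ?m)" using rbdr_diff[OF 2 1] by simp
 have tc: "top_cells C {} j = cdim j" by (auto simp: top_cells_def cdim_def)
 have "?m d = 0" by (rule sk_gen(2)[OF S, of j ?m d]) (use 3 d in \<open>simp_all add: tc, simp add: cdim_def j_def\<close>)
 moreover have "(\<Sum>c\<in>C. inc d c * inc c e) = ?m d"
  using inc_nz[of d] by (intro sum.mono_neutral_right) (auto simp: finC cdim_def j_def)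
 ultimately show ?thesis by simp
qed

text \<open>A cellular cycle becomes a singular relative cycle after a correction \<open>w\<close>
  of lower filtration. It bounds by hypothesis, the bounding chain is pressed into the next
  skeleton, and its coefficients there are the solution.\<close>

theorem cellular_exact:
 assumes Y: "sub Y" and L: "sub L" and LY: "L \<subseteq> Y"
  and van_k: "\<And>c. rcyc X k (\<Union>Y) (\<Union>L) c \<Longrightarrow> rbdr X k (\<Union>Y) (\<Union>L) c"
  and n: "\<And>a. n a \<noteq> 0 \<Longrightarrow> dm a = k" "\<And>a. a \<in> Y - L \<Longrightarrow> (\<Sum>b\<in>Y-L. inc a b * n b) = 0"
 shows "\<exists>y. (\<forall>b. y b \<noteq> 0 \<longrightarrow> dm b = Suc k) \<and> (\<forall>a\<in>Y-L. (\<Sum>b\<in>Y-L. inc a b * y b) = n a)"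
proof -
 note S = Y L LY
 let ?A = "\<lambda>k. \<Union>(sk Y L k)" and ?T = "top_cells Y L"
 define c where "c = zsum (?T k) n"
 have finY: "finite Y" using finite_subset[OF subC[OF Y] finC] .
 have TY: "e \<in> Y \<and> dm e = i" if "e \<in> ?T i" for e i using that by (auto simp: top_cells_def)
 have incY: "e \<in> Y \<Longrightarrow> inc d e \<noteq> 0 \<Longrightarrow> d \<in> Y" for d e using inc_nz[of d e] Y by (auto simp: sub_def)
 have cs: "schain X k (?A (Suc k)) c" unfolding c_def
  by (rule zsum_schain[OF sk_sub[OF S]]) (auto simp: top_cells_def sk_def)
 have sumT: "(\<Sum>b\<in>Y-L. inc a b * f b) = (\<Sum>b\<in>?T i. inc a b * f b)" if "\<And>b. f b \<noteq> 0 \<Longrightarrow> dm b = i" for a f i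
  using that finY by (intro sum.mono_neutral_right) (auto simp: top_cells_def)
 \<comment> \<open>The boundary of \<open>c\<close> agrees with that of a chain in a lower skeleton
   only up to a remainder. That remainder lives on cells of dimension below its degree, so
   \<open>van\<close> fills it there modulo \<open>L\<close>.\<close>
 have "\<exists>w. schain X k (?A k) w \<and> rcyc X k (\<Union>Y) (\<Union>L) (c - w)"
 proof (cases k)
  case 0
  have "schain X k (\<Union>Y) c" by (rule schain_mono[OF cs sk_mono(3)[OF S]])
  then have "rcyc X k (\<Union>Y) (\<Union>L) (c - 0)" using 0 by (simp add: rcyc_def chain_boundary_def)
  then show ?thesis by (intro exI[of _ 0]) simp
 next
  case (Suc j)
  let ?m = "\<lambda>d. \<Sum>e\<in>?T k. inc d e * n e"
  have m: "d \<in> Y" if nz: "?m d \<noteq> 0" for d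
  proof -
   obtain e where "e \<in> ?T k" "inc d e * n e \<noteq> 0" using nz by (meson sum.neutral)
   then show ?thesis using incY[of e d] TY by auto
  qed
  have "zsum (?T j) ?m = 0" unfolding zsum_def
  proof (rule sum.neutral, rule ballI)
   fix a assume "a \<in> ?T j"
   then have "?m a = 0" using n(2)[of a] sumT[of n k a] n(1) by (auto simp: top_cells_def)
   then show "frag_cmul (?m a) (zc a) = 0" by simp
  qed
  then have "rbdr X j (?A k) (?A j) (zsum (cdim j) ?m)" using red_sk[OF S, of ?m j] m Suc by auto
  moreover have "rbdr X j (?A k) (?A j) (bnd k c - zsum (cdim j) ?m)"
   unfolding Suc c_def by (rule bd_zsum_sk[OF S]) (use TY in auto)
  ultimately have "rbdr X j (?A k) (?A j) (bnd k c)" using rbdr_add by fastforce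
  then obtain w w' where w: "schain X k (?A k) w" "schain X j (?A j) w'" "bnd k c = bnd k w + w'"
   unfolding rbdr_def Suc by blast
  have "bnd j (bnd k c) = 0" "bnd j (bnd k w) = 0"
   using bdry_bdry cs w(1) unfolding Suc by blast+
  then have "bnd j w' = 0" using w(3) by (simp add: chain_boundary_add)
  then have "rcyc X j (?A j) (\<Union>L) w'" using w(2) by (simp add: rcyc_def)
  then have "rbdr X j (?A j) (\<Union>L) w'" by (rule van[OF sk_sub[OF S] L, rotated 2]) (auto simp: sk_def)
  then obtain v v' where v: "schain X k (?A j) v" "schain X j (\<Union>L) v'" "w' = bnd k v + v'"
   unfolding rbdr_def Suc by blast
  have vk: "schain X k (?A k) v" using schain_mono[OF v(1) sk_mono(1)[OF S]] Suc by auto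
  have "bnd k (c - (w + v)) = v'"
   unfolding chain_boundary_diff chain_boundary_add w(3) v(3) by simp
  moreover have "schain X k (\<Union>Y) (c - (w + v))"
   using schain_mono[OF cs sk_mono(3)[OF S]] schain_mono[OF w(1) sk_mono(3)[OF S]] schain_mono[OF vk sk_mono(3)[OF S]]
   by (intro singular_chain_diff singular_chain_add)
  ultimately have "rcyc X k (\<Union>Y) (\<Union>L) (c - (w + v))" using v(2) Suc by (simp add: rcyc_def)
  then show ?thesis using singular_chain_add[OF w(1) vk] by blast
 qed
 then obtain w where w: "schain X k (?A k) w" "rcyc X k (\<Union>Y) (\<Union>L) (c - w)" by blast
 obtain y l where y: "schain X (Suc k) (\<Union>Y) y" "schain X k (\<Union>L) l" "c - w = bnd (Suc k) y + l"
  using van_k[OF w(2)] unfolding rbdr_def by blast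
 have wA: "schain X k (?A (Suc k)) w" by (rule schain_mono[OF w(1) sk_mono(1)[OF S]]) simp
 have lA: "schain X k (?A i) l" for i by (rule schain_mono[OF y(2) sk_mono(2)[OF S]])
 have bdy: "bnd (Suc k) y = c - w - l" using y(3) by (simp add: algebra_simps)
 have byA: "schain X k (?A (Suc k)) (bnd (Suc k) y)"
  unfolding bdy using cs wA lA by (intro singular_chain_diff)
 \<comment> \<open>The cells of \<open>Y\<close> outside this stage have dimension above
   \<open>k + 1\<close>, so \<open>van\<close> lets \<open>y\<close> be replaced by a chain of the
   skeleton with the same boundary.\<close>
 have "rcyc X (Suc k) (\<Union>Y) (?A (Suc (Suc k))) y"
  using y(1) schain_mono[OF byA sk_mono(1)[OF S]] by (simp add: rcyc_def)
 then have "rbdr X (Suc k) (\<Union>Y) (?A (Suc (Suc k))) y"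
  by (rule van[OF Y sk_sub[OF S], rotated 2]) (use LY in \<open>auto simp: sk_def\<close>)
 then obtain q y' where q: "schain X (Suc (Suc k)) (\<Union>Y) q" "schain X (Suc k) (?A (Suc (Suc k))) y'"
  "y = bnd (Suc (Suc k)) q + y'" unfolding rbdr_def by blast
 have bdy': "bnd (Suc k) y = bnd (Suc k) y'"
  unfolding q(3) chain_boundary_add bdry_bdry[OF q(1)] by simp
 then have "rcyc X (Suc k) (?A (Suc (Suc k))) (?A (Suc k)) y'" using q(2) byA by (simp add: rcyc_def)
 from sk_gen(1)[OF S this] obtain m where
  m: "rbdr X (Suc k) (?A (Suc (Suc k))) (?A (Suc k)) (y' - zsum (?T (Suc k)) m)" ..
 then obtain r r' where r: "schain X (Suc (Suc k)) (?A (Suc (Suc k))) r" "schain X (Suc k) (?A (Suc k)) r'"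
  "y' - zsum (?T (Suc k)) m = bnd (Suc (Suc k)) r + r'" unfolding rbdr_def by blast
 have "bnd (Suc k) (y' - zsum (?T (Suc k)) m) = bnd (Suc k) r'"
  unfolding r(3) chain_boundary_add bdry_bdry[OF r(1)] by simp
 then have c_eq: "c = bnd (Suc k) (zsum (?T (Suc k)) m) + bnd (Suc k) r' + (w + l)"
  using bdy bdy' by (simp add: chain_boundary_diff algebra_simps)
 let ?m = "\<lambda>d. \<Sum>e\<in>?T (Suc k). inc d e * m e"
 have mY: "d \<in> Y" if nz: "?m d \<noteq> 0" for d
 proof -
  obtain e where "e \<in> ?T (Suc k)" "inc d e * m e \<noteq> 0" using nz by (meson sum.neutral)
  then show ?thesis using incY[of e d] TY by auto
 qed
 have 1: "rbdr X k (?A (Suc k)) (?A k) (bnd (Suc k) (zsum (?T (Suc k)) m) - zsum (cdim k) ?m)"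
  by (rule bd_zsum_sk[OF S]) (use TY in auto)
 have 2: "rbdr X k (?A (Suc k)) (?A k) (bnd (Suc k) r' + (w + l))"
  by (rule rbdr_add[OF rbdr_boundary[OF r(2)] rbdr_schain[OF singular_chain_add[OF w(1) lA]]])
 have 3: "rbdr X k (?A (Suc k)) (?A k) (zsum (cdim k) ?m - zsum (?T k) ?m)"
  by (rule red_sk[OF S]) (use mY in blast)
 have zd: "zsum (?T k) (\<lambda>a. n a - ?m a) = c - zsum (?T k) ?m"
  unfolding c_def zsum_def frag_cmul_diff_distrib sum_subtractf ..
 have eq: "zsum (?T k) (\<lambda>a. n a - ?m a) =
   ((bnd (Suc k) (zsum (?T (Suc k)) m) - zsum (cdim k) ?m) + (bnd (Suc k) r' + (w + l)))
   + (zsum (cdim k) ?m - zsum (?T k) ?m)"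
  unfolding zd c_eq by (simp add: algebra_simps)
 have z: "rbdr X k (?A (Suc k)) (?A k) (zsum (?T k) (\<lambda>a. n a - ?m a))"
  unfolding eq by (rule rbdr_add[OF rbdr_add[OF 1 2] 3])
 define f where "f = (\<lambda>b. if dm b = Suc k then m b else 0)"
 have f_nz: "f b \<noteq> 0 \<Longrightarrow> dm b = Suc k" for b by (simp add: f_def split: if_splits)
 have "(\<Sum>b\<in>Y-L. inc a b * f b) = n a" if a: "a \<in> Y - L" for a
 proof -
  have s: "(\<Sum>b\<in>Y-L. inc a b * f b) = ?m a"
   by (rule trans[OF sumT[OF f_nz]], assumption, rule sum.cong[OF refl]) (simp add: f_def top_cells_def)
  show ?thesis
  proof (cases "dm a = k")
   case True
   then have "n a - ?m a = 0" using sk_gen(2)[OF S z, of a] a by (auto simp: top_cells_def)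
   then show ?thesis using s by simp
  next
   case False
   then have "n a = 0" using n(1) by blast
   moreover have "?m a = 0" using False inc_nz[of a] by (intro sum.neutral) (fastforce simp: top_cells_def)
   ultimately show ?thesis using s by simp
  qed
 qed
 then show ?thesis by (intro exI[of _ f]) (auto simp: f_def)
qed

end

text \<open>Built rank by rank, as for a bounded exact complex of free modules: for \<open>b\<close>
  of rank \<open>D\<close> the error \<open>n b\<close> of the contraction so far is a cycle, and a
  primitive of it becomes the new column at \<open>b\<close>.\<close>

lemma partial_contraction:
 fixes eps :: "'p \<Rightarrow> 'p \<Rightarrow> int"
 assumes fin: "finite Q"
  and eps_rk: "\<And>a b. eps a b \<noteq> 0 \<Longrightarrow> rk b = Suc (rk a)"
  and eps_eps: "\<And>a c. a \<in> Q \<Longrightarrow> c \<in> Q \<Longrightarrow> (\<Sum>b\<in>Q. eps a b * eps b c) = 0"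
  and exact: "\<And>k n. k < D \<Longrightarrow> (\<And>a. n a \<noteq> 0 \<Longrightarrow> rk a = k) \<Longrightarrow> (\<And>a. a \<in> Q \<Longrightarrow> (\<Sum>b\<in>Q. eps a b * n b) = 0) \<Longrightarrow>
    \<exists>y. (\<forall>b. y b \<noteq> 0 \<longrightarrow> rk b = Suc k) \<and> (\<forall>a\<in>Q. (\<Sum>b\<in>Q. eps a b * y b) = n a)"
 shows "\<exists>s::'p \<Rightarrow> 'p \<Rightarrow> int. (\<forall>a b. s a b \<noteq> 0 \<longrightarrow> rk a = Suc (rk b)) \<and>
   (\<forall>a\<in>Q. \<forall>b\<in>Q. rk b < D \<longrightarrow> (\<Sum>c\<in>Q. s a c * eps c b + eps a c * s c b) = (if a = b then 1 else 0))"
 using exact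
proof (induction D)
 case 0
 then show ?case by (intro exI[of _ "\<lambda>_ _. 0"]) simp
next
 case (Suc D)
 obtain s :: "'p \<Rightarrow> 'p \<Rightarrow> int" where s: "\<forall>a b. s a b \<noteq> 0 \<longrightarrow> rk a = Suc (rk b)"
  "\<forall>a\<in>Q. \<forall>b\<in>Q. rk b < D \<longrightarrow> (\<Sum>c\<in>Q. s a c * eps c b + eps a c * s c b) = (if a = b then 1 else 0)"
 proof -
  have "\<exists>s::'p \<Rightarrow> 'p \<Rightarrow> int. (\<forall>a b. s a b \<noteq> 0 \<longrightarrow> rk a = Suc (rk b)) \<and>
   (\<forall>a\<in>Q. \<forall>b\<in>Q. rk b < D \<longrightarrow> (\<Sum>c\<in>Q. s a c * eps c b + eps a c * s c b) = (if a = b then 1 else 0))"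
   by (rule Suc.IH) (rule Suc.prems, auto)
  then show thesis by (elim exE conjE) (rule that)
 qed
 have s1: "\<And>a b. s a b \<noteq> 0 \<Longrightarrow> rk a = Suc (rk b)"
  and s2: "\<And>a b. a \<in> Q \<Longrightarrow> b \<in> Q \<Longrightarrow> rk b < D \<Longrightarrow>
   (\<Sum>c\<in>Q. s a c * eps c b + eps a c * s c b) = (if a = b then 1 else 0)" using s by blast+
 define n where "n = (\<lambda>b a. if a \<in> Q then (if a = b then 1 else 0) - (\<Sum>c\<in>Q. s a c * eps c b) else 0)"
 have ex: "\<exists>y. (\<forall>a. y a \<noteq> 0 \<longrightarrow> rk a = Suc D) \<and> (\<forall>a\<in>Q. (\<Sum>c\<in>Q. eps a c * y c) = n b a)"
  if b: "b \<in> Q" "rk b = D" for b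
 proof (rule Suc.prems)
  fix a assume na: "n b a \<noteq> 0"
  show "rk a = D"
  proof (cases "a = b")
   case False
   then have "(\<Sum>c\<in>Q. s a c * eps c b) \<noteq> 0" using na by (auto simp: n_def split: if_splits)
   then obtain c where "s a c * eps c b \<noteq> 0" by (meson sum.neutral)
   then show ?thesis using s1[of a c] eps_rk[of c b] b by auto
  qed (use b in simp)
 next
  fix e assume e: "e \<in> Q"
  have "(\<Sum>a\<in>Q. eps e a * n b a) = (\<Sum>a\<in>Q. eps e a * (if a = b then 1 else 0)) - (\<Sum>a\<in>Q. \<Sum>c\<in>Q. eps e a * s a c * eps c b)"
   by (simp add: n_def sum_subtractf[symmetric] right_diff_distrib sum_distrib_left mult.assoc)
  also have "(\<Sum>a\<in>Q. eps e a * (if a = b then 1 else 0)) = eps e b" using b fin by (simp add: if_distrib cong: if_cong)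
  also have "(\<Sum>a\<in>Q. \<Sum>c\<in>Q. eps e a * s a c * eps c b) = (\<Sum>c\<in>Q. (\<Sum>a\<in>Q. eps e a * s a c) * eps c b)"
   by (subst sum.swap) (simp add: sum_distrib_right)
  also have "\<dots> = (\<Sum>c\<in>Q. ((if e = c then 1 else 0) - (\<Sum>a\<in>Q. s e a * eps a c)) * eps c b)"
  proof (rule sum.cong)
   fix c assume c: "c \<in> Q"
   show "(\<Sum>a\<in>Q. eps e a * s a c) * eps c b = ((if e = c then 1 else 0) - (\<Sum>a\<in>Q. s e a * eps a c)) * eps c b"
   proof (cases "eps c b = 0")
    case False
    then have "rk c < D" using eps_rk[of c b] b by simp
    from s2[OF e c this] show ?thesis by (simp add: sum.distrib)
   qed simp
  qed simp
  also have "\<dots> = (\<Sum>c\<in>Q. (if e = c then 1 else 0) * eps c b) - (\<Sum>c\<in>Q. \<Sum>a\<in>Q. s e a * eps a c * eps c b)"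
   by (simp add: left_diff_distrib sum_subtractf sum_distrib_right)
  also have "(\<Sum>c\<in>Q. (if e = c then 1 else 0) * eps c b) = eps e b" using e fin by (simp add: if_distrib if_distribR cong: if_cong)
  also have "(\<Sum>c\<in>Q. \<Sum>a\<in>Q. s e a * eps a c * eps c b) = (\<Sum>a\<in>Q. s e a * (\<Sum>c\<in>Q. eps a c * eps c b))"
   by (subst sum.swap) (simp add: sum_distrib_left mult.assoc)
  also have "\<dots> = 0" by (intro sum.neutral ballI) (simp add: eps_eps b)
  finally show "(\<Sum>a\<in>Q. eps e a * n b a) = 0" by simp
 qed simp
 define y where "y = (\<lambda>b. SOME y. (\<forall>a. y a \<noteq> 0 \<longrightarrow> rk a = Suc D) \<and> (\<forall>a\<in>Q. (\<Sum>c\<in>Q. eps a c * y c) = n b a))"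
 have y: "y b a \<noteq> 0 \<Longrightarrow> rk a = Suc D" "a \<in> Q \<Longrightarrow> (\<Sum>c\<in>Q. eps a c * y b c) = n b a"
  if b: "b \<in> Q" "rk b = D" for a b
 proof -
  have "(\<forall>a. y b a \<noteq> 0 \<longrightarrow> rk a = Suc D) \<and> (\<forall>a\<in>Q. (\<Sum>c\<in>Q. eps a c * y b c) = n b a)"
   unfolding y_def by (rule someI_ex[OF ex[OF b]])
  then show "y b a \<noteq> 0 \<Longrightarrow> rk a = Suc D" "a \<in> Q \<Longrightarrow> (\<Sum>c\<in>Q. eps a c * y b c) = n b a" by blast+
 qed
 \<comment> \<open>New values enter only in columns of rank \<open>D\<close>. By \<open>te\<close>
   products with \<open>eps\<close> in ranks up to \<open>D\<close> involve older columns, so the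
   identities already established survive.\<close>
 define t where "t = (\<lambda>a b. if b \<in> Q \<and> rk b = D then y b a else s a b)"
 have t1: "rk a = Suc (rk b)" if "t a b \<noteq> 0" for a b
  using that y(1)[of b a] s1[of a b] by (auto simp: t_def split: if_splits)
 have te: "t a c * eps c b = s a c * eps c b" if "rk b \<le> D" for a b c
  using eps_rk[of c b] that by (cases "eps c b = 0") (auto simp: t_def)
 have t2: "(\<Sum>c\<in>Q. t a c * eps c b + eps a c * t c b) = (if a = b then 1 else 0)"
  if ab: "a \<in> Q" "b \<in> Q" "rk b < Suc D" for a b
 proof (cases "rk b = D")
  case True
  have "(\<Sum>c\<in>Q. t a c * eps c b + eps a c * t c b) = (\<Sum>c\<in>Q. s a c * eps c b) + (\<Sum>c\<in>Q. eps a c * y b c)"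
   using ab True by (simp add: te sum.distrib) (simp add: t_def)
  also have "(\<Sum>c\<in>Q. eps a c * y b c) = n b a" by (rule y(2)[OF ab(2) True ab(1)])
  finally show ?thesis using ab(1) by (simp add: n_def)
 next
  case False
  then have lt: "rk b < D" and tb: "t c b = s c b" for c using ab by (simp_all add: t_def)
  have "(\<Sum>c\<in>Q. t a c * eps c b + eps a c * t c b) = (\<Sum>c\<in>Q. s a c * eps c b + eps a c * s c b)"
   unfolding tb using te[of b] lt by (intro sum.cong) simp_all
  then show ?thesis using s2[OF ab(1,2) lt] by simp
 qed
 show ?case by (rule exI[of _ t]) (use t1 t2 in blast)
qed

lemma partial_contraction_real:
 fixes eps :: "'p \<Rightarrow> 'p \<Rightarrow> int"
 assumes fin: "finite Q"
  and eps_rk: "\<And>a b. eps a b \<noteq> 0 \<Longrightarrow> rk b = Suc (rk a)"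
  and eps_eps: "\<And>a c. a \<in> Q \<Longrightarrow> c \<in> Q \<Longrightarrow> (\<Sum>b\<in>Q. eps a b * eps b c) = 0"
  and exact: "\<And>k n. k < D \<Longrightarrow> (\<And>a. n a \<noteq> 0 \<Longrightarrow> rk a = k) \<Longrightarrow> (\<And>a. a \<in> Q \<Longrightarrow> (\<Sum>b\<in>Q. eps a b * n b) = 0) \<Longrightarrow>
    \<exists>y. (\<forall>b. y b \<noteq> 0 \<longrightarrow> rk b = Suc k) \<and> (\<forall>a\<in>Q. (\<Sum>b\<in>Q. eps a b * y b) = n a)"
 shows "\<exists>s::'p \<Rightarrow> 'p \<Rightarrow> real. (\<forall>a b. s a b \<noteq> 0 \<longrightarrow> a \<in> Q \<and> b \<in> Q \<and> rk a = Suc (rk b)) \<and>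
   (\<forall>a\<in>Q. \<forall>b\<in>Q. rk b < D \<longrightarrow>
    (\<Sum>c\<in>Q. s a c * real_of_int (eps c b) + real_of_int (eps a c) * s c b) = (if a = b then 1 else 0))"
proof -
 have "\<exists>s::'p \<Rightarrow> 'p \<Rightarrow> int. (\<forall>a b. s a b \<noteq> 0 \<longrightarrow> rk a = Suc (rk b)) \<and>
   (\<forall>a\<in>Q. \<forall>b\<in>Q. rk b < D \<longrightarrow> (\<Sum>c\<in>Q. s a c * eps c b + eps a c * s c b) = (if a = b then 1 else 0))"
  by (rule partial_contraction[OF fin]) (rule eps_rk eps_eps exact; assumption)+
 then obtain s :: "'p \<Rightarrow> 'p \<Rightarrow> int" where s: "\<forall>a b. s a b \<noteq> 0 \<longrightarrow> rk a = Suc (rk b)"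
  "\<forall>a\<in>Q. \<forall>b\<in>Q. rk b < D \<longrightarrow> (\<Sum>c\<in>Q. s a c * eps c b + eps a c * s c b) = (if a = b then 1 else 0)"
  by (elim exE conjE)
 define t where "t = (\<lambda>a b. if a \<in> Q \<and> b \<in> Q then real_of_int (s a b) else 0)"
 show ?thesis
 proof (intro exI[of _ t] conjI allI ballI impI)
  fix a b assume ab: "a \<in> Q" "b \<in> Q" "rk b < D"
  have "(\<Sum>c\<in>Q. t a c * real_of_int (eps c b) + real_of_int (eps a c) * t c b) =
   real_of_int (\<Sum>c\<in>Q. s a c * eps c b + eps a c * s c b)"
   using ab by (simp add: t_def)
  also have "\<dots> = (if a = b then 1 else 0)" using s(2) ab by simp
  finally show "(\<Sum>c\<in>Q. t a c * real_of_int (eps c b) + real_of_int (eps a c) * t c b) = (if a = b then 1 else 0)" .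
 qed (use s(1) in \<open>auto simp: t_def split: if_splits\<close>)
qed

text \<open>The coefficient sum of a chain, obtained by sending every simplex to one
  generator.\<close>

definition aug :: "'a chain \<Rightarrow> int" where
 "aug c = poly_mapping.lookup (frag_extend (\<lambda>_. frag_of ()) c) ()"

lemma aug_add: "aug (a + b) = aug a + aug b" and aug_diff: "aug (a - b) = aug a - aug b"
 and aug_cmul: "aug (frag_cmul n a) = n * aug a" and aug_of: "aug (frag_of f) = 1" and aug_0: "aug 0 = 0"
 by (simp_all add: aug_def frag_extend_add frag_extend_diff frag_extend_cmul lookup_add lookup_minus)

lemma aug_sum: "aug (sum f I) = (\<Sum>i\<in>I. aug (f i))"
 by (induction I rule: infinite_finite_induct) (simp_all add: aug_add aug_0)

lemma aug_boundary: "aug (bnd (Suc 0) d) = 0"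
proof (rule frag_induction[of d UNIV "\<lambda>d. aug (bnd (Suc 0) d) = 0"])
 fix x show "aug (bnd (Suc 0) (frag_of x)) = 0"
  by (simp add: chain_boundary_of aug_add aug_cmul aug_of aug_diff)
qed (simp_all add: aug_0 chain_boundary_diff aug_diff)

section \<open>Interior points of a cell detected by homology\<close>

context cell
begin

lemma fr_nonempty: assumes "0 < n" shows "fr \<noteq> {}"
proof -
 have "(\<lambda>i. if i = 0 then 1 else 0) \<in> sphr n"
  using assms by (auto simp: unit_ball_boundary_eq bset_def nsq_def if_distrib[of "\<lambda>x. x ^ 2"] cong: if_cong)
 then show ?thesis by (auto simp: fr_def)
qed

lemma hvan_point: assumes "x \<in> cl" shows "hvan X cl {x}"
proof (rule hvan_cell_homotopy[where h="\<lambda>(t, y) i. (1 - t) * y i + t * inv\<Phi> x i"])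
 have wb: "inv\<Phi> x \<in> bset n" using assms inv\<Phi>_in by blast
 have sc: "(\<lambda>i. (1 - t) * y i + t * inv\<Phi> x i) \<in> bset n" if "y \<in> bset n" "0 \<le> t" "t \<le> 1" for t y
 proof -
  have "L2_set (\<lambda>i. (1 - t) * y i + t * inv\<Phi> x i) {..<n} \<le> L2_set (\<lambda>i. (1 - t) * y i) {..<n} + L2_set (\<lambda>i. t * inv\<Phi> x i) {..<n}"
   by (rule L2_set_triangle_ineq)
  also have "\<dots> = (1 - t) * L2_set y {..<n} + t * L2_set (inv\<Phi> x) {..<n}"
   using that by (simp add: L2_set_right_distrib)
  also have "\<dots> \<le> (1 - t) * 1 + t * 1"
   using that wb by (intro add_mono mult_left_mono) (auto simp: bset_def nsq_L2[symmetric])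
  finally have "L2_set (\<lambda>i. (1 - t) * y i + t * inv\<Phi> x i) {..<n} \<le> 1" by simp
  then show ?thesis using that wb by (auto simp: bset_def nsq_L2[symmetric])
 qed
 show "continuous_on ({0..1} \<times> inv\<Phi> ` cl) (\<lambda>(t, y) i. (1 - t) * y i + t * inv\<Phi> x i)"
  unfolding split_beta
  by (rule continuous_on_pair_fun)
   (intro continuous_on_add continuous_on_mult continuous_on_diff continuous_on_const continuous_on_fst continuous_on_snd
    continuous_coord continuous_on_id)
 fix y
 show "(case (t, y) of (t, y) \<Rightarrow> \<lambda>i. (1 - t) * y i + t * inv\<Phi> x i) \<in> inv\<Phi> ` cl"
  if "0 \<le> t" "t \<le> 1" "y \<in> inv\<Phi> ` cl" for t
  using sc[of y t] that unfolding inv_cl by simp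
 show "(case (t, y) of (t, y) \<Rightarrow> \<lambda>i. (1 - t) * y i + t * inv\<Phi> x i) \<in> inv\<Phi> ` {x}"
  if "0 \<le> t" "t \<le> 1" "y \<in> inv\<Phi> ` {x}" for t
  using that by (auto simp: algebra_simps)
 show "(case (0, y) of (t, y) \<Rightarrow> \<lambda>i. (1 - t) * y i + t * inv\<Phi> x i) = y" by simp
 show "(case (1, y) of (t, y) \<Rightarrow> \<lambda>i. (1 - t) * y i + t * inv\<Phi> x i) \<in> inv\<Phi> ` {x}" by simp
qed (use assms in auto)

text \<open>By \<open>hvan_minus_e\<close> the complement of \<open>x\<close> retracts to
  \<open>fr\<close>, so vanishing would kill the generator of the top relative homology. With
  \<open>hvan_cl_minus\<close> this separates interior from boundary points.\<close>

lemma not_hvan_minus_e: assumes "x \<in> e" shows "\<not> hvan X cl (cl - {x})"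
proof
 assume a: "hvan X cl (cl - {x})"
 have "fr \<union> e = cl" using cl_eq by blast
 then have "hvan X (cl - {x}) fr"
  using hvan_minus_e[of fr x] closed_fr e_fr assms by (simp add: Int_commute)
 then have "hvan X cl fr" by (rule hvan_trans[OF a]) (use assms fr_cl e_fr in auto)
 moreover obtain z where "hgen X n cl fr z" using hgen_cl ..
 ultimately have "rbdr X n cl fr (frag_cmul 1 z)" by (simp add: hgen_def hvan_def)
 moreover have "\<forall>k. rbdr X n cl fr (frag_cmul k z) \<longrightarrow> k = 0"
  using \<open>hgen X n cl fr z\<close> unfolding hgen_def by (elim conjE)
 ultimately have "1 = (0::int)" by (elim allE impE)
 then show False by simp
qed

end

section \<open>The face poset with the empty cell\<close>

context regcw
begin

lemma finite_sub: "sub Y \<Longrightarrow> finite Y" using finite_subset[OF subC finC] .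

lemma sub_below: "sub {d. below d e}"
 unfolding sub_def
proof (intro conjI ballI subsetI)
 fix d assume "d \<in> {d. below d e}" then show "d \<in> C" by (simp add: below_def)
next
 fix d c assume dc: "d \<in> {d. below d e}" "c \<in> bdc d"
 then have "below c d" using bdc_C by (auto simp: below_def)
 then show "c \<in> {d. below d e}" using below_trans dc by blast
qed

lemma Union_below: "e \<in> C \<Longrightarrow> \<Union>{d. below d e} = X closure_of e"
 using closure_un[of e] bdc_C by (auto simp: below_def)

lemma inc_dm: "inc a b \<noteq> 0 \<Longrightarrow> dm b = Suc (dm a)" using inc_nz by blast

lemma inc_inc_pair:
 assumes "sub Y" "sub L" "a \<in> Y - L" "c \<in> Y - L"
 shows "(\<Sum>b\<in>Y-L. inc a b * inc b c) = 0"
proof -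
 have "(\<Sum>b\<in>C. inc a b * inc b c) = (\<Sum>b\<in>Y-L. inc a b * inc b c)"
 proof (rule sum.mono_neutral_right[OF finC])
  show "Y - L \<subseteq> C" using subC[OF assms(1)] by blast
  show "\<forall>b\<in>C - (Y - L). inc a b * inc b c = 0"
  proof (intro ballI, rule ccontr)
   fix b assume b: "b \<in> C - (Y - L)" "inc a b * inc b c \<noteq> 0"
   then have "a \<in> bdc b" "b \<in> bdc c" using inc_nz[of a b] inc_nz[of b c] by auto
   then have "b \<in> Y" "b \<notin> L" using assms by (auto simp: sub_def)
   then show False using b by simp
  qed
 qed
 then show ?thesis using inc_inc by simp
qed

lemma pair_contraction:
 assumes Y: "sub Y" "sub L" "L \<subseteq> Y" and v: "\<And>k c. k < D \<Longrightarrow> rcyc X k (\<Union>Y) (\<Union>L) c \<Longrightarrow> rbdr X k (\<Union>Y) (\<Union>L) c"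
 shows "\<exists>s::'a set \<Rightarrow> 'a set \<Rightarrow> real. (\<forall>a b. s a b \<noteq> 0 \<longrightarrow> a \<in> Y - L \<and> b \<in> Y - L \<and> dm a = Suc (dm b)) \<and>
   (\<forall>a\<in>Y-L. \<forall>b\<in>Y-L. dm b < D \<longrightarrow>
    (\<Sum>c\<in>Y-L. s a c * real_of_int (inc c b) + real_of_int (inc a c) * s c b) = (if a = b then 1 else 0))"
proof (rule partial_contraction_real[of "Y - L" inc dm D])
 show "finite (Y - L)" using finite_sub[OF Y(1)] by simp
 show "inc a b \<noteq> 0 \<Longrightarrow> dm b = Suc (dm a)" for a b by (rule inc_dm)
 show "(\<Sum>b\<in>Y-L. inc a b * inc b c) = 0" if "a \<in> Y - L" "c \<in> Y - L" for a c
  by (rule inc_inc_pair[OF Y(1,2) that])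
 show "\<exists>y. (\<forall>b. y b \<noteq> 0 \<longrightarrow> dm b = Suc k) \<and> (\<forall>a\<in>Y-L. (\<Sum>b\<in>Y-L. inc a b * y b) = n a)"
  if "k < D" "\<And>a. n a \<noteq> 0 \<Longrightarrow> dm a = k" "\<And>a. a \<in> Y-L \<Longrightarrow> (\<Sum>b\<in>Y-L. inc a b * n b) = 0" for k n
  by (rule cellular_exact[OF Y v[OF that(1)] that(2,3)])
qed

lemma hvan_contraction:
 assumes Y: "sub Y" "sub L" "L \<subseteq> Y" and v: "hvan X (\<Union>Y) (\<Union>L)"
 shows "\<exists>s::'a set \<Rightarrow> 'a set \<Rightarrow> real. (\<forall>a b. s a b \<noteq> 0 \<longrightarrow> a \<in> Y - L \<and> b \<in> Y - L \<and> dm a = Suc (dm b)) \<and>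
   (\<forall>a\<in>Y-L. \<forall>b\<in>Y-L. dm b < D \<longrightarrow>
    (\<Sum>c\<in>Y-L. s a c * real_of_int (inc c b) + real_of_int (inc a c) * s c b) = (if a = b then 1 else 0))"
 by (rule pair_contraction[OF Y]) (rule hvanD[OF v])

lemma euler_pair:
 assumes Y: "sub Y" "sub L" "L \<subseteq> Y" and v: "hvan X (\<Union>Y) (\<Union>L)"
 shows "(\<Sum>a\<in>Y-L. (-1) ^ dm a) = (0::int)"
proof -
 define D where "D = Suc (Max (dm ` Y))"
 have D: "dm a < D" if "a \<in> Y - L" for a using that finite_sub[OF Y(1)] by (simp add: D_def le_imp_less_Suc)
 obtain s :: "'a set \<Rightarrow> 'a set \<Rightarrow> real" where s: "\<forall>a b. s a b \<noteq> 0 \<longrightarrow> a \<in> Y - L \<and> b \<in> Y - L \<and> dm a = Suc (dm b)"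
   "\<forall>a\<in>Y-L. \<forall>b\<in>Y-L. dm b < D \<longrightarrow>
    (\<Sum>c\<in>Y-L. s a c * real_of_int (inc c b) + real_of_int (inc a c) * s c b) = (if a = b then 1 else 0)"
  using hvan_contraction[OF Y v, of D] by (elim exE conjE)
 show ?thesis
 proof (rule euler_contraction[where s=s and eps="\<lambda>a b. real_of_int (inc a b)"])
  show "s a b \<noteq> 0 \<Longrightarrow> dm a = Suc (dm b)" for a b using s(1) by simp
  show "(\<Sum>c\<in>Y-L. s a c * real_of_int (inc c a) + real_of_int (inc a c) * s c a) = 1" if "a \<in> Y - L" for a
   using bspec[OF bspec[OF s(2) that] that] D[OF that] by simp
 qed
qed

text \<open>A cell of least dimension below \<open>e\<close> has empty boundary, whereas the sphere
  bounding a cell of positive dimension is nonempty.\<close>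

lemma vertex_below:
 assumes e: "e \<in> C"
 obtains v where "below v e" "dm v = 0"
proof -
 have "finite {d. below d e}" "{d. below d e} \<noteq> {}" using finite_sub[OF sub_below] below_refl[OF e] by auto
 then obtain v where v: "below v e" "\<And>d. below d e \<Longrightarrow> dm v \<le> dm d"
  using arg_min_if_finite(1)[of "{d. below d e}" dm] arg_min_least[of "{d. below d e}" _ dm] by auto
 have vC: "v \<in> C" using v by (simp add: below_def)
 have "bdc v = {}"
 proof (rule ccontr)
  assume "bdc v \<noteq> {}"
  then obtain d where d: "d \<in> bdc v" by auto
  then have "below d v" using vC bdc_C by (auto simp: below_def)
  then have "dm v \<le> dm d" using v below_trans by blast
  then show False using bdc_dm[OF vC d] by simp
 qed
 moreover obtain \<Phi> where "cell X (dm v) v \<Phi>" using cellI[OF vC] ..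
 then interpret c: cell X "dm v" v \<Phi> .
 have "c.fr = \<Union>(bdc v)" unfolding c.fr_closure by (rule bdc_un[OF vC])
 ultimately have "dm v = 0" using c.fr_nonempty by auto
 then show thesis using that v(1) by blast
qed

lemma vertex:
 assumes v: "v \<in> C" "dm v = 0"
 obtains x where "v = {x}" "X closure_of v = {x}"
proof -
 obtain \<Phi> where "cell X (dm v) v \<Phi>" using cellI[OF v(1)] ..
 then interpret c: cell X 0 v \<Phi> using v(2) by simp
 have "oball 0 = {\<lambda>i. 0}" by (auto simp: unit_ball_interior_eq bset_def nsq_def)
 then have "v = {\<Phi> (\<lambda>i. 0)}" unfolding c.e_eq by simp
 moreover have "bdc v = {}" using bdc_dm[OF v(1)] v(2) by auto
 then have "X closure_of v = v" using closure_un[OF v(1)] by simp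
 ultimately show thesis using that by metis
qed

text \<open>Shifted by one to make room for the empty cell in rank 0.\<close>

definition rkc :: "'a set \<Rightarrow> nat" where "rkc e = (if e = {} then 0 else Suc (dm e))"

text \<open>The augmented cellular complex: the empty cell meets a vertex with the augmentation of
  its chosen generator, a unit by \<open>aug_unit\<close>.\<close>

definition ieps :: "'a set \<Rightarrow> 'a set \<Rightarrow> int" where
 "ieps a b = (if a = {} then (if b \<in> cdim 0 then aug (zc b) else 0) else inc a b)"

definition leq :: "'a set \<Rightarrow> 'a set \<Rightarrow> bool" where
 "leq a b \<longleftrightarrow> (a = {} \<and> b \<in> insert {} C) \<or> below a b"

lemma empty_C: "{} \<notin> C" using cell_ne by blast

lemma inc_empty: "inc a {} = 0" "inc {} a = 0" using inc_nz[of a "{}"] inc_nz[of "{}" a] empty_C by blast+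

lemma ieps_nz: "ieps a b \<noteq> 0 \<Longrightarrow> leq a b \<and> rkc b = Suc (rkc a)"
 using inc_nz[of a b] empty_C by (auto simp: ieps_def leq_def rkc_def cdim_def below_def split: if_splits)

lemma aug_inc: "(\<Sum>b\<in>cdim 0. aug (zc b) * inc b c) = 0"
proof (cases "c \<in> C \<and> dm c = Suc 0")
 case False
 then have "inc b c = 0" if "b \<in> cdim 0" for b using inc_nz[of b c] that by (auto simp: cdim_def)
 then show ?thesis by simp
next
 case True
 then have c: "c \<in> C" "dm c = Suc 0" by auto
 obtain d e where de: "schain X 0 (\<Union>{b \<in> bdc c. dm b < 0}) e"
  "bnd (Suc 0) (zc c) - zsum (cdim 0) (\<lambda>d. inc d c) = bnd (Suc 0) d + e"
  using bd_zc[OF c] unfolding rbdr_def by blast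
 have "e = 0" using de(1) singular_chain_empty[of "subtopology X {}" 0 e] by simp
 then have "aug (bnd (Suc 0) (zc c) - zsum (cdim 0) (\<lambda>d. inc d c)) = 0"
  unfolding de(2) by (simp add: aug_boundary)
 then have "aug (zsum (cdim 0) (\<lambda>d. inc d c)) = 0" by (simp add: aug_diff aug_boundary)
 then show ?thesis by (simp add: zsum_def aug_sum aug_cmul mult.commute)
qed

lemma ieps_ieps: "(\<Sum>b\<in>insert {} C. ieps a b * ieps b c) = 0"
proof -
 have "(\<Sum>b\<in>insert {} C. ieps a b * ieps b c) = (\<Sum>b\<in>C. ieps a b * ieps b c)"
  using finC empty_C by (simp add: ieps_def inc_empty cdim_def)
 also have "\<dots> = (\<Sum>b\<in>C. ieps a b * inc b c)" using empty_C by (intro sum.cong) (auto simp: ieps_def)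
 also have "\<dots> = 0"
 proof (cases "a = {}")
  case True
  then have "(\<Sum>b\<in>C. ieps a b * inc b c) = (\<Sum>b\<in>cdim 0. aug (zc b) * inc b c)"
   using finC by (intro sum.mono_neutral_cong_right) (auto simp: ieps_def cdim_def)
  then show ?thesis using aug_inc by simp
 qed (simp add: ieps_def inc_inc)
 finally show ?thesis .
qed

text \<open>The constant simplex has augmentation 1 and is, modulo boundaries, a multiple of the
  generator.\<close>

lemma aug_unit:
 assumes v: "v \<in> C" "dm v = 0"
 obtains m where "m * aug (zc v) = 1"
proof -
 obtain x where x: "v = {x}" "X closure_of v = {x}" using vertex[OF v] .
 define f where "f = restrict (\<lambda>_::nat \<Rightarrow> real. x) (standard_simplex 0)"
 have xX: "x \<in> topspace X" using closure_of_subset_topspace[of X v] x(2) by auto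
 have "singular_simplex 0 (subtopology X {x}) f"
  unfolding singular_simplex_def f_def using xX by (auto simp: continuous_map_eq[OF continuous_map_const[THEN iffD2]])
 then have "rcyc X 0 {x} {} (frag_of f)" by (simp add: rcyc_def singular_chain_of chain_boundary_def)
 moreover have "hgen X 0 {x} {} (zc v)" using zc[OF v(1)] v(2) x by simp
 ultimately obtain m where "rbdr X 0 {x} {} (frag_of f - frag_cmul m (zc v))" unfolding hgen_def by blast
 then obtain d e where de: "schain X 0 {} e" "frag_of f - frag_cmul m (zc v) = bnd (Suc 0) d + e"
  unfolding rbdr_def by blast
 have "e = 0" using de(1) singular_chain_empty[of "subtopology X {}" 0 e] by simp
 then have "aug (frag_of f - frag_cmul m (zc v)) = 0" unfolding de(2) by (simp add: aug_boundary)
 then have "m * aug (zc v) = 1" by (simp add: aug_diff aug_cmul aug_of)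
 then show thesis by (rule that)
qed

text \<open>A point \<open>p\<close> of \<open>x\<close> lies on the boundary sphere of
  \<open>y\<close>; deleting it from the closed cell changes no homology, and what is left retracts
  to the complement of the star of \<open>x\<close>.\<close>

lemma interval_hvan:
 assumes "below x y" "x \<noteq> y"
 shows "hvan X (\<Union>{d. below d y}) (\<Union>{d \<in> {d. below d y}. \<not> below x d})"
proof -
 have xy: "x \<in> C" "y \<in> C" "x \<in> bdc y" using assms by (auto simp: below_def)
 obtain p where p: "p \<in> x" using cell_ne[OF xy(1)] by auto
 obtain \<Phi> where "cell X (dm y) y \<Phi>" using cellI[OF xy(2)] ..
 then interpret c: cell X "dm y" y \<Phi> .
 have "p \<in> c.fr" unfolding c.fr_closure using p xy(3) by (auto simp: bdc_def)
 from c.hvan_cl_minus[OF this]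
 have "hvan X (\<Union>{d. below d y}) (\<Union>{d. below d y} - {p})"
  unfolding c.cl_closure Union_below[OF xy(2)] .
 then show ?thesis
 proof (rule hvan_trans[OF _ hvan_minus_star[OF sub_below _ p]])
  show "x \<in> {d. below d y}" using assms by simp
  have "p \<notin> d" if "d \<in> C" "\<not> below x d" for d
   using cell_eq[OF that(1) xy(1) _ p] that(2) below_refl[OF xy(1)] by blast
  then show "\<Union>{d \<in> {d. below d y}. \<not> below x d} \<subseteq> \<Union>{d. below d y} - {p}"
   by (auto simp: below_def)
 qed auto
qed

text \<open>Reduced exactness of a closed cell, derived from the acyclic pair of the cell and one
  vertex \<open>v\<close>. The pair leaves the equation at \<open>v\<close> open; the augmentation
  settles it.\<close>

lemma augmented_exact:
 assumes y: "y \<in> C" and Q: "Q = insert {} {d. below d y}"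
  and n: "\<And>a. n a \<noteq> 0 \<Longrightarrow> rkc a = k" "\<And>a. a \<in> Q \<Longrightarrow> (\<Sum>b\<in>Q. ieps a b * n b) = 0"
 shows "\<exists>f. (\<forall>b. f b \<noteq> 0 \<longrightarrow> rkc b = Suc k) \<and> (\<forall>a\<in>Q. (\<Sum>b\<in>Q. ieps a b * f b) = n a)"
proof -
 let ?Y = "{d. below d y}"
 have YC: "?Y \<subseteq> C" by (auto simp: below_def)
 have finY: "finite ?Y" by (rule finite_sub[OF sub_below])
 have eY: "{} \<notin> ?Y" using YC empty_C by blast
 obtain v where v: "below v y" "dm v = 0" using vertex_below[OF y] .
 have vC: "v \<in> C" "v \<noteq> {}" using v empty_C by (auto simp: below_def)
 obtain m where m: "m * aug (zc v) = 1" using aug_unit[OF vC(1) v(2)] .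
 have sumQ: "(\<Sum>b\<in>Q. ieps a b * g b) = (\<Sum>b\<in>?Y. inc a b * g b)" if "a \<noteq> {}" for a g
  unfolding Q using finY eY that by (simp add: ieps_def inc_empty)
 have incv: "inc a v = 0" for a using inc_nz[of a v] v(2) by auto
 show ?thesis
 proof (cases k)
  case 0
  \<comment> \<open>In rank 0 the only datum is the value at the empty cell, and \<open>m\<close>
    inverts the augmentation at \<open>v\<close>.\<close>
  define f where "f = (\<lambda>b. if b = v then m * n {} else 0)"
  have "(\<Sum>b\<in>Q. ieps a b * f b) = n a" if a: "a \<in> Q" for a
  proof -
   have "(\<Sum>b\<in>Q. ieps a b * f b) = ieps a v * (m * n {})"
    unfolding f_def Q using finY v(1) vC by (simp add: if_distrib sum.delta cong: if_cong)
   then show ?thesis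
    using n(1)[of a] 0 m v(2) vC by (cases "a = {}") (auto simp: ieps_def incv cdim_def rkc_def mult.assoc[symmetric] mult.commute[of "aug (zc v)"])
  qed
  then show ?thesis by (intro exI[of _ f]) (auto simp: f_def rkc_def 0 v(2) vC)
 next
  case (Suc j)
  have n0: "n {} = 0" using n(1)[of "{}"] Suc by (auto simp: rkc_def)
  obtain x where x: "v = {x}" "X closure_of v = {x}" using vertex[OF vC(1) v(2)] .
  let ?L = "{v}"
  have "bdc v = {}" using bdc_dm[OF vC(1)] v(2) by auto
  then have L: "sub ?L" "?L \<subseteq> ?Y" using vC v by (auto simp: sub_def)
  obtain \<Phi> where "cell X (dm y) y \<Phi>" using cellI[OF y] ..
  then interpret c: cell X "dm y" y \<Phi> .
  have "x \<in> c.cl" unfolding c.cl_closure Union_below[OF y, symmetric] using v(1) x by auto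
  then have hv: "hvan X (\<Union>?Y) (\<Union>?L)" using c.hvan_point unfolding Union_below[OF y] c.cl_closure x by simp
  have YL: "(\<Sum>b\<in>?Y - ?L. inc a b * g b) = (\<Sum>b\<in>?Y. inc a b * g b)" for a g
   using finY by (intro sum.mono_neutral_left) (auto simp: incv)
  define n' where "n' = (\<lambda>a. if a \<in> C then n a else 0)"
  have n'Y: "(\<Sum>b\<in>?Y. inc a b * n' b) = (\<Sum>b\<in>?Y. inc a b * n b)" for a
   using YC by (intro sum.cong) (auto simp: n'_def)
  have "\<exists>f. (\<forall>b. f b \<noteq> 0 \<longrightarrow> dm b = Suc j) \<and> (\<forall>a\<in>?Y-?L. (\<Sum>b\<in>?Y-?L. inc a b * f b) = n' a)"
  proof (rule cellular_exact[OF sub_below L hvanD[OF hv]])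
   show "n' a \<noteq> 0 \<Longrightarrow> dm a = j" for a using n(1)[of a] empty_C Suc by (auto simp: n'_def rkc_def split: if_splits)
   fix a assume a: "a \<in> ?Y - ?L"
   then have "a \<noteq> {}" "a \<in> Q" using eY Q by auto
   then show "(\<Sum>b\<in>?Y - ?L. inc a b * n' b) = 0" unfolding YL n'Y using n(2)[of a] sumQ[of a n] by simp
  qed
  then obtain f where f: "\<And>b. f b \<noteq> 0 \<Longrightarrow> dm b = Suc j" "\<And>a. a \<in> ?Y-?L \<Longrightarrow> (\<Sum>b\<in>?Y-?L. inc a b * f b) = n' a" by blast
  define g where "g = (\<lambda>b. if b \<in> ?Y then f b else 0)"
  have gr: "g b \<noteq> 0 \<Longrightarrow> rkc b = Suc k" for b
   using f(1)[of b] eY Suc by (auto simp: g_def rkc_def split: if_splits)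
  have gY: "(\<Sum>b\<in>?Y. inc a b * g b) = (\<Sum>b\<in>?Y-?L. inc a b * f b)" for a
   unfolding YL by (intro sum.cong) (auto simp: g_def)
  have bulk: "(\<Sum>b\<in>Q. ieps a b * g b) = n a" if "a \<in> ?Y - ?L" for a
  proof -
   have "a \<noteq> {}" "a \<in> C" using that eY YC by auto
   then show ?thesis using sumQ[of a g] gY[of a] f(2)[OF that] by (simp add: n'_def)
  qed
  have bottom: "(\<Sum>b\<in>Q. ieps {} b * g b) = 0"
  proof (intro sum.neutral ballI)
   fix b show "ieps {} b * g b = 0" using ieps_nz[of "{}" b] gr[of b] Suc
    by (cases "ieps {} b = 0"; cases "g b = 0") (simp_all add: rkc_def)
  qed
  have "(\<Sum>b\<in>Q. ieps v b * g b) = n v"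
  proof (cases "j = 0")
   case False
   have "n v = 0" using n(1)[of v] vC v(2) Suc False by (auto simp: rkc_def)
   moreover have "ieps v b * g b = 0" for b using ieps_nz[of v b] gr[of b] vC v(2) Suc False by (auto simp: rkc_def)
   ultimately show ?thesis by (simp add: sum.neutral)
  next
   case True
   \<comment> \<open>The discrepancy \<open>?h\<close> is zero away from \<open>v\<close>, and
     \<open>ieps {}\<close> annihilates it by \<open>ieps_ieps\<close>; its value at
     \<open>v\<close> is thereby multiplied by a unit and must be zero.\<close>
   let ?h = "\<lambda>a. n a - (\<Sum>b\<in>Q. ieps a b * g b)"
   have "(\<Sum>a\<in>Q. ieps {} a * (\<Sum>b\<in>Q. ieps a b * g b)) = 0"
   proof -
    have "(\<Sum>a\<in>Q. ieps {} a * (\<Sum>b\<in>Q. ieps a b * g b)) = (\<Sum>b\<in>Q. (\<Sum>a\<in>Q. ieps {} a * ieps a b) * g b)"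
     unfolding sum_distrib_left sum_distrib_right by (subst sum.swap) (simp add: mult.assoc)
    also have "\<dots> = 0"
    proof (rule sum.neutral, rule ballI)
     fix b assume b: "b \<in> Q"
     have "(\<Sum>a\<in>Q. ieps {} a * ieps a b) = (\<Sum>a\<in>insert {} C. ieps {} a * ieps a b)"
     proof (rule sum.mono_neutral_left)
      show "\<forall>a\<in>insert {} C - Q. ieps {} a * ieps a b = 0"
      proof (intro ballI, rule ccontr)
       fix a assume a: "a \<in> insert {} C - Q" "ieps {} a * ieps a b \<noteq> 0"
       then have "leq a b" "a \<noteq> {}" using ieps_nz[of a b] Q by auto
       then have "below a b" by (simp add: leq_def)
       then have "below a y" using b below_trans[of a b y] empty_C unfolding Q below_def by auto
       then show False using a(1) Q by simp
      qed
     qed (use finC YC Q in auto)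
     then show "(\<Sum>a\<in>Q. ieps {} a * ieps a b) * g b = 0" by (simp add: ieps_ieps)
    qed
    finally show ?thesis .
   qed
   then have "(\<Sum>a\<in>Q. ieps {} a * ?h a) = 0" using n(2)[of "{}"] Q by (simp add: right_diff_distrib sum_subtractf)
   moreover have "(\<Sum>a\<in>Q. ieps {} a * ?h a) = (\<Sum>a\<in>{v}. ieps {} a * ?h a)"
   proof (rule sum.mono_neutral_right)
    show "\<forall>a\<in>Q - {v}. ieps {} a * ?h a = 0"
    proof
     fix a assume "a \<in> Q - {v}"
     then show "ieps {} a * ?h a = 0"
      using bulk[of a] bottom n0 Q by (cases "a = {}") auto
    qed
   qed (use finY Q v in auto)
   ultimately have "aug (zc v) * ?h v = 0" using vC v(2) by (simp add: ieps_def cdim_def)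
   then show ?thesis using m by auto
  qed
  then have "(\<Sum>b\<in>Q. ieps a b * g b) = n a" if "a \<in> Q" for a
   using bulk[of a] bottom n0 that Q by (cases "a = {}"; cases "a = v") auto
  then show ?thesis using gr by blast
 qed
qed

text \<open>Intervals starting at the empty cell are reduced complexes of closed cells, treated by
  \<open>augmented_exact\<close>; all others are relative complexes, acyclic by
  \<open>interval_hvan\<close>.\<close>

theorem cell_poset: "cell_poset (insert {} C) leq rkc (\<lambda>a b. real_of_int (ieps a b)) {}"
proof unfold_locales
 show "finite (insert {} C)" using finC by simp
 show "x \<in> insert {} C \<Longrightarrow> leq x x" for x using below_refl by (auto simp: leq_def)
 show "leq x z" if "leq x y" "leq y z" for x y z
  using that below_trans[of x y z] empty_C by (auto simp: leq_def below_def)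
 show "leq x y \<Longrightarrow> x \<in> insert {} C \<and> y \<in> insert {} C" for x y by (auto simp: leq_def below_def)
 show "rkc x < rkc y" if "leq x y" "x \<noteq> y" for x y
  using that below_dm[of x y] empty_C by (auto simp: leq_def rkc_def below_def)
 show "real_of_int (ieps x y) \<noteq> 0 \<Longrightarrow> leq x y \<and> rkc y = Suc (rkc x)" for x y using ieps_nz by simp
 show "(\<Sum>y\<in>insert {} C. real_of_int (ieps x y) * real_of_int (ieps y z)) = 0" for x z
  unfolding of_int_mult[symmetric] of_int_sum[symmetric] ieps_ieps by simp
 show "x \<in> insert {} C \<Longrightarrow> leq {} x" for x by (simp add: leq_def)
 show "\<exists>s. (\<forall>a b. s a b \<noteq> 0 \<longrightarrow> rkc a = Suc (rkc b)) \<and>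
     (\<forall>a b. leq x a \<and> leq a y \<and> leq x b \<and> leq b y \<longrightarrow>
      (\<Sum>c | leq x c \<and> leq c y. s a c * real_of_int (ieps c b) + real_of_int (ieps a c) * s c b) = (if a = b then 1 else 0))"
  if xy: "leq x y" "x \<noteq> y" for x y
 proof -
  let ?Q = "{c. leq x c \<and> leq c y}"
  have yC: "y \<in> C" using xy by (auto simp: leq_def below_def)
  \<comment> \<open>Above every rank, so that a partial contraction is a contraction
    everywhere.\<close>
  define D where "D = Suc (Max (rkc ` insert {} C))"
  have D: "rkc a < D" if "a \<in> insert {} C" for a unfolding D_def
   using that finC by (intro le_imp_less_Suc Max_ge) auto
  have Q0: "?Q = insert {} {d. below d y}" if "x = {}"
   using that yC empty_C by (auto simp: leq_def below_def)
  have Q1: "?Q = {d. below d y} - {d \<in> {d. below d y}. \<not> below x d}" if "x \<noteq> {}"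
   using that empty_C by (auto simp: leq_def below_def)
  have "\<exists>s. (\<forall>a b. s a b \<noteq> 0 \<longrightarrow> rkc a = Suc (rkc b)) \<and>
    (\<forall>a\<in>?Q. \<forall>b\<in>?Q. (\<Sum>c\<in>?Q. s a c * real_of_int (ieps c b) + real_of_int (ieps a c) * s c b) = (if a = b then 1 else 0))"
  proof (cases "x = {}")
   case True
   let ?R = "insert {} {d. below d y}"
   have RC: "?R \<subseteq> insert {} C" by (auto simp: below_def)
   have finR: "finite ?R" using finite_subset[OF RC] finC by simp
   have ee: "(\<Sum>b\<in>?R. ieps a b * ieps b c) = 0" if "a \<in> ?R" "c \<in> ?R" for a c
   proof -
    have "(\<Sum>b\<in>insert {} C. ieps a b * ieps b c) = (\<Sum>b\<in>?R. ieps a b * ieps b c)"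
    proof (rule sum.mono_neutral_right)
     show "\<forall>b\<in>insert {} C - ?R. ieps a b * ieps b c = 0"
     proof (intro ballI, rule ccontr)
      fix b assume b: "b \<in> insert {} C - ?R" "ieps a b * ieps b c \<noteq> 0"
      then have "leq b c" "b \<noteq> {}" using ieps_nz[of b c] by auto
      then have "below b c" by (simp add: leq_def)
      then have "below b y" using that(2) below_trans[of b c y] empty_C by (auto simp: below_def)
      then show False using b by simp
     qed
    qed (use finC RC in auto)
    then show ?thesis using ieps_ieps by simp
   qed
   have "\<exists>s::'a set \<Rightarrow> 'a set \<Rightarrow> real. (\<forall>a b. s a b \<noteq> 0 \<longrightarrow> a \<in> ?R \<and> b \<in> ?R \<and> rkc a = Suc (rkc b)) \<and>
    (\<forall>a\<in>?R. \<forall>b\<in>?R. rkc b < D \<longrightarrow>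
     (\<Sum>c\<in>?R. s a c * real_of_int (ieps c b) + real_of_int (ieps a c) * s c b) = (if a = b then 1 else 0))"
   proof (rule partial_contraction_real[of ?R ieps rkc D])
    show "\<exists>f. (\<forall>b. f b \<noteq> 0 \<longrightarrow> rkc b = Suc k) \<and> (\<forall>a\<in>?R. (\<Sum>b\<in>?R. ieps a b * f b) = n a)"
     if "k < D" "\<And>a. n a \<noteq> 0 \<Longrightarrow> rkc a = k" "\<And>a. a \<in> ?R \<Longrightarrow> (\<Sum>b\<in>?R. ieps a b * n b) = 0" for k n
     by (rule augmented_exact[OF yC refl that(2,3)])
   qed (rule finR, use ieps_nz in blast, rule ee)
   then obtain s :: "'a set \<Rightarrow> 'a set \<Rightarrow> real" where
    s: "\<forall>a b. s a b \<noteq> 0 \<longrightarrow> a \<in> ?R \<and> b \<in> ?R \<and> rkc a = Suc (rkc b)"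
    "\<forall>a\<in>?R. \<forall>b\<in>?R. rkc b < D \<longrightarrow>
     (\<Sum>c\<in>?R. s a c * real_of_int (ieps c b) + real_of_int (ieps a c) * s c b) = (if a = b then 1 else 0)"
    by (elim exE conjE)
   have lt: "rkc b < D" if "b \<in> ?R" for b by (rule D, rule subsetD[OF RC that])
   show ?thesis unfolding Q0[OF True]
   proof (intro exI[of _ s] conjI allI ballI impI)
    fix a b assume "s a b \<noteq> 0"
    from s(1)[THEN spec, THEN spec, THEN mp, OF this] show "rkc a = Suc (rkc b)" by (elim conjE)
   next
    fix a b assume ab: "a \<in> ?R" "b \<in> ?R"
    show "(\<Sum>c\<in>?R. s a c * real_of_int (ieps c b) + real_of_int (ieps a c) * s c b) = (if a = b then 1 else 0)"
     by (rule mp[OF bspec[OF bspec[OF s(2) ab(1)] ab(2)] lt[OF ab(2)]])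
   qed
  next
   case False
   let ?Y = "{d. below d y}" and ?L = "{d \<in> {d. below d y}. \<not> below x d}"
   have b: "below x y" using False xy(1) by (simp add: leq_def)
   note hv = interval_hvan[OF b xy(2)]
   have LY: "?L \<subseteq> ?Y" by auto
   obtain s :: "'a set \<Rightarrow> 'a set \<Rightarrow> real" where
    s: "\<forall>a b. s a b \<noteq> 0 \<longrightarrow> a \<in> ?Y - ?L \<and> b \<in> ?Y - ?L \<and> dm a = Suc (dm b)"
    "\<forall>a\<in>?Y - ?L. \<forall>b\<in>?Y - ?L. dm b < D \<longrightarrow>
     (\<Sum>c\<in>?Y - ?L. s a c * real_of_int (inc c b) + real_of_int (inc a c) * s c b) = (if a = b then 1 else 0)"
    using hvan_contraction[OF sub_below sub_minus_star[OF sub_below] LY hv, of D] by (elim exE conjE)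
   have ne: "a \<noteq> {}" "dm a < D" if "a \<in> ?Y - ?L" for a
    using that D[of a] empty_C by (auto simp: below_def rkc_def split: if_splits)
   show ?thesis unfolding Q1[OF False]
   proof (intro exI[of _ s] conjI allI ballI impI)
    fix a b assume "s a b \<noteq> 0"
    then show "rkc a = Suc (rkc b)" using s(1)[THEN spec, THEN spec, THEN mp, of a b] ne(1)[of a] ne(1)[of b] by (simp add: rkc_def)
   next
    fix a b assume ab: "a \<in> ?Y - ?L" "b \<in> ?Y - ?L"
    have "(\<Sum>c\<in>?Y - ?L. s a c * real_of_int (ieps c b) + real_of_int (ieps a c) * s c b) =
     (\<Sum>c\<in>?Y - ?L. s a c * real_of_int (inc c b) + real_of_int (inc a c) * s c b)"
     using ne(1) ab by (intro sum.cong refl) (simp add: ieps_def)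
    then show "(\<Sum>c\<in>?Y - ?L. s a c * real_of_int (ieps c b) + real_of_int (ieps a c) * s c b) = (if a = b then 1 else 0)"
     using bspec[OF bspec[OF s(2) ab(1)] ab(2)] ne(2)[OF ab(2)] by simp
   qed
  qed
  then obtain s where s: "\<forall>a b. s a b \<noteq> 0 \<longrightarrow> rkc a = Suc (rkc b)"
    "\<forall>a\<in>?Q. \<forall>b\<in>?Q. (\<Sum>c\<in>?Q. s a c * real_of_int (ieps c b) + real_of_int (ieps a c) * s c b) = (if a = b then 1 else 0)"
   by (elim exE conjE)
  show ?thesis
  proof (intro exI[of _ s] conjI allI impI)
   fix a b assume "leq x a \<and> leq a y \<and> leq x b \<and> leq b y"
   then have "a \<in> ?Q" "b \<in> ?Q" by simp_all
   then show "(\<Sum>c\<in>?Q. s a c * real_of_int (ieps c b) + real_of_int (ieps a c) * s c b) = (if a = b then 1 else 0)"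
    using bspec[OF bspec[OF s(2)]] by blast
  qed (use s(1) in blast)
 qed
qed (auto simp: rkc_def)

end

section \<open>Closures of cells\<close>

text \<open>Closure and frontier depend on \<open>e\<close> alone, and their relative homology is
  nonzero only in the dimension of the cell.\<close>

lemma cell_dim_unique:
 assumes "cell X n e \<Phi>" "cell X m e \<Psi>" shows "n = m"
proof (rule ccontr)
 assume nm: "n \<noteq> m"
 interpret c: cell X n e \<Phi> by fact
 interpret d: cell X m e \<Psi> by fact
 obtain z where z: "hgen X n c.cl c.fr z" using c.hgen_cl ..
 have "rcyc X n d.cl d.fr z" using z unfolding hgen_def c.cl_closure c.fr_closure d.cl_closure d.fr_closure by (elim conjE)
 then have "rbdr X n d.cl d.fr z" by (rule d.rbdr_cl[OF nm])
 then have "rbdr X n c.cl c.fr (frag_cmul 1 z)"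
  unfolding c.cl_closure c.fr_closure d.cl_closure d.fr_closure by simp
 moreover have "\<forall>k. rbdr X n c.cl c.fr (frag_cmul k z) \<longrightarrow> k = 0" using z unfolding hgen_def by (elim conjE)
 ultimately have "1 = (0::int)" by (elim allE impE)
 then show False by simp
qed

lemma connected_unit_ball_interior: "connected (oball n)"
proof -
 let ?s = "\<lambda>y::nat\<Rightarrow>real. (\<lambda>t i. t * y i) ` {0..1::real}"
 have in_int: "?s y \<subseteq> oball n" if "y \<in> oball n" for y
 proof
  fix w assume "w \<in> ?s y"
  then obtain t where t: "0 \<le> t" "t \<le> 1" "w = (\<lambda>i. t * y i)" by auto
  have "nsq n w = t\<^sup>2 * nsq n y" unfolding t(3) by (rule nsq_scale)
  also have "\<dots> \<le> 1 * nsq n y" using t nsq_nonneg[of n y] by (intro mult_right_mono) (auto simp: power_le_one)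
  finally show "w \<in> oball n" using that t(3) by (auto simp: unit_ball_interior_eq bset_def)
 qed
 have "connected (?s y)" for y
  by (rule connected_continuous_image, rule continuous_on_pair_fun) (auto intro!: continuous_intros)
 moreover have "(\<lambda>i. 0) \<in> ?s y" for y by (rule image_eqI[of _ _ 0]) auto
 then have "(\<lambda>i. 0) \<in> \<Inter>(?s ` oball n)" by blast
 then have "\<Inter>(?s ` oball n) \<noteq> {}" by (rule ex_in_conv[THEN iffD1, OF exI])
 ultimately have "connected (\<Union>(?s ` oball n))" by (intro connected_Union) auto
 moreover have "y \<in> ?s y" for y by (rule image_eqI[of _ _ 1]) auto
 then have "oball n \<subseteq> \<Union>(?s ` oball n)" by (intro subsetI UN_I)
 then have "\<Union>(?s ` oball n) = oball n" using in_int by (intro equalityI UN_least)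
 ultimately show ?thesis by simp
qed

text \<open>Coning off turns an open piece of the sphere \<open>fr\<close> lying in another cell into an open subset of
 Euclidean space to which invariance of domain applies.\<close>

lemma open_piece:
 assumes "cell X n e \<Phi>" "cell X m c \<Psi>" and mn: "m < n"
  and W: "openin (subtopology X (X closure_of e - e)) W" "W \<noteq> {}" "W \<subseteq> c"
 shows "n = Suc m" "openin (top_of_set (oball m)) {y \<in> oball m. \<Psi> y \<in> W}"
proof -
 interpret e: cell X n e \<Phi> by fact
 interpret c: cell X m c \<Psi> by fact
 define E where "E = (\<lambda>n. {x::nat \<Rightarrow> real. \<forall>i\<ge>n. x i = 0})"
 have Eeu: "Euclidean_space k = top_of_set (E k)" for k by (simp add: Euclidean_top_of_set E_def)
 define V where "V = {y \<in> sphr n. \<Phi> y \<in> W}"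
 have bd_b: "sphr n \<subseteq> bset n" by (auto simp: unit_ball_boundary_eq)
 have "continuous_map (top_of_set (sphr n)) (subtopology X (X closure_of e - e)) \<Phi>"
 proof -
  have "continuous_map (subtopology (unit_ball n) (sphr n)) X \<Phi>"
   by (rule continuous_map_from_subtopology[OF e.cont\<Phi>])
  moreover have "subtopology (unit_ball n) (sphr n) = top_of_set (sphr n)"
   unfolding unit_ball_top_of_set subtopology_subtopology using bd_b by (simp add: inf.absorb2)
  ultimately show ?thesis unfolding e.fr_closure[symmetric]
   by (auto simp: continuous_map_in_subtopology e.fr_def)
 qed
 from openin_continuous_map_preimage[OF this W(1)]
 have "openin (top_of_set (sphr n)) V" by (simp add: V_def)
 then obtain O' where O': "open O'" "V = sphr n \<inter> O'" by (auto simp: openin_open)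
 \<comment> \<open>Radial projection; \<open>T\<close> is the cone over \<open>V\<close> without its
   apex, an open subset of \<open>n\<close>-dimensional Euclidean space.\<close>
 define u where "u = (\<lambda>(v::nat\<Rightarrow>real) i. v i / sqrt (nsq n v))"
 define T where "T = {v \<in> E n - {\<lambda>i. 0}. u v \<in> O'}"
 have pos: "0 < nsq n v" if "v \<in> E n - {\<lambda>i. 0}" for v
 proof -
  have "nsq n v \<noteq> 0"
  proof
   assume 0: "nsq n v = 0"
   then have "v \<in> bset n" using that by (simp add: bset_def E_def)
   then show False using nsq_eq_0[of v n] 0 that by simp
  qed
  then show ?thesis using nsq_nonneg[of n v] by linarith
 qed
 have u_bd: "u v \<in> sphr n" if "v \<in> E n - {\<lambda>i. 0}" for v
 proof -
  have "nsq n (u v) = (1 / sqrt (nsq n v))\<^sup>2 * nsq n v"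
   unfolding u_def using nsq_scale[of n "1 / sqrt (nsq n v)" v] by simp
  also have "\<dots> = 1" using pos[OF that] by (simp add: power_divide)
  finally show ?thesis using that by (simp add: unit_ball_boundary_eq bset_def u_def E_def)
 qed
 have TV: "u v \<in> V" if "v \<in> T" for v using that u_bd O'(2) by (auto simp: T_def)
 have cont_u: "continuous_on (E n - {\<lambda>i. 0}) u"
  unfolding u_def
 proof (rule continuous_on_pair_fun)
  fix i
  have "\<forall>v\<in>E n - {\<lambda>i. 0}. sqrt (nsq n v) \<noteq> 0"
  proof
   fix v assume "v \<in> E n - {\<lambda>i. 0}" then show "sqrt (nsq n v) \<noteq> 0" using pos[of v] by simp
  qed
  then show "continuous_on (E n - {\<lambda>i. 0}) (\<lambda>v. v i / sqrt (nsq n v))"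
   by (rule continuous_on_divide[OF continuous_coord[OF continuous_on_id] continuous_on_real_sqrt[OF continuous_nsq[OF continuous_on_id]]])
 qed
 have openT: "openin (Euclidean_space n) T"
 proof -
  have "openin (top_of_set (E n - {\<lambda>i. 0})) T"
   unfolding T_def using continuous_openin_preimage_gen[OF cont_u O'(1)] by (simp add: vimage_def Int_def)
  moreover have "openin (top_of_set (E n)) (E n - {\<lambda>i. 0})" by (intro openin_diff) (auto simp: E_def)
  ultimately show ?thesis unfolding Eeu by (rule openin_trans)
 qed
 define g where "g = (\<lambda>y. c.inv\<Phi> (\<Phi> y))"
 have VW: "\<Phi> y \<in> c.cl" "\<Phi> y \<in> c" if "y \<in> V" for y using that W(3) c.e_cl by (auto simp: V_def)
 have g_int: "g y \<in> oball m" if "y \<in> V" for y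
  using VW(2)[OF that] c.inv_e unfolding g_def by blast
 have cont_g: "continuous_on V g"
 proof -
  have 1: "continuous_map (top_of_set V) X \<Phi>"
  proof -
   have "continuous_map (subtopology (unit_ball n) V) X \<Phi>" by (rule continuous_map_from_subtopology[OF e.cont\<Phi>])
   moreover have "subtopology (unit_ball n) V = top_of_set V"
    unfolding unit_ball_top_of_set subtopology_subtopology using bd_b by (auto simp: V_def inf.absorb2 Int_absorb1 subset_iff)
   ultimately show ?thesis by simp
  qed
  then have "continuous_map (top_of_set V) (subtopology X c.cl) \<Phi>"
   using VW by (auto simp: continuous_map_in_subtopology)
  from continuous_map_compose[OF this c.continv] have "continuous_map (top_of_set V) (top_of_set (bset m)) g"
   unfolding g_def unit_ball_top_of_set by (simp add: comp_def)
  then show ?thesis by auto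
 qed
 \<comment> \<open>The position of the direction inside \<open>c\<close> occupies \<open>m\<close>
   coordinates and the norm one more. All further coordinates are 0, so openness of the image forces
   \<open>n = Suc m\<close>.\<close>
 define G where "G = (\<lambda>v i. if i < m then g (u v) i else if i = m then sqrt (nsq n v) else 0)"
 have GE: "G v \<in> E n" for v using mn by (auto simp: G_def E_def)
 have cont_G: "continuous_map (subtopology (Euclidean_space n) T) (Euclidean_space n) G"
 proof -
  have TE: "T \<subseteq> E n - {\<lambda>i. 0}" "T \<subseteq> E n" by (auto simp: T_def)
  have "continuous_on T (\<lambda>v. g (u v))"
   by (rule continuous_on_compose2[OF cont_g continuous_on_subset[OF cont_u TE(1)]]) (use TV in blast)
  then have "continuous_on T G" unfolding G_def
  proof (intro continuous_on_pair_fun)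
   fix i assume c: "continuous_on T (\<lambda>v. g (u v))"
   show "continuous_on T (\<lambda>v. if i < m then g (u v) i else if i = m then sqrt (nsq n v) else 0)"
    using continuous_coord[OF c] continuous_on_real_sqrt[OF continuous_nsq[OF continuous_on_id]]
    by (cases "i < m"; cases "i = m") auto
  qed
  moreover have "subtopology (top_of_set (E n)) T = top_of_set T"
   unfolding subtopology_subtopology using TE by (simp add: inf.absorb2)
  ultimately show ?thesis unfolding Eeu using GE by auto
 qed
 have inj_G: "inj_on G T"
 proof (rule inj_onI)
  fix v w assume vw: "v \<in> T" "w \<in> T" "G v = G w"
  have "sqrt (nsq n v) = sqrt (nsq n w)" using fun_cong[OF vw(3), of m] by (simp add: G_def)
  moreover have "g (u v) = g (u w)"
  proof
   fix i
   show "g (u v) i = g (u w) i"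
   proof (cases "i < m")
    case True then show ?thesis using fun_cong[OF vw(3), of i] by (simp add: G_def)
   next
    case False
    then show ?thesis using g_int[OF TV[OF vw(1)]] g_int[OF TV[OF vw(2)]]
     by (simp add: unit_ball_interior_eq bset_def)
   qed
  qed
  then have "\<Psi> (g (u v)) = \<Psi> (g (u w))" by simp
  then have "\<Phi> (u v) = \<Phi> (u w)"
   unfolding g_def using c.\<Phi>_inv[OF VW(1)[OF TV[OF vw(1)]]] c.\<Phi>_inv[OF VW(1)[OF TV[OF vw(2)]]] by simp
  moreover have "u v \<in> bset n" "u w \<in> bset n" using TV[OF vw(1)] TV[OF vw(2)] bd_b by (auto simp: V_def)
  ultimately have sq: "sqrt (nsq n v) = sqrt (nsq n w)" and uu: "u v = u w" using inj_onD[OF e.inj, of "u v" "u w"] by auto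
  have "sqrt (nsq n w) \<noteq> 0" using pos[of w] vw by (auto simp: T_def)
  then have "v i = w i" for i using fun_cong[OF uu, of i] unfolding u_def sq by simp
  then show "v = w" by blast
 qed
 have openG: "openin (Euclidean_space n) (G ` T)"
  by (rule invariance_of_domain_Euclidean_space[OF openT cont_G inj_G])
 then obtain Q where Q: "open Q" "G ` T = E n \<inter> Q" unfolding Eeu openin_open by auto
 have VT: "y \<in> T" "u y = y" "nsq n y = 1" if "y \<in> V" for y
 proof -
  have y: "y \<in> bset n" "nsq n y = 1" using that by (auto simp: V_def unit_ball_boundary_eq)
  then have "y \<noteq> (\<lambda>i. 0)" by (auto simp: nsq_def)
  moreover show "u y = y" using y by (simp add: u_def)
  ultimately show "y \<in> T" using y that O'(2) by (auto simp: T_def E_def bset_def)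
  show "nsq n y = 1" by fact
 qed
 obtain x where x: "x \<in> W" using W(2) by auto
 have "x \<in> e.fr" using x openin_subset[OF W(1)] by (auto simp: e.fr_closure)
 then obtain y0 where y0: "y0 \<in> V" using x by (auto simp: e.fr_def V_def)
 show n: "n = Suc m"
 proof (rule ccontr)
  assume "n \<noteq> Suc m"
  then have lt: "Suc m < n" using mn by simp
  let ?f = "\<lambda>t::real. (G y0)(n - 1 := t)"
  have Gn: "G v (n - 1) = 0" for v using lt by (auto simp: G_def)
  have "continuous_on UNIV ?f"
  proof (rule continuous_on_pair_fun)
   fix i show "continuous_on UNIV (\<lambda>t. ?f t i)" by (cases "i = n - 1") (simp_all add: continuous_on_id)
  qed
  then have "open (?f -` Q)" using Q(1) by (auto intro: open_vimage)
  moreover have "?f -` Q = {0}"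
  proof (intro equalityI subsetI)
   fix t assume "t \<in> ?f -` Q"
   moreover have "?f t \<in> E n" using GE[of y0] lt by (auto simp: E_def)
   ultimately have "?f t \<in> G ` T" using Q(2) by auto
   then obtain v where "?f t = G v" by auto
   then have "t = G v (n - 1)" by (metis fun_upd_same)
   then show "t \<in> {0}" using Gn by simp
  next
   fix t :: real assume "t \<in> {0}"
   then have "?f t = G y0" using Gn[of y0] by (auto simp: fun_eq_iff)
   then show "t \<in> ?f -` Q" using VT(1)[OF y0] Q(2) by auto
  qed
  ultimately show False using not_open_singleton[of "0::real"] by simp
 qed
 let ?I = "oball m"
 \<comment> \<open>The slice of the open image at radius 1 is the set of parameters in
   question.\<close>
 let ?k = "\<lambda>(y::nat\<Rightarrow>real) i. if i < m then y i else if i = m then 1 else (0::real)"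
 have "continuous_on ?I ?k"
 proof (intro continuous_on_pair_fun)
  fix i show "continuous_on ?I (\<lambda>y. if i < m then y i else if i = m then 1 else (0::real))"
   using continuous_coord[OF continuous_on_id, of ?I i] by (cases "i < m"; cases "i = m") auto
 qed
 from continuous_openin_preimage_gen[OF this Q(1)]
 have "openin (top_of_set ?I) {y \<in> ?I. ?k y \<in> Q}" by (simp add: vimage_def Int_def)
 moreover have "{y \<in> ?I. ?k y \<in> Q} = {y \<in> ?I. \<Psi> y \<in> W}"
 proof (intro Collect_cong conj_cong refl)
  fix y assume y: "y \<in> ?I"
  have yb: "y \<in> bset m" using y by (simp add: unit_ball_interior_eq)
  show "?k y \<in> Q \<longleftrightarrow> \<Psi> y \<in> W"
  proof
   assume "?k y \<in> Q"
   then have "?k y \<in> G ` T" using Q(2) n by (auto simp: E_def)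
   then obtain v where v: "v \<in> T" "?k y = G v" by auto
   have "y = g (u v)"
   proof
    fix i show "y i = g (u v) i"
    proof (cases "i < m")
     case True then show ?thesis using fun_cong[OF v(2), of i] by (simp add: G_def)
    next
     case False then show ?thesis using g_int[OF TV[OF v(1)]] yb by (simp add: unit_ball_interior_eq bset_def)
    qed
   qed
   then have "\<Psi> y = \<Phi> (u v)" unfolding g_def using c.\<Phi>_inv[OF VW(1)[OF TV[OF v(1)]]] by simp
   then show "\<Psi> y \<in> W" using TV[OF v(1)] by (simp add: V_def)
  next
   assume w: "\<Psi> y \<in> W"
   then have "\<Psi> y \<in> e.fr" using openin_subset[OF W(1)] by (auto simp: e.fr_closure)
   then obtain y' where y': "y' \<in> V" "\<Psi> y = \<Phi> y'" using w by (auto simp: e.fr_def V_def)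
   have gy: "g y' = y" unfolding g_def y'(2)[symmetric] by (rule c.inv_\<Phi>[OF yb])
   have "G y' = ?k y" unfolding G_def VT(2,3)[OF y'(1)] gy real_sqrt_one ..
   then have "?k y \<in> G ` T" using VT(1)[OF y'(1)] by (metis imageI)
   then show "?k y \<in> Q" using Q(2) by simp
  qed
 qed
 ultimately show "openin (top_of_set ?I) {y \<in> ?I. \<Psi> y \<in> W}" by simp
qed

text \<open>The literal content of \<open>finite_regular_CW\<close> with dimensions named: cell
  boundaries are merely covered by lower cells. The locale serves to derive
  \<open>regcw\<close>.\<close>

locale precw =
 fixes X :: "'a topology" and C :: "'a set set" and dm :: "'a set \<Rightarrow> nat"
 assumes haus: "Hausdorff_space X" and finC: "finite C" and disj: "disjoint C"
  and cells: "e \<in> C \<Longrightarrow> \<exists>\<Phi>. characteristic_map X (dm e) e \<Phi>"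
  and low: "e \<in> C \<Longrightarrow> X closure_of e - e \<subseteq> \<Union>{c \<in> C. dm c < dm e}"
begin

lemma cellI: "e \<in> C \<Longrightarrow> \<exists>\<Phi>. cell X (dm e) e \<Phi>"
 using cells[of e] haus by (simp add: cell_def)

lemma cell_eq: "d \<in> C \<Longrightarrow> e \<in> C \<Longrightarrow> x \<in> d \<Longrightarrow> x \<in> e \<Longrightarrow> d = e"
 using disj by (auto simp: disjoint_def)

lemma e_closure: assumes "e \<in> C" shows "e \<subseteq> X closure_of e"
proof -
 obtain \<Phi> where "cell X (dm e) e \<Phi>" using cellI[OF assms] ..
 then interpret c: cell X "dm e" e \<Phi> .
 show ?thesis using c.e_cl unfolding c.cl_closure .
qed

text \<open>Boundaries drop strictly in dimension, so leaving out one cell of top dimension keeps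
  the skeleton closed; the left-out cell is thus relatively open.\<close>

lemma closed_skel: "closedin X (\<Union>{c \<in> C. dm c \<le> k \<and> c \<noteq> c0})" if "c0 \<notin> C \<or> k \<le> dm c0"
proof -
 have eq: "\<Union>{c \<in> C. dm c \<le> k \<and> c \<noteq> c0} = (\<Union>c\<in>{c \<in> C. dm c \<le> k \<and> c \<noteq> c0}. X closure_of c)"
 proof (intro equalityI subsetI)
  fix x assume "x \<in> \<Union>{c \<in> C. dm c \<le> k \<and> c \<noteq> c0}"
  then show "x \<in> (\<Union>c\<in>{c \<in> C. dm c \<le> k \<and> c \<noteq> c0}. X closure_of c)" using e_closure by auto
 next
  fix x assume "x \<in> (\<Union>c\<in>{c \<in> C. dm c \<le> k \<and> c \<noteq> c0}. X closure_of c)"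
  then obtain c where c: "c \<in> C" "dm c \<le> k" "c \<noteq> c0" "x \<in> X closure_of c" by auto
  show "x \<in> \<Union>{c \<in> C. dm c \<le> k \<and> c \<noteq> c0}"
  proof (cases "x \<in> c")
   case False
   then obtain d where "d \<in> C" "dm d < dm c" "x \<in> d" using low[OF c(1)] c(4) by auto
   then show ?thesis using c(2) that by auto
  qed (use c in auto)
 qed
 show ?thesis unfolding eq using finC by (intro closedin_Union) auto
qed

lemma open_top:
 assumes c: "c \<in> C" and W: "W \<subseteq> \<Union>{c' \<in> C. dm c' \<le> dm c}" and WS: "openin (subtopology X S) W"
 shows "openin (subtopology X S) (W \<inter> c)"
proof -
 let ?K = "\<Union>{c' \<in> C. dm c' \<le> dm c \<and> c' \<noteq> c}"
 have "W \<inter> c = W - ?K"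
 proof (intro equalityI subsetI)
  fix x assume x: "x \<in> W \<inter> c"
  then show "x \<in> W - ?K" using cell_eq[OF c] by auto
 next
  fix x assume "x \<in> W - ?K" then show "x \<in> W \<inter> c" using W by auto
 qed
 also have "\<dots> = W - (?K \<inter> S)" using openin_subset[OF WS] by auto
 finally show ?thesis
  using WS openin_diff[OF WS] closedin_subtopology[of X S "?K \<inter> S"] closed_skel[of c "dm c"] by auto
qed

text \<open>In codimension one, \<open>c\<close> meets the sphere in a set that is closed in
  \<open>c\<close>, and open by \<open>open_piece\<close>, while \<open>c\<close> is connected. In
  higher codimension the closures of the codimension-one cells cover the sphere, and induction on
  \<open>dm e\<close> applies to one of them.\<close>

lemma boundary_cells:
 assumes "e \<in> C" "c \<in> C" "c \<inter> (X closure_of e - e) \<noteq> {}"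
 shows "c \<subseteq> X closure_of e - e"
 using assms
proof (induction "dm e" arbitrary: e c rule: less_induct)
 case less
 let ?S = "X closure_of e - e" and ?n = "dm e"
 obtain \<Phi> where ce: "cell X ?n e \<Phi>" using cellI[OF less.prems(1)] ..
 then interpret e: cell X ?n e \<Phi> .
 have closedS: "closedin X ?S" using e.closed_fr unfolding e.fr_closure .
 have SX: "?S \<subseteq> topspace X" using closedin_subset[OF closedS] .
 have dmS: "dm c' < ?n" if c': "c' \<in> C" "x \<in> c'" "x \<in> ?S" for c' x
 proof -
  obtain d where d: "d \<in> C" "dm d < ?n" "x \<in> d" using low[OF less.prems(1)] c'(3) by auto
  then show ?thesis using cell_eq[OF c'(1) d(1) c'(2) d(3)] by simp
 qed
 have top: "c' \<subseteq> ?S" if c': "c' \<in> C" "Suc (dm c') = ?n" "c' \<inter> ?S \<noteq> {}" for c'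
 proof -
  obtain \<Psi> where cc: "cell X (dm c') c' \<Psi>" using cellI[OF c'(1)] ..
  then interpret c: cell X "dm c'" c' \<Psi> .
  let ?I = "oball (dm c')"
  have "?S \<subseteq> \<Union>{d \<in> C. dm d \<le> dm c'}" using low[OF less.prems(1)] unfolding c'(2)[symmetric] less_Suc_eq_le .
  moreover have "openin (subtopology X ?S) ?S" using openin_topspace[of "subtopology X ?S"] SX by (simp add: inf.absorb2)
  ultimately have op: "openin (subtopology X ?S) (?S \<inter> c')" by (rule open_top[OF c'(1)])
  have "openin (top_of_set ?I) {y \<in> ?I. \<Psi> y \<in> ?S \<inter> c'}"
   by (rule open_piece(2)[OF ce cc _ op]) (use c' in auto)
  moreover have im: "\<Psi> ` ?I = c'" by (rule c.e_eq[symmetric])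
  have "{y \<in> ?I. \<Psi> y \<in> ?S \<inter> c'} = {y \<in> ?I. \<Psi> y \<in> ?S}" using im by blast
  ultimately have 1: "openin (top_of_set ?I) {y \<in> ?I. \<Psi> y \<in> ?S}" by simp
  have "continuous_map (top_of_set ?I) X \<Psi>"
  proof -
   have "continuous_map (subtopology (unit_ball (dm c')) ?I) X \<Psi>"
    by (rule continuous_map_from_subtopology[OF c.cont\<Phi>])
   moreover have "subtopology (unit_ball (dm c')) ?I = top_of_set ?I"
    unfolding unit_ball_top_of_set subtopology_subtopology by (simp add: unit_ball_interior_eq inf.absorb2)
   ultimately show ?thesis by simp
  qed
  from closedin_continuous_map_preimage[OF this closedS]
  have 2: "closedin (top_of_set ?I) {y \<in> ?I. \<Psi> y \<in> ?S}" by simp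
  obtain x where x: "x \<in> \<Psi> ` ?I" "x \<in> ?S" using c'(3) unfolding im by blast
  then have "{y \<in> ?I. \<Psi> y \<in> ?S} \<noteq> {}" by blast
  then have "{y \<in> ?I. \<Psi> y \<in> ?S} = ?I"
   using connected_unit_ball_interior[of "dm c'"] 1 2 unfolding connected_clopen by blast
  then have "\<Psi> ` ?I \<subseteq> ?S" by blast
  then show ?thesis unfolding im .
 qed
 obtain x where x: "x \<in> c" "x \<in> ?S" using less.prems(3) by auto
 show ?case
 proof (cases "Suc (dm c) = ?n")
  case True
  then show ?thesis using top less.prems by simp
 next
  case False
  let ?T = "{c' \<in> C. Suc (dm c') = ?n \<and> c' \<inter> ?S \<noteq> {}}"
  let ?A = "\<Union>c'\<in>?T. X closure_of c'"
  \<comment> \<open>Otherwise a nonempty open piece of the sphere avoids \<open>?A\<close>. A cell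
    of greatest dimension meeting it does so in an open set, so \<open>open_piece\<close> gives it
    codimension one and it belongs to \<open>?T\<close>.\<close>
  have "x \<in> ?A"
  proof (rule ccontr)
   assume xA: "x \<notin> ?A"
   have "closedin X ?A" using finC by (intro closedin_Union) auto
   then have W0: "openin (subtopology X ?S) (?S - ?A)"
    using openin_diff[OF openin_topspace[of "subtopology X ?S"], of "?A \<inter> ?S"] closedin_subtopology[of X ?S "?A \<inter> ?S"] SX
    by (simp add: inf.absorb2 Diff_Int_distrib2 Diff_Int) blast
   let ?M = "{c' \<in> C. c' \<inter> (?S - ?A) \<noteq> {}}"
   have "?M \<noteq> {}" using x xA less.prems(2) by blast
   then obtain c' where c': "c' \<in> ?M" "\<And>d. d \<in> ?M \<Longrightarrow> dm d \<le> dm c'" using finite_max_ex[of ?M dm] finC by auto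
   have c'C: "c' \<in> C" using c' by simp
   have "?S - ?A \<subseteq> \<Union>{d \<in> C. dm d \<le> dm c'}"
   proof
    fix y assume y: "y \<in> ?S - ?A"
    then obtain d where d: "d \<in> C" "y \<in> d" using low[OF less.prems(1)] by auto
    then have "d \<in> ?M" using y by auto
    then show "y \<in> \<Union>{d \<in> C. dm d \<le> dm c'}" using c'(2) d by auto
   qed
   then have op: "openin (subtopology X ?S) ((?S - ?A) \<inter> c')" by (rule open_top[OF c'C _ W0])
   obtain \<Psi> where cc: "cell X (dm c') c' \<Psi>" using cellI[OF c'C] ..
   obtain y where y: "y \<in> c'" "y \<in> ?S" "y \<notin> ?A" using c'(1) by auto
   have lt: "dm c' < ?n" by (rule dmS[OF c'C y(1,2)])
   have "?n = Suc (dm c')" by (rule open_piece(1)[OF ce cc lt op]) (use y in auto)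
   then have "c' \<in> ?T" using c'C y by auto
   moreover have "y \<in> X closure_of c'" using e_closure[OF c'C] y(1) by auto
   ultimately show False using y(3) by auto
  qed
  then obtain c' where c': "c' \<in> C" "Suc (dm c') = ?n" "c' \<inter> ?S \<noteq> {}" "x \<in> X closure_of c'" by auto
  have c'S: "c' \<subseteq> ?S" using top[OF c'(1,2,3)] .
  have clS: "X closure_of c' \<subseteq> ?S" by (rule closure_of_minimal[OF c'S closedS])
  show ?thesis
  proof (cases "x \<in> c'")
   case True
   then show ?thesis using cell_eq[OF less.prems(2) c'(1) x(1)] c'S by simp
  next
   case no: False
   have "c \<subseteq> X closure_of c' - c'" by (rule less.hyps[OF _ c'(1) less.prems(2)]) (use c' x no in auto)
   then show ?thesis using clS by blast
  qed
 qed
qed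

theorem regcw: "regcw X C dm"
proof
 show "\<exists>D\<subseteq>C. X closure_of e - e = \<Union>D \<and> (\<forall>d\<in>D. dm d < dm e)" if e: "e \<in> C" for e
 proof (intro exI[of _ "{c \<in> C. c \<subseteq> X closure_of e - e \<and> c \<inter> (X closure_of e - e) \<noteq> {}}"] conjI ballI)
  show "X closure_of e - e = \<Union>{c \<in> C. c \<subseteq> X closure_of e - e \<and> c \<inter> (X closure_of e - e) \<noteq> {}}"
  proof (intro equalityI subsetI)
   fix x assume x: "x \<in> X closure_of e - e"
   then obtain c where c: "c \<in> C" "x \<in> c" using low[OF e] by auto
   then have "c \<inter> (X closure_of e - e) \<noteq> {}" using x by blast
   then show "x \<in> \<Union>{c \<in> C. c \<subseteq> X closure_of e - e \<and> c \<inter> (X closure_of e - e) \<noteq> {}}"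
    using boundary_cells[OF e c(1)] c by blast
  qed blast
 next
  fix d assume d: "d \<in> {c \<in> C. c \<subseteq> X closure_of e - e \<and> c \<inter> (X closure_of e - e) \<noteq> {}}"
  then obtain x where x: "x \<in> d" "x \<in> X closure_of e - e" by blast
  then obtain c where c: "c \<in> C" "dm c < dm e" "x \<in> c" using low[OF e] by auto
  then have "c = d" using cell_eq[OF c(1) _ c(3) x(1)] d by simp
  then show "dm d < dm e" using c by simp
 qed blast
 show "Hausdorff_space X" by (rule haus)
 show "finite C" by (rule finC)
 show "disjoint C" by (rule disj)
 show "\<exists>\<Phi>. characteristic_map X (dm e) e \<Phi>" if "e \<in> C" for e by (rule cells[OF that])
qed

end

text \<open>By \<open>cell_dim_unique\<close> dimensions are well defined, so the dimensions hidden
  under existential quantifiers become inequalities for one function \<open>dm\<close>.\<close>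

lemma finite_regular_CW_regcw:
 assumes "finite_regular_CW X C"
 obtains dm where "regcw X C dm"
proof -
 have haus: "Hausdorff_space X" and fin: "finite C" and disj: "disjoint C"
  and cells: "\<And>e. e \<in> C \<Longrightarrow> \<exists>n \<Phi>. characteristic_map X n e \<Phi> \<and>
    \<Phi> ` sphr n \<subseteq> \<Union>{c \<in> C. \<exists>m<n. \<exists>\<Psi>. characteristic_map X m c \<Psi>}"
  using assms by (auto simp: finite_regular_CW_def)
 define dm where "dm = (\<lambda>e. SOME n. \<exists>\<Phi>. characteristic_map X n e \<Phi>)"
 have dm: "dm e = n" if "characteristic_map X n e \<Phi>" for n e \<Phi>
 proof -
  have "\<exists>\<Phi>. characteristic_map X (dm e) e \<Phi>" unfolding dm_def by (rule someI_ex) (use that in blast)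
  then obtain \<Psi> where "cell X (dm e) e \<Psi>" using haus by (auto simp: cell_def)
  moreover have "cell X n e \<Phi>" using that haus by (simp add: cell_def)
  ultimately show ?thesis by (rule cell_dim_unique)
 qed
 have "precw X C dm"
 proof
  fix e assume e: "e \<in> C"
  obtain n \<Phi> where c: "characteristic_map X n e \<Phi>"
   "\<Phi> ` sphr n \<subseteq> \<Union>{c \<in> C. \<exists>m<n. \<exists>\<Psi>. characteristic_map X m c \<Psi>}" using cells[OF e] by blast
  then show "\<exists>\<Phi>. characteristic_map X (dm e) e \<Phi>" using dm[OF c(1)] by auto
  interpret c: cell X n e \<Phi> using c(1) haus by (simp add: cell_def)
  have "\<Union>{c \<in> C. \<exists>m<n. \<exists>\<Psi>. characteristic_map X m c \<Psi>} \<subseteq> \<Union>{c \<in> C. dm c < dm e}"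
   using dm dm[OF c(1)] by fastforce
  from subset_trans[OF c(2) this]
  show "X closure_of e - e \<subseteq> \<Union>{c \<in> C. dm c < dm e}"
   unfolding c.fr_closure[symmetric] c.fr_def .
 qed (use haus fin disj in auto)
 then show thesis by (rule that[OF precw.regcw])
qed

section \<open>Balls\<close>

context regcw
begin

text \<open>Exactness was obtained over the integers; a contraction survives the change of
  coefficients and gives it over the reals.\<close>

lemma real_exact:
 assumes Y: "sub Y" "sub L" "L \<subseteq> Y" and v: "\<And>k c. k < D \<Longrightarrow> rcyc X k (\<Union>Y) (\<Union>L) c \<Longrightarrow> rbdr X k (\<Union>Y) (\<Union>L) c"
  and j: "j < D" and z: "\<And>a. z a \<noteq> 0 \<Longrightarrow> a \<in> Y - L \<and> dm a = j"
  and cyc: "\<And>a. a \<in> Y - L \<Longrightarrow> (\<Sum>b\<in>Y-L. real_of_int (inc a b) * z b) = 0"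
 shows "\<exists>y. (\<forall>a. y a \<noteq> 0 \<longrightarrow> a \<in> Y - L \<and> dm a = Suc j) \<and>
  (\<forall>a\<in>Y-L. (\<Sum>b\<in>Y-L. real_of_int (inc a b) * y b) = z a)"
proof -
 let ?Q = "Y - L"
 have fin: "finite ?Q" using finite_sub[OF Y(1)] by simp
 have "\<exists>s::'a set \<Rightarrow> 'a set \<Rightarrow> real. (\<forall>a b. s a b \<noteq> 0 \<longrightarrow> a \<in> ?Q \<and> b \<in> ?Q \<and> dm a = Suc (dm b)) \<and>
   (\<forall>a\<in>?Q. \<forall>b\<in>?Q. dm b < D \<longrightarrow>
    (\<Sum>c\<in>?Q. s a c * real_of_int (inc c b) + real_of_int (inc a c) * s c b) = (if a = b then 1 else 0))"
  by (rule pair_contraction[OF Y]) (rule v)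
 then obtain s :: "'a set \<Rightarrow> 'a set \<Rightarrow> real" where s1: "\<forall>a b. s a b \<noteq> 0 \<longrightarrow> a \<in> ?Q \<and> b \<in> ?Q \<and> dm a = Suc (dm b)"
  and s2: "\<forall>a\<in>?Q. \<forall>b\<in>?Q. dm b < D \<longrightarrow>
    (\<Sum>c\<in>?Q. s a c * real_of_int (inc c b) + real_of_int (inc a c) * s c b) = (if a = b then 1 else 0)"
  by (elim exE conjE)
 define y where "y = (\<lambda>a. \<Sum>b\<in>?Q. s a b * z b)"
 show ?thesis
 proof (intro exI[of _ y] conjI allI ballI impI)
  fix a assume "y a \<noteq> 0"
  then obtain b where "s a b * z b \<noteq> 0" unfolding y_def by (meson sum.neutral)
  then have "s a b \<noteq> 0" "z b \<noteq> 0" by auto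
  then show "a \<in> ?Q" "dm a = Suc j" using s1[THEN spec, THEN spec, THEN mp, of a b] z[of b] by simp_all
 next
  fix a assume a: "a \<in> ?Q"
  have "(\<Sum>c\<in>?Q. real_of_int (inc a c) * y c) = (\<Sum>b\<in>?Q. (\<Sum>c\<in>?Q. real_of_int (inc a c) * s c b) * z b)"
   unfolding y_def sum_distrib_left sum_distrib_right by (subst sum.swap) (simp add: mult.assoc)
  also have "\<dots> = (\<Sum>b\<in>?Q. ((if a = b then 1 else 0) - (\<Sum>c\<in>?Q. s a c * real_of_int (inc c b))) * z b)"
  proof (rule sum.cong[OF refl])
   fix b assume b: "b \<in> ?Q"
   show "(\<Sum>c\<in>?Q. real_of_int (inc a c) * s c b) * z b = ((if a = b then 1 else 0) - (\<Sum>c\<in>?Q. s a c * real_of_int (inc c b))) * z b"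
   proof (cases "z b = 0")
    case False
    then have "dm b < D" using z[of b] j by simp
    from mp[OF bspec[OF bspec[OF s2 a] b] this] show ?thesis by (simp add: sum.distrib)
   qed simp
  qed
  also have "\<dots> = (\<Sum>b\<in>?Q. (if a = b then 1 else 0) * z b) - (\<Sum>b\<in>?Q. \<Sum>c\<in>?Q. s a c * real_of_int (inc c b) * z b)"
   by (simp add: left_diff_distrib sum_subtractf sum_distrib_right)
  also have "(\<Sum>b\<in>?Q. (if a = b then 1 else 0) * z b) = z a" using a fin by (simp add: if_distrib if_distribR cong: if_cong)
  also have "(\<Sum>b\<in>?Q. \<Sum>c\<in>?Q. s a c * real_of_int (inc c b) * z b) = (\<Sum>c\<in>?Q. s a c * (\<Sum>b\<in>?Q. real_of_int (inc c b) * z b))"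
   by (subst sum.swap) (simp add: sum_distrib_left mult.assoc)
  also have "\<dots> = 0" using cyc by (intro sum.neutral ballI) simp
  finally show "(\<Sum>b\<in>?Q. real_of_int (inc a b) * y b) = z a" by simp
 qed
qed

text \<open>Modulo a vertex the ball is acyclic, so its cells cancel except for that vertex.\<close>

lemma euler_ball:
 assumes Y: "sub Y" and c: "cell X n b \<Phi>" and cl: "X closure_of b = \<Union>Y"
 shows "(\<Sum>a\<in>Y. (-1) ^ dm a) = (1::int)"
proof -
 interpret c: cell X n b \<Phi> by fact
 have "\<Union>Y \<noteq> {}" using c.e_nonempty c.e_cl unfolding c.cl_closure cl by blast
 then obtain e where e: "e \<in> Y" by blast
 then have eC: "e \<in> C" using subC[OF Y] by blast
 obtain v where v: "below v e" "dm v = 0" using vertex_below[OF eC] .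
 have vC: "v \<in> C" using v by (simp add: below_def)
 have vY: "v \<in> Y" using v(1) e Y by (auto simp: below_def sub_def)
 obtain x where x: "v = {x}" "X closure_of v = {x}" using vertex[OF vC v(2)] .
 have "bdc v = {}" using bdc_dm[OF vC] v(2) by auto
 then have L: "sub {v}" "{v} \<subseteq> Y" using vC vY by (auto simp: sub_def)
 have "x \<in> c.cl" unfolding c.cl_closure cl using vY x by auto
 from c.hvan_point[OF this] have "hvan X (\<Union>Y) (\<Union>{v})" unfolding c.cl_closure cl x by simp
 from euler_pair[OF Y L this] have "(\<Sum>a\<in>Y-{v}. (-1) ^ dm a) = (0::int)" .
 then show ?thesis using sum.remove[OF finite_sub[OF Y] vY, of "\<lambda>a. (-1) ^ dm a :: int"] v(2) by simp
qed

end

text \<open>The ball enters twice, as the single cell \<open>b\<close> and as the complex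
  \<open>C\<close> subdividing it, so that the homology of one cell can be read off on the
  complex.\<close>

locale ballcw = regcw X C dm + ball: cell X n b \<Phi>
 for X :: "'a topology" and C dm n b \<Phi> +
 assumes cover: "ball.cl = \<Union>C"
begin

definition BC :: "'a set set" where "BC = {e \<in> C. e \<subseteq> ball.fr}"
definition IC :: "'a set set" where "IC = {e \<in> C. \<not> e \<subseteq> ball.fr}"

lemma C_split: "C = BC \<union> IC" "BC \<inter> IC = {}" "BC \<subseteq> C" "IC \<subseteq> C" by (auto simp: BC_def IC_def)

lemma finite_BC: "finite BC" and finite_IC: "finite IC"
 using finite_subset[OF _ finC] C_split by blast+

lemma mem_star: "e \<in> C \<Longrightarrow> x \<in> e \<Longrightarrow> x \<notin> \<Union>{d \<in> C. \<not> below e d}"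
proof
 assume e: "e \<in> C" "x \<in> e" and "x \<in> \<Union>{d \<in> C. \<not> below e d}"
 then obtain d where d: "d \<in> C" "\<not> below e d" "x \<in> d" by auto
 then have "d = e" using cell_eq[OF d(1) e(1) d(3) e(2)] by simp
 then show False using d(2) below_refl[OF e(1)] by simp
qed

text \<open>The right-hand side depends on the cell \<open>e\<close> only, not on the point
  \<open>x\<close>. Hence a cell meeting the boundary of the ball lies in it entirely.\<close>

lemma star_fr:
 assumes e: "e \<in> C" "x \<in> e"
 shows "x \<in> ball.fr \<longleftrightarrow> hvan X (\<Union>C) (\<Union>{d \<in> C. \<not> below e d})"
proof -
 let ?L = "\<Union>{d \<in> C. \<not> below e d}"
 have st: "hvan X (\<Union>C - {x}) ?L" by (rule hvan_minus_star[OF sub_C e])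
 have L: "?L \<subseteq> \<Union>C - {x}" using mem_star[OF e] by auto
 show ?thesis
 proof
  assume "x \<in> ball.fr"
  then have "hvan X (\<Union>C) (\<Union>C - {x})" using ball.hvan_cl_minus[of x] unfolding cover by blast
  then show "hvan X (\<Union>C) ?L" by (rule hvan_trans[OF _ st L]) auto
 next
  assume "hvan X (\<Union>C) ?L"
  from hvan_left[OF this st L] have h: "hvan X ball.cl (ball.cl - {x})" unfolding cover by auto
  show "x \<in> ball.fr"
  proof (rule ccontr)
   assume "x \<notin> ball.fr"
   moreover have "x \<in> ball.cl" unfolding cover using e by auto
   ultimately have "x \<in> b" unfolding ball.cl_eq by simp
   then show False using ball.not_hvan_minus_e[of x] h by simp
  qed
 qed
qed

lemma BC_iff: "e \<in> C \<Longrightarrow> x \<in> e \<Longrightarrow> e \<in> BC \<longleftrightarrow> x \<in> ball.fr"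
 using star_fr[of e] by (auto simp: BC_def)

lemma Union_BC: "\<Union>BC = ball.fr"
proof
 show "\<Union>BC \<subseteq> ball.fr" by (auto simp: BC_def)
 show "ball.fr \<subseteq> \<Union>BC"
 proof
  fix x assume x: "x \<in> ball.fr"
  then obtain e where e: "e \<in> C" "x \<in> e" using ball.fr_cl unfolding cover by auto
  then show "x \<in> \<Union>BC" using BC_iff[OF e] x by auto
 qed
qed

lemma sub_BC: "sub BC"
 unfolding sub_def
proof (intro conjI ballI subsetI)
 show "e \<in> BC \<Longrightarrow> e \<in> C" for e by (simp add: BC_def)
 fix e d assume ed: "e \<in> BC" "d \<in> bdc e"
 then have "X closure_of e \<subseteq> ball.fr" using closure_of_minimal[OF _ ball.closed_fr, of e] by (simp add: BC_def)
 then show "d \<in> BC" using ed(2) by (auto simp: bdc_def BC_def)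
qed

lemma IC_up: "e \<in> IC \<Longrightarrow> below e d \<Longrightarrow> d \<in> IC"
proof -
 assume e: "e \<in> IC" and d: "below e d"
 have "d \<in> C" using d by (simp add: below_def)
 moreover have "d \<notin> BC"
 proof
  assume "d \<in> BC"
  then have "e \<in> BC" using d sub_BC by (auto simp: below_def sub_def)
  then show False using e by (simp add: BC_def IC_def)
 qed
 ultimately show "d \<in> IC" by (simp add: BC_def IC_def)
qed

lemma IC_point:
 assumes "e \<in> IC"
 obtains x where "x \<in> e" "x \<in> b" "e \<in> C"
proof -
 have e: "e \<in> C" "\<not> e \<subseteq> ball.fr" using assms by (auto simp: IC_def)
 then obtain x where x: "x \<in> e" "x \<notin> ball.fr" by auto
 have "x \<in> ball.cl" unfolding cover using e x by auto
 then have "x \<in> b" using x unfolding ball.cl_eq by simp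
 then show thesis using that x e by blast
qed

lemma hvan_minus_b: "x \<in> b \<Longrightarrow> hvan X (\<Union>C - {x}) ball.fr"
proof -
 assume x: "x \<in> b"
 have "ball.fr \<union> b = \<Union>C" using ball.cl_eq cover by blast
 moreover have "ball.fr \<inter> b = {}" using ball.e_fr by blast
 ultimately show ?thesis using ball.hvan_minus_e[OF ball.closed_fr subset_refl _ x] by simp
qed

lemma BC_sub_star: "e \<in> IC \<Longrightarrow> BC \<subseteq> {d \<in> C. \<not> below e d}"
 using IC_up[of e] C_split by blast

text \<open>Deleting from the ball an interior point that lies in \<open>e\<close> leaves a space
  that retracts both to the complement of the star and to the boundary sphere.\<close>

lemma hvan_link:
 assumes "e \<in> IC" shows "hvan X (\<Union>{d \<in> C. \<not> below e d}) ball.fr"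
proof -
 obtain x where x: "x \<in> e" "x \<in> b" "e \<in> C" using IC_point[OF assms] .
 show ?thesis
 proof (rule hvan_right[OF hvan_minus_star[OF sub_C x(3,1)] hvan_minus_b[OF x(2)]])
  show "ball.fr \<subseteq> \<Union>{d \<in> C. \<not> below e d}" unfolding Union_BC[symmetric] by (rule Union_mono[OF BC_sub_star[OF assms]])
  show "\<Union>{d \<in> C. \<not> below e d} \<subseteq> \<Union>C - {x}" using mem_star[OF x(3,1)] by auto
 qed
qed

lemma rbdr_star:
 assumes "e \<in> IC" "k \<noteq> n" "rcyc X k (\<Union>C) (\<Union>{d \<in> C. \<not> below e d}) c"
 shows "rbdr X k (\<Union>C) (\<Union>{d \<in> C. \<not> below e d}) c"
proof -
 let ?L = "\<Union>{d \<in> C. \<not> below e d}"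
 have fL: "ball.fr \<subseteq> ?L" unfolding Union_BC[symmetric] by (rule Union_mono[OF BC_sub_star[OF assms(1)]])
 have LC: "?L \<subseteq> \<Union>C" by auto
 obtain c' where c': "rcyc X k (\<Union>C) ball.fr c'" "rbdr X k (\<Union>C) ?L (c - c')"
  using rcyc_lift[OF hvan_link[OF assms(1)] fL LC assms(3)] .
 have "rbdr X k (\<Union>C) ball.fr c'" using ball.rbdr_cl[OF assms(2), unfolded cover, OF c'(1)] .
 then have "rbdr X k (\<Union>C) ?L c'" by (rule rbdr_mono) (use fL in auto)
 from rbdr_add[OF c'(2) this] show ?thesis by simp
qed

text \<open>The star of such a cell is the cell alone, so its local homology is infinite cyclic in
  degree \<open>dm e\<close>. At a boundary cell it would vanish, and at an interior cell it lives
  in degree \<open>n\<close> only.\<close>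

lemma top_cells_dim:
 assumes e: "e \<in> C" "\<And>d. d \<in> C \<Longrightarrow> dm d \<le> dm e"
 shows "e \<in> IC" "dm e = n"
proof -
 have L: "{d \<in> C. \<not> below e d} = C - {e}"
 proof -
  have "d = e" if "d \<in> C" "below e d" for d
  proof (rule ccontr)
   assume "d \<noteq> e"
   then have "dm e < dm d" using below_dm[OF that(2)] by auto
   then show False using e(2)[OF that(1)] by simp
  qed
  then show ?thesis using below_refl[OF e(1)] by blast
 qed
 have sub': "sub (C - {e})" using sub_minus_star[OF sub_C, of e] unfolding L .
 have bd: "bdc e \<subseteq> C - {e}" using bdc_dm[OF e(1)] bdc_C[of e] by auto
 have un: "\<Union>(C - {e}) \<union> e = \<Union>C" using e(1) by auto
 have g: "hgen X (dm e) (\<Union>C) (\<Union>(C - {e})) (zc e)"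
  using attach_gen[OF sub' e(1) _ bd zc[OF e(1)]] unfolding un by simp
 have cyc: "rcyc X (dm e) (\<Union>C) (\<Union>(C - {e})) (zc e)" using g unfolding hgen_def by (elim conjE)
 have nb: "\<not> rbdr X (dm e) (\<Union>C) (\<Union>(C - {e})) (zc e)"
 proof
  assume "rbdr X (dm e) (\<Union>C) (\<Union>(C - {e})) (zc e)"
  then have "rbdr X (dm e) (\<Union>C) (\<Union>(C - {e})) (frag_cmul 1 (zc e))" by simp
  moreover have "\<forall>k. rbdr X (dm e) (\<Union>C) (\<Union>(C - {e})) (frag_cmul k (zc e)) \<longrightarrow> k = 0"
   using g unfolding hgen_def by (elim conjE)
  ultimately have "1 = (0::int)" by (elim allE impE)
  then show False by simp
 qed
 show IC: "e \<in> IC"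
 proof (rule ccontr)
  assume "e \<notin> IC"
  then have "e \<in> BC" using e(1) C_split by blast
  moreover obtain x where x: "x \<in> e" using cell_ne[OF e(1)] by auto
  ultimately have "x \<in> ball.fr" using BC_iff[OF e(1) x] by simp
  then have "hvan X (\<Union>C) (\<Union>(C - {e}))" using star_fr[OF e(1) x] unfolding L by simp
  then show False using hvanD[OF _ cyc] nb by blast
 qed
 show "dm e = n"
 proof (rule ccontr)
  assume "dm e \<noteq> n"
  from rbdr_star[OF IC this, unfolded L, OF cyc] show False using nb by simp
 qed
qed

lemma exists_top: "\<exists>e\<in>C. dm e = n"
 and dm_le: "e \<in> C \<Longrightarrow> dm e \<le> n"
 and dm_BC: "e \<in> BC \<Longrightarrow> dm e < n"
proof -
 have "\<Union>C \<noteq> {}" using ball.e_nonempty ball.e_cl unfolding cover by blast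
 then have "C \<noteq> {}" by auto
 then obtain t where t: "t \<in> C" "\<And>d. d \<in> C \<Longrightarrow> dm d \<le> dm t" using finite_max_ex[OF finC, of dm] by blast
 note top = top_cells_dim[OF t]
 show "\<exists>e\<in>C. dm e = n" using t(1) top(2) by blast
 show le: "dm e \<le> n" if "e \<in> C" for e using t(2)[OF that] top(2) by simp
 show "dm e < n" if "e \<in> BC"
 proof (rule ccontr)
  assume "\<not> dm e < n"
  moreover have e: "e \<in> C" using that by (simp add: BC_def)
  ultimately have "dm e = n" using le[OF e] by simp
  then have "e \<in> IC" using top_cells_dim(1)[OF e] le by simp
  then show False using that C_split by blast
 qed
qed

lemma b_notin_BC: "b \<notin> BC"
 using ball.e_nonempty ball.e_fr by (auto simp: BC_def)

text \<open>Merging all interior cells turns the Euler characteristics of stars in the boundary into those of intervals.\<close>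

lemma coarse: "regcw X (insert b BC) (dm(b := n))"
proof
 show "Hausdorff_space X" by (rule haus)
 show "finite (insert b BC)" using finite_BC by simp
 have "b \<inter> e = {}" if "e \<in> BC" for e using that ball.e_fr by (auto simp: BC_def)
 moreover have "disjoint BC" using disj C_split(3) by (auto simp: disjoint_def)
 ultimately show "disjoint (insert b BC)" by (auto simp: disjoint_def)
 show "\<exists>\<Phi>. characteristic_map X ((dm(b := n)) e) e \<Phi>" if "e \<in> insert b BC" for e
 proof (cases "e = b")
  case True then show ?thesis using ball.char by auto
 next
  case False
  then have "e \<in> C" using that C_split(3) by auto
  then show ?thesis using cells[of e] False by simp
 qed
 show "\<exists>D\<subseteq>insert b BC. X closure_of e - e = \<Union>D \<and> (\<forall>d\<in>D. (dm(b := n)) d < (dm(b := n)) e)" if "e \<in> insert b BC" for e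
 proof (cases "e = b")
  case True
  have "X closure_of b - b = \<Union>BC" using Union_BC ball.fr_closure by simp
  moreover have "(dm(b := n)) d < (dm(b := n)) b" if "d \<in> BC" for d using dm_BC[OF that] b_notin_BC that by auto
  ultimately show ?thesis unfolding True by (intro exI[of _ BC]) auto
 next
  case False
  then have e: "e \<in> BC" "e \<in> C" using that C_split(3) by auto
  have "bdc e \<subseteq> BC" using sub_BC e(1) by (auto simp: sub_def)
  moreover have "(dm(b := n)) d < (dm(b := n)) e" if "d \<in> bdc e" for d
   using bdc_dm[OF e(2) that] calculation b_notin_BC that False by auto
  ultimately show ?thesis using bdc_un[OF e(2)] by (intro exI[of _ "bdc e"]) auto
 qed
qed

text \<open>In the coarse complex the closed ball has Euler characteristic 1 and the interval from
  \<open>a\<close> to \<open>b\<close> has 0; the cell \<open>b\<close> accounts for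
  \<open>(-1) ^ n\<close> in each.\<close>

lemma euler_BC: "(\<Sum>d\<in>BC. (-1) ^ dm d) = (1 - (-1) ^ n :: int)" (is ?A)
 and euler_BC_star: "a \<in> BC \<Longrightarrow> (\<Sum>d | d \<in> BC \<and> below a d. (-1) ^ dm d) = - ((-1) ^ n :: int)"
proof -
 interpret r: regcw X "insert b BC" "dm(b := n)" by (rule coarse)
 have dmB: "(\<Sum>d\<in>S. (-1) ^ (dm(b := n)) d) = (\<Sum>d\<in>S. (-1) ^ dm d :: int)" if "S \<subseteq> BC" for S
  using that b_notin_BC by (intro sum.cong) auto
 have clb: "X closure_of b = \<Union>(insert b BC)" using ball.cl_closure ball.cl_eq Union_BC by auto
 have "(\<Sum>a\<in>insert b BC. (-1) ^ (dm(b := n)) a) = (1::int)"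
  by (rule r.euler_ball[OF r.sub_C ball.cell_axioms clb])
 then have "(-1) ^ n + (\<Sum>a\<in>BC. (-1) ^ (dm(b := n)) a) = (1::int)"
  using finite_BC b_notin_BC by simp
 then show ?A using dmB[of BC] by simp
 show "(\<Sum>d | d \<in> BC \<and> below a d. (-1) ^ dm d) = - ((-1) ^ n :: int)" if a: "a \<in> BC"
 proof -
  have aC: "a \<in> C" "a \<in> insert b BC" "b \<in> insert b BC" using a C_split(3) by auto
  have ab: "a \<noteq> b" using a b_notin_BC by auto
  have rb: "r.below d b" if "d \<in> insert b BC" for d
  proof -
   have "d \<subseteq> X closure_of b" unfolding clb using that by blast
   then have "X closure_of d \<subseteq> X closure_of b" using closure_of_minimal[of d "X closure_of b" X] by simp
   then show ?thesis using r.below_closure[OF that aC(3)] by simp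
  qed
  have Y: "{d. r.below d b} = insert b BC" using rb by (auto simp: r.below_def)
  have "(\<Sum>d\<in>insert b BC - {d \<in> insert b BC. \<not> r.below a d}. (-1) ^ (dm(b := n)) d) = (0::int)"
   using r.euler_pair[OF r.sub_below r.sub_minus_star[OF r.sub_below] _ r.interval_hvan[OF rb[OF aC(2)] ab]]
   unfolding Y by blast
  moreover have "insert b BC - {d \<in> insert b BC. \<not> r.below a d} = insert b {d. d \<in> BC \<and> below a d}"
   using rb[OF aC(2)] r.below_closure[OF aC(2)] below_closure[OF aC(1)] C_split(3) by auto
  ultimately have "(-1) ^ n + (\<Sum>d | d \<in> BC \<and> below a d. (-1) ^ (dm(b := n)) d) = (0::int)"
   using finite_BC b_notin_BC by simp
  then show ?thesis using dmB[of "{d. d \<in> BC \<and> below a d}"] by simp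
 qed
qed

lemma sum_C_split:
 fixes f :: "'a set \<Rightarrow> int"
 shows "(\<Sum>d | d \<in> C \<and> P d. f d) = (\<Sum>d | d \<in> BC \<and> P d. f d) + (\<Sum>d | d \<in> IC \<and> P d. f d)"
proof -
 have "{d. d \<in> C \<and> P d} = {d. d \<in> BC \<and> P d} \<union> {d. d \<in> IC \<and> P d}" using C_split by blast
 then show ?thesis using finite_BC finite_IC C_split(2)
  by (simp only:) (intro sum.union_disjoint, auto)
qed

lemma euler_IC: "(\<Sum>d\<in>IC. (-1) ^ dm d) = ((-1) ^ n :: int)"
proof -
 have "(\<Sum>d\<in>C. (-1) ^ dm d) = (1::int)"
  by (rule euler_ball[OF sub_C ball.cell_axioms]) (use ball.cl_closure cover in simp)
 then show ?thesis using sum_C_split[where P="\<lambda>_. True" and f="\<lambda>d. (-1) ^ dm d"] euler_BC by simp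
qed

text \<open>The indicator of the interior cells thus has constant dual. Above a boundary cell the
  star in \<open>C\<close> is acyclic and the boundary star is subtracted; above an interior cell
  the complement of the star retracts to the boundary, so the star carries the whole sum.\<close>

lemma euler_interior:
 assumes "a \<in> insert {} C"
 shows "(\<Sum>d | d \<in> IC \<and> leq a d. (-1) ^ dm d) = ((-1) ^ n :: int)"
proof -
 consider "a = {}" | "a \<in> BC" | "a \<in> IC" using assms C_split by blast
 then show ?thesis
 proof cases
  case 1
  then have "{d. d \<in> IC \<and> leq a d} = IC" using C_split(4) by (auto simp: leq_def)
  then show ?thesis using euler_IC by simp
 next
  case 2
  then have aC: "a \<in> C" "a \<noteq> {}" using C_split(3) empty_C by auto
  have leq: "leq a d \<longleftrightarrow> below a d" for d using aC by (simp add: leq_def)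
  obtain x where x: "x \<in> a" using aC by auto
  have "x \<in> ball.fr" using BC_iff[OF aC(1) x] 2 by simp
  then have hv: "hvan X (\<Union>C) (\<Union>{d \<in> C. \<not> below a d})" using star_fr[OF aC(1) x] by simp
  have "(\<Sum>d\<in>C - {d \<in> C. \<not> below a d}. (-1) ^ dm d) = (0::int)"
   by (rule euler_pair[OF sub_C sub_minus_star[OF sub_C] _ hv]) auto
  moreover have "C - {d \<in> C. \<not> below a d} = {d. d \<in> C \<and> below a d}" by auto
  ultimately show ?thesis
   using sum_C_split[where P="below a" and f="\<lambda>d. (-1) ^ dm d"] euler_BC_star[OF 2] unfolding leq by simp
 next
  case 3
  then have aC: "a \<in> C" "a \<noteq> {}" using C_split(4) empty_C by auto
  have leq: "leq a d \<longleftrightarrow> below a d" for d using aC by (simp add: leq_def)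
  let ?L = "{d \<in> C. \<not> below a d}"
  have hv: "hvan X (\<Union>?L) (\<Union>BC)" using hvan_link[OF 3] unfolding Union_BC .
  have "(\<Sum>d\<in>?L - BC. (-1) ^ dm d) = (0::int)"
   by (rule euler_pair[OF sub_minus_star[OF sub_C] sub_BC BC_sub_star[OF 3] hv])
  moreover have un: "{d. d \<in> IC \<and> below a d} \<union> (?L - BC) = IC" using C_split by auto
  have "(\<Sum>d\<in>{d. d \<in> IC \<and> below a d} \<union> (?L - BC). (-1) ^ dm d) =
   (\<Sum>d | d \<in> IC \<and> below a d. (-1) ^ dm d) + (\<Sum>d\<in>?L - BC. (-1) ^ dm d :: int)"
   by (rule sum.union_disjoint) (use finite_IC finC in auto)
  then have "(\<Sum>d\<in>IC. (-1) ^ dm d) = (\<Sum>d | d \<in> IC \<and> below a d. (-1) ^ dm d) + (\<Sum>d\<in>?L - BC. (-1) ^ dm d :: int)"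
   unfolding un .
  ultimately show ?thesis using euler_IC unfolding leq by simp
 qed
qed

lemma rbdr_fr: "k \<noteq> n \<Longrightarrow> rcyc X k (\<Union>C) (\<Union>BC) c \<Longrightarrow> rbdr X k (\<Union>C) (\<Union>BC) c"
 using ball.rbdr_cl[of k c] unfolding cover Union_BC .

text \<open>The ball modulo its sphere punctured at a point of \<open>a\<close> is acyclic. In the
  triple of ball, sphere and punctured sphere the local homology in degree \<open>k\<close>
  therefore comes from the ball modulo its sphere in degree \<open>k + 1\<close>, where it vanishes
  unless \<open>k + 1 = n\<close>.\<close>

lemma rbdr_BC_star:
 assumes a: "a \<in> BC" and k: "Suc k < n" and c: "rcyc X k (\<Union>BC) (\<Union>{d \<in> BC. \<not> below a d}) c"
 shows "rbdr X k (\<Union>BC) (\<Union>{d \<in> BC. \<not> below a d}) c"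
proof -
 have aC: "a \<in> C" using a C_split(3) by auto
 obtain x where x: "x \<in> a" using cell_ne[OF aC] by auto
 have xf: "x \<in> ball.fr" using BC_iff[OF aC x] a by simp
 let ?L = "\<Union>{d \<in> BC. \<not> below a d}"
 have L: "?L \<subseteq> ball.fr - {x}" using mem_star[OF aC x] C_split(3) Union_BC by auto
 have st: "hvan X (ball.fr - {x}) ?L" using hvan_minus_star[OF sub_BC a x] unfolding Union_BC .
 have "ball.fr \<union> b = ball.cl" "ball.fr \<inter> b = {}" using ball.cl_eq ball.e_fr by auto
 then have 1: "hvan X (ball.cl - {x}) (ball.fr - {x})" using ball.hvan_minus_fr[OF ball.closed_fr subset_refl _ xf] by simp
 have fl: "ball.fr - {x} \<subseteq> ball.cl - {x}" using ball.fr_cl by auto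
 have 2: "hvan X ball.cl (ball.fr - {x})" by (rule hvan_trans[OF ball.hvan_cl_minus[OF xf] 1 fl]) auto
 have c1: "rcyc X k ball.fr (ball.fr - {x}) c" using c unfolding Union_BC by (rule rcyc_mono) (use L in auto)
 have "rcyc X k ball.cl (ball.fr - {x}) c" by (rule rcyc_mono[OF c1 ball.fr_cl]) simp
 from hvanD[OF 2 this] obtain y l where y: "schain X (Suc k) ball.cl y" "schain X k (ball.fr - {x}) l"
  "c = bnd (Suc k) y + l" unfolding rbdr_def by blast
 have "bnd (Suc k) y = c - l" using y(3) by simp
 moreover have "schain X k ball.fr c" using c1 by (simp add: rcyc_def)
 moreover have "schain X k ball.fr l" by (rule schain_mono[OF y(2)]) auto
 ultimately have "rcyc X (Suc k) ball.cl ball.fr y" using y(1) by (simp add: rcyc_def singular_chain_diff)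
 from ball.rbdr_cl[OF _ this] k obtain q y' where q: "schain X (Suc (Suc k)) ball.cl q" "schain X (Suc k) ball.fr y'"
  "y = bnd (Suc (Suc k)) q + y'" unfolding rbdr_def by auto
 have "bnd (Suc k) y = bnd (Suc k) y'"
  unfolding q(3) chain_boundary_add bdry_bdry[OF q(1)] by simp
 then have "c = bnd (Suc k) y' + l" using y(3) by simp
 then have "rbdr X k ball.fr (ball.fr - {x}) c" using q(2) y(2) unfolding rbdr_def by blast
 then have "rbdr X k ball.fr ?L c" by (rule rbdr_lift[OF st _ c[unfolded Union_BC], rotated]) auto
 then show ?thesis unfolding Union_BC .
qed

text \<open>For \<open>x\<close> empty or interior, the interior cells above \<open>x\<close> are
  the cells of a pair with the homology of the ball modulo its sphere. For \<open>x\<close> on the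
  boundary they form the quotient of the acyclic star in \<open>C\<close> by the boundary star,
  whose long exact sequence is chased by hand.\<close>

lemma interior_exact:
 assumes x: "x \<in> insert {} C" and j: "j < n" and z: "\<And>a. z a \<noteq> 0 \<Longrightarrow> a \<in> IC \<and> leq x a \<and> dm a = j"
  and cyc: "\<And>a. a \<in> IC \<Longrightarrow> leq x a \<Longrightarrow> (\<Sum>d\<in>C. real_of_int (inc a d) * z d) = 0"
 shows "\<exists>y. (\<forall>a. y a \<noteq> 0 \<longrightarrow> a \<in> IC \<and> leq x a \<and> dm a = Suc j) \<and>
  (\<forall>a. a \<in> IC \<and> leq x a \<longrightarrow> (\<Sum>d\<in>C. real_of_int (inc a d) * y d) = z a)"
proof -
 have sumQ: "(\<Sum>d\<in>C. real_of_int (inc a d) * g d) = (\<Sum>d\<in>Q. real_of_int (inc a d) * g d)"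
  if "Q \<subseteq> C" "\<And>d. g d \<noteq> 0 \<Longrightarrow> d \<in> C \<Longrightarrow> d \<in> Q" for Q a and g :: "'a set \<Rightarrow> real"
  using that finC by (intro sum.mono_neutral_right) auto
 have pair: ?thesis if L: "sub L" "L \<subseteq> C" "\<And>k c. k < n \<Longrightarrow> rcyc X k (\<Union>C) (\<Union>L) c \<Longrightarrow> rbdr X k (\<Union>C) (\<Union>L) c"
  and Q: "C - L = {a. a \<in> IC \<and> leq x a}" for L
 proof -
  have mem: "a \<in> C - L \<longleftrightarrow> a \<in> IC \<and> leq x a" for a using Q by blast
  have z1: "z a \<noteq> 0 \<Longrightarrow> a \<in> C - L \<and> dm a = j" for a using z[of a] mem by simp
  have z2: "(\<Sum>d\<in>C-L. real_of_int (inc a d) * z d) = 0" if "a \<in> C - L" for a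
  proof -
   have "(\<Sum>d\<in>C. real_of_int (inc a d) * z d) = (\<Sum>d\<in>C-L. real_of_int (inc a d) * z d)"
    by (rule sumQ) (use z mem in blast)+
   then show ?thesis using cyc[of a] that mem[of a] by simp
  qed
  have "\<exists>y. (\<forall>a. y a \<noteq> 0 \<longrightarrow> a \<in> C - L \<and> dm a = Suc j) \<and>
   (\<forall>a\<in>C-L. (\<Sum>b\<in>C-L. real_of_int (inc a b) * y b) = z a)"
   by (rule real_exact[OF sub_C L(1,2) _ j]) (rule L(3) z1 z2; assumption)+
  then obtain y where y: "\<forall>a. y a \<noteq> 0 \<longrightarrow> a \<in> C - L \<and> dm a = Suc j"
   "\<forall>a\<in>C-L. (\<Sum>b\<in>C-L. real_of_int (inc a b) * y b) = z a" by (elim exE conjE)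
  show ?thesis
  proof (intro exI[of _ y] conjI allI impI)
   fix a
   show "a \<in> IC" "leq x a" "dm a = Suc j" if "y a \<noteq> 0"
    using y(1)[THEN spec, THEN mp, OF that] mem[of a] by simp_all
   show "(\<Sum>d\<in>C. real_of_int (inc a d) * y d) = z a" if "a \<in> IC \<and> leq x a"
   proof -
    have "(\<Sum>d\<in>C. real_of_int (inc a d) * y d) = (\<Sum>d\<in>C-L. real_of_int (inc a d) * y d)"
     by (rule sumQ) (use y(1) in blast)+
    then show ?thesis using bspec[OF y(2), of a] that mem[of a] by simp
   qed
  qed
 qed
 consider "x = {}" | "x \<in> BC" | "x \<in> IC" using x C_split by blast
 then show ?thesis
 proof cases
  case 1
  have eq: "C - BC = {a. a \<in> IC \<and> leq x a}" using C_split 1 by (auto simp: leq_def)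
  show ?thesis
  proof (rule pair[OF sub_BC C_split(3) _ eq])
   show "rbdr X k (\<Union>C) (\<Union>BC) c" if "k < n" "rcyc X k (\<Union>C) (\<Union>BC) c" for k c
    by (rule rbdr_fr[OF _ that(2)]) (use that(1) in simp)
  qed
 next
  case 3
  then have xC: "x \<in> C" "x \<noteq> {}" using C_split(4) empty_C by auto
  have eq: "C - {d \<in> C. \<not> below x d} = {a. a \<in> IC \<and> leq x a}"
   using IC_up[OF 3] C_split(4) xC by (auto simp: leq_def)
  show ?thesis
  proof (rule pair[OF sub_minus_star[OF sub_C] _ _ eq])
   show "rbdr X k (\<Union>C) (\<Union>{d \<in> C. \<not> below x d}) c" if "k < n" "rcyc X k (\<Union>C) (\<Union>{d \<in> C. \<not> below x d}) c" for k c
    by (rule rbdr_star[OF 3 _ that(2)]) (use that(1) in simp)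
  qed auto
 next
  case 2
  then have xC: "x \<in> C" "x \<noteq> {}" using C_split(3) empty_C by auto
  have leq: "leq x d \<longleftrightarrow> below x d" for d using xC by (simp add: leq_def)
  let ?L = "{d \<in> C. \<not> below x d}" and ?M = "{d \<in> BC. \<not> below x d}"
  have Lsub: "sub ?L" "?L \<subseteq> C" and Msub: "sub ?M" "?M \<subseteq> BC" using sub_minus_star[OF sub_C] sub_minus_star[OF sub_BC] by auto
  have CL: "a \<in> C - ?L \<longleftrightarrow> a \<in> C \<and> below x a" for a by auto
  have BM: "a \<in> BC - ?M \<longleftrightarrow> a \<in> BC \<and> below x a" for a by auto
  obtain p where p: "p \<in> x" using xC by auto
  have "p \<in> ball.fr" using BC_iff[OF xC(1) p] 2 by simp
  then have hv: "hvan X (\<Union>C) (\<Union>?L)" using star_fr[OF xC(1) p] by simp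
  have zC: "z d \<noteq> 0 \<Longrightarrow> d \<in> IC \<and> below x d \<and> dm d = j" for d using z[of d] leq by simp
  \<comment> \<open>The part of the boundary of \<open>z\<close> on boundary cells is a cycle there;
    it bounds some \<open>w\<close> because the boundary star is exact below degree
    \<open>n - 1\<close>.\<close>
  define w0 where "w0 = (\<lambda>a. if a \<in> BC \<and> below x a then (\<Sum>d\<in>C. real_of_int (inc a d) * z d) else 0)"
  have "\<exists>w. (\<forall>a. w a \<noteq> 0 \<longrightarrow> a \<in> BC \<and> below x a \<and> dm a = j) \<and>
    (\<forall>a. a \<in> BC \<and> below x a \<longrightarrow> (\<Sum>d\<in>BC - ?M. real_of_int (inc a d) * w d) = w0 a)"
  proof (cases "j = 0")
   case True
   have "w0 a = 0" for a
   proof -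
    have "inc a d = 0 \<or> z d = 0" for d using inc_nz[of a d] zC[of d] True
     by (cases "inc a d = 0"; cases "z d = 0") auto
    then have "(\<Sum>d\<in>C. real_of_int (inc a d) * z d) = 0" by (intro sum.neutral) auto
    then show ?thesis by (simp add: w0_def)
   qed
   then show ?thesis by (intro exI[of _ "\<lambda>_. 0"]) simp
  next
   case False
   then obtain i where i: "j = Suc i" using not0_implies_Suc by blast
   have w0z: "a \<in> BC - ?M \<and> dm a = i" if "w0 a \<noteq> 0" for a
   proof -
    have a: "a \<in> BC" "below x a" "(\<Sum>d\<in>C. real_of_int (inc a d) * z d) \<noteq> 0"
     using that by (auto simp: w0_def split: if_splits)
    then obtain d where "real_of_int (inc a d) * z d \<noteq> 0" by (meson sum.neutral)
    then have "inc a d \<noteq> 0" "z d \<noteq> 0" by auto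
    then show ?thesis using inc_nz[of a d] zC[of d] i a by auto
   qed
   have w0c: "(\<Sum>d\<in>BC - ?M. real_of_int (inc a d) * w0 d) = 0" if a: "a \<in> BC - ?M" for a
   proof -
    have "(\<Sum>c\<in>C. real_of_int (inc a c) * (\<Sum>d\<in>C. real_of_int (inc c d) * z d)) =
     (\<Sum>d\<in>C. real_of_int (\<Sum>c\<in>C. inc a c * inc c d) * z d)"
     unfolding sum_distrib_left of_int_sum sum_distrib_right by (subst sum.swap) (simp add: mult.assoc)
    also have "\<dots> = 0" unfolding inc_inc by simp
    finally have 0: "(\<Sum>c\<in>C. real_of_int (inc a c) * (\<Sum>d\<in>C. real_of_int (inc c d) * z d)) = 0" .
    have "(\<Sum>c\<in>C. real_of_int (inc a c) * (\<Sum>d\<in>C. real_of_int (inc c d) * z d)) =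
     (\<Sum>c\<in>BC - ?M. real_of_int (inc a c) * w0 c)"
    proof (rule sum.mono_neutral_cong_right[OF finC])
     show "BC - ?M \<subseteq> C" using C_split(3) by auto
     show "real_of_int (inc a c) * (\<Sum>d\<in>C. real_of_int (inc c d) * z d) = real_of_int (inc a c) * w0 c" if "c \<in> BC - ?M" for c
      using that by (simp add: w0_def)
     show "\<forall>c\<in>C - (BC - ?M). real_of_int (inc a c) * (\<Sum>d\<in>C. real_of_int (inc c d) * z d) = 0"
     proof
      fix c assume c: "c \<in> C - (BC - ?M)"
      show "real_of_int (inc a c) * (\<Sum>d\<in>C. real_of_int (inc c d) * z d) = 0"
      proof (cases "inc a c = 0")
       case False
       then have "below a c" using inc_nz[of a c] by (auto simp: below_def)
       then have xc: "below x c" using below_trans[of x a c] a by auto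
       then have "c \<in> IC" using c C_split by auto
       then show ?thesis using cyc[of c] xc leq by simp
      qed simp
     qed
    qed
    then show ?thesis using 0 by simp
   qed
   have v: "rbdr X k (\<Union>BC) (\<Union>?M) c" if "k < n - 1" "rcyc X k (\<Union>BC) (\<Union>?M) c" for k c
    by (rule rbdr_BC_star[OF 2 _ that(2)]) (use that(1) in simp)
   have i_lt: "i < n - 1" using i j by simp
   have "\<exists>w. (\<forall>a. w a \<noteq> 0 \<longrightarrow> a \<in> BC - ?M \<and> dm a = Suc i) \<and>
    (\<forall>a\<in>BC-?M. (\<Sum>d\<in>BC-?M. real_of_int (inc a d) * w d) = w0 a)"
    by (rule real_exact[OF sub_BC Msub _ i_lt]) (rule v w0z w0c; assumption)+
   then obtain w where w: "\<forall>a. w a \<noteq> 0 \<longrightarrow> a \<in> BC - ?M \<and> dm a = Suc i"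
    "\<forall>a\<in>BC-?M. (\<Sum>d\<in>BC-?M. real_of_int (inc a d) * w d) = w0 a" by (elim exE conjE)
   show ?thesis
   proof (intro exI[of _ w] conjI allI impI)
    fix a
    show "a \<in> BC" "below x a" "dm a = j" if "w a \<noteq> 0"
     using w(1)[THEN spec, THEN mp, OF that] i by simp_all
    show "(\<Sum>d\<in>BC - ?M. real_of_int (inc a d) * w d) = w0 a" if "a \<in> BC \<and> below x a"
     by (rule bspec[OF w(2)]) (use that in simp)
   qed
  qed
  then obtain w where w: "\<forall>a. w a \<noteq> 0 \<longrightarrow> a \<in> BC \<and> below x a \<and> dm a = j"
    "\<forall>a. a \<in> BC \<and> below x a \<longrightarrow> (\<Sum>d\<in>BC - ?M. real_of_int (inc a d) * w d) = w0 a" by (elim exE conjE)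
  have wC: "(\<Sum>d\<in>C. real_of_int (inc a d) * w d) = (\<Sum>d\<in>BC - ?M. real_of_int (inc a d) * w d)" for a
   by (rule sumQ) (use w(1) C_split(3) in auto)
  \<comment> \<open>Subtracting \<open>w\<close> turns \<open>z\<close> into a cycle of the full
    star, which is acyclic. The interior part of a primitive solves the problem, since boundary
    cells have no interior faces.\<close>
  define g where "g = (\<lambda>a. z a - w a)"
  have gz: "g a \<noteq> 0 \<Longrightarrow> a \<in> C - ?L \<and> dm a = j" for a
   using zC[of a] w(1)[THEN spec, of a] C_split by (cases "z a = 0") (auto simp: g_def)
  have gc: "(\<Sum>d\<in>C-?L. real_of_int (inc a d) * g d) = 0" if a: "a \<in> C - ?L" for a
  proof -
   have "(\<Sum>d\<in>C-?L. real_of_int (inc a d) * g d) = (\<Sum>d\<in>C. real_of_int (inc a d) * g d)"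
    by (rule sumQ[symmetric]) (use gz in auto)
   also have "\<dots> = (\<Sum>d\<in>C. real_of_int (inc a d) * z d) - (\<Sum>d\<in>BC - ?M. real_of_int (inc a d) * w d)"
    unfolding wC[symmetric] by (simp add: g_def right_diff_distrib sum_subtractf)
   also have "\<dots> = 0"
   proof (cases "a \<in> BC")
    case True
    then show ?thesis using w(2)[THEN spec, of a] a by (simp add: w0_def)
   next
    case False
    then have aI: "a \<in> IC" "leq x a" using a C_split leq by auto
    have "inc a d = 0 \<or> w d = 0" for d
    proof (rule ccontr)
     assume "\<not> (inc a d = 0 \<or> w d = 0)"
     then have "below a d" "d \<in> BC" using inc_nz[of a d] w(1)[THEN spec, of d] by (auto simp: below_def)
     then show False using IC_up[OF aI(1)] C_split(2) by blast
    qed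
    then have "(\<Sum>d\<in>BC - ?M. real_of_int (inc a d) * w d) = 0" by (intro sum.neutral) auto
    then show ?thesis using cyc[OF aI] by simp
   qed
   finally show ?thesis .
  qed
  have "\<exists>y. (\<forall>a. y a \<noteq> 0 \<longrightarrow> a \<in> C - ?L \<and> dm a = Suc j) \<and>
   (\<forall>a\<in>C-?L. (\<Sum>d\<in>C-?L. real_of_int (inc a d) * y d) = g a)"
   by (rule real_exact[OF sub_C Lsub _ j]) (rule hvanD[OF hv] gz gc; assumption)+
  then obtain y where y: "\<forall>a. y a \<noteq> 0 \<longrightarrow> a \<in> C - ?L \<and> dm a = Suc j"
   "\<forall>a\<in>C-?L. (\<Sum>d\<in>C-?L. real_of_int (inc a d) * y d) = g a" by (elim exE conjE)
  define y' where "y' = (\<lambda>a. if a \<in> IC then y a else 0)"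
  show ?thesis
  proof (intro exI[of _ y'] conjI allI impI)
   fix a assume "y' a \<noteq> 0"
   then have "a \<in> IC" "y a \<noteq> 0" by (simp_all add: y'_def split: if_splits)
   then show "a \<in> IC" "leq x a" "dm a = Suc j" using y(1)[THEN spec, THEN mp, of a] leq by simp_all
  next
   fix a assume "a \<in> IC \<and> leq x a"
   then have a: "a \<in> IC" "leq x a" by simp_all
   have ab: "a \<in> C - ?L" using a leq C_split(4) by auto
   have "(\<Sum>d\<in>C. real_of_int (inc a d) * y' d) = (\<Sum>d\<in>C. real_of_int (inc a d) * y d)"
   proof (rule sum.cong[OF refl])
    fix d
    show "real_of_int (inc a d) * y' d = real_of_int (inc a d) * y d"
    proof (cases "inc a d = 0")
     case False
     then have "below a d" using inc_nz[of a d] by (auto simp: below_def)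
     then show ?thesis using IC_up[OF a(1)] by (simp add: y'_def)
    qed simp
   qed
   also have "\<dots> = (\<Sum>d\<in>C-?L. real_of_int (inc a d) * y d)" by (rule sumQ) (use y(1) in blast)+
   also have "\<dots> = g a" by (rule bspec[OF y(2) ab])
   also have "\<dots> = z a" using w(1)[THEN spec, of a] a C_split(2) by (auto simp: g_def)
   finally show "(\<Sum>d\<in>C. real_of_int (inc a d) * y' d) = z a" .
  qed
 qed
qed

text \<open>The constant one-dimensional stalk on interior cells, carried by the empty list because
  families take values in functions on lists.\<close>

definition line :: "'a set \<Rightarrow> ('a set list \<Rightarrow> real) set" where
 "line a = (if a \<in> IC then {f. \<forall>l. l \<noteq> [] \<longrightarrow> f l = 0} else {0})"

lemma dim_line: "dim (line a) = (if a \<in> IC then 1 else 0)"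
proof (cases "a \<in> IC")
 case True
 let ?f = "(\<lambda>l. if l = [] then 1 else 0) :: 'a set list \<Rightarrow> real"
 have "dim {f::'a set list \<Rightarrow> real. \<forall>l. l \<noteq> [] \<longrightarrow> f l = 0} = 1"
 proof (rule dim_unique[of "{?f}"])
  show "{f::'a set list \<Rightarrow> real. \<forall>l. l \<noteq> [] \<longrightarrow> f l = 0} \<subseteq> span {?f}"
  proof
   fix f :: "'a set list \<Rightarrow> real" assume "f \<in> {f. \<forall>l. l \<noteq> [] \<longrightarrow> f l = 0}"
   then have "f = f [] *\<^sub>R ?f" by (auto simp: fun_eq_iff scaleR_fun_def)
   then show "f \<in> span {?f}" by (metis span_base span_scale singletonI)
  qed
  have "?f \<noteq> 0"
  proof
   assume "?f = 0"
   then have "?f [] = (0 :: 'a set list \<Rightarrow> real) []" by (rule fun_cong)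
   then show False by simp
  qed
  then show "independent {?f}" by (simp add: dependent_single)
 qed auto
 then show ?thesis using True by (simp add: line_def)
next
 case False
 then show ?thesis by (simp only: line_def dim_zero_space if_False)
qed

text \<open>The dimension is \<open>Suc n\<close> because ranks exceed cell dimensions by one;
  exactness is \<open>interior_exact\<close>, shifted accordingly.\<close>

theorem interior_cm:
 "cm_family (insert {} C) leq rkc (\<lambda>a b. real_of_int (ieps a b)) {} line IC (Suc n) {[]}"
proof -
 interpret p: cell_poset "insert {} C" leq rkc "\<lambda>a b. real_of_int (ieps a b)" "{}" by (rule cell_poset)
 have neI: "a \<noteq> {}" "rkc a = Suc (dm a)" if "a \<in> IC" for a using that C_split(4) empty_C by (auto simp: rkc_def)
 show ?thesis
 proof unfold_locales
  show "IC \<subseteq> insert {} C" using C_split(4) by auto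
  show "d \<in> IC" if "a \<in> IC" "leq a d" for a d using that IC_up[of a d] neI(1)[OF that(1)] by (simp add: leq_def)
  then show "line d \<subseteq> line a" if "a \<in> IC" "leq a d" for a d using that by (simp add: line_def)
  show "subspace (line a)" for a
   by (auto simp: line_def subspace_def scaleR_fun_def)
  show "line a = {0}" if "a \<notin> IC \<or> Suc n < rkc a" for a
   using that dm_le[of a] neI(2)[of a] C_split(4) by (auto simp: line_def)
  show "finite {[] :: 'a set list}" by simp
  show "f \<in> line a \<Longrightarrow> l \<notin> {[]} \<Longrightarrow> f l = 0" for f a l by (auto simp: line_def split: if_splits)
  fix k x and z :: "'a set \<Rightarrow> 'a set list \<Rightarrow> real"
  assume k: "k < Suc n" and z: "z \<in> p.chains line k x" and bz: "p.bd IC x z = 0"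
  have zN: "z a \<in> line a" if "leq x a" "rkc a = k" for a using z that unfolding p.chains_def by blast
  have z0: "z a = 0" if "\<not> (leq x a \<and> rkc a = k)" for a using z that unfolding p.chains_def by blast
  define ze where "ze = (\<lambda>a. z a [])"
  have zl: "z a l = 0" if "l \<noteq> []" for a l
   using zN[of a] z0[of a] that by (cases "leq x a \<and> rkc a = k") (auto simp: line_def split: if_splits)
  have zeI: "ze a \<noteq> 0 \<Longrightarrow> a \<in> IC \<and> leq x a \<and> rkc a = k" for a
   using zN[of a] z0[of a] by (cases "leq x a \<and> rkc a = k") (auto simp: line_def ze_def split: if_splits)
  show "\<exists>y\<in>p.chains line (Suc k) x. p.bd IC x y = z"
  \<comment> \<open>Interior cells have positive rank, so for \<open>k = 0\<close>, or for
    \<open>x\<close> off the poset, the only chain is zero.\<close>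
  proof (cases "x \<in> insert {} C \<and> k \<noteq> 0")
   case False
   have "ze a = 0" for a
    using zeI[of a] neI(2)[of a] False p.le_P[of x a] by (cases "ze a = 0") auto
   then have "z = 0" using zl by (intro ext) (metis ze_def zero_fun_apply)
   moreover have "(0 :: 'a set \<Rightarrow> 'a set list \<Rightarrow> real) \<in> p.chains line (Suc k) x"
    by (auto simp: p.chains_def line_def)
   moreover have "p.bd IC x (0 :: 'a set \<Rightarrow> 'a set list \<Rightarrow> real) = 0" by (auto simp: p.bd_def fun_eq_iff)
   ultimately show ?thesis by metis
  next
   case True
   then obtain j where j: "k = Suc j" using not0_implies_Suc by blast
   have bd_eq: "p.bd IC x y a l = (\<Sum>d\<in>C. real_of_int (inc a d) * y d l)" if "a \<in> IC" "leq x a"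
    for a l and y :: "'a set \<Rightarrow> 'a set list \<Rightarrow> real"
    unfolding p.bd_def using that neI(1)[OF that(1)] finC empty_C
    by (simp add: ieps_def inc_empty sum_fun_apply' scaleR_fun_def)
   have "\<exists>y. (\<forall>a. y a \<noteq> 0 \<longrightarrow> a \<in> IC \<and> leq x a \<and> dm a = Suc j) \<and>
    (\<forall>a. a \<in> IC \<and> leq x a \<longrightarrow> (\<Sum>d\<in>C. real_of_int (inc a d) * y d) = ze a)"
   proof (rule interior_exact[of x j ze])
    show "x \<in> insert {} C" using True by simp
    show "j < n" using k j by simp
    show "ze a \<noteq> 0 \<Longrightarrow> a \<in> IC \<and> leq x a \<and> dm a = j" for a using zeI[of a] neI(2)[of a] j by auto
    show "(\<Sum>d\<in>C. real_of_int (inc a d) * ze d) = 0" if "a \<in> IC" "leq x a" for a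
     using bd_eq[OF that, of z "[]"] bz by (simp add: ze_def)
   qed
   then obtain y where "\<forall>a. y a \<noteq> 0 \<longrightarrow> a \<in> IC \<and> leq x a \<and> dm a = Suc j"
    "\<forall>a. a \<in> IC \<and> leq x a \<longrightarrow> (\<Sum>d\<in>C. real_of_int (inc a d) * y d) = ze a" by (elim exE conjE)
   then have y: "\<And>a. y a \<noteq> 0 \<Longrightarrow> a \<in> IC \<and> leq x a \<and> dm a = Suc j"
    "\<And>a. a \<in> IC \<Longrightarrow> leq x a \<Longrightarrow> (\<Sum>d\<in>C. real_of_int (inc a d) * y d) = ze a" by blast+
   define Y where "Y = (\<lambda>a l. if l = ([] :: 'a set list) then y a else 0)"
   have "Y \<in> p.chains line (Suc k) x"
    unfolding p.chains_def
   proof (intro CollectI allI conjI impI)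
    fix a
    show "Y a \<in> line a"
     using y(1)[of a] by (cases "y a = 0") (auto simp: Y_def line_def fun_eq_iff)
    show "Y a = 0" if "\<not> (leq x a \<and> rkc a = Suc k)"
     using y(1)[of a] that neI(2)[of a] j by (cases "y a = 0") (auto simp: Y_def fun_eq_iff)
   qed
   moreover have "p.bd IC x Y a l = z a l" for a l
   proof (cases "a \<in> IC \<and> leq x a")
    case aI: True
    then have "p.bd IC x Y a l = (\<Sum>d\<in>C. real_of_int (inc a d) * Y d l)" by (intro bd_eq) auto
    also have "\<dots> = z a l" using y(2)[of a] aI zl[of l a] by (cases "l = []") (auto simp: Y_def ze_def)
    finally show ?thesis .
   next
    case no: False
    then have "ze a = 0" using zeI[of a] by auto
    then have "z a l = 0" using zl[of l a] by (cases "l = []") (auto simp: ze_def)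
    then show ?thesis using no by (auto simp: p.bd_def)
   qed
   ultimately show ?thesis by (intro bexI[of _ Y] ext) auto
  qed
 qed
qed

text \<open>By \<open>euler_interior\<close> the dual of the interior indicator is 1, so its defect
  is carried by the boundary cells and the empty cell, and the polynomial is \<open>gpoly\<close> at
  rank \<open>Suc n\<close>.\<close>

theorem interior_gamma:
 fixes u :: "'a set \<Rightarrow> int poly"
 assumes u0: "u {} = 1"
  and u: "\<And>a. a \<in> C \<Longrightarrow> u a = pX * (\<Sum>d | leq d a \<and> d \<noteq> a. u d * pY ^ (rkc a - 1 - rkc d))"
 shows "gamma_nonneg (Suc n) ((\<Sum>a\<in>IC. u a * pY ^ (Suc n - rkc a)) - pX * (\<Sum>a\<in>insert {} BC. u a * pY ^ (n - rkc a)))"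
proof -
 interpret p: cell_poset "insert {} C" leq rkc "\<lambda>a b. real_of_int (ieps a b)" "{}" by (rule cell_poset)
 interpret p: flag_poset "insert {} C" leq rkc "\<lambda>a b. real_of_int (ieps a b)" "{}" u
  by unfold_locales (use u0 u in auto)
 let ?q = "\<lambda>a. int (dim (line a))"
 have q: "?q a = (if a \<in> IC then 1 else 0)" for a by (simp add: dim_line)
 have g: "gamma_nonneg (Suc n) (p.gpoly ?q (Suc n))" by (rule p.gpoly_gamma_nonneg[OF interior_cm])
 have rI: "rkc a = Suc (dm a)" "dm a \<le> n" if "a \<in> IC" for a
  using that C_split(4) empty_C dm_le[of a] by (auto simp: rkc_def)
 have rB: "rkc a \<le> n" if "a \<in> insert {} BC" for a using that dm_BC[of a] by (auto simp: rkc_def)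
 have PI: "insert {} C = insert {} BC \<union> IC" "insert {} BC \<inter> IC = {}" using C_split empty_C by auto
 have dual: "p.dual ?q (Suc n) a = 1" if a: "a \<in> insert {} C" for a
 proof -
  have fin: "finite {d. leq a d \<and> rkc d \<le> Suc n}" by (rule finite_subset[of _ "insert {} C"]) (auto dest: p.le_P simp: finC)
  have "p.dual ?q (Suc n) a = (\<Sum>d | d \<in> IC \<and> leq a d. (-1) ^ (n - dm d))"
   unfolding p.dual_def q
   using fin rI by (intro sum.mono_neutral_cong_right) auto
  also have "\<dots> = (\<Sum>d | d \<in> IC \<and> leq a d. (-1) ^ n * (-1) ^ dm d)"
  proof (rule sum.cong[OF refl])
   fix d assume "d \<in> {d. d \<in> IC \<and> leq a d}"
   then have "dm d \<le> n" using rI by simp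
   then have h: "(-1::int) ^ n = (-1) ^ (n - dm d) * (-1) ^ dm d" by (simp add: power_add[symmetric])
   have sq: "(-1::int) ^ dm d * (-1) ^ dm d = 1" by (simp add: power_mult_distrib[symmetric])
   show "(-1::int) ^ (n - dm d) = (-1) ^ n * (-1) ^ dm d" unfolding h mult.assoc sq mult_1_right ..
  qed
  also have "\<dots> = (-1) ^ n * (-1) ^ n" unfolding sum_distrib_left[symmetric] euler_interior[OF a] ..
  finally show ?thesis by (simp add: power_add[symmetric] mult_2[symmetric])
 qed
 have "p.hsum ?q (Suc n) = (\<Sum>a\<in>IC. u a * pY ^ (Suc n - rkc a))"
  unfolding p.hsum_def q using finC C_split(4) rI by (intro sum.mono_neutral_cong_right) auto
 moreover have "p.defect ?q (Suc n) = (\<Sum>a\<in>insert {} BC. u a * pY ^ (n - rkc a))"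
  unfolding p.defect_def
 proof (rule sum.mono_neutral_cong_right)
  show "finite {a \<in> insert {} C. rkc a < Suc n}" using finC by simp
  show "insert {} BC \<subseteq> {a \<in> insert {} C. rkc a < Suc n}"
  proof
   fix a assume a: "a \<in> insert {} BC"
   then show "a \<in> {a \<in> insert {} C. rkc a < Suc n}" using rB[OF a] C_split(3) by auto
  qed
  show "\<forall>a\<in>{a \<in> insert {} C. rkc a < Suc n} - insert {} BC.
   of_int (p.dual ?q (Suc n) a - ?q a) * u a * pY ^ (Suc n - 1 - rkc a) = 0"
  proof
   fix a assume a: "a \<in> {a \<in> insert {} C. rkc a < Suc n} - insert {} BC"
   then have "a \<in> IC" "a \<in> insert {} C" using PI by auto
   then have z: "p.dual ?q (Suc n) a - ?q a = 0" using dual[of a] q[of a] by simp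
   show "of_int (p.dual ?q (Suc n) a - ?q a) * u a * pY ^ (Suc n - 1 - rkc a) = 0"
    unfolding z by simp
  qed
  fix a assume a: "a \<in> insert {} BC"
  then have "a \<in> insert {} C" "a \<notin> IC" using PI by auto
  then show "of_int (p.dual ?q (Suc n) a - ?q a) * u a * pY ^ (Suc n - 1 - rkc a) = u a * pY ^ (n - rkc a)"
   using dual[of a] q[of a] by simp
 qed
 ultimately show ?thesis using g unfolding p.gpoly_def by simp
qed

end

section \<open>Barycentric subdivisions\<close>

lemma chain_maxI:
 assumes "c \<in> sd X S" "t \<in> c" "\<And>r. r \<in> c \<Longrightarrow> r = t \<or> face_less X r t"
 shows "chain_max X c = t"
proof (rule ccontr)
 assume ne: "chain_max X c \<noteq> t"
 have "c \<noteq> {}" using assms(2) by auto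
 note m = chain_max_works[OF assms(1) this]
 have "face_less X (chain_max X c) t" using assms(3)[of "chain_max X c"] m ne by auto
 moreover have "face_less X t (chain_max X c)" using m assms(2) ne by auto
 ultimately show False by (auto simp: face_less_def)
qed

section \<open>Chains of cells sorted by their maximum\<close>

context regcw
begin

lemma face_less_iff: "a \<in> C \<Longrightarrow> d \<in> C \<Longrightarrow> face_less X a d \<longleftrightarrow> leq a d \<and> a \<noteq> d"
proof -
 assume ad: "a \<in> C" "d \<in> C"
 have ne: "a \<noteq> {}" using ad empty_C by auto
 have "X closure_of a = X closure_of d \<Longrightarrow> a = d"
 proof (rule ccontr)
  assume "X closure_of a = X closure_of d" "a \<noteq> d"
  then have "below a d" "below d a" using below_closure ad by auto
  then show False using below_dm[of a d] below_dm[of d a] \<open>a \<noteq> d\<close> by auto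
 qed
 then show ?thesis using below_closure[OF ad] ne by (auto simp: face_less_def leq_def)
qed

definition mchains :: "'a set \<Rightarrow> 'a set set set" where
 "mchains t = {c \<in> sd X (insert {} C). chain_max X c = t}"

definition flagpoly :: "'a set \<Rightarrow> int poly" where
 "flagpoly t = (\<Sum>c\<in>mchains t. pX ^ card c * pY ^ (rkc t - card c))"

lemma sd_iff: "c \<in> sd X (insert {} C) \<longleftrightarrow>
 c \<subseteq> C \<and> (\<forall>a\<in>c. \<forall>d\<in>c. a \<noteq> d \<longrightarrow> leq a d \<or> leq d a)"
proof -
 have "insert {} C - {{}} = C" using empty_C by auto
 moreover have "finite c" if "c \<subseteq> C" using finite_subset[OF that finC] .
 moreover have "pairwise (\<lambda>a d. face_less X a d \<or> face_less X d a) c \<longleftrightarrow>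
   (\<forall>a\<in>c. \<forall>d\<in>c. a \<noteq> d \<longrightarrow> leq a d \<or> leq d a)" if "c \<subseteq> C"
  unfolding pairwise_def
 proof (intro ball_cong refl)
  fix a d assume "a \<in> c" "d \<in> c"
  then have "a \<in> C" "d \<in> C" using that by auto
  then show "(a \<noteq> d \<longrightarrow> face_less X a d \<or> face_less X d a) = (a \<noteq> d \<longrightarrow> leq a d \<or> leq d a)"
   using face_less_iff[of a d] face_less_iff[of d a] by auto
 qed
 ultimately show ?thesis unfolding sd_def by auto
qed

lemma finite_sd: "finite (sd X (insert {} C))"
 by (rule finite_subset[of _ "Pow C"]) (auto simp: sd_iff finC)

lemma finite_mchains: "finite (mchains t)"
 using finite_sd by (simp add: mchains_def)

lemma mchains_empty: "mchains {} = {{}}"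
proof -
 have A: "c = {}" if c: "c \<in> sd X (insert {} C)" "chain_max X c = {}" for c
 proof (rule ccontr)
  assume "c \<noteq> {}"
  then have "{} \<in> c" using chain_max_works[OF c(1)] c(2) by auto
  then show False using c(1) empty_C by (auto simp: sd_iff)
 qed
 have "{} \<in> sd X (insert {} C)" "chain_max X {} = {}" by (simp_all add: sd_iff chain_max_def)
 then show ?thesis using A by (auto simp: mchains_def)
qed

lemma mchains_iff:
 assumes "t \<in> C"
 shows "c \<in> mchains t \<longleftrightarrow> c \<in> sd X (insert {} C) \<and> t \<in> c \<and> (\<forall>r\<in>c. leq r t)"
proof
 assume "c \<in> mchains t"
 then have c: "c \<in> sd X (insert {} C)" "chain_max X c = t" by (auto simp: mchains_def)
 have "c \<noteq> {}" using c(2) assms empty_C by (auto simp: chain_max_def)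
 note m = chain_max_works[OF c(1) this, unfolded c(2)]
 have cC: "c \<subseteq> C" using c(1) by (simp add: sd_iff)
 have "leq r t" if "r \<in> c" for r
 proof (cases "r = t")
  case True then show ?thesis using below_refl[OF assms] by (simp add: leq_def)
 next
  case False
  then have "face_less X r t" using m that by auto
  then show ?thesis using face_less_iff[of r t] that cC assms by auto
 qed
 then show "c \<in> sd X (insert {} C) \<and> t \<in> c \<and> (\<forall>r\<in>c. leq r t)" using c m by auto
next
 assume c: "c \<in> sd X (insert {} C) \<and> t \<in> c \<and> (\<forall>r\<in>c. leq r t)"
 then have cC: "c \<subseteq> C" by (simp add: sd_iff)
 have "chain_max X c = t"
 proof (rule chain_maxI)
  fix r assume "r \<in> c"
  then show "r = t \<or> face_less X r t" using face_less_iff[of r t] c cC assms by auto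
 qed (use c in auto)
 then show "c \<in> mchains t" using c by (simp add: mchains_def)
qed

lemma mchains_P: "c \<in> sd X (insert {} C) \<Longrightarrow> chain_max X c \<in> insert {} C"
proof (cases "c = {}")
 case False
 assume c: "c \<in> sd X (insert {} C)"
 then show ?thesis using chain_max_works[OF c False] by (auto simp: sd_iff)
qed (simp add: chain_max_def)

lemma leq_rkc: "leq a d \<Longrightarrow> a \<noteq> d \<Longrightarrow> rkc a < rkc d"
 using cell_poset.rk_less[OF cell_poset] .

lemma leq_trans: "leq a d \<Longrightarrow> leq d e \<Longrightarrow> leq a e"
 using cell_poset.le_trans[OF cell_poset] .

lemma leq_P: "leq a d \<Longrightarrow> a \<in> insert {} C \<and> d \<in> insert {} C"
 using cell_poset.le_P[OF cell_poset] .

lemma mchains_card: assumes "t \<in> insert {} C" "c \<in> mchains t" shows "card c \<le> rkc t"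
proof (cases "t = {}")
 case True
 then show ?thesis using assms(2) mchains_empty by simp
next
 case False
 then have t: "t \<in> C" using assms by simp
 note c = assms(2)[unfolded mchains_iff[OF t]]
 have cC: "c \<subseteq> C" using c by (simp add: sd_iff)
 have "inj_on rkc c"
 proof (rule inj_onI, rule ccontr)
  fix a d assume ad: "a \<in> c" "d \<in> c" "rkc a = rkc d" "a \<noteq> d"
  then have "leq a d \<or> leq d a" using c by (auto simp: sd_iff)
  then show False using leq_rkc[of a d] leq_rkc[of d a] ad by auto
 qed
 moreover have "rkc ` c \<subseteq> {1..rkc t}"
 proof
  fix k assume "k \<in> rkc ` c"
  then obtain r where r: "r \<in> c" "k = rkc r" by auto
  then have "r \<noteq> {}" using cC empty_C by auto
  moreover have "rkc r \<le> rkc t" using leq_rkc[of r t] c r(1) by (cases "r = t") auto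
  ultimately show "k \<in> {1..rkc t}" using r by (simp add: rkc_def)
 qed
 ultimately show ?thesis using card_inj_on_le[of rkc c "{1..rkc t}"] by simp
qed

lemma mchains_insert:
 assumes t: "t \<in> C" and r: "leq r t" "r \<noteq> t" and c: "c \<in> mchains r"
 shows "t \<notin> c" "insert t c \<in> mchains t"
proof -
 have sdc: "c \<in> sd X (insert {} C)" using c by (simp add: mchains_def)
 have ct: "leq s r" if "s \<in> c" for s
 proof (cases "r = {}")
  case True then show ?thesis using c mchains_empty that by auto
 next
  case False
  then have "r \<in> C" using leq_P[OF r(1)] by simp
  then show ?thesis using c that by (simp add: mchains_iff)
 qed
 show "t \<notin> c"
 proof
  assume "t \<in> c"
  then show False using leq_rkc[OF r] ct[of t] leq_rkc[of t r] r(2) by fastforce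
 qed
 have "insert t c \<in> sd X (insert {} C)" using sdc t ct leq_trans[OF _ r(1)] by (auto simp: sd_iff)
 moreover have "leq t t" using below_refl[OF t] by (simp add: leq_def)
 ultimately show "insert t c \<in> mchains t" using ct leq_trans[OF _ r(1)] by (auto simp: mchains_iff[OF t])
qed

lemma mchains_remove:
 assumes t: "t \<in> C" and c: "c \<in> mchains t"
 obtains r where "leq r t" "r \<noteq> t" "c - {t} \<in> mchains r"
proof -
 note c' = c[unfolded mchains_iff[OF t]]
 have sdc: "c - {t} \<in> sd X (insert {} C)" using c' by (auto simp: sd_iff)
 let ?r = "chain_max X (c - {t})"
 have m: "c - {t} \<in> mchains ?r" using sdc by (simp add: mchains_def)
 show thesis
 proof (cases "c - {t} = {}")
  case True
  then have "?r = {}" unfolding True by (simp add: chain_max_def)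
  then show thesis using that[of ?r] m t empty_C by (auto simp: leq_def)
 next
  case False
  have "?r \<in> c - {t}" using chain_max_works[OF sdc False] by simp
  then show thesis using that[of ?r] m c' by auto
 qed
qed

lemma flagpoly_empty: "flagpoly {} = 1"
 by (simp add: flagpoly_def mchains_empty rkc_def)

text \<open>Deleting \<open>t\<close> matches the chains with maximum \<open>t\<close> with those of
  smaller maximum \<open>r\<close>, the empty chain having the empty cell as maximum. The deleted
  cell costs one factor \<open>pX\<close>, hence the exponent
  \<open>rkc t - 1 - rkc r\<close>.\<close>

lemma flagpoly_rec:
 assumes t: "t \<in> C"
 shows "flagpoly t = pX * (\<Sum>r | leq r t \<and> r \<noteq> t. flagpoly r * pY ^ (rkc t - 1 - rkc r))"
proof -
 let ?R = "{r. leq r t \<and> r \<noteq> t}"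
 have finR: "finite ?R" by (rule finite_subset[of _ "insert {} C"]) (use leq_P finC in auto)
 have im: "mchains t = insert t ` (\<Union>r\<in>?R. mchains r)"
 proof (intro equalityI subsetI)
  fix c assume c: "c \<in> mchains t"
  obtain r where r: "leq r t" "r \<noteq> t" "c - {t} \<in> mchains r" using mchains_remove[OF t c] .
  moreover have "t \<in> c" using c by (simp add: mchains_iff[OF t])
  then have "c = insert t (c - {t})" by auto
  ultimately show "c \<in> insert t ` (\<Union>r\<in>?R. mchains r)" by blast
 next
  fix c assume "c \<in> insert t ` (\<Union>r\<in>?R. mchains r)"
  then show "c \<in> mchains t" using mchains_insert(2)[OF t] by auto
 qed
 have inj: "inj_on (insert t) (\<Union>r\<in>?R. mchains r)"
 proof (rule inj_onI)
  fix c c' assume cc: "c \<in> (\<Union>r\<in>?R. mchains r)" "c' \<in> (\<Union>r\<in>?R. mchains r)" "insert t c = insert t c'"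
  then have "t \<notin> c" "t \<notin> c'" using mchains_insert(1)[OF t] by auto
  then show "c = c'" using cc(3) by (metis insert_ident)
 qed
 have "flagpoly t = (\<Sum>c\<in>(\<Union>r\<in>?R. mchains r). pX ^ card (insert t c) * pY ^ (rkc t - card (insert t c)))"
  unfolding flagpoly_def im sum.reindex[OF inj] by (simp only: o_def)
 also have "\<dots> = (\<Sum>r\<in>?R. \<Sum>c\<in>mchains r. pX ^ card (insert t c) * pY ^ (rkc t - card (insert t c)))"
  using finR finite_mchains by (intro sum.UNION_disjoint) (auto simp: mchains_def)
 also have "\<dots> = (\<Sum>r\<in>?R. pX * (flagpoly r * pY ^ (rkc t - 1 - rkc r)))"
 proof (rule sum.cong[OF refl])
  fix r assume r: "r \<in> ?R"
  have "pX ^ card (insert t c) * pY ^ (rkc t - card (insert t c)) = pX * (pX ^ card c * pY ^ (rkc r - card c) * pY ^ (rkc t - 1 - rkc r))"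
   if c: "c \<in> mchains r" for c
  proof -
   have cC: "c \<subseteq> C" using c by (simp add: mchains_def sd_iff)
   have "finite c" using finite_subset[OF cC finC] .
   then have 1: "card (insert t c) = Suc (card c)" using mchains_insert(1)[OF t _ _ c] r by simp
   have "card c \<le> rkc r" "rkc r < rkc t" using mchains_card[OF _ c] leq_P[of r t] leq_rkc[of r t] r by auto
   then have 2: "rkc t - Suc (card c) = (rkc r - card c) + (rkc t - 1 - rkc r)" by simp
   show ?thesis unfolding 1 2 power_add power_Suc by (simp only: mult.assoc)
  qed
  then show "(\<Sum>c\<in>mchains r. pX ^ card (insert t c) * pY ^ (rkc t - card (insert t c))) = pX * (flagpoly r * pY ^ (rkc t - 1 - rkc r))"
   unfolding flagpoly_def sum_distrib_left sum_distrib_right by (intro sum.cong refl)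
 qed
 also have "\<dots> = pX * (\<Sum>r\<in>?R. flagpoly r * pY ^ (rkc t - 1 - rkc r))" by (rule sum_distrib_left[symmetric])
 finally show ?thesis .
qed

text \<open>The diagonal entry of the contraction identity at \<open>t\<close> is 1, so some
  incidence number into \<open>t\<close> is nonzero.\<close>

lemma facet_exists:
 assumes t: "t \<in> C"
 obtains r where "leq r t" "rkc t = Suc (rkc r)"
proof -
 interpret p: cell_poset "insert {} C" leq rkc "\<lambda>a b. real_of_int (ieps a b)" "{}" by (rule cell_poset)
 have "leq {} t" "{} \<noteq> t" using t empty_C by (auto simp: leq_def)
 from p.contraction[OF this] obtain s :: "'a set \<Rightarrow> 'a set \<Rightarrow> real" where
  s: "\<forall>a b. leq {} a \<and> leq a t \<and> leq {} b \<and> leq b t \<longrightarrow>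
    (\<Sum>c | leq {} c \<and> leq c t. s a c * real_of_int (ieps c b) + real_of_int (ieps a c) * s c b) = (if a = b then 1 else 0)"
  by (elim exE conjE)
 have tt: "leq t t" using p.le_refl t by simp
 have "(\<Sum>c | leq {} c \<and> leq c t. s t c * real_of_int (ieps c t) + real_of_int (ieps t c) * s c t) = 1"
  using s[THEN spec, THEN spec, of t t] \<open>leq {} t\<close> tt by simp
 then have "(\<Sum>c | leq {} c \<and> leq c t. s t c * real_of_int (ieps c t) + real_of_int (ieps t c) * s c t) \<noteq> 0" by simp
 then obtain c where c: "leq c t" "s t c * real_of_int (ieps c t) + real_of_int (ieps t c) * s c t \<noteq> 0"
  by (metis (mono_tags, lifting) mem_Collect_eq sum.neutral)
 have "ieps t c = 0"
 proof (rule ccontr)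
  assume "ieps t c \<noteq> 0"
  then have "rkc c = Suc (rkc t)" using ieps_nz by simp
  then show False using leq_rkc[OF c(1)] by (cases "c = t") auto
 qed
 then have "ieps c t \<noteq> 0" using c(2) by auto
 then show thesis using that[of c] ieps_nz[of c t] by simp
qed

text \<open>Shows that the bound of \<open>mchains_card\<close> is attained, which fixes the
  dimension seen by \<open>h_poly\<close>.\<close>

lemma full_chain: "t \<in> insert {} C \<Longrightarrow> \<exists>c\<in>mchains t. card c = rkc t"
proof (induction "rkc t" arbitrary: t rule: less_induct)
 case less
 show ?case
 proof (cases "t = {}")
  case True then show ?thesis by (simp add: mchains_empty rkc_def)
 next
  case False
  then have t: "t \<in> C" using less.prems by simp
  obtain r where r: "leq r t" "rkc t = Suc (rkc r)" using facet_exists[OF t] .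
  have rt: "r \<noteq> t" using r(2) by auto
  obtain c where c: "c \<in> mchains r" "card c = rkc r" using less.hyps[of r] r leq_P[OF r(1)] by auto
  have "c \<subseteq> C" using c by (simp add: mchains_def sd_iff)
  then have "finite c" using finite_subset finC by blast
  then have "card (insert t c) = rkc t" using mchains_insert(1)[OF t r(1) rt c(1)] c(2) r(2) by simp
  then show ?thesis using mchains_insert(2)[OF t r(1) rt c(1)] by blast
 qed
qed

end

section \<open>Restrictions of the subdivision as subdivided balls\<close>

locale subdivision = regcw X C dm
 for X :: "'a topology" and C dm +
 fixes V :: "'v set" and \<sigma> :: "'a set \<Rightarrow> 'v set"
 assumes subdiv: "CW_regular_subdivision V X C \<sigma>" and finV: "finite V"
begin

definition CF :: "'v set \<Rightarrow> 'a set set" where "CF F = {e \<in> C. \<sigma> e \<subseteq> F}"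

lemma R_eq: "F \<subseteq> V \<Longrightarrow> restriction C \<sigma> F = insert {} (CF F)"
 and R_closed: "F \<subseteq> V \<Longrightarrow> e \<in> CF F \<Longrightarrow> X closure_of e \<subseteq> \<Union>(CF F)"
 and sigma_empty: "\<sigma> {} = {}"
proof -
 have sc: "subcomplex X C (restriction C \<sigma> F)" if "F \<subseteq> V" for F
  using subdiv that by (simp add: CW_regular_subdivision_def)
 have "{} \<in> restriction C \<sigma> {}" using sc[of "{}"] by (simp add: subcomplex_def)
 then show s: "\<sigma> {} = {}" by (simp add: restriction_def)
 show R: "restriction C \<sigma> F = insert {} (CF F)" if "F \<subseteq> V" for F
  using s empty_C by (auto simp: restriction_def face_poset_def CF_def)
 show "X closure_of e \<subseteq> \<Union>(CF F)" if "F \<subseteq> V" "e \<in> CF F"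
 proof -
  have "\<forall>t\<in>insert {} (CF F). X closure_of t \<subseteq> \<Union>(insert {} (CF F))"
   using sc[OF that(1)] unfolding R[OF that(1)] subcomplex_def by (elim conjE)
  then show ?thesis using that(2) by simp
 qed
qed

lemma bdc_CF: assumes F: "F \<subseteq> V" and e: "e \<in> CF F" shows "bdc e \<subseteq> CF F"
proof
 fix d assume d: "d \<in> bdc e"
 have dC: "d \<in> C" using d bdc_C by blast
 obtain x where x: "x \<in> d" using cell_ne[OF dC] by auto
 then have "x \<in> \<Union>(CF F)" using d R_closed[OF F e] by (auto simp: bdc_def)
 then obtain e' where e': "e' \<in> CF F" "x \<in> e'" by auto
 then have "e' = d" using cell_eq[of e' d x] dC x by (simp add: CF_def)
 then show "d \<in> CF F" using e' by simp
qed

lemma regcw_CF: assumes F: "F \<subseteq> V" shows "regcw X (CF F) dm"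
proof
 have CC: "CF F \<subseteq> C" by (auto simp: CF_def)
 show "Hausdorff_space X" by (rule haus)
 show "finite (CF F)" by (rule finite_subset[OF CC finC])
 show "disjoint (CF F)" using disj CC by (auto simp: disjoint_def)
 show "\<exists>\<Phi>. characteristic_map X (dm e) e \<Phi>" if "e \<in> CF F" for e using cells[of e] that CC by blast
 show "\<exists>D\<subseteq>CF F. X closure_of e - e = \<Union>D \<and> (\<forall>d\<in>D. dm d < dm e)" if "e \<in> CF F" for e
 proof -
  have eC: "e \<in> C" using that CC by blast
  show ?thesis using bdc_CF[OF F that] bdc_un[OF eC] bdc_dm[OF eC] by (intro exI[of _ "bdc e"]) simp
 qed
qed

lemma leq_CF:
 assumes F: "F \<subseteq> V" and a: "a \<in> insert {} (CF F)"
 shows "regcw.leq X (CF F) d a \<longleftrightarrow> leq d a"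
proof -
 interpret r: regcw X "CF F" dm by (rule regcw_CF[OF F])
 have CC: "CF F \<subseteq> C" by (auto simp: CF_def)
 have dn: "d \<in> CF F" if "below d a" using that a bdc_CF[OF F, of a] empty_C by (auto simp: below_def)
 have "r.below d a \<longleftrightarrow> below d a"
 proof (cases "d \<in> CF F \<and> a \<in> CF F")
  case True
  then show ?thesis using r.below_closure[of d a] below_closure[of d a] CC by auto
 next
  case False
  then show ?thesis using dn a empty_C by (auto simp: r.below_def below_def)
 qed
 then show ?thesis using a CC by (auto simp: r.leq_def leq_def)
qed

lemma CF_empty: "CF {} = {}"
proof -
 have "is_ball (int (card ({}::'v set)) - 1) (subtopology X (\<Union>(restriction C \<sigma> {})))"
  using subdiv unfolding CW_regular_subdivision_def by blast
 then have "topspace (subtopology X (\<Union>(insert {} (CF {})))) = {}" using R_eq[of "{}"] by (simp add: is_ball_def)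
 moreover have "\<Union>(CF {}) \<subseteq> topspace X"
 proof -
  interpret r: regcw X "CF {}" dm by (rule regcw_CF) simp
  show ?thesis by (rule r.sub_Union[OF r.sub_C])
 qed
 ultimately have "\<Union>(CF {}) = {}" by auto
 then show ?thesis using cell_ne by (auto simp: CF_def)
qed

text \<open>\<open>ball_boundary\<close> ranges over all homeomorphisms. By the homological test for
  boundary points they all give the same set, so one can be fixed, and the interior cells of the
  subdivision are those of \<open>ballcw\<close>.\<close>

lemma ball_CF:
 assumes F: "F \<subseteq> V" "F \<noteq> {}"
 obtains b \<Phi> where "ballcw X (CF F) dm (card F - 1) b \<Phi>"
  "ballcw.BC (CF F) (card F - 1) \<Phi> = {e \<in> C. \<sigma> e \<subset> F}" "ballcw.IC (CF F) (card F - 1) \<Phi> = {e \<in> C. \<sigma> e = F}"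
proof -
 interpret r: regcw X "CF F" dm by (rule regcw_CF[OF F(1)])
 define n where "n = card F - 1"
 let ?B = "\<Union>(CF F)"
 have finF: "finite F" using finite_subset[OF F(1) finV] .
 then have cF: "0 < card F" using F(2) by (simp add: card_gt_0_iff)
 then have int_n: "int (card F) - 1 = int n" by (simp add: n_def)
 have BX: "?B \<subseteq> topspace X" by (rule r.sub_Union[OF r.sub_C])
 have UR: "\<Union>(restriction C \<sigma> F) = ?B" using R_eq[OF F(1)] by simp
 have "is_ball (int (card F) - 1) (subtopology X (\<Union>(restriction C \<sigma> F)))"
  using subdiv F(1) unfolding CW_regular_subdivision_def by blast
 then have "unit_ball n homeomorphic_space subtopology X ?B" unfolding UR int_n by (simp add: is_ball_def)
 then obtain \<Phi> where \<Phi>: "homeomorphic_map (unit_ball n) (subtopology X ?B) \<Phi>"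
  unfolding homeomorphic_space_def homeomorphic_map_maps by blast
 have mk: "cell X n (h ` oball n) h" "h ` bset n = ?B"
  if h: "homeomorphic_map (unit_ball n) (subtopology X ?B) h" for h
 proof -
  show im: "h ` bset n = ?B" using homeomorphic_imp_surjective_map[OF h] BX by auto
  then have "embedding_map (unit_ball n) X h" using h by (simp add: embedding_map_def)
  then show "cell X n (h ` oball n) h" using haus by (simp add: cell_def characteristic_map_def)
 qed
 let ?b = "\<Phi> ` oball n"
 interpret c: cell X n ?b \<Phi> by (rule mk(1)[OF \<Phi>])
 have cl: "c.cl = ?B" using mk(2)[OF \<Phi>] by (simp add: c.cl_def)
 have bw: "ballcw X (CF F) dm n ?b \<Phi>"
  by (intro ballcw.intro ballcw_axioms.intro regcw_CF[OF F(1)] c.cell_axioms cl)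
 interpret w: ballcw X "CF F" dm n ?b \<Phi> by (rule bw)
 have bb: "ball_boundary n (subtopology X ?B) = c.fr"
 proof (intro equalityI subsetI)
  fix x assume "x \<in> ball_boundary n (subtopology X ?B)"
  then obtain h where h: "homeomorphic_map (unit_ball n) (subtopology X ?B) h" "x \<in> h ` sphr n"
   unfolding ball_boundary_def by blast
  interpret d: cell X n "h ` oball n" h by (rule mk(1)[OF h(1)])
  have dcl: "d.cl = c.cl" using mk(2)[OF h(1)] cl by (simp add: d.cl_def)
  have xf: "x \<in> d.fr" using h(2) by (simp add: d.fr_def)
  from d.hvan_cl_minus[OF xf] have hv: "hvan X c.cl (c.cl - {x})" unfolding dcl .
  have "x \<in> c.cl" using xf d.fr_cl dcl by auto
  then show "x \<in> c.fr" using c.not_hvan_minus_e[of x] hv unfolding c.cl_eq by blast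
 next
  fix x assume "x \<in> c.fr"
  then show "x \<in> ball_boundary n (subtopology X ?B)" using \<Phi> unfolding ball_boundary_def c.fr_def by blast
 qed
 have ic: "{\<tau> \<in> face_poset C. \<sigma> \<tau> = F} = interior_cells X (int (card F) - 1) (restriction C \<sigma> F)"
  using subdiv F(1) unfolding CW_regular_subdivision_def by blast
 have "interior_cells X (int (card F) - 1) (restriction C \<sigma> F) = {\<tau> \<in> insert {} (CF F). \<not> \<tau> \<subseteq> c.fr}"
  unfolding interior_cells_def int_n UR R_eq[OF F(1)] nat_int by (simp add: bb)
 also have "\<dots> = w.IC" unfolding w.IC_def by auto
 finally have IC: "w.IC = {\<tau> \<in> face_poset C. \<sigma> \<tau> = F}" using ic by simp
 have "{\<tau> \<in> face_poset C. \<sigma> \<tau> = F} = {e \<in> C. \<sigma> e = F}" using sigma_empty F(2) by (auto simp: face_poset_def)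
 then have IC': "w.IC = {e \<in> C. \<sigma> e = F}" using IC by simp
 have BC': "w.BC = {e \<in> C. \<sigma> e \<subset> F}"
 proof -
  have "w.BC = CF F - w.IC" using w.C_split by auto
  then show ?thesis unfolding IC' by (auto simp: CF_def)
 qed
 show thesis by (rule that[OF bw[unfolded n_def] BC'[unfolded n_def] IC'[unfolded n_def]])
qed

lemma ball_CF_ex:
 assumes F: "F \<subseteq> V" "F \<noteq> {}"
 shows "\<exists>b \<Phi>. ballcw X (CF F) dm (card F - 1) b \<Phi>"
proof -
 obtain b \<Phi> where "ballcw X (CF F) dm (card F - 1) b \<Phi>"
  and "ballcw.BC (CF F) (card F - 1) \<Phi> = {e \<in> C. \<sigma> e \<subset> F}" and "ballcw.IC (CF F) (card F - 1) \<Phi> = {e \<in> C. \<sigma> e = F}"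
  using ball_CF[OF F] .
 then show ?thesis by (intro exI)
qed

text \<open>\<open>t\<close> is a cell of the ball over its own carrier. This keeps the truncated
  subtractions in the exponents exact.\<close>

lemma rkc_le: assumes "t \<in> insert {} C" shows "rkc t \<le> card (\<sigma> t)"
proof (cases "t = {}")
 case False
 then have t: "t \<in> C" using assms by simp
 have sV: "\<sigma> t \<subseteq> V" using subdiv t unfolding CW_regular_subdivision_def face_poset_def by blast
 have tF: "t \<in> CF (\<sigma> t)" using t by (simp add: CF_def)
 then have ne: "\<sigma> t \<noteq> {}" using CF_empty by auto
 obtain b \<Phi> where "ballcw X (CF (\<sigma> t)) dm (card (\<sigma> t) - 1) b \<Phi>" using ball_CF_ex[OF sV ne] by (elim exE)
 from ballcw.dm_le[OF this tF] have "dm t \<le> card (\<sigma> t) - 1" .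
 moreover have "0 < card (\<sigma> t)" using finite_subset[OF sV finV] ne by (simp add: card_gt_0_iff)
 ultimately show ?thesis using False by (simp add: rkc_def)
qed (simp add: rkc_def)

definition I :: "'v set \<Rightarrow> int poly" where
 "I F = (\<Sum>t | t \<in> insert {} C \<and> \<sigma> t = F. flagpoly t * pY ^ (card F - rkc t))"

lemma sum_I:
 assumes F: "F \<subseteq> V" and A: "A \<subseteq> Pow F" and k: "\<And>G. G \<in> A \<Longrightarrow> card G \<le> k"
 shows "(\<Sum>G\<in>A. I G * pY ^ (k - card G)) = (\<Sum>t | t \<in> insert {} C \<and> \<sigma> t \<in> A. flagpoly t * pY ^ (k - rkc t))"
proof -
 have "I G * pY ^ (k - card G) = (\<Sum>t | t \<in> insert {} C \<and> \<sigma> t = G. flagpoly t * pY ^ (k - rkc t))" if G: "G \<in> A" for G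
  unfolding I_def sum_distrib_right
 proof (rule sum.cong[OF refl])
  fix t assume t: "t \<in> {t. t \<in> insert {} C \<and> \<sigma> t = G}"
  then have "k - rkc t = (card G - rkc t) + (k - card G)" using rkc_le[of t] k[OF G] by auto
  then show "flagpoly t * pY ^ (card G - rkc t) * pY ^ (k - card G) = flagpoly t * pY ^ (k - rkc t)"
   by (simp only: power_add mult.assoc)
 qed
 then have "(\<Sum>G\<in>A. I G * pY ^ (k - card G)) = (\<Sum>G\<in>A. \<Sum>t | t \<in> insert {} C \<and> \<sigma> t = G. flagpoly t * pY ^ (k - rkc t))"
  by (rule sum.cong[OF refl])
 also have "\<dots> = (\<Sum>G\<in>A. \<Sum>t | t \<in> {t \<in> insert {} C. \<sigma> t \<in> A} \<and> \<sigma> t = G. flagpoly t * pY ^ (k - rkc t))"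
  by (intro sum.cong refl) auto
 also have "\<dots> = (\<Sum>t | t \<in> insert {} C \<and> \<sigma> t \<in> A. flagpoly t * pY ^ (k - rkc t))"
 proof (rule sum.group)
  show "finite {t. t \<in> insert {} C \<and> \<sigma> t \<in> A}" using finC by simp
  have "finite F" using finite_subset[OF F finV] .
  then show "finite A" using finite_subset[OF A] by simp
 qed auto
 finally show ?thesis .
qed

text \<open>\<open>interior_gamma\<close> for the ball over \<open>F\<close>, of dimension
  \<open>card F - 1\<close>, with boundary cells regrouped by carrier. The empty \<open>F\<close> is
  separate, its ball having dimension -1.\<close>

lemma theta_gamma:
 assumes F: "F \<subseteq> V"
 shows "gamma_nonneg (card F) (I F - pX * (\<Sum>G | G \<subset> F. I G * pY ^ (card F - card G - 1)))"
proof (cases "F = {}")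
 case True
 have "{t. t \<in> insert {} C \<and> \<sigma> t = {}} = {{}}" using CF_empty sigma_empty by (auto simp: CF_def)
 then have "I {} = 1" by (simp add: I_def flagpoly_empty rkc_def)
 then show ?thesis using True gamma_nonneg_1 by simp
next
 case False
 have finF: "finite F" using finite_subset[OF F finV] .
 then have cF: "0 < card F" using False by (simp add: card_gt_0_iff)
 obtain b \<Phi> where w: "ballcw X (CF F) dm (card F - 1) b \<Phi>"
  and BC: "ballcw.BC (CF F) (card F - 1) \<Phi> = {e \<in> C. \<sigma> e \<subset> F}" and IC: "ballcw.IC (CF F) (card F - 1) \<Phi> = {e \<in> C. \<sigma> e = F}"
  using ball_CF[OF F False] .
 interpret w: ballcw X "CF F" dm "card F - 1" b \<Phi> by (rule w)
 have "gamma_nonneg (Suc (card F - 1)) ((\<Sum>a\<in>w.IC. flagpoly a * pY ^ (Suc (card F - 1) - rkc a))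
  - pX * (\<Sum>a\<in>insert {} w.BC. flagpoly a * pY ^ (card F - 1 - rkc a)))"
 proof (rule w.interior_gamma[of flagpoly, OF flagpoly_empty])
  fix a assume a: "a \<in> CF F"
  then have aC: "a \<in> C" by (simp add: CF_def)
  have "{d. w.leq d a \<and> d \<noteq> a} = {d. leq d a \<and> d \<noteq> a}" using leq_CF[OF F, of a] a by auto
  then show "flagpoly a = pX * (\<Sum>d | w.leq d a \<and> d \<noteq> a. flagpoly d * pY ^ (rkc a - 1 - rkc d))"
   using flagpoly_rec[OF aC] by (simp only:)
 qed
 moreover have "(\<Sum>a\<in>w.IC. flagpoly a * pY ^ (Suc (card F - 1) - rkc a)) = I F"
 proof -
  have "w.IC = {t. t \<in> insert {} C \<and> \<sigma> t = F}" unfolding IC using sigma_empty False by auto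
  then show ?thesis using cF by (simp add: I_def)
 qed
 moreover have "(\<Sum>a\<in>insert {} w.BC. flagpoly a * pY ^ (card F - 1 - rkc a)) = (\<Sum>G | G \<subset> F. I G * pY ^ (card F - card G - 1))"
 proof -
  have lt: "card G \<le> card F - 1" if "G \<in> {G. G \<subset> F}" for G using psubset_card_mono[OF finF, of G] that by auto
  have eqB: "insert {} w.BC = {t. t \<in> insert {} C \<and> \<sigma> t \<in> {G. G \<subset> F}}" unfolding BC using sigma_empty False by auto
  have "(\<Sum>a\<in>insert {} w.BC. flagpoly a * pY ^ (card F - 1 - rkc a)) = (\<Sum>G | G \<subset> F. I G * pY ^ (card F - 1 - card G))"
   unfolding eqB by (rule sum_I[OF F _ lt, symmetric]) auto
  also have "\<dots> = (\<Sum>G | G \<subset> F. I G * pY ^ (card F - card G - 1))" by (intro sum.cong refl) (simp add: diff_commute)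
  finally show ?thesis .
 qed
 ultimately show ?thesis using cF by simp
qed

text \<open>Chains are grouped by their maximum \<open>t\<close>, the gap between
  \<open>rkc t\<close> and \<open>card F\<close> being filled by a power of
  \<open>pY\<close>.\<close>

lemma h_poly_CF:
 assumes F: "F \<subseteq> V"
 shows "h_poly (sd X (restriction C \<sigma> F)) = (\<Sum>G\<in>Pow F. I G * pY ^ (card F - card G))"
proof -
 let ?D = "sd X (restriction C \<sigma> F)" and ?R = "{t. t \<in> insert {} C \<and> \<sigma> t \<in> Pow F}"
 have finF: "finite F" using finite_subset[OF F finV] .
 have fp: "face_poset C = insert {} C" by (simp add: face_poset_def)
 have D: "?D = {c \<in> sd X (insert {} C). \<sigma> (chain_max X c) \<subseteq> F}"
  using sd_restriction[OF subdiv F] unfolding fp sd_carrier_def by simp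
 have finD: "finite ?D" unfolding D using finite_sd by simp
 have cl: "card c \<le> rkc (chain_max X c)" if "c \<in> sd X (insert {} C)" for c
  by (rule mchains_card[OF mchains_P[OF that]]) (simp add: mchains_def that)
 have cF: "card c \<le> card F" if "c \<in> ?D" for c
 proof -
  have c: "c \<in> sd X (insert {} C)" "\<sigma> (chain_max X c) \<subseteq> F" using that D by auto
  have "card c \<le> card (\<sigma> (chain_max X c))" using cl[OF c(1)] rkc_le[OF mchains_P[OF c(1)]] by simp
  also have "\<dots> \<le> card F" by (rule card_mono[OF finF c(2)])
  finally show ?thesis .
 qed
 \<comment> \<open>\<open>h_poly\<close> takes its exponent from the largest face; a top cell of the
   ball and a full chain below it show that this is \<open>card F\<close>.\<close>
 have ex: "\<exists>c\<in>?D. card c = card F"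
 proof (cases "F = {}")
  case True
  have "{} \<in> sd X (insert {} C)" by (simp add: sd_iff)
  then have "{} \<in> ?D" unfolding D by (simp add: chain_max_def sigma_empty)
  then show ?thesis using True by (intro bexI[of _ "{}"]) auto
 next
  case False
  then have c0: "0 < card F" using finF by (simp add: card_gt_0_iff)
  obtain b \<Phi> where "ballcw X (CF F) dm (card F - 1) b \<Phi>" using ball_CF_ex[OF F False] by (elim exE)
  from ballcw.exists_top[OF this] obtain e where e: "e \<in> CF F" "dm e = card F - 1" ..
  have eC: "e \<in> C" "\<sigma> e \<subseteq> F" using e by (auto simp: CF_def)
  then have "rkc e = card F" using e(2) empty_C c0 by (auto simp: rkc_def)
  moreover obtain c where c: "c \<in> mchains e" "card c = rkc e" using full_chain[of e] eC by auto
  moreover have "c \<in> ?D" unfolding D using c(1) eC by (simp add: mchains_def)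
  ultimately show ?thesis by auto
 qed
 obtain c where c: "c \<in> ?D" "card c = card F" using ex ..
 have "card F \<in> card ` ?D" using imageI[OF c(1), of card] unfolding c(2) .
 then have Mx: "Max (card ` ?D) = card F" using finD cF by (intro Max_eqI) auto
 have "h_poly ?D = (\<Sum>i=0..card F. of_nat (card {G \<in> ?D. card G = i}) * pX ^ i * pY ^ (card F - i))"
  unfolding h_poly_def Let_def Mx ..
 also have "\<dots> = (\<Sum>i=0..card F. \<Sum>c | c \<in> ?D \<and> card c = i. pX ^ card c * pY ^ (card F - card c))"
 proof (rule sum.cong[OF refl])
  fix i
  have "(\<Sum>c | c \<in> ?D \<and> card c = i. pX ^ card c * pY ^ (card F - card c)) = (\<Sum>c | c \<in> ?D \<and> card c = i. pX ^ i * pY ^ (card F - i))"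
   by (rule sum.cong) auto
  then show "of_nat (card {G \<in> ?D. card G = i}) * pX ^ i * pY ^ (card F - i) =
   (\<Sum>c | c \<in> ?D \<and> card c = i. pX ^ card c * pY ^ (card F - card c))"
   by (simp only: sum_constant mult.assoc)
 qed
 also have "\<dots> = (\<Sum>c\<in>?D. pX ^ card c * pY ^ (card F - card c))"
  by (rule sum.group[OF finD]) (use cF in auto)
 also have "\<dots> = (\<Sum>t\<in>?R. \<Sum>c | c \<in> ?D \<and> chain_max X c = t. pX ^ card c * pY ^ (card F - card c))"
  by (rule sum.group[OF finD, symmetric]) (use finC mchains_P in \<open>auto simp: D\<close>)
 also have "\<dots> = (\<Sum>t\<in>?R. flagpoly t * pY ^ (card F - rkc t))"
 proof (rule sum.cong[OF refl])
  fix t assume t: "t \<in> ?R"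
  have eq: "{c. c \<in> ?D \<and> chain_max X c = t} = mchains t" using t unfolding D mchains_def by auto
  have rF: "rkc t \<le> card F" using rkc_le[of t] card_mono[OF finF, of "\<sigma> t"] t by auto
  show "(\<Sum>c | c \<in> ?D \<and> chain_max X c = t. pX ^ card c * pY ^ (card F - card c)) = flagpoly t * pY ^ (card F - rkc t)"
   unfolding eq flagpoly_def sum_distrib_right
  proof (rule sum.cong[OF refl])
   fix c assume c: "c \<in> mchains t"
   have "card c \<le> rkc t" using mchains_card[OF _ c] t by simp
   then have "card F - card c = (rkc t - card c) + (card F - rkc t)" using rF by simp
   then show "pX ^ card c * pY ^ (card F - card c) = pX ^ card c * pY ^ (rkc t - card c) * pY ^ (card F - rkc t)"
    by (simp only: power_add mult.assoc)
  qed
 qed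
 also have "\<dots> = (\<Sum>G\<in>Pow F. I G * pY ^ (card F - card G))"
  by (rule sum_I[OF F subset_refl, symmetric]) (use finF in \<open>auto intro: card_mono\<close>)
 finally show ?thesis .
qed

theorem local_h_gamma_nonneg:
 "gamma_nonneg (card V) (local_h_poly V (sd X (face_poset C)) (sd_carrier X \<sigma>))"
proof -
 have "local_h_poly V (sd X (face_poset C)) (sd_carrier X \<sigma>) =
  (\<Sum>F\<in>Pow V. (-1) ^ (card V - card F) * (\<Sum>G\<in>Pow F. I G * pY ^ (card F - card G)))"
  unfolding local_h_poly_sd[OF subdiv] using h_poly_CF by (intro sum.cong refl) simp
 then show ?thesis using local_sum_gamma_nonneg[OF finV theta_gamma] by simp
qed

end

theorem theorem1p3:
  fixes V :: "'v set" and d :: nat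
    and X :: "'a topology" and C :: "'a set set" and \<sigma> :: "'a set \<Rightarrow> 'v set"
  assumes "finite V" and "V \<noteq> {}" and "card V = d"
    and "CW_regular_subdivision V X C \<sigma>"
  shows "(\<exists>\<xi>. is_local_gamma_vector d
                 (local_h_poly V (sd X (face_poset C)) (sd_carrier X \<sigma>)) \<xi>) \<and>
         (\<forall>\<xi>. is_local_gamma_vector d
                 (local_h_poly V (sd X (face_poset C)) (sd_carrier X \<sigma>)) \<xi> \<longrightarrow>
               (\<forall>k\<le>d div 2. 0 \<le> \<xi> k))"
proof -
 let ?l = "local_h_poly V (sd X (face_poset C)) (sd_carrier X \<sigma>)"
 have "finite_regular_CW X C" using assms(4) by (simp add: CW_regular_subdivision_def)
 then obtain dm where dm: "regcw X C dm" by (rule finite_regular_CW_regcw)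
 have "subdivision X C dm V \<sigma>"
  by (intro subdivision.intro subdivision_axioms.intro dm assms(1,4))
 from subdivision.local_h_gamma_nonneg[OF this]
 have g: "gamma_nonneg d ?l" using assms(3) by simp
 obtain \<xi> where \<xi>: "\<forall>k. 0 \<le> \<xi> k" "?l = (\<Sum>k=0..d div 2. of_int (\<xi> k) * pX ^ k * pZ ^ (d - 2 * k))"
  using gamma_nonneg_imp_coeffs[OF g] by blast
 show ?thesis
 proof (intro conjI allI impI)
  show "\<exists>\<xi>. is_local_gamma_vector d ?l \<xi>" unfolding is_local_gamma_vector_def using \<xi>(2) by blast
  fix \<eta> k assume \<eta>: "is_local_gamma_vector d ?l \<eta>" and k: "k \<le> d div 2"
  \<comment> \<open>Coefficients in this basis are unique, so nonnegativity passes from the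
    constructed vector to every local \<open>\<gamma>\<close>-vector.\<close>
  have "\<eta> k = \<xi> k"
   by (rule gamma_coeffs_unique[OF _ k]) (use \<eta> \<xi>(2) in \<open>simp add: is_local_gamma_vector_def\<close>)
  then show "0 \<le> \<eta> k" using \<xi>(1) by simp
 qed
qed

end
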